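(* Let $H_0,H_1,U,Y$ be Hilbert spaces, let $F:D(F)\subseteq H_0\to H_1$ be densely defined, closed and linear, let $r>0$, let $K:B_{\mathbb{C}}(r,r)\to L(H_0\oplus H_1)$ be a linear material law (i.e. bounded and analytic), let $M_{1,i2}\in L(Y;H_i)$ and $M_{1,2i}\in L(H_i;Y)$ for $i\in\{0,1\}$, and let $M_{1,22}\in L(Y;Y)$. Define, for $z\in B_{\mathbb{C}}(r,r)$, \[ M(z):=\begin{pmatrix} K(z) & \begin{pmatrix}0\\0\end{pmatrix}\\ \begin{pmatrix}0&0\end{pmatrix} & 0\end{pmatrix}+z\begin{pmatrix} 0 & \begin{pmatrix}M_{1,02}\\ M_{1,12}\end{pmatrix}\\ \begin{pmatrix}M_{1,20}&M_{1,21}\end{pmatrix} & M_{1,22}\end{pmatrix}\in L\big((H_0\oplus H_1)\oplus Y\big), \] and \[ J:=\frac12\begin{pmatrix}M_{1,02}+M_{1,20}^{*}\\ M_{1,12}+M_{1,21}^{*}\end{pmatrix}\in L(Y;H_0\oplus H_1). \] Let $\mathcal{C}_{M,F,B}$ be the corresponding abstract linear control system with control operator $B$. Assume that there are constants $c_0,c_1>0$ such that $\operatorname{Re} z^{-1}K(z)\ge c_0$ for all $z\in B_{\mathbb{C}}(r,r)$ and $\operatorname{Re}M_{1,22}\ge c_1$, and that there is $\delta>0$ such that $c_0-\delta\|J\|>0$ and $c_1-\frac1\delta\|J\|>0$. Then $\mathcal{C}_{M,F,B}$ is well-posed and its solution operator is causal.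
   Context: All Hilbert spaces are complex. $L(X;Z)$ denotes the bounded linear operators from $X$ to $Z$, and $L(X)=L(X;X)$. $B_{\mathbb{C}}(r,r)$ is the open ball in $\mathbb{C}$ with centre $r$ and radius $r$. For a bounded operator $T$ on a Hilbert space, $\operatorname{Re}T=\frac12(T+T^* )$, and $\operatorname{Re}T\ge c$ means $\operatorname{Re}\langle Tw|w\rangle\ge c|w|^2$ for all $w$. Weighted space and time derivative. For $\nu>0$ and a Hilbert space $H$, $H_{\nu,0}(\mathbb{R};H)$ is the space of (classes of) measurable $f:\mathbb{R}\to H$ with $\int_{\mathbb{R}}|f(t)|_H^2e^{-2\nu t}\,dt<\infty$, a Hilbert space with inner product $\langle f|g\rangle_{\nu,0}=\int_{\mathbb{R}}\langle f(t)|g(t)\rangle_H e^{-2\nu t}\,dt$. The operator $\partial_0=\partial_{0,\nu}$ is the closure in $H_{\nu,0}(\mathbb{R};H)$ of the derivative $\phi\mapsto\phi'$ on $H$-valued $C_c^\infty$ functions; it is normal and boundedly invertible with $\|\partial_0^{-1}\|\le 1/\nu$. With the unitary Fourier transform $\mathcal{F}$ on $L_2(\mathbb{R};H)$ and the unitary operator $e^{-\nu m}:H_{\nu,0}(\mathbb{R};H)\to L_2(\mathbb{R};H)$, $(e^{-\nu m}f)(x)=e^{-\nu x}f(x)$, the Fourier-Laplace transform is $\mathcal{L}_\nu=\mathcal{F}e^{-\nu m}$. Linear material law. For bounded analytic $M:B_{\mathbb{C}}(r,r)\to L(H)$ and $\nu>\frac1{2r}$, define $M(\partial_0^{-1}):=\mathcal{L}_\nu^{*}M\big(\frac{1}{\mathrm{i}m+\nu}\big)\mathcal{L}_\nu\in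 L(H_{\nu,0}(\mathbb{R};H))$, where $\big(M(\frac{1}{\mathrm{i}m+\nu})f\big)(x)=M\big(\frac1{\mathrm{i}x+\nu}\big)f(x)$ for a.e. $x\in\mathbb{R}$. Densely defined closed operators on Hilbert spaces such as $F$ are identified with their canonical (pointwise in time) closed extensions to the corresponding $H_{\nu,0}$-spaces. Abstract linear control system. With $M$ as in the claim, $\mathcal{C}_{M,F,B}$ is the equation \[ \left(\partial_0M(\partial_0^{-1})+\begin{pmatrix}0&F^*&0\\-F&0&0\\0&0&0\end{pmatrix}\right)\begin{pmatrix}x\\ \xi\\ y\end{pmatrix}=f+Bu, \] where $f$ is an arbitrary source term in $H_{\nu,-\infty}(\mathbb{R};H_0\oplus H_1\oplus Y)$ (the union over $k$ of the extrapolation spaces of order $-k$ associated with $\partial_0$), $u\in H_{\nu,0}(\mathbb{R};U)$ is the control and $B\in L\big(H_{\nu,0}(\mathbb{R};U);H_{\nu,0}(\mathbb{R};H_0\oplus H_1\oplus Y)\big)$ is the control operator. The system is called well-posed if, for all sufficiently large $\nu$, the operator \[ \partial_0M(\partial_0^{-1})+\begin{pmatrix}0&F^*&0\\-F&0&0\\0&0&0\end{pmatrix} \] in $H_{\nu,0}(\mathbb{R};H_0\oplus H_1\oplus Y)$ has a densely defined bounded inverse. The continuous extension of this inverse to all of $H_{\nu,0}(\mathbb{R};H_0\oplus H_1\oplus Y)$ is called the solution operator. Causality. A mapping $S:H_{\nu,0}(\mathbb{R};H)\to H_{\nu,0}(\mathbb{R};H)$ is causal if for each $a\in\mathbb{R}$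 one has $\chi_{(-\infty,a]}(m)\,S\,\chi_{(-\infty,a]}(m)=\chi_{(-\infty,a]}(m)\,S$, where $\chi_{(-\infty,a]}(m)$ maps $f$ to $t\mapsto\chi_{(-\infty,a]}(t)f(t)$. *)

theory Defs
  imports "HOL-Analysis.Analysis"
begin

section \<open>Complex normed spaces and complex Hilbert spaces\<close>

class scaleC =
  fixes scaleC :: "complex \<Rightarrow> 'a \<Rightarrow> 'a"  (infixr "*\<^sub>C" 75)

class complex_normed_vector = real_normed_vector + scaleC +
  assumes scaleC_add_right: "c *\<^sub>C (x + y) = c *\<^sub>C x + c *\<^sub>C y"
    and scaleC_add_left: "(c + d) *\<^sub>C x = c *\<^sub>C x + d *\<^sub>C x"
    and scaleC_scaleC: "c *\<^sub>C d *\<^sub>C x = (c * d) *\<^sub>C x"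
    and scaleC_of_real: "complex_of_real a *\<^sub>C x = a *\<^sub>R x"
    and norm_scaleC: "norm (c *\<^sub>C x) = cmod c * norm x"

text \<open>
  The complex inner product is linear in its second argument; its real part is the inner product
  of the underlying real Hilbert space, so that the norm is the one induced by it.
\<close>

class complex_hilbert = complex_normed_vector + real_inner + complete_space +
  fixes cinner :: "'a \<Rightarrow> 'a \<Rightarrow> complex"
  assumes cinner_add_right: "cinner x (y + z) = cinner x y + cinner x z"
    and cinner_scaleC_right: "cinner x (c *\<^sub>C y) = c * cinner x y"
    and cinner_commute: "cinner x y = cnj (cinner y x)"
    and Re_cinner: "Re (cinner x y) = x \<bullet> y"

instantiation prod :: (complex_normed_vector, complex_normed_vector) complex_normed_vector
begin

definition scaleC_prod :: "complex \<Rightarrow> 'a \<times> 'b \<Rightarrow> 'a \<times> 'b"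
  where "scaleC_prod c x = (c *\<^sub>C fst x, c *\<^sub>C snd x)"

instance
proof
  fix c :: complex and x :: "'a \<times> 'b"
  have "norm (c *\<^sub>C x) = sqrt ((cmod c)\<^sup>2 * ((norm (fst x))\<^sup>2 + (norm (snd x))\<^sup>2))"
    by (simp add: scaleC_prod_def norm_prod_def norm_scaleC power_mult_distrib distrib_left)
  then show "norm (c *\<^sub>C x) = cmod c * norm x"
    by (simp add: real_sqrt_mult norm_prod_def)
qed (auto simp: scaleC_prod_def scaleC_add_right scaleC_add_left scaleC_scaleC scaleC_of_real
        prod_eq_iff)

end

instantiation prod :: (complex_hilbert, complex_hilbert) complex_hilbert
begin

definition cinner_prod :: "'a \<times> 'b \<Rightarrow> 'a \<times> 'b \<Rightarrow> complex"
  where "cinner_prod x y = cinner (fst x) (fst y) + cinner (snd x) (snd y)"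

instance
proof
  fix x y :: "'a \<times> 'b"
  show "cinner x y = cnj (cinner y x)"
    unfolding cinner_prod_def
    using cinner_commute[of "fst x" "fst y"] cinner_commute[of "snd x" "snd y"] by simp
qed (simp_all add: cinner_prod_def scaleC_prod_def cinner_add_right cinner_scaleC_right
        Re_cinner inner_prod_def distrib_left)

end


section \<open>Bounded operators\<close>

lemma scaleC_scaleR: "c *\<^sub>C (a *\<^sub>R x) = a *\<^sub>R (c *\<^sub>C (x :: 'a :: complex_normed_vector))"
  by (simp flip: scaleC_of_real add: scaleC_scaleC mult.commute)

instantiation blinfun :: (real_normed_vector, complex_normed_vector) complex_normed_vector
begin

lift_definition scaleC_blinfun :: "complex \<Rightarrow> ('a \<Rightarrow>\<^sub>L 'b) \<Rightarrow> ('a \<Rightarrow>\<^sub>L 'b)"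
  is "\<lambda>c f x. c *\<^sub>C f x"
proof -
  fix c :: complex and f :: "'a \<Rightarrow> 'b"
  assume f: "bounded_linear f"
  then obtain C where C: "\<And>x. norm (f x) \<le> norm x * C"
    using bounded_linear.bounded by blast
  show "bounded_linear (\<lambda>x. c *\<^sub>C f x)"
  proof (rule bounded_linear_intro[where K = "cmod c * C"])
    show "norm (c *\<^sub>C f x) \<le> norm x * (cmod c * C)" for x
      using mult_left_mono[OF C[of x], of "cmod c"] by (simp add: norm_scaleC ac_simps)
  qed (simp_all add: f bounded_linear.linear linear_add linear_scale scaleC_add_right scaleC_scaleR)
qed

instance
proof
  fix c :: complex and f :: "'a \<Rightarrow>\<^sub>L 'b"
  have 1: "norm (c *\<^sub>C f) \<le> cmod c * norm f" for c and f :: "'a \<Rightarrow>\<^sub>L 'b"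
    using norm_blinfun[of f]
    by (intro norm_blinfun_bound)
      (auto simp: scaleC_blinfun.rep_eq norm_scaleC mult.assoc intro!: mult_left_mono)
  have "cmod c * norm f \<le> norm (c *\<^sub>C f)"
  proof (cases "c = 0")
    case False
    have "inverse c *\<^sub>C c *\<^sub>C f = f"
      using False scaleC_of_real[of 1]
      by (intro blinfun_eqI) (simp add: scaleC_blinfun.rep_eq scaleC_scaleC)
    then have "norm f \<le> inverse (cmod c) * norm (c *\<^sub>C f)"
      using 1[of "inverse c" "c *\<^sub>C f"] by (simp add: norm_inverse)
    then show ?thesis
      using False by (simp add: field_simps)
  qed simp
  with 1 show "norm (c *\<^sub>C f) = cmod c * norm f"
    by (simp add: antisym)
qed (auto intro!: blinfun_eqI simp: scaleC_blinfun.rep_eq blinfun.add_left blinfun.scaleR_left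
        scaleC_add_right scaleC_add_left scaleC_scaleC scaleC_of_real)

end

text \<open>
  The elements of \<open>'a \<Rightarrow>\<^sub>L 'b\<close> are bounded and real linear; the space \<open>L(X;Z)\<close> consists of those
  that are complex linear.
\<close>

definition complex_linear :: "('a::complex_normed_vector \<Rightarrow>\<^sub>L 'b::complex_normed_vector) \<Rightarrow> bool"
  where "complex_linear T \<longleftrightarrow> (\<forall>c x. blinfun_apply T (c *\<^sub>C x) = c *\<^sub>C blinfun_apply T x)"

definition adj :: "('a::complex_hilbert \<Rightarrow>\<^sub>L 'b::complex_hilbert) \<Rightarrow> ('b \<Rightarrow>\<^sub>L 'a)"
  where "adj T =
    (THE S. \<forall>x y. cinner (blinfun_apply T x) y = cinner x (blinfun_apply S y))"

definition Re_ge :: "('a::complex_hilbert \<Rightarrow>\<^sub>L 'a) \<Rightarrow> real \<Rightarrow> bool"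
  where "Re_ge T c \<longleftrightarrow> (\<forall>w. Re (cinner (blinfun_apply T w) w) \<ge> c * (norm w)\<^sup>2)"

lift_definition column_op ::
    "('c::real_normed_vector \<Rightarrow>\<^sub>L 'a::real_normed_vector) \<Rightarrow> ('c \<Rightarrow>\<^sub>L 'b::real_normed_vector)
      \<Rightarrow> ('c \<Rightarrow>\<^sub>L ('a \<times> 'b))"
  is "\<lambda>S T x. (S x, T x)"
  by (rule bounded_linear_Pair)

lift_definition row_op ::
    "('a::real_normed_vector \<Rightarrow>\<^sub>L 'c::real_normed_vector) \<Rightarrow> ('b::real_normed_vector \<Rightarrow>\<^sub>L 'c)
      \<Rightarrow> (('a \<times> 'b) \<Rightarrow>\<^sub>L 'c)"
  is "\<lambda>S T x. S (fst x) + T (snd x)"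
  by (intro bounded_linear_add)
    (auto intro: bounded_linear_compose bounded_linear_fst bounded_linear_snd)

definition block_op ::
    "('a::real_normed_vector \<Rightarrow>\<^sub>L 'c::real_normed_vector) \<Rightarrow> ('b::real_normed_vector \<Rightarrow>\<^sub>L 'c)
      \<Rightarrow> ('a \<Rightarrow>\<^sub>L 'd::real_normed_vector) \<Rightarrow> ('b \<Rightarrow>\<^sub>L 'd) \<Rightarrow> (('a \<times> 'b) \<Rightarrow>\<^sub>L ('c \<times> 'd))"
  where "block_op A B C D = column_op (row_op A B) (row_op C D)"


section \<open>Linear material laws\<close>

definition analytic_on_open :: "complex set \<Rightarrow> (complex \<Rightarrow> 'a::complex_normed_vector) \<Rightarrow> bool"
  where "analytic_on_open S f \<longleftrightarrow> open S \<and>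
    (\<forall>z\<in>S. \<exists>D. ((\<lambda>w. inverse (w - z) *\<^sub>C (f w - f z)) \<longlongrightarrow> D) (at z))"

definition linear_material_law ::
    "real \<Rightarrow> (complex \<Rightarrow> ('a::complex_hilbert \<Rightarrow>\<^sub>L 'a)) \<Rightarrow> bool"
  where "linear_material_law r M \<longleftrightarrow>
    (\<forall>z \<in> ball (of_real r) r. complex_linear (M z)) \<and>
    bounded (M ` ball (of_real r) r) \<and> analytic_on_open (ball (of_real r) r) M"


section \<open>Unbounded operators\<close>

text \<open>Unbounded operators are given by their graphs.\<close>

definition densely_defined_closed_operator ::
    "('a::complex_hilbert \<times> 'b::complex_hilbert) set \<Rightarrow> bool"
  where "densely_defined_closed_operator F \<longleftrightarrow>
    0 \<in> F \<and> (\<forall>p\<in>F. \<forall>q\<in>F. p + q \<in> F) \<and> (\<forall>c. \<forall>p\<in>F. c *\<^sub>C p \<in> F) \<and>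
    single_valued F \<and> closed F \<and> closure (Domain F) = UNIV"

definition adjoint_graph :: "('a::complex_hilbert \<times> 'b::complex_hilbert) set \<Rightarrow> ('b \<times> 'a) set"
  where "adjoint_graph F = {(y, x). \<forall>(u, v) \<in> F. cinner v y = cinner u x}"

text \<open>The operator matrix with rows \<open>(0, F\<^sup>*, 0)\<close>, \<open>(-F, 0, 0)\<close> and \<open>(0, 0, 0)\<close>.\<close>

definition skew_matrix ::
    "('h0::complex_hilbert \<times> 'h1::complex_hilbert) set
      \<Rightarrow> ((('h0 \<times> 'h1) \<times> 'y::complex_hilbert) \<times> (('h0 \<times> 'h1) \<times> 'y)) set"
  where "skew_matrix F =
    {(((x, \<xi>), y), ((a, - b), 0)) | x \<xi> y a b. (\<xi>, a) \<in> adjoint_graph F \<and> (x, b) \<in> F}"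


section \<open>Weighted spaces\<close>

text \<open>
  Elements of the weighted space \<open>H\<^bsub>\<nu>,0\<^esub>(\<real>;H)\<close> are represented by functions, two functions
  representing the same element iff they agree almost everywhere. Operators between such spaces
  are represented by graphs which contain, with any pair, all pairs of a.e. equal functions.
  The value \<open>\<nu> = 0\<close> gives \<open>L\<^sub>2(\<real>;H)\<close>. Measurability is strong (Bochner) measurability, as \<open>H\<close> is
  not assumed to be separable.
\<close>

definition strongly_measurable :: "(real \<Rightarrow> 'a::topological_space) \<Rightarrow> bool"
  where "strongly_measurable f \<longleftrightarrow>
    (\<exists>s. (\<forall>n. simple_function lebesgue (s n)) \<and> (AE t in lebesgue. (\<lambda>n. s n t) \<longlonglongrightarrow> f t))"

definition wspace :: "real \<Rightarrow> (real \<Rightarrow> 'a::complex_hilbert) set"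
  where "wspace \<nu> = {f. strongly_measurable f \<and>
    integrable lebesgue (\<lambda>t. (norm (f t))\<^sup>2 * exp (- 2 * \<nu> * t))}"

definition winner :: "real \<Rightarrow> (real \<Rightarrow> 'a::complex_hilbert) \<Rightarrow> (real \<Rightarrow> 'a) \<Rightarrow> complex"
  where "winner \<nu> f g = (\<integral>t. cinner (f t) (g t) * of_real (exp (- 2 * \<nu> * t)) \<partial>lebesgue)"

definition wnorm :: "real \<Rightarrow> (real \<Rightarrow> 'a::complex_hilbert) \<Rightarrow> real"
  where "wnorm \<nu> f = sqrt (\<integral>t. (norm (f t))\<^sup>2 * exp (- 2 * \<nu> * t) \<partial>lebesgue)"

type_synonym ('a, 'b) woperator = "((real \<Rightarrow> 'a) \<times> (real \<Rightarrow> 'b)) set"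

definition wclosure ::
    "real \<Rightarrow> ('a::complex_hilbert, 'b::complex_hilbert) woperator \<Rightarrow> ('a, 'b) woperator"
  where "wclosure \<nu> T = {(f, g). f \<in> wspace \<nu> \<and> g \<in> wspace \<nu> \<and>
    (\<exists>p q. (\<forall>n. (p n, q n) \<in> T \<and> p n \<in> wspace \<nu> \<and> q n \<in> wspace \<nu>) \<and>
      (\<lambda>n. wnorm \<nu> (\<lambda>t. p n t - f t)) \<longlonglongrightarrow> 0 \<and> (\<lambda>n. wnorm \<nu> (\<lambda>t. q n t - g t)) \<longlonglongrightarrow> 0)}"

text \<open>The adjoint of an operator from \<open>H\<^bsub>\<mu>,0\<^esub>\<close> to \<open>H\<^bsub>\<nu>,0\<^esub>\<close>.\<close>

definition wadjoint ::
    "real \<Rightarrow> real \<Rightarrow> ('a::complex_hilbert, 'b::complex_hilbert) woperator \<Rightarrow> ('b, 'a) woperator"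
  where "wadjoint \<mu> \<nu> T = {(g, h). g \<in> wspace \<nu> \<and> h \<in> wspace \<mu> \<and>
    (\<forall>(u, v) \<in> T. winner \<nu> v g = winner \<mu> u h)}"

definition woperator_plus ::
    "('a, 'b::plus) woperator \<Rightarrow> ('a, 'b) woperator \<Rightarrow> ('a, 'b) woperator"
  where "woperator_plus S T = {(f, \<lambda>t. g t + h t) | f g h. (f, g) \<in> S \<and> (f, h) \<in> T}"

definition pointwise_extension ::
    "real \<Rightarrow> ('a::complex_hilbert \<times> 'b::complex_hilbert) set \<Rightarrow> ('a, 'b) woperator"
  where "pointwise_extension \<nu> A =
    {(f, g). f \<in> wspace \<nu> \<and> g \<in> wspace \<nu> \<and> (AE t in lebesgue. (f t, g t) \<in> A)}"

text \<open>Maps of representatives which induce an element of \<open>L(H\<^bsub>\<nu>,0\<^esub>(\<real>;U); H\<^bsub>\<nu>,0\<^esub>(\<real>;H))\<close>.\<close>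

definition wbounded_operator ::
    "real \<Rightarrow> ((real \<Rightarrow> 'u::complex_hilbert) \<Rightarrow> (real \<Rightarrow> 'a::complex_hilbert)) \<Rightarrow> bool"
  where "wbounded_operator \<nu> B \<longleftrightarrow>
    (\<forall>u \<in> wspace \<nu>. B u \<in> wspace \<nu>) \<and>
    (\<forall>u \<in> wspace \<nu>. \<forall>v \<in> wspace \<nu>. (AE t in lebesgue. u t = v t) \<longrightarrow>
      (AE t in lebesgue. B u t = B v t)) \<and>
    (\<forall>u \<in> wspace \<nu>. \<forall>v \<in> wspace \<nu>. AE t in lebesgue. B (\<lambda>s. u s + v s) t = B u t + B v t) \<and>
    (\<forall>c. \<forall>u \<in> wspace \<nu>. AE t in lebesgue. B (\<lambda>s. c *\<^sub>C u s) t = c *\<^sub>C B u t) \<and>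
    (\<exists>C. \<forall>u \<in> wspace \<nu>. wnorm \<nu> (B u) \<le> C * wnorm \<nu> u)"


section \<open>The time derivative and the Fourier--Laplace transform\<close>

definition test_function :: "(real \<Rightarrow> 'a::real_normed_vector) \<Rightarrow> bool"
  where "test_function \<phi> \<longleftrightarrow>
    (\<forall>n t. ((\<lambda>\<psi> s. vector_derivative \<psi> (at s)) ^^ n) \<phi> differentiable (at t)) \<and>
    compact (closure {t. \<phi> t \<noteq> 0})"

definition time_derivative :: "real \<Rightarrow> ('a::complex_hilbert, 'a) woperator"
  where "time_derivative \<nu> =
    wclosure \<nu> {(\<phi>, \<lambda>t. vector_derivative \<phi> (at t)) | \<phi>. test_function \<phi>}"

text \<open>
  The unitary Fourier transform is the continuous extension of the Fourier integral from test
  functions to \<open>L\<^sub>2(\<real>;H)\<close>. The Henstock-Kurzweil integral is used because the Bochner integral of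
  the library requires a separable codomain.
\<close>

definition fourier :: "('a::complex_hilbert, 'a) woperator"
  where "fourier =
    wclosure 0 {(\<phi>, \<lambda>x. (1 / sqrt (2 * pi)) *\<^sub>R integral UNIV (\<lambda>t. cis (- (x * t)) *\<^sub>C \<phi> t)) | \<phi>.
      test_function \<phi>}"

definition fourier_laplace :: "real \<Rightarrow> ('a::complex_hilbert, 'a) woperator"
  where "fourier_laplace \<nu> =
    {(f, g). f \<in> wspace \<nu> \<and> ((\<lambda>x. exp (- \<nu> * x) *\<^sub>R f x), g) \<in> fourier}"

definition multiplication_operator ::
    "(real \<Rightarrow> ('a::complex_hilbert \<Rightarrow>\<^sub>L 'a)) \<Rightarrow> ('a, 'a) woperator"
  where "multiplication_operator N = {(f, g). f \<in> wspace 0 \<and> g \<in> wspace 0 \<and>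
    (AE x in lebesgue. g x = blinfun_apply (N x) (f x))}"

text \<open>\<open>M(\<partial>\<^sub>0\<^sup>-\<^sup>1)\<close>; note that in \<open>S O T\<close> the relation \<open>S\<close> is applied first.\<close>

definition material_law_operator ::
    "real \<Rightarrow> (complex \<Rightarrow> ('a::complex_hilbert \<Rightarrow>\<^sub>L 'a)) \<Rightarrow> ('a, 'a) woperator"
  where "material_law_operator \<nu> M =
    fourier_laplace \<nu> O multiplication_operator (\<lambda>x. M (1 / (\<i> * of_real x + of_real \<nu>)))
      O wadjoint \<nu> 0 (fourier_laplace \<nu>)"


section \<open>Abstract linear control systems\<close>

text \<open>
  The abstract linear control system is the equation whose left-hand side is
  \<open>system_operator C \<nu>\<close> and whose right-hand side is an arbitrary source term plus the image of the
  control under the control operator. It is identified with the data determining it; the control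
  operator is given for each weight \<open>\<nu>\<close>. Well-posedness and causality concern the left-hand side only.
\<close>

record (overloaded) ('h0, 'h1, 'y, 'u) control_system =
  material_law :: "complex \<Rightarrow> (('h0::complex_hilbert \<times> 'h1::complex_hilbert) \<times> 'y::complex_hilbert)
    \<Rightarrow>\<^sub>L (('h0 \<times> 'h1) \<times> 'y)"
  spatial_operator :: "('h0 \<times> 'h1) set"
  control_operator :: "real \<Rightarrow> (real \<Rightarrow> 'u::complex_hilbert) \<Rightarrow> (real \<Rightarrow> ('h0 \<times> 'h1) \<times> 'y)"

definition system_operator ::
    "('h0::complex_hilbert, 'h1::complex_hilbert, 'y::complex_hilbert, 'u::complex_hilbert)
      control_system \<Rightarrow> real \<Rightarrow> (('h0 \<times> 'h1) \<times> 'y, ('h0 \<times> 'h1) \<times> 'y) woperator"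
  where "system_operator C \<nu> =
    woperator_plus (material_law_operator \<nu> (material_law C) O time_derivative \<nu>)
      (pointwise_extension \<nu> (skew_matrix (spatial_operator C)))"

definition densely_defined_bounded_inverse ::
    "real \<Rightarrow> ('a::complex_hilbert, 'a) woperator \<Rightarrow> bool"
  where "densely_defined_bounded_inverse \<nu> T \<longleftrightarrow>
    (\<forall>(f, g) \<in> T. \<forall>(f', g') \<in> T. (AE t in lebesgue. g t = g' t) \<longrightarrow> (AE t in lebesgue. f t = f' t)) \<and>
    (\<exists>C. \<forall>(f, g) \<in> T. wnorm \<nu> f \<le> C * wnorm \<nu> g) \<and>
    (\<forall>h \<in> wspace \<nu>. \<forall>\<epsilon>>0. \<exists>(f, g) \<in> T. wnorm \<nu> (\<lambda>t. g t - h t) < \<epsilon>)"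

definition well_posed ::
    "('h0::complex_hilbert, 'h1::complex_hilbert, 'y::complex_hilbert, 'u::complex_hilbert)
      control_system \<Rightarrow> bool"
  where "well_posed C \<longleftrightarrow>
    (\<forall>\<^sub>F \<nu> in at_top. densely_defined_bounded_inverse \<nu> (system_operator C \<nu>))"

text \<open>The continuous extension of a bounded operator to the closure of its domain has as its graph
  the closure of the given graph.\<close>

definition solution_operator ::
    "('h0::complex_hilbert, 'h1::complex_hilbert, 'y::complex_hilbert, 'u::complex_hilbert)
      control_system \<Rightarrow> real \<Rightarrow> (('h0 \<times> 'h1) \<times> 'y, ('h0 \<times> 'h1) \<times> 'y) woperator"
  where "solution_operator C \<nu> = wclosure \<nu> ((system_operator C \<nu>)\<inverse>)"

definition cutoff :: "real \<Rightarrow> real \<Rightarrow> ('a::complex_hilbert, 'a) woperator"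
  where "cutoff \<nu> a = {(f, g). f \<in> wspace \<nu> \<and> g \<in> wspace \<nu> \<and>
    (AE t in lebesgue. g t = indicat_real {..a} t *\<^sub>R f t)}"

definition causal :: "real \<Rightarrow> ('a::complex_hilbert, 'a) woperator \<Rightarrow> bool"
  where "causal \<nu> S \<longleftrightarrow> (\<forall>a. cutoff \<nu> a O S O cutoff \<nu> a = S O cutoff \<nu> a)"

end

theory Submission
  imports Defs "HOL-Probability.Probability" "HOL-Complex_Analysis.Complex_Analysis"
begin

text \<open>
  The Fourier--Laplace transform turns the system into the family \<open>\<zeta> M(1 / \<zeta>) + A\<close> with
  \<open>\<zeta> = i x + \<nu>\<close> and the skew-selfadjoint operator \<open>A\<close> built from \<open>F\<close>. The conditions on \<open>\<delta>\<close> make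
  \<open>\<zeta> M(1 / \<zeta>) \<ge> c\<close> for some \<open>c > 0\<close>, so that these operators have inverses of norm at most \<open>1 / c\<close>
  which depend analytically on \<open>\<zeta>\<close>. Multiplication by the inverses is the solution operator; the
  range of the system is dense, as it contains every function whose transform has bounded support.
  For a source that is a multiple of a test function supported in \<open>[a, \<infinity>)\<close>, the integral of the solution
  against a test function supported in \<open>(-\<infinity>, a]\<close> is an integral over the line \<open>Re \<zeta> = \<nu>\<close>, and it
  vanishes because the line can be shifted to \<open>Re \<zeta> \<rightarrow> \<infinity>\<close>. Causality follows by density.
\<close>

section \<open>Complex Hilbert spaces\<close>

text \<open>The system asks \<open>f\<close> to lie in the domains of both summands at once, so the
  sum need not be closed nor its range be everything. It is therefore compared with the bounded
  operator \<open>solution\<close>: each pair of the system satisfies \<open>f = solution g\<close>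
  after weighting, and truncation in frequency, which makes the unbounded symbol bounded, gives a
  dense set of solvable sources. Multiplying by the weight and identifying functions that agree
  almost everywhere leads to the type \<open>L2\<close>, a complex Hilbert space in its own right,
  where projections, adjoints and closures can be taken. The fibres may be nonseparable, so Fubini
  and Plancherel are applied to scalar integrals of inner products. The constant is the minimum of
  \<open>c0 - \<delta> * norm J\<close> and \<open>c1 - 1 / \<delta> * norm J\<close>: the
  off-diagonal blocks contribute \<open>2 * (J y \<bullet> p)\<close>, which Young's inequality with
  parameter \<open>\<delta>\<close> splits between the diagonal terms. Inversion maps
  \<open>Re \<zeta> > 1 / (2 * r)\<close> into the ball, so every such \<open>\<nu>\<close> is
  admissible. In the causality argument two derivatives of one bump supply the decay in
  \<open>\<zeta>\<close>, and the exponentials coming from the two supports multiply to at most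
  \<open>1\<close>.\<close>

instance complex_hilbert \<subseteq> banach ..

lemma scaleC_one [simp]: "1 *\<^sub>C x = (x :: 'a::complex_normed_vector)"
  using scaleC_of_real[of 1 x] by simp

lemma bounded_bilinear_scaleC:
  "bounded_bilinear (scaleC :: complex \<Rightarrow> 'a::complex_normed_vector \<Rightarrow> 'a)"
proof
  show "(a *\<^sub>R c) *\<^sub>C x = a *\<^sub>R (c *\<^sub>C x)" for a c and x :: 'a
    by (simp add: scaleR_conv_of_real scaleC_of_real flip: scaleC_scaleC)
  show "\<exists>K. \<forall>a b. norm (a *\<^sub>C (b :: 'a)) \<le> norm a * norm b * K"
    by (rule exI[of _ 1]) (simp add: norm_scaleC)
qed (simp_all add: scaleC_add_left scaleC_add_right scaleC_scaleR)

interpretation scaleC: bounded_bilinear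
  "scaleC :: complex \<Rightarrow> 'a::complex_normed_vector \<Rightarrow> 'a"
  by (rule bounded_bilinear_scaleC)

lemma scaleC_zero [simp]:
  "c *\<^sub>C (0 :: 'a::complex_normed_vector) = 0" "0 *\<^sub>C (x :: 'a) = 0"
  by (simp_all add: scaleC.zero_left scaleC.zero_right)

lemma cinner_add_left: "cinner (x + y) z = cinner x z + cinner y (z :: 'a::complex_hilbert)"
  by (metis cinner_commute cinner_add_right complex_cnj_add)

lemma cinner_scaleC_left: "cinner (c *\<^sub>C x) y = cnj c * cinner x (y :: 'a::complex_hilbert)"
  by (metis cinner_commute cinner_scaleC_right complex_cnj_mult)

text \<open>Rotating \<open>y\<close> by a complex number of modulus one makes the inner product
  real and nonnegative, where the real Cauchy-Schwarz inequality applies.\<close>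

lemma cmod_cinner_le: "cmod (cinner x y) \<le> norm x * norm (y :: 'a::complex_hilbert)"
proof (cases "cinner x y = 0")
  case False
  define u where "u = cnj (cinner x y) / of_real (cmod (cinner x y))"
  have u: "cmod u = 1"
    using False by (simp add: u_def norm_divide)
  have "u * cinner x y = of_real (cmod (cinner x y))"
    using False by (simp add: u_def field_simps complex_norm_square[symmetric] power2_eq_square)
  then have "cmod (cinner x y) = x \<bullet> (u *\<^sub>C y)"
    by (simp flip: Re_cinner add: cinner_scaleC_right)
  also have "\<dots> \<le> norm x * norm (u *\<^sub>C y)"
    by (rule norm_cauchy_schwarz)
  finally show ?thesis
    by (simp add: norm_scaleC u)
qed simp

lemma bounded_bilinear_cinner:
  "bounded_bilinear (cinner :: 'a::complex_hilbert \<Rightarrow> 'a \<Rightarrow> complex)"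
proof
  show "cinner (a *\<^sub>R x) y = a *\<^sub>R cinner x y" for a and x y :: 'a
    by (simp flip: scaleC_of_real add: cinner_scaleC_left scaleR_conv_of_real)
  show "cinner x (a *\<^sub>R y) = a *\<^sub>R cinner x y" for a and x y :: 'a
    by (simp flip: scaleC_of_real add: cinner_scaleC_right scaleR_conv_of_real)
  show "\<exists>K. \<forall>a b. norm (cinner a (b :: 'a)) \<le> norm a * norm b * K"
    by (rule exI[of _ 1]) (simp add: cmod_cinner_le)
qed (simp_all add: cinner_add_left cinner_add_right)

interpretation cinner: bounded_bilinear
  "cinner :: 'a::complex_hilbert \<Rightarrow> 'a \<Rightarrow> complex"
  by (rule bounded_bilinear_cinner)

text \<open>A complex form is determined by its real part, at the cost of a factor
  \<open>\<i>\<close>. With \<open>Re_cinner\<close> this reduces many complex statements below to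
  the real inner product.\<close>

lemma Im_cinner: "Im (cinner x y) = - (x \<bullet> (\<i> *\<^sub>C (y :: 'a::complex_hilbert)))"
  by (simp flip: Re_cinner add: cinner_scaleC_right)

lemma cinner_self: "cinner x x = complex_of_real ((norm (x :: 'a::complex_hilbert))\<^sup>2)"
proof (rule complex_eqI)
  show "Im (cinner x x) = Im (complex_of_real ((norm x)\<^sup>2))"
    using cinner_commute[of x x] by (simp add: complex_eq_iff)
qed (simp add: Re_cinner dot_square_norm)

lemma inner_scaleC_left: "(c *\<^sub>C x) \<bullet> y = x \<bullet> (cnj c *\<^sub>C (y :: 'a::complex_hilbert))"
  by (simp flip: Re_cinner add: cinner_scaleC_right cinner_scaleC_left)

lemma isometry_inner:
  fixes U :: "'a::real_inner \<Rightarrow> 'b::real_inner"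
  assumes "linear U" "\<And>x. norm (U x) = norm x"
  shows "U x \<bullet> U y = x \<bullet> y"
proof -
  have "U x \<bullet> U y = ((norm (U (x + y)))\<^sup>2 - (norm (U x))\<^sup>2 - (norm (U y))\<^sup>2) / 2"
    using assms(1) by (simp add: linear_add dot_norm)
  then show ?thesis
    by (simp add: assms(2) dot_norm)
qed

lemma complex_isometry_cinner:
  fixes U :: "'a::complex_hilbert \<Rightarrow> 'b::complex_hilbert"
  assumes "linear U" "\<And>x. norm (U x) = norm x" "\<And>c x. U (c *\<^sub>C x) = c *\<^sub>C U x"
  shows "cinner (U x) (U y) = cinner x y"
  using isometry_inner[OF assms(1,2)]
  by (simp add: complex_eq_iff Re_cinner Im_cinner flip: assms(3))

subsection \<open>Orthogonal projections and adjoints\<close>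

lemma closest_point_orthogonal:
  fixes x p :: "'a::real_inner"
  assumes "subspace S" "p \<in> S" "s \<in> S" and min: "\<And>s. s \<in> S \<Longrightarrow> norm (x - p) \<le> norm (x - s)"
  shows "(x - p) \<bullet> s = 0"
proof (cases "s = 0")
  case False
  \<comment> \<open>\<open>t\<close> minimizes the squared norm of
    \<open>x - p - t *\<^sub>R s\<close>. Since \<open>p\<close> is already closest, the gain
    \<open>((x - p) \<bullet> s)\<^sup>2 / (s \<bullet> s)\<close> must vanish.\<close>
  define t where "t = ((x - p) \<bullet> s) / (s \<bullet> s)"
  have "p + t *\<^sub>R s \<in> S"
    using assms by (simp add: subspace_add subspace_scale)
  then have "(norm (x - p))\<^sup>2 \<le> (norm ((x - p) - t *\<^sub>R s))\<^sup>2"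
    using min[of "p + t *\<^sub>R s"] by (simp add: diff_diff_eq power_mono)
  also have "\<dots> = (norm (x - p))\<^sup>2 - ((x - p) \<bullet> s)\<^sup>2 / (s \<bullet> s)"
  proof -
    have "(norm ((x - p) - t *\<^sub>R s))\<^sup>2 =
        (norm (x - p))\<^sup>2 - 2 * t * ((x - p) \<bullet> s) + t\<^sup>2 * (s \<bullet> s)"
      unfolding power2_norm_eq_inner inner_diff_left[of "x - p" "t *\<^sub>R s"]
        inner_diff_right[of _ "x - p" "t *\<^sub>R s"]
      by (simp add: inner_commute power2_eq_square)
    then show ?thesis
      using False by (simp add: t_def power2_eq_square)
  qed
  finally have "((x - p) \<bullet> s)\<^sup>2 / (s \<bullet> s) \<le> 0"
    by simp
  then have "((x - p) \<bullet> s)\<^sup>2 \<le> 0"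
    using inner_gt_zero_iff[THEN iffD2, OF False] by (simp add: divide_le_0_iff)
  then show ?thesis
    by simp
qed simp

text \<open>A minimizing sequence for the distance to \<open>S\<close> is Cauchy. Orthogonality is
  meant for the real inner product; on subspaces invariant under complex scalars it agrees with
  complex orthogonality.\<close>

lemma orthogonal_projection_exists:
  fixes S :: "'a::{real_inner, complete_space} set"
  assumes S: "subspace S" "closed S"
  obtains p where "p \<in> S" "\<And>s. s \<in> S \<Longrightarrow> (x - p) \<bullet> s = 0"
proof -
  define d where "d = infdist x S"
  have ne: "S \<noteq> {}"
    using S subspace_0 by blast
  have d: "d \<le> norm (x - s)" if "s \<in> S" for s
    using infdist_le[OF that, of x] by (simp add: d_def dist_norm)
  have "\<exists>s\<in>S. norm (x - s) < d + 1 / real (Suc n)" for n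
    using cInf_lessD[of "dist x ` S" "d + 1 / real (Suc n)"] ne
    by (auto simp: d_def infdist_def dist_norm image_comp)
  then obtain s where s: "\<And>n. s n \<in> S" "\<And>n. norm (x - s n) < d + 1 / real (Suc n)"
    by metis
  have lim: "(\<lambda>n. norm (x - s n)) \<longlonglongrightarrow> d"
  proof (rule tendsto_sandwich[of "\<lambda>_. d" _ _ "\<lambda>n. d + 1 / real (Suc n)"])
    show "(\<lambda>n. d + 1 / real (Suc n)) \<longlonglongrightarrow> d"
      using tendsto_add[OF tendsto_const[of d] LIMSEQ_inverse_real_of_nat]
      by (simp add: inverse_eq_divide)
  qed (use s d in \<open>auto intro!: always_eventually less_imp_le\<close>)
  \<comment> \<open>Parallelogram identity: the midpoint of \<open>s m\<close> and
    \<open>s n\<close> lies in \<open>S\<close>, hence at distance at least \<open>d\<close> from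
    \<open>x\<close>.\<close>
  have par: "(norm (s m - s n))\<^sup>2 \<le> 2 * (norm (x - s m))\<^sup>2 + 2 * (norm (x - s n))\<^sup>2 - 4 * d\<^sup>2" for m n
  proof -
    have "(1/2) *\<^sub>R (s m + s n) \<in> S"
      using S s by (simp add: subspace_add subspace_scale)
    then have "d\<^sup>2 \<le> (norm (x - (1/2) *\<^sub>R (s m + s n)))\<^sup>2"
      using d by (intro power_mono) (auto simp: d_def infdist_nonneg)
    moreover have "(norm (s m - s n))\<^sup>2 = 2 * (norm (x - s m))\<^sup>2 + 2 * (norm (x - s n))\<^sup>2
        - 4 * (norm (x - (1/2) *\<^sub>R (s m + s n)))\<^sup>2"
      by (simp add: power2_norm_eq_inner inner_diff_left inner_diff_right inner_add_left
          inner_add_right algebra_simps inner_commute)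
    ultimately show ?thesis
      by simp
  qed
  have "Cauchy s"
  proof (rule metric_CauchyI)
    fix e :: real assume e: "e > 0"
    have "(\<lambda>n. (norm (x - s n))\<^sup>2) \<longlonglongrightarrow> d\<^sup>2"
      by (intro tendsto_power lim)
    then have "\<forall>\<^sub>F n in sequentially. (norm (x - s n))\<^sup>2 < d\<^sup>2 + e\<^sup>2 / 4"
      by (rule order_tendstoD) (use e in simp)
    then obtain N where N: "\<And>n. n \<ge> N \<Longrightarrow> (norm (x - s n))\<^sup>2 < d\<^sup>2 + e\<^sup>2 / 4"
      by (auto simp: eventually_sequentially)
    have "dist (s m) (s n) < e" if "m \<ge> N" "n \<ge> N" for m n
    proof -
      have "(norm (s m - s n))\<^sup>2 < e\<^sup>2"
        using par[of m n] N[OF that(1)] N[OF that(2)] by linarith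
      then show ?thesis
        using e by (simp add: dist_norm power_less_imp_less_base)
    qed
    then show "\<exists>N. \<forall>m\<ge>N. \<forall>n\<ge>N. dist (s m) (s n) < e"
      by blast
  qed
  then obtain p where p: "s \<longlonglongrightarrow> p"
    using Cauchy_convergent_iff convergent_def by blast
  have pS: "p \<in> S"
    using closed_sequentially[OF S(2)] s(1) p by blast
  have "(\<lambda>n. norm (x - s n)) \<longlonglongrightarrow> norm (x - p)"
    by (intro tendsto_intros p)
  then have "norm (x - p) = d"
    using lim LIMSEQ_unique by blast
  then have "(x - p) \<bullet> t = 0" if "t \<in> S" for t
    using closest_point_orthogonal[OF S(1) pS that] d by simp
  with pS show ?thesis
    by (rule that)
qed

text \<open>To be used with \<open>S\<close> a closed relation: membership becomes the equation
  \<open>P x = x\<close> for a bounded complex linear \<open>P\<close>, and such an equation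
  commutes with the Fourier transform. Complex linearity holds because a scalar moves across the
  inner product as its conjugate, under which \<open>S\<close> is invariant.\<close>

lemma orthogonal_projection_op:
  fixes S :: "'a::complex_hilbert set"
  assumes S: "subspace S" "closed S" and SC: "\<And>c s. s \<in> S \<Longrightarrow> c *\<^sub>C s \<in> S"
  obtains P :: "'a \<Rightarrow>\<^sub>L 'a" where "complex_linear P" "\<And>x. P x \<in> S" "\<And>x. x \<in> S \<Longrightarrow> P x = x"
proof -
  have "\<exists>p. p \<in> S \<and> (\<forall>s\<in>S. (x - p) \<bullet> s = 0)" for x
    using orthogonal_projection_exists[OF S] by metis
  then obtain P where P: "\<And>x. P x \<in> S" "\<And>x s. s \<in> S \<Longrightarrow> (x - P x) \<bullet> s = 0"
    by metis
  have uniq: "P x = p" if "p \<in> S" "\<And>s. s \<in> S \<Longrightarrow> (x - p) \<bullet> s = 0" for x p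
  proof -
    have "P x - p \<in> S"
      using that P S by (simp add: subspace_diff)
    then have "(x - p) \<bullet> (P x - p) = 0" "(x - P x) \<bullet> (P x - p) = 0"
      using that P by blast+
    then have "(P x - p) \<bullet> (P x - p) = 0"
      by (simp add: inner_diff_left)
    then show ?thesis
      by simp
  qed
  have 1: "P (x + y) = P x + P y" for x y
  proof (rule uniq)
    show "(x + y - (P x + P y)) \<bullet> s = 0" if "s \<in> S" for s
      using P(2)[OF that, of x] P(2)[OF that, of y]
      by (simp add: inner_add_left inner_diff_left)
  qed (use P S in \<open>simp add: subspace_add\<close>)
  have 2: "P (c *\<^sub>C x) = c *\<^sub>C P x" for c x
  proof (rule uniq)
    show "(c *\<^sub>C x - c *\<^sub>C P x) \<bullet> s = 0" if "s \<in> S" for s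
      using P(2)[OF SC[OF that, of "cnj c"], of x]
      by (simp flip: scaleC.diff_right add: inner_scaleC_left)
  qed (use P SC in auto)
  have 3: "P (a *\<^sub>R x) = a *\<^sub>R P x" for a x
    using 2[of "of_real a" x] by (simp add: scaleC_of_real)
  have 4: "norm (P x) \<le> norm x" for x
  proof -
    have "(x - P x) \<bullet> P x = 0"
      using P by blast
    then have "(norm (P x))\<^sup>2 = x \<bullet> P x"
      by (simp add: inner_diff_left power2_norm_eq_inner)
    also have "\<dots> \<le> norm x * norm (P x)"
      by (rule norm_cauchy_schwarz)
    finally show ?thesis
      by (cases "P x = 0") (simp_all add: power2_eq_square)
  qed
  have bl: "bounded_linear P"
    by (rule bounded_linear_intro[where K=1]) (auto simp: 1 3 4)
  show ?thesis
  proof (rule that[of "Blinfun P"])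
    show "complex_linear (Blinfun P)"
      by (simp add: complex_linear_def bounded_linear_Blinfun_apply[OF bl] 2)
    show "Blinfun P x = x" if "x \<in> S" for x
      using uniq[OF that] by (simp add: bounded_linear_Blinfun_apply[OF bl])
  qed (simp add: bounded_linear_Blinfun_apply[OF bl] P)
qed

lemma riesz_representation:
  fixes f :: "'a::{real_inner, complete_space} \<Rightarrow> real"
  assumes f: "bounded_linear f"
  obtains v where "\<And>x. f x = v \<bullet> x"
proof (cases "\<forall>x. f x = 0")
  case True
  then show ?thesis
    using that[of 0] by simp
next
  case False
  then obtain x where x: "f x \<noteq> 0"
    by blast
  interpret f: bounded_linear f
    by (rule f)
  have S: "subspace {x. f x = 0}"
    by (simp add: subspace_def f.add f.scaleR f.zero)
  have "closed {x. f x = 0}"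
    by (intro closed_Collect_eq linear_continuous_on f continuous_on_const)
  note S = S this
  obtain p where "p \<in> {x. f x = 0}" "\<And>s. s \<in> {x. f x = 0} \<Longrightarrow> (x - p) \<bullet> s = 0"
  proof (rule orthogonal_projection_exists[OF S, of x])
    fix p
    assume "p \<in> {x. f x = 0}" "\<And>s. s \<in> {x. f x = 0} \<Longrightarrow> (x - p) \<bullet> s = 0"
    then show thesis
      by (rule that)
  qed
  then have p: "f p = 0" "\<And>s. f s = 0 \<Longrightarrow> (x - p) \<bullet> s = 0"
    by simp_all
  \<comment> \<open>\<open>e\<close> is normal to the kernel, and every \<open>y\<close> differs
    from a multiple of \<open>e\<close> by an element of the kernel; this fixes the scaling of the
    representing vector.\<close>
  define e where "e = x - p"
  have "f e \<noteq> 0"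
    using x p by (simp add: e_def f.diff)
  then have e: "f e \<noteq> 0" "e \<noteq> 0"
    using f.zero by metis+
  show ?thesis
  proof (rule that[of "(f e / (e \<bullet> e)) *\<^sub>R e"])
    fix y
    have "e \<bullet> (y - (f y / f e) *\<^sub>R e) = 0"
      using p(2)[of "y - (f y / f e) *\<^sub>R e"] e by (simp add: e_def[symmetric] f.diff f.scaleR)
    then have "e \<bullet> y = f y / f e * (e \<bullet> e)"
      by (simp add: inner_diff_right)
    then show "f y = (f e / (e \<bullet> e)) *\<^sub>R e \<bullet> y"
      using e by simp
  qed
qed

lemma real_adjoint_exists:
  fixes T :: "'a::{real_inner, complete_space} \<Rightarrow>\<^sub>L 'b::real_inner"
  obtains S :: "'b \<Rightarrow>\<^sub>L 'a" where "\<And>x y. T x \<bullet> y = x \<bullet> S y"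
proof -
  have "bounded_linear (\<lambda>x. T x \<bullet> y)" for y
    by (rule bounded_linear_compose[OF bounded_linear_inner_left blinfun.bounded_linear_right])
  then have "\<exists>v. \<forall>x. T x \<bullet> y = v \<bullet> x" for y
    by (metis riesz_representation)
  then obtain S where S: "\<And>x y. T x \<bullet> y = S y \<bullet> x"
    by metis
  have eqI: "u = v" if "\<And>x. u \<bullet> x = v \<bullet> x" for u v :: 'a
    using that[of "u - v"] by (metis eq_iff_diff_eq_0 inner_diff_left inner_eq_zero_iff)
  have 1: "S (y + z) = S y + S z" for y z
    by (rule eqI) (simp add: inner_add_left inner_add_right flip: S)
  have 2: "S (a *\<^sub>R y) = a *\<^sub>R S y" for a y
    by (rule eqI) (simp flip: S)
  have 3: "norm (S y) \<le> norm y * norm T" for y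
  proof -
    have "(norm (S y))\<^sup>2 = T (S y) \<bullet> y"
      by (simp add: S power2_norm_eq_inner)
    also have "\<dots> \<le> norm T * norm (S y) * norm y"
      by (meson norm_cauchy_schwarz norm_blinfun mult_right_mono norm_ge_zero order_trans)
    finally show ?thesis
      by (cases "S y = 0") (simp_all add: power2_eq_square mult.assoc mult.left_commute mult.commute)
  qed
  have "bounded_linear S"
    by (rule bounded_linear_intro[OF 1 2 3])
  then show ?thesis
    using that[of "Blinfun S"] S by (simp add: bounded_linear_Blinfun_apply inner_commute)
qed

text \<open>\<open>adj\<close> is a definite description, so existence and uniqueness are both at
  stake. Existence comes from the real adjoint: complex linearity of \<open>T\<close> lets the
  factor \<open>\<i>\<close> pass through, which upgrades the identity of real parts to the complex
  one.\<close>

lemma cinner_adj: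
  fixes T :: "'a::complex_hilbert \<Rightarrow>\<^sub>L 'b::complex_hilbert"
  assumes T: "complex_linear T"
  shows "cinner (T x) y = cinner x (adj T y)"
proof -
  obtain S where S: "\<And>x y. T x \<bullet> y = x \<bullet> blinfun_apply S y"
    using real_adjoint_exists[of T] by blast
  have TC: "T (c *\<^sub>C x) = c *\<^sub>C T x" for c x
    using T by (simp add: complex_linear_def)
  have S': "y \<bullet> T x = S y \<bullet> x" for x y
    by (metis S inner_commute)
  have C: "cinner (T x) y = cinner x (S y)" for x y
  proof -
    have "cinner y (T x) = cinner (S y) x"
      by (simp add: complex_eq_iff Re_cinner Im_cinner S' flip: TC)
    then show ?thesis
      by (metis cinner_commute)
  qed
  have "(\<forall>x y. cinner (T x) y = cinner x (adj T y))"
    unfolding adj_def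
  proof (rule theI[of _ S])
    fix S' :: "'b \<Rightarrow>\<^sub>L 'a" assume S': "\<forall>x y. cinner (T x) y = cinner x (S' y)"
    show "S' = S"
    proof (rule blinfun_eqI)
      fix y
      have "cinner x (S' y - S y) = 0" for x
        using S' C by (simp add: cinner.diff_right)
      then have "cinner (S' y - S y) (S' y - S y) = 0"
        by blast
      then show "S' y = S y"
        by (simp add: cinner_self)
    qed
  qed (use C in blast)
  then show ?thesis
    by blast
qed

subsection \<open>Accretive perturbations of skew-selfadjoint relations\<close>

text \<open>For a complex subspace \<open>A\<close>, the last condition says that the adjoint of \<open>A\<close> is contained
  in \<open>-A\<close>; real parts suffice there because \<open>A\<close> is invariant under multiplication by the
  imaginary unit.\<close>

definition skew_selfadjoint :: "('a::complex_hilbert \<times> 'a) set \<Rightarrow> bool"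
  where "skew_selfadjoint A \<longleftrightarrow> subspace A \<and> closed A \<and> (\<forall>c. \<forall>p\<in>A. c *\<^sub>C p \<in> A) \<and>
    (\<forall>(w, v) \<in> A. v \<bullet> w = 0) \<and>
    (\<forall>g h. (\<forall>(w, v) \<in> A. v \<bullet> g + w \<bullet> h = 0) \<longrightarrow> (g, h) \<in> A)"

text \<open>The Lax-Milgram pattern. Skewness removes \<open>A\<close> from
  \<open>g \<bullet> w\<close> and leaves the accretivity of \<open>N\<close>; this gives the bound,
  and the bound makes the range of \<open>N + A\<close> closed. A vector orthogonal to the range
  lies in the domain of \<open>A\<close> by maximality, and accretivity then forces it to be
  zero.\<close>

lemma
  fixes N :: "'a::complex_hilbert \<Rightarrow>\<^sub>L 'a"
  assumes A: "skew_selfadjoint A" and c: "c > 0" and N: "\<And>w. N w \<bullet> w \<ge> c * (norm w)\<^sup>2"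
  shows skew_resolvent_bound: "(w, g - N w) \<in> A \<Longrightarrow> c * norm w \<le> norm g"
    and skew_resolvent_exists: "\<exists>w. (w, g - N w) \<in> A"
proof -
  have A1: "subspace A" "closed A" "\<And>w v. (w, v) \<in> A \<Longrightarrow> v \<bullet> w = 0"
    using A by (auto simp: skew_selfadjoint_def)
  have A2: "(g, h) \<in> A" if "\<And>w v. (w, v) \<in> A \<Longrightarrow> v \<bullet> g + w \<bullet> h = 0" for g h
    using A that unfolding skew_selfadjoint_def by blast
  show bound: "c * norm w \<le> norm g" if "(w, g - N w) \<in> A" for w g
  proof -
    have "c * (norm w)\<^sup>2 \<le> g \<bullet> w"
      using A1(3)[OF that] N[of w] by (simp add: inner_diff_left)
    also have "\<dots> \<le> norm g * norm w"
      by (rule norm_cauchy_schwarz)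
    finally show ?thesis
      by (cases "w = 0") (simp_all add: power2_eq_square)
  qed
  define Q where "Q = {g. \<exists>w. (w, g - N w) \<in> A}"
  have diff: "(w - w', (g - g') - N (w - w')) \<in> A"
    if "(w, g - N w) \<in> A" "(w', g' - N w') \<in> A" for w w' g g'
    using subspace_diff[OF A1(1) that] by (simp add: blinfun.diff_right algebra_simps)
  have Q: "subspace Q"
    unfolding subspace_def
  proof (intro conjI ballI allI)
    show "0 \<in> Q"
      using subspace_0[OF A1(1)] by (auto simp: Q_def zero_prod_def blinfun.zero_right intro!: exI[of _ 0])
  next
    fix x y assume "x \<in> Q" "y \<in> Q"
    then obtain w w' where w: "(w, x - N w) \<in> A" "(w', y - N w') \<in> A"
      by (auto simp: Q_def)
    then show "x + y \<in> Q"
      using subspace_add[OF A1(1) w]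
      by (auto simp: Q_def blinfun.add_right algebra_simps intro!: exI[of _ "w + w'"])
  next
    fix a x assume "x \<in> Q"
    then obtain w where w: "(w, x - N w) \<in> A"
      by (auto simp: Q_def)
    then show "a *\<^sub>R x \<in> Q"
      using subspace_scale[OF A1(1) w, of a]
      by (auto simp: Q_def blinfun.scaleR_right algebra_simps intro!: exI[of _ "a *\<^sub>R w"])
  qed
  have "closed Q"
  proof (rule closed_sequential_limits[THEN iffD2], intro allI impI)
    fix x l assume x: "(\<forall>n. x n \<in> Q) \<and> x \<longlonglongrightarrow> l"
    then obtain w where w: "\<And>n. (w n, x n - N (w n)) \<in> A"
      by (auto simp: Q_def) metis
    have "Cauchy w"
    proof (rule metric_CauchyI)
      fix e :: real assume e: "e > 0"
      have "Cauchy x"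
        using x LIMSEQ_imp_Cauchy by blast
      then obtain M where M: "\<And>m n. m \<ge> M \<Longrightarrow> n \<ge> M \<Longrightarrow> dist (x m) (x n) < c * e"
        using e c by (metis Cauchy_def mult_pos_pos)
      have "dist (w m) (w n) < e" if "m \<ge> M" "n \<ge> M" for m n
      proof -
        have "c * dist (w m) (w n) < c * e"
          using bound[OF diff[OF w[of m] w[of n]]] M[OF that] by (simp add: dist_norm)
        then show ?thesis
          using c by simp
      qed
      then show "\<exists>M. \<forall>m\<ge>M. \<forall>n\<ge>M. dist (w m) (w n) < e"
        by blast
    qed
    then obtain w0 where w0: "w \<longlonglongrightarrow> w0"
      using Cauchy_convergent_iff convergent_def by blast
    have "(\<lambda>n. (w n, x n - N (w n))) \<longlonglongrightarrow> (w0, l - N w0)"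
      using x w0 by (intro tendsto_intros) auto
    then have "(w0, l - N w0) \<in> A"
      by (rule closed_sequentially[OF A1(2) w])
    then show "l \<in> Q"
      by (auto simp: Q_def)
  qed
  then obtain p where p: "p \<in> Q" "\<And>s. s \<in> Q \<Longrightarrow> (g - p) \<bullet> s = 0"
    using orthogonal_projection_exists[OF Q] by blast
  obtain S where S: "\<And>x y. N x \<bullet> y = x \<bullet> blinfun_apply S y"
    using real_adjoint_exists[of N] by blast
  \<comment> \<open>Orthogonality to \<open>N w + v\<close> for all \<open>(w, v)\<close> in
    \<open>A\<close> is the premise of maximality, with \<open>S\<close> the adjoint of
    \<open>N\<close>.\<close>
  have "(g - p, S (g - p)) \<in> A"
  proof (rule A2)
    fix w v assume "(w, v) \<in> A"
    then have "N w + v \<in> Q"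
      by (auto simp: Q_def intro!: exI[of _ w])
    then show "v \<bullet> (g - p) + w \<bullet> S (g - p) = 0"
      using p(2)[of "N w + v"] by (simp add: inner_commute inner_add_right flip: S)
  qed
  then have "N (g - p) \<bullet> (g - p) = 0"
    using A1(3) S by (metis inner_commute)
  then have "g - p = 0"
    using N[of "g - p"] c by (simp add: mult_le_0_iff)
  then show "\<exists>w. (w, g - N w) \<in> A"
    using p(1) by (simp add: Q_def)
qed

text \<open>The inverse of \<open>N + A\<close>; the form \<open>(w, g - N w) \<in> A\<close> states
  the equation for \<open>w\<close> without treating the relation \<open>A\<close> as a
  function.\<close>

definition skew_resolvent :: "('a::complex_hilbert \<times> 'a) set \<Rightarrow> ('a \<Rightarrow>\<^sub>L 'a) \<Rightarrow> 'a \<Rightarrow>\<^sub>L 'a"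
  where "skew_resolvent A N = Blinfun (\<lambda>g. THE w. (w, g - N w) \<in> A)"

lemma
  fixes N :: "'a::complex_hilbert \<Rightarrow>\<^sub>L 'a"
  assumes A: "skew_selfadjoint A" and c: "c > 0" and N: "\<And>w. N w \<bullet> w \<ge> c * (norm w)\<^sup>2"
  shows skew_resolvent_iff: "(w, g - N w) \<in> A \<longleftrightarrow> w = skew_resolvent A N g"
    and norm_skew_resolvent: "norm (skew_resolvent A N) \<le> 1 / c"
    and complex_linear_skew_resolvent:
      "complex_linear N \<Longrightarrow> complex_linear (skew_resolvent A N)"
proof -
  note bound = skew_resolvent_bound[OF assms] and ex = skew_resolvent_exists[OF assms]
  have A1: "subspace A" "\<And>p c. p \<in> A \<Longrightarrow> c *\<^sub>C p \<in> A"
    using A by (auto simp: skew_selfadjoint_def)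
  have uniq: "w = w'" if "(w, g - N w) \<in> A" "(w', g - N w') \<in> A" for w w' g
  proof -
    have "(w - w', 0 - N (w - w')) \<in> A"
      using subspace_diff[OF A1(1) that] by (simp add: blinfun.diff_right algebra_simps)
    from bound[OF this] show ?thesis
      using c by (simp add: mult_le_0_iff)
  qed
  define f where "f g = (THE w. (w, g - N w) \<in> A)" for g
  have f: "(w, g - N w) \<in> A \<longleftrightarrow> w = f g" for w g
  proof -
    have "\<exists>!w. (w, g - N w) \<in> A"
      using ex[of g] uniq[where g = g] by blast
    from theI'[OF this] show ?thesis
      using uniq[where g = g] unfolding f_def by blast
  qed
  have fA: "(f g, g - N (f g)) \<in> A" for g
    by (simp add: f)
  have 1: "f (g + h) = f g + f h" for g h
    using subspace_add[OF A1(1) fA[of g] fA[of h]]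
    by (intro f[THEN iffD1, symmetric]) (simp add: blinfun.add_right algebra_simps)
  have 2: "f (a *\<^sub>R g) = a *\<^sub>R f g" for a g
    using subspace_scale[OF A1(1) fA[of g], of a]
    by (intro f[THEN iffD1, symmetric]) (simp add: blinfun.scaleR_right algebra_simps)
  have 3: "norm (f g) \<le> norm g * (1 / c)" for g
    using bound[OF fA[of g]] c by (simp add: field_simps)
  have bl: "bounded_linear f"
    by (rule bounded_linear_intro[OF 1 2 3])
  have "f = (\<lambda>g. THE w. (w, g - N w) \<in> A)"
    by (simp add: fun_eq_iff f_def)
  then have R: "skew_resolvent A N = Blinfun f"
    by (simp add: skew_resolvent_def)
  have Rf: "skew_resolvent A N g = f g" for g
    by (simp add: R bounded_linear_Blinfun_apply[OF bl])
  show "(w, g - N w) \<in> A \<longleftrightarrow> w = skew_resolvent A N g"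
    by (simp add: Rf f)
  show "norm (skew_resolvent A N) \<le> 1 / c"
    using c 3 by (intro norm_blinfun_bound) (simp_all add: Rf mult.commute)
  show "complex_linear (skew_resolvent A N)" if NC: "complex_linear N"
    unfolding complex_linear_def
  proof (intro allI)
    fix a g
    show "skew_resolvent A N (a *\<^sub>C g) = a *\<^sub>C skew_resolvent A N g"
      using A1(2)[OF fA[of g], of a] NC unfolding Rf
      by (intro f[THEN iffD1, symmetric])
        (simp add: scaleC_prod_def complex_linear_def scaleC.diff_right)
  qed
qed

text \<open>The second resolvent identity. The difference of the two defining pairs stays in the
  subspace \<open>A\<close>, so \<open>A\<close> cancels and only the bounded operator
  \<open>N' - N\<close> is left.\<close>

lemma skew_resolvent_diff:
  fixes N N' :: "'a::complex_hilbert \<Rightarrow>\<^sub>L 'a"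
  assumes A: "skew_selfadjoint A" and c: "c > 0"
    and N: "\<And>w. N w \<bullet> w \<ge> c * (norm w)\<^sup>2" and N': "\<And>w. N' w \<bullet> w \<ge> c * (norm w)\<^sup>2"
  shows "skew_resolvent A N - skew_resolvent A N' =
    skew_resolvent A N o\<^sub>L (N' - N) o\<^sub>L skew_resolvent A N'"
proof (rule blinfun_eqI)
  fix g
  define w where "w = skew_resolvent A N g"
  define w' where "w' = skew_resolvent A N' g"
  have "(w, g - N w) \<in> A" "(w', g - N' w') \<in> A"
    using skew_resolvent_iff[OF A c N, of w g] skew_resolvent_iff[OF A c N', of w' g]
    by (simp_all add: w_def w'_def)
  moreover have "subspace A"
    using A by (simp add: skew_selfadjoint_def)
  ultimately have "(w, g - N w) - (w', g - N' w') \<in> A"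
    using subspace_diff by blast
  then have "(w - w', (N' - N) w' - N (w - w')) \<in> A"
    by (simp add: blinfun.diff_right blinfun.diff_left)
  then have "w - w' = skew_resolvent A N ((N' - N) w')"
    using skew_resolvent_iff[OF A c N] by blast
  then show "(skew_resolvent A N - skew_resolvent A N') g =
      (skew_resolvent A N o\<^sub>L (N' - N) o\<^sub>L skew_resolvent A N') g"
    by (simp add: w_def w'_def blinfun.diff_left)
qed

text \<open>Skewness is the cancellation between \<open>F\<close> and its adjoint. For maximality
  the components decouple: varying \<open>y\<close> alone kills \<open>\<tau>\<close>, varying
  \<open>x\<close> alone puts \<open>(\<pi>, s)\<close> into the adjoint graph, and varying
  \<open>\<xi>\<close> alone puts \<open>(p, - \<sigma>)\<close> into the second adjoint of
  \<open>F\<close>, which is contained in \<open>F\<close> because \<open>F\<close> is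
  closed.\<close>

lemma skew_selfadjoint_skew_matrix:
  fixes F :: "('h0::complex_hilbert \<times> 'h1::complex_hilbert) set"
  assumes F: "densely_defined_closed_operator F"
  shows "skew_selfadjoint (skew_matrix F :: ((('h0 \<times> 'h1) \<times> 'y::complex_hilbert) \<times> _) set)"
proof -
  let ?A = "skew_matrix F :: ((('h0 \<times> 'h1) \<times> 'y) \<times> (('h0 \<times> 'h1) \<times> 'y)) set"
  let ?G = "adjoint_graph F"
  have A: "(((x, \<xi>), y), ((a, b), z)) \<in> ?A \<longleftrightarrow> z = 0 \<and> (\<xi>, a) \<in> ?G \<and> (x, - b) \<in> F" for x \<xi> y a b z
    unfolding skew_matrix_def by (force intro: exI[of _ "- b"])
  have F0: "0 \<in> F" "\<And>p q. p \<in> F \<Longrightarrow> q \<in> F \<Longrightarrow> p + q \<in> F" "\<And>c p. p \<in> F \<Longrightarrow> c *\<^sub>C p \<in> F" "closed F"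
    using F by (auto simp: densely_defined_closed_operator_def)
  have FR: "a *\<^sub>R p \<in> F" if "p \<in> F" for a p
    using F0(3)[OF that, of "of_real a"] by (simp add: scaleC_of_real)
  have Fs: "subspace F"
    using F0 FR by (simp add: subspace_def)
  \<comment> \<open>Real parts suffice because \<open>F\<close> contains \<open>\<i>\<close> times
    each of its pairs.\<close>
  have G: "(y, x) \<in> ?G \<longleftrightarrow> (\<forall>(u, v) \<in> F. v \<bullet> y = u \<bullet> x)" for x y
  proof
    assume *: "\<forall>(u, v) \<in> F. v \<bullet> y = u \<bullet> x"
    have "cinner v y = cinner u x" if uv: "(u, v) \<in> F" for u v
    proof (rule complex_eqI)
      show "Re (cinner v y) = Re (cinner u x)"
        using * uv by (auto simp: Re_cinner)
      have "(\<i> *\<^sub>C u, \<i> *\<^sub>C v) \<in> F"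
        using F0(3)[OF uv, of \<i>] by (simp add: scaleC_prod_def)
      then have "(\<i> *\<^sub>C v) \<bullet> y = (\<i> *\<^sub>C u) \<bullet> x"
        using * by auto
      then show "Im (cinner v y) = Im (cinner u x)"
        by (simp add: Im_cinner inner_scaleC_left scaleC.minus_left)
    qed
    then show "(y, x) \<in> ?G"
      by (auto simp: adjoint_graph_def)
  next
    assume "(y, x) \<in> ?G"
    then show "\<forall>(u, v) \<in> F. v \<bullet> y = u \<bullet> x"
      by (auto simp: adjoint_graph_def simp flip: Re_cinner)
  qed
  \<comment> \<open>The second adjoint: the residual \<open>e\<close> of the projection of
    \<open>(p, \<sigma>)\<close> onto \<open>F\<close>, rotated to \<open>(snd e, - fst e)\<close>,
    lies in the adjoint graph. The premise makes \<open>e\<close> orthogonal to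
    \<open>(p, \<sigma>)\<close>, and it is orthogonal to the projection \<open>q\<close> anyway, so
    \<open>e = 0\<close>.\<close>
  have GF: "(p, \<sigma>) \<in> F" if *: "\<And>\<xi> a. (\<xi>, a) \<in> ?G \<Longrightarrow> a \<bullet> p = \<xi> \<bullet> \<sigma>" for p \<sigma>
  proof -
    obtain q where q: "q \<in> F" "\<And>s. s \<in> F \<Longrightarrow> ((p, \<sigma>) - q) \<bullet> s = 0"
      using orthogonal_projection_exists[OF Fs F0(4)] by blast
    define e where "e = (p, \<sigma>) - q"
    have "(snd e, - fst e) \<in> ?G"
      unfolding G using q(2) by (force simp: e_def[symmetric] inner_prod_def inner_commute)
    from *[OF this] have "e \<bullet> (p, \<sigma>) = 0"
      by (simp add: inner_prod_def)
    moreover have "e \<bullet> q = 0"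
      using q by (simp add: e_def)
    ultimately have "e \<bullet> e = 0"
      by (simp add: e_def inner_diff_right)
    then show ?thesis
      using q(1) by (simp add: e_def)
  qed
  have Gcl: "closed ?G"
  proof -
    have "?G = (\<Inter>(u, v)\<in>F. {p. v \<bullet> fst p = u \<bullet> snd p})"
      by (auto simp: G split_beta) (metis fst_conv snd_conv)+
    then show ?thesis
      by (auto intro!: closed_INT closed_Collect_eq continuous_intros)
  qed
  have "?A = (\<lambda>p. (snd (fst (fst p)), fst (fst (snd p)))) -` ?G \<inter>
      (\<lambda>p. (fst (fst (fst p)), - snd (fst (snd p)))) -` F \<inter> {p. snd (snd p) = 0}"
    using A by auto
  then have Acl: "closed ?A"
    using Gcl F0(4)
    by (auto intro!: closed_Int closed_vimage closed_Collect_eq continuous_intros)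
  have "0 \<in> ?A"
    using A[of 0 0 0 0 0 0] F0(1) by (auto simp: G zero_prod_def)
  moreover have "p + q \<in> ?A" if "p \<in> ?A" "q \<in> ?A" for p q
  proof -
    obtain x \<xi> y a b z where p: "p = (((x, \<xi>), y), ((a, b), z))"
      by (metis surj_pair)
    obtain x' \<xi>' y' a' b' z' where q: "q = (((x', \<xi>'), y'), ((a', b'), z'))"
      by (metis surj_pair)
    show ?thesis
      using that F0(2)[of "(x, - b)" "(x', - b')"] unfolding p q
      by (simp add: A G split_beta inner_add_right)
  qed
  moreover have C: "c *\<^sub>C p \<in> ?A" if "p \<in> ?A" for c p
  proof -
    obtain x \<xi> y a b z where p: "p = (((x, \<xi>), y), ((a, b), z))"
      by (metis surj_pair)
    show ?thesis
      using that F0(3)[of "(x, - b)" c] unfolding p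
      by (auto simp: A scaleC_prod_def scaleC.minus_right adjoint_graph_def cinner_scaleC_right)
  qed
  moreover have "a *\<^sub>R p \<in> ?A" if "p \<in> ?A" for a p
    using C[OF that, of "of_real a"] by (simp add: scaleC_of_real)
  ultimately have sub: "subspace ?A"
    by (simp add: subspace_def)
  have skew: "v \<bullet> w = 0" if "(w, v) \<in> ?A" for v w
  proof -
    obtain x \<xi> y a b z where p: "w = ((x, \<xi>), y)" "v = ((a, b), z)"
      by (metis surj_pair)
    have "z = 0" "(\<xi>, a) \<in> ?G" "(x, - b) \<in> F"
      using that by (auto simp: p A)
    then have "(- b) \<bullet> \<xi> = x \<bullet> a"
      by (auto simp: G)
    then show ?thesis
      using \<open>z = 0\<close> by (simp add: p inner_prod_def inner_commute)
  qed
  have adj: "(g, h) \<in> ?A" if *: "\<forall>(w, v) \<in> ?A. v \<bullet> g + w \<bullet> h = 0" for g h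
  proof -
    obtain p \<pi> q s \<sigma> \<tau> where gh: "g = ((p, \<pi>), q)" "h = ((s, \<sigma>), \<tau>)"
      by (metis surj_pair)
    have *: "a \<bullet> p + b \<bullet> \<pi> + (x \<bullet> s + \<xi> \<bullet> \<sigma> + y \<bullet> \<tau>) = 0"
      if "(\<xi>, a) \<in> ?G" "(x, - b) \<in> F" for x \<xi> y a b
    proof -
      have "(((x, \<xi>), y), ((a, b), 0)) \<in> ?A"
        using that by (simp add: A)
      from *[rule_format, OF this] show ?thesis
        by (simp add: gh inner_prod_def algebra_simps)
    qed
    have G00: "(0, 0) \<in> ?G"
      by (auto simp: G)
    have F00: "(0, - 0) \<in> F"
      using F0(1) by (simp add: zero_prod_def)
    have "\<tau> = 0"
      using *[OF G00 F00, of \<tau>] by simp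
    moreover have "(\<pi>, s) \<in> ?G"
    proof -
      have "v \<bullet> \<pi> = u \<bullet> s" if "(u, v) \<in> F" for u v
        using *[OF G00, of u "- v" 0] that by simp
      then show ?thesis
        by (auto simp: G)
    qed
    moreover have "(p, - \<sigma>) \<in> F"
      using *[OF _ F00, of _ _ 0] by (intro GF) (force simp: inner_minus_right)
    ultimately show ?thesis
      by (simp add: gh A)
  qed
  show ?thesis
    unfolding skew_selfadjoint_def using sub Acl C skew adj by blast
qed

section \<open>Strongly measurable functions\<close>

lemma strongly_measurable_simple: "simple_function lebesgue s \<Longrightarrow> strongly_measurable s"
  unfolding strongly_measurable_def by (rule exI[of _ "\<lambda>_. s"]) simp

lemma strongly_measurable_const [simp]: "strongly_measurable (\<lambda>t. c)"
  by (rule strongly_measurable_simple) simp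

lemma strongly_measurable_cong_AE:
  assumes "strongly_measurable f" "AE t in lebesgue. f t = g t"
  shows "strongly_measurable g"
proof -
  obtain s where s: "\<And>n. simple_function lebesgue (s n)" "AE t in lebesgue. (\<lambda>n. s n t) \<longlonglongrightarrow> f t"
    using assms(1) by (auto simp: strongly_measurable_def)
  have "AE t in lebesgue. (\<lambda>n. s n t) \<longlonglongrightarrow> g t"
    using s(2) assms(2) by eventually_elim simp
  then show ?thesis
    using s(1) by (auto simp: strongly_measurable_def)
qed

lemma strongly_measurable_compose:
  fixes h :: "'a::t2_space \<Rightarrow> 'b::topological_space"
  assumes f: "strongly_measurable f" and h: "continuous_on UNIV h"
  shows "strongly_measurable (\<lambda>t. h (f t))"
proof -
  obtain s where s: "\<And>n. simple_function lebesgue (s n)" "AE t in lebesgue. (\<lambda>n. s n t) \<longlonglongrightarrow> f t"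
    using f by (auto simp: strongly_measurable_def)
  have "AE t in lebesgue. (\<lambda>n. h (s n t)) \<longlonglongrightarrow> h (f t)"
    using s(2)
  proof eventually_elim
    case (elim t)
    with h show ?case
      by (intro isCont_tendsto_compose[of _ h]) (auto simp: continuous_on_eq_continuous_at)
  qed
  moreover have "simple_function lebesgue (\<lambda>t. h (s n t))" for n
    using simple_function_compose[OF s(1)[of n], of h] by (simp add: comp_def)
  ultimately show ?thesis
    unfolding strongly_measurable_def by (intro exI[of _ "\<lambda>n t. h (s n t)"]) blast
qed

lemma strongly_measurable_Pair:
  assumes f: "strongly_measurable f" and g: "strongly_measurable g"
  shows "strongly_measurable (\<lambda>t. (f t, g t))"
proof -
  obtain s where s: "\<And>n. simple_function lebesgue (s n)" "AE t in lebesgue. (\<lambda>n. s n t) \<longlonglongrightarrow> f t"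
    using f by (auto simp: strongly_measurable_def)
  obtain s' where s': "\<And>n. simple_function lebesgue (s' n)" "AE t in lebesgue. (\<lambda>n. s' n t) \<longlonglongrightarrow> g t"
    using g by (auto simp: strongly_measurable_def)
  have "AE t in lebesgue. (\<lambda>n. (s n t, s' n t)) \<longlonglongrightarrow> (f t, g t)"
    using s(2) s'(2) by eventually_elim (rule tendsto_Pair)
  then show ?thesis
    using s(1) s'(1) unfolding strongly_measurable_def
    by (intro exI[of _ "\<lambda>n t. (s n t, s' n t)"]) auto
qed

lemma strongly_measurable_compose2:
  fixes h :: "'a::t2_space \<Rightarrow> 'b::t2_space \<Rightarrow> 'c::topological_space"
  assumes "strongly_measurable f" "strongly_measurable g"
    and "continuous_on UNIV (\<lambda>(x, y). h x y)"
  shows "strongly_measurable (\<lambda>t. h (f t) (g t))"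
  using strongly_measurable_compose[OF strongly_measurable_Pair[OF assms(1,2)] assms(3)] by simp

lemma strongly_measurable_bilinear:
  assumes "bounded_bilinear h" "strongly_measurable f" "strongly_measurable g"
  shows "strongly_measurable (\<lambda>t. h (f t) (g t))"
  using assms(2,3)
proof (rule strongly_measurable_compose2)
  show "continuous_on UNIV (\<lambda>(x, y). h x y)"
    unfolding split_beta
    by (intro bounded_bilinear.continuous_on[OF assms(1)] continuous_intros)
qed

lemma strongly_measurable_add:
  fixes f :: "real \<Rightarrow> 'a::real_normed_vector"
  assumes "strongly_measurable f" "strongly_measurable g"
  shows "strongly_measurable (\<lambda>t. f t + g t)"
  using assms
  by (rule strongly_measurable_compose2) (auto simp: split_beta intro!: continuous_intros)

text \<open>Cutting off the exceptional null set makes the convergence hold everywhere; changing the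
  limit back on that set preserves measurability for the complete measure
  \<open>lebesgue\<close>.\<close>

lemma borel_measurable_AE_LIMSEQ:
  fixes g :: "real \<Rightarrow> 'a::euclidean_space"
  assumes f: "\<And>n. f n \<in> borel_measurable lebesgue"
    and lim: "AE t in lebesgue. (\<lambda>n. f n t) \<longlonglongrightarrow> g t"
  shows "g \<in> borel_measurable lebesgue"
proof -
  obtain N where N: "N \<in> null_sets lebesgue" "{t. \<not> (\<lambda>n. f n t) \<longlonglongrightarrow> g t} \<subseteq> N"
    using lim unfolding eventually_ae_filter by auto
  have "(\<lambda>t. indicat_real (- N) t *\<^sub>R g t) \<in> borel_measurable lebesgue"
  proof (rule borel_measurable_LIMSEQ_metric)
    have "- N \<in> sets lebesgue"
      using N(1) by (metis Compl_in_sets_lebesgue null_setsD2)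
    then show "(\<lambda>t. indicat_real (- N) t *\<^sub>R f n t) \<in> borel_measurable lebesgue" for n
      using f by (intro borel_measurable_scaleR borel_measurable_indicator)
    show "(\<lambda>n. indicat_real (- N) t *\<^sub>R f n t) \<longlonglongrightarrow> indicat_real (- N) t *\<^sub>R g t" for t
      using N(2) by (cases "t \<in> N") (auto simp: indicator_def)
  qed
  moreover have "AE t in lebesgue. indicat_real (- N) t *\<^sub>R g t = g t"
    using AE_not_in[OF N(1)] by eventually_elim simp
  ultimately show ?thesis
    by (rule borel_measurable_AE)
qed

lemma strongly_measurable_imp_borel_measurable:
  fixes f :: "real \<Rightarrow> 'a::euclidean_space"
  assumes "strongly_measurable f"
  shows "f \<in> borel_measurable lebesgue"
proof -
  obtain s where s: "\<And>n. simple_function lebesgue (s n)" "AE t in lebesgue. (\<lambda>n. s n t) \<longlonglongrightarrow> f t"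
    using assms unfolding strongly_measurable_def by blast
  show ?thesis
    by (rule borel_measurable_AE_LIMSEQ[OF borel_measurable_simple_function[OF s(1)] s(2)])
qed

section \<open>Strong measurability and essentially separable range (Pettis)\<close>

lemma strongly_measurable_separable:
  fixes f :: "real \<Rightarrow> 'a::metric_space"
  assumes "strongly_measurable f"
  obtains D where "countable D" "AE t in lebesgue. f t \<in> closure D"
proof -
  obtain s where s: "\<And>n. simple_function lebesgue (s n)" "AE t in lebesgue. (\<lambda>n. s n t) \<longlonglongrightarrow> f t"
    using assms by (auto simp: strongly_measurable_def)
  show ?thesis
  proof
    show "countable (\<Union>n. range (s n))"
      using s(1) by (auto simp: simple_function_def intro: countable_finite)
    show "AE t in lebesgue. f t \<in> closure (\<Union>n. range (s n))"
      using s(2)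
    proof eventually_elim
      case (elim t)
      then show ?case
        unfolding closure_sequential by (intro exI[of _ "\<lambda>n. s n t"]) auto
    qed
  qed
qed

lemma strongly_measurableI_separable:
  fixes f :: "real \<Rightarrow> 'a::metric_space"
  assumes D: "countable D" "AE t in lebesgue. f t \<in> closure D"
    and meas: "\<And>d. (\<lambda>t. dist (f t) d) \<in> borel_measurable lebesgue"
  shows "strongly_measurable f"
proof (cases "D = {}")
  case True
  then have "AE t in lebesgue. f t = undefined"
    using D(2) by (auto elim: eventually_mono)
  then show ?thesis
    by (intro strongly_measurable_cong_AE[OF strongly_measurable_const[of undefined]]) auto
next
  case False
  define d where "d = from_nat_into D"
  have d: "range d = D"
    using D(1) False by (simp add: d_def range_from_nat_into)
  \<comment> \<open>\<open>s n t\<close> is a nearest point to \<open>f t\<close> among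
    \<open>d 0\<close>, ..., \<open>d n\<close>; on a tie the earlier point is kept.\<close>
  define s where "s = rec_nat (\<lambda>t. d 0)
    (\<lambda>n r t. if dist (f t) (d (Suc n)) < dist (f t) (r t) then d (Suc n) else r t)"
  have s0: "s 0 = (\<lambda>t. d 0)"
    and sS: "s (Suc n) = (\<lambda>t. if dist (f t) (d (Suc n)) < dist (f t) (s n t) then d (Suc n) else s n t)" for n
    by (simp_all only: s_def nat.rec)
  have simple: "simple_function lebesgue (s n)" for n
  proof (induction n)
    case (Suc n)
    have "(\<lambda>t. dist (f t) (s n t)) \<in> borel_measurable lebesgue"
    proof (rule measurable_compose_countable'[where I = "range (s n)"])
      show "s n \<in> measurable lebesgue (count_space (range (s n)))"
        using Suc by (subst measurable_count_space_eq_countable)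
          (auto simp: simple_function_def intro: countable_finite)
      show "countable (range (s n))"
        using Suc by (auto simp: simple_function_def intro: countable_finite)
    qed (rule meas)
    then have "{t \<in> space lebesgue. dist (f t) (d (Suc n)) < dist (f t) (s n t)} \<in> sets lebesgue"
      using meas by (intro borel_measurable_less)
    then show ?case
      unfolding sS using Suc by (intro simple_function_If) auto
  qed (simp add: s0)
  have min: "dist (f t) (s n t) \<le> dist (f t) (d k)" if "k \<le> n" for n k t
    using that
  proof (induction n)
    case (Suc n)
    then show ?case
      by (cases "k = Suc n") (auto simp: sS intro: order_trans)
  qed (simp add: s0)
  have "(\<lambda>n. s n t) \<longlonglongrightarrow> f t" if t: "f t \<in> closure D" for t
  proof (rule metric_LIMSEQ_I)
    fix e :: real assume "e > 0"
    then obtain y where "y \<in> D" "dist y (f t) < e"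
      using t by (auto simp: closure_approachable)
    then obtain k where k: "dist (f t) (d k) < e"
      using d by (metis dist_commute rangeE)
    have "dist (s n t) (f t) < e" if "n \<ge> k" for n
      using min[OF that, of t] k by (simp add: dist_commute)
    then show "\<exists>k. \<forall>n\<ge>k. dist (s n t) (f t) < e"
      by blast
  qed
  then have "AE t in lebesgue. (\<lambda>n. s n t) \<longlonglongrightarrow> f t"
    using D(2) by auto
  with simple show ?thesis
    unfolding strongly_measurable_def by blast
qed

text \<open>Instead of diagonalizing the approximating simple functions, essential separability and
  measurable distances are passed to the limit, where the nearest-point criterion applies.\<close>

lemma strongly_measurable_AE_LIMSEQ:
  fixes g :: "real \<Rightarrow> 'a::metric_space"
  assumes f: "\<And>n. strongly_measurable (f n)"
    and lim: "AE t in lebesgue. (\<lambda>n. f n t) \<longlonglongrightarrow> g t"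
  shows "strongly_measurable g"
proof -
  have "\<exists>D. countable D \<and> (AE t in lebesgue. f n t \<in> closure D)" for n
    using strongly_measurable_separable[OF f] by metis
  then obtain D where D: "\<And>n. countable (D n)" "\<And>n. AE t in lebesgue. f n t \<in> closure (D n)"
    by metis
  show ?thesis
  proof (rule strongly_measurableI_separable)
    show "countable (\<Union>n. D n)"
      using D by auto
    have "AE t in lebesgue. \<forall>n. f n t \<in> closure (D n)"
      using D(2) by (simp add: AE_all_countable)
    then show "AE t in lebesgue. g t \<in> closure (\<Union>n. D n)"
      using lim
    proof eventually_elim
      case (elim t)
      then have "f n t \<in> closure (\<Union>n. D n)" for n
        using closure_mono[of "D n" "\<Union>n. D n"] by blast
      then show ?case
        using elim(2) by (rule closed_sequentially[OF closed_closure])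
    qed
    show "(\<lambda>t. dist (g t) d) \<in> borel_measurable lebesgue" for d
    proof (rule borel_measurable_AE_LIMSEQ)
      show "(\<lambda>t. dist (f n t) d) \<in> borel_measurable lebesgue" for n
        by (intro strongly_measurable_imp_borel_measurable
            strongly_measurable_compose[OF f, where h = "\<lambda>x. dist x d"] continuous_intros)
      show "AE t in lebesgue. (\<lambda>n. dist (f n t) d) \<longlonglongrightarrow> dist (g t) d"
        using lim by eventually_elim (intro tendsto_intros)
    qed
  qed
qed

text \<open>The values at rational times are dense in the range, and the distance to a fixed point
  is continuous in \<open>t\<close>.\<close>

lemma strongly_measurable_continuous:
  fixes f :: "real \<Rightarrow> 'a::metric_space"
  assumes f: "continuous_on UNIV f"
  shows "strongly_measurable f"
proof (rule strongly_measurableI_separable)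
  show "countable (f ` \<rat>)"
    using countable_rat by (rule countable_image)
  have "f ` closure \<rat> \<subseteq> closure (f ` \<rat>)"
    using f by (intro image_closure_subset) (auto intro: continuous_on_subset closure_subset[THEN subsetD])
  then show "AE t in lebesgue. f t \<in> closure (f ` \<rat>)"
    using Rats_closure_real by blast
  show "(\<lambda>t. dist (f t) d) \<in> borel_measurable lebesgue" for d
    using f by (intro measurable_completion[where M = lborel]) (auto intro!: borel_measurable_continuous_onI continuous_intros)
qed

lemma strongly_measurable_borel:
  fixes f :: "real \<Rightarrow> 'a::euclidean_space"
  assumes f: "f \<in> borel_measurable lebesgue"
  shows "strongly_measurable f"
proof -
  obtain D :: "'a set" where D: "countable D" "closure D = UNIV"
    using separable[of "UNIV :: 'a set"] by (metis top.extremum_uniqueI)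
  show ?thesis
    using D f by (intro strongly_measurableI_separable[of D] borel_measurable_dist) auto
qed

lemma strongly_measurable_norm:
  fixes f :: "real \<Rightarrow> 'a::real_normed_vector"
  assumes "strongly_measurable f"
  shows "(\<lambda>t. norm (f t)) \<in> borel_measurable lebesgue"
  by (intro strongly_measurable_imp_borel_measurable strongly_measurable_compose[OF assms]
      continuous_intros)

lemma strongly_measurable_scaleR:
  fixes f :: "real \<Rightarrow> 'a::real_normed_vector"
  assumes "g \<in> borel_measurable lebesgue" "strongly_measurable f"
  shows "strongly_measurable (\<lambda>t. g t *\<^sub>R f t)"
  by (rule strongly_measurable_bilinear[OF bounded_bilinear_scaleR strongly_measurable_borel])
    (use assms in auto)

section \<open>The Hilbert space of square-integrable functions\<close>

lemma wspace_0:
  "f \<in> wspace 0 \<longleftrightarrow> strongly_measurable f \<and> integrable lebesgue (\<lambda>t. (norm (f t))\<^sup>2)"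
  by (simp add: wspace_def)

text \<open>Multiplication by the weight is reversible, so questions about
  \<open>wspace \<nu>\<close> reduce to the unweighted space; squaring the norm doubles the
  exponent.\<close>

lemma wspace_iff_wspace_0: "f \<in> wspace \<nu> \<longleftrightarrow> (\<lambda>t. exp (- \<nu> * t) *\<^sub>R f t) \<in> wspace 0"
proof -
  have meas: "(\<lambda>t. exp (a * t)) \<in> borel_measurable lebesgue" for a :: real
    by (rule measurable_completion) measurable
  have "strongly_measurable (\<lambda>t. exp (- \<nu> * t) *\<^sub>R f t) \<longleftrightarrow> strongly_measurable f"
  proof
    assume "strongly_measurable (\<lambda>t. exp (- \<nu> * t) *\<^sub>R f t)"
    from strongly_measurable_scaleR[OF meas[of \<nu>] this] show "strongly_measurable f"
      by (simp flip: exp_add)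
  qed (rule strongly_measurable_scaleR[OF meas])
  moreover have "(norm (exp (- \<nu> * t) *\<^sub>R f t))\<^sup>2 = (norm (f t))\<^sup>2 * exp (- 2 * \<nu> * t)" for t
    by (simp add: power_mult_distrib mult.commute mult.left_commute flip: exp_double)
  ultimately show ?thesis
    by (simp add: wspace_0 wspace_def)
qed

lemma wspace_0_dominated:
  fixes g :: "real \<Rightarrow> 'b::complex_hilbert"
  assumes f: "strongly_measurable f" and g: "g \<in> wspace 0"
    and le: "AE t in lebesgue. norm (f t) \<le> C * norm (g t)"
  shows "f \<in> wspace 0"
proof -
  have "integrable lebesgue (\<lambda>t. C\<^sup>2 * (norm (g t))\<^sup>2)"
    using g by (simp add: wspace_0)
  then have "integrable lebesgue (\<lambda>t. (norm (f t))\<^sup>2)"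
  proof (rule Bochner_Integration.integrable_bound)
    show "(\<lambda>t. (norm (f t))\<^sup>2) \<in> borel_measurable lebesgue"
      using strongly_measurable_norm[OF f] by simp
    show "AE t in lebesgue. norm ((norm (f t))\<^sup>2) \<le> norm (C\<^sup>2 * (norm (g t))\<^sup>2)"
      using le by eventually_elim (simp add: power_mono flip: power_mult_distrib)
  qed
  with f show ?thesis
    by (simp add: wspace_0)
qed

lemma wspace_0_add:
  assumes f: "f \<in> wspace 0" and g: "g \<in> wspace 0"
  shows "(\<lambda>t. f t + g t) \<in> wspace 0"
proof -
  have meas: "strongly_measurable (\<lambda>t. f t + g t)"
    using f g by (auto simp: wspace_0 intro: strongly_measurable_add)
  have "integrable lebesgue (\<lambda>t. 2 * (norm (f t))\<^sup>2 + 2 * (norm (g t))\<^sup>2)"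
    using f g by (simp add: wspace_0)
  then have "integrable lebesgue (\<lambda>t. (norm (f t + g t))\<^sup>2)"
  proof (rule Bochner_Integration.integrable_bound)
    show "(\<lambda>t. (norm (f t + g t))\<^sup>2) \<in> borel_measurable lebesgue"
      using strongly_measurable_norm[OF meas] by simp
    have "(norm (f t + g t))\<^sup>2 \<le> 2 * (norm (f t))\<^sup>2 + 2 * (norm (g t))\<^sup>2" for t
    proof -
      have "(norm (f t + g t))\<^sup>2 \<le> (norm (f t) + norm (g t))\<^sup>2"
        by (intro power_mono norm_triangle_ineq) simp
      also have "\<dots> \<le> 2 * (norm (f t))\<^sup>2 + 2 * (norm (g t))\<^sup>2"
        using zero_le_power2[of "norm (f t) - norm (g t)"] by (simp add: power2_eq_square algebra_simps)
      finally show ?thesis .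
    qed
    then show "AE t in lebesgue. norm ((norm (f t + g t))\<^sup>2)
        \<le> norm (2 * (norm (f t))\<^sup>2 + 2 * (norm (g t))\<^sup>2)"
      by auto
  qed
  with meas show ?thesis
    by (simp add: wspace_0)
qed

lemma wspace_0_zero [simp]: "(\<lambda>t. 0) \<in> wspace 0"
  by (simp add: wspace_0)

lemma wspace_0_scaleC: "f \<in> wspace 0 \<Longrightarrow> (\<lambda>t. c *\<^sub>C f t) \<in> wspace 0"
  by (rule wspace_0_dominated[of _ f "cmod c"])
    (auto simp: wspace_0 norm_scaleC
      intro: strongly_measurable_bilinear[OF bounded_bilinear_scaleC strongly_measurable_const])

lemma wspace_0_scaleR: "f \<in> wspace 0 \<Longrightarrow> (\<lambda>t. a *\<^sub>R f t) \<in> wspace 0"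
  using wspace_0_scaleC[of f "of_real a"] by (simp add: scaleC_of_real)

lemma wspace_0_diff: "f \<in> wspace 0 \<Longrightarrow> g \<in> wspace 0 \<Longrightarrow> (\<lambda>t. f t - g t) \<in> wspace 0"
  using wspace_0_add[OF _ wspace_0_scaleR[of g "-1"], of f] by simp

lemma integrable_wspace_0_norm_mult:
  assumes "f \<in> wspace 0" "g \<in> wspace 0"
  shows "integrable lebesgue (\<lambda>t. norm (f t) * norm (g t))"
proof (rule Bochner_Integration.integrable_bound)
  show "integrable lebesgue (\<lambda>t. (norm (f t))\<^sup>2 + (norm (g t))\<^sup>2)"
    using assms by (simp add: wspace_0)
  show "(\<lambda>t. norm (f t) * norm (g t)) \<in> borel_measurable lebesgue"
    using assms by (intro borel_measurable_times strongly_measurable_norm) (auto simp: wspace_0)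
  have "x * y \<le> x\<^sup>2 + y\<^sup>2" for x y :: real
    using sum_squares_bound[of x y] zero_le_power2[of x] zero_le_power2[of y] by linarith
  then show "AE t in lebesgue. norm (norm (f t) * norm (g t)) \<le> norm ((norm (f t))\<^sup>2 + (norm (g t))\<^sup>2)"
    by auto
qed

lemma integrable_wspace_0_cinner:
  assumes "f \<in> wspace 0" "g \<in> wspace 0"
  shows "integrable lebesgue (\<lambda>t. cinner (f t) (g t))"
proof (rule Bochner_Integration.integrable_bound[OF integrable_wspace_0_norm_mult[OF assms]])
  show "(\<lambda>t. cinner (f t) (g t)) \<in> borel_measurable lebesgue"
    using assms
    by (intro strongly_measurable_imp_borel_measurable strongly_measurable_bilinear[OF bounded_bilinear_cinner])
      (auto simp: wspace_0)
qed (auto simp: cmod_cinner_le)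

lemma part_equivp_wspace_0_AE:
  "part_equivp (\<lambda>f g :: real \<Rightarrow> 'a::complex_hilbert.
    f \<in> wspace 0 \<and> g \<in> wspace 0 \<and> (AE t in lebesgue. f t = g t))"
proof (rule part_equivpI)
  show "\<exists>f :: real \<Rightarrow> 'a. f \<in> wspace 0 \<and> f \<in> wspace 0 \<and> (AE t in lebesgue. f t = f t)"
    by (rule exI[of _ "\<lambda>t. 0"]) simp
  show "symp (\<lambda>f g :: real \<Rightarrow> 'a. f \<in> wspace 0 \<and> g \<in> wspace 0 \<and> (AE t in lebesgue. f t = g t))"
    by (auto intro!: sympI elim: AE_mp)
  show "transp (\<lambda>f g :: real \<Rightarrow> 'a. f \<in> wspace 0 \<and> g \<in> wspace 0 \<and> (AE t in lebesgue. f t = g t))"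
    by (auto intro!: transpI elim: eventually_elim2)
qed

\<comment> \<open>A type rather than a set of functions, so that it can become an instance of
  \<open>complex_hilbert\<close> and all facts about Hilbert spaces apply to it. The relation is
  partial: functions outside \<open>wspace 0\<close> represent nothing.\<close>
quotient_type (overloaded) 'a L2 = "real \<Rightarrow> 'a::complex_hilbert" / partial:
  "\<lambda>f g. f \<in> wspace 0 \<and> g \<in> wspace 0 \<and> (AE t in lebesgue. f t = g t)"
  by (rule part_equivp_wspace_0_AE)

lemma integral_cinner_cong_AE:
  assumes "f \<in> wspace 0" "f' \<in> wspace 0" "g \<in> wspace 0" "g' \<in> wspace 0"
    and "AE t in lebesgue. f t = f' t" "AE t in lebesgue. g t = g' t"
  shows "(\<integral>t. cinner (f t) (g t) \<partial>lebesgue) = (\<integral>t. cinner (f' t) (g' t) \<partial>lebesgue)"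
proof (rule integral_cong_AE)
  show "AE t in lebesgue. cinner (f t) (g t) = cinner (f' t) (g' t)"
    using assms(5,6) by eventually_elim simp
qed (intro borel_measurable_integrable integrable_wspace_0_cinner assms)+

instantiation L2 :: (complex_hilbert) real_vector
begin
lift_definition zero_L2 :: "'a L2" is "\<lambda>t. 0" by simp
lift_definition plus_L2 :: "'a L2 \<Rightarrow> 'a L2 \<Rightarrow> 'a L2" is "\<lambda>f g t. f t + g t"
  by (auto intro: wspace_0_add elim: eventually_elim2)
lift_definition minus_L2 :: "'a L2 \<Rightarrow> 'a L2 \<Rightarrow> 'a L2" is "\<lambda>f g t. f t - g t"
  by (auto intro: wspace_0_diff elim: eventually_elim2)
lift_definition uminus_L2 :: "'a L2 \<Rightarrow> 'a L2" is "\<lambda>f t. - f t"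
  using wspace_0_scaleR[of _ "-1"] by (auto elim: eventually_mono)
lift_definition scaleR_L2 :: "real \<Rightarrow> 'a L2 \<Rightarrow> 'a L2" is "\<lambda>a f t. a *\<^sub>R f t"
  by (auto intro: wspace_0_scaleR elim: eventually_mono)
instance
proof
  fix x y z :: "'a L2" and a b :: real
  show "x + y + z = x + (y + z)"
    by transfer (auto intro: wspace_0_add simp: add.assoc)
  show "x + y = y + x"
    by transfer (auto intro: wspace_0_add simp: add.commute)
  show "0 + x = x"
    by transfer auto
  show "- x + x = 0"
    by transfer auto
  show "x - y = x + - y"
    by transfer (auto intro: wspace_0_diff)
  show "a *\<^sub>R (x + y) = a *\<^sub>R x + a *\<^sub>R y"
    by transfer (auto intro!: wspace_0_add wspace_0_scaleR simp flip: scaleR_add_right)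
  show "(a + b) *\<^sub>R x = a *\<^sub>R x + b *\<^sub>R x"
    by transfer (auto intro!: wspace_0_scaleR simp flip: scaleR_add_left)
  show "a *\<^sub>R b *\<^sub>R x = (a * b) *\<^sub>R x"
    by transfer (auto intro!: wspace_0_scaleR)
  show "1 *\<^sub>R x = x"
    by transfer auto
qed
end

instantiation L2 :: (complex_hilbert) real_inner
begin
lift_definition inner_L2 :: "'a L2 \<Rightarrow> 'a L2 \<Rightarrow> real" is "\<lambda>f g. Re (\<integral>t. cinner (f t) (g t) \<partial>lebesgue)"
  by (auto intro!: arg_cong[where f = Re] integral_cinner_cong_AE)
definition norm_L2 :: "'a L2 \<Rightarrow> real" where "norm_L2 x = sqrt (x \<bullet> x)"
definition dist_L2 :: "'a L2 \<Rightarrow> 'a L2 \<Rightarrow> real" where "dist_L2 x y = norm (x - y)"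
definition sgn_L2 :: "'a L2 \<Rightarrow> 'a L2" where "sgn_L2 x = x /\<^sub>R norm x"
definition uniformity_L2 :: "('a L2 \<times> 'a L2) filter"
  where "uniformity_L2 = (INF e\<in>{0 <..}. principal {(x, y). dist x y < e})"
definition open_L2 :: "'a L2 set \<Rightarrow> bool"
  where "open_L2 S \<longleftrightarrow> (\<forall>x\<in>S. \<forall>\<^sub>F (x', y) in uniformity. x' = x \<longrightarrow> y \<in> S)"
instance
proof
  fix x y z :: "'a L2" and r :: real
  show "x \<bullet> y = y \<bullet> x"
    by transfer
      (simp add: integrable_wspace_0_cinner Re_cinner inner_commute flip: integral_Re)
  show "(x + y) \<bullet> z = x \<bullet> z + y \<bullet> z"
    by transfer (simp add: integrable_wspace_0_cinner cinner_add_left)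
  show "(r *\<^sub>R x) \<bullet> y = r * (x \<bullet> y)"
    by transfer (simp add: cinner.scaleR_left)
  show "0 \<le> x \<bullet> x"
    by transfer (auto simp: integrable_wspace_0_cinner Re_cinner simp flip: integral_Re)
  show "(x \<bullet> x = 0) = (x = 0)"
  proof transfer
    fix f :: "real \<Rightarrow> 'a"
    assume "f \<in> wspace 0 \<and> f \<in> wspace 0 \<and> (AE t in lebesgue. f t = f t)"
    then have f: "f \<in> wspace 0"
      by simp
    have "Re (\<integral>t. cinner (f t) (f t) \<partial>lebesgue) = (\<integral>t. (norm (f t))\<^sup>2 \<partial>lebesgue)"
      using f by (simp add: integrable_wspace_0_cinner Re_cinner dot_square_norm flip: integral_Re)
    also have "\<dots> = 0 \<longleftrightarrow> (AE t in lebesgue. (norm (f t))\<^sup>2 = 0)"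
      using f by (intro integral_nonneg_eq_0_iff_AE) (auto simp: wspace_0)
    finally show "(Re (\<integral>t. cinner (f t) (f t) \<partial>lebesgue) = 0) =
        (f \<in> wspace 0 \<and> (\<lambda>t. 0::'a) \<in> wspace 0 \<and> (AE t in lebesgue. f t = 0))"
      using f by simp
  qed
qed (simp_all add: norm_L2_def dist_L2_def sgn_L2_def uniformity_L2_def open_L2_def)
end

lemma rep_L2_wspace: "rep_L2 x \<in> wspace 0"
  using Quotient_rep_reflp[OF Quotient_L2] by blast

lemma abs_rep_L2 [simp]: "abs_L2 (rep_L2 x) = x"
  by (rule Quotient_abs_rep[OF Quotient_L2])

lemma abs_L2_eq_iff:
  "f \<in> wspace 0 \<Longrightarrow> g \<in> wspace 0 \<Longrightarrow> abs_L2 f = abs_L2 g \<longleftrightarrow> (AE t in lebesgue. f t = g t)"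
  using Quotient_rel[OF Quotient_L2, of f g] by simp

lemma rep_abs_L2: "f \<in> wspace 0 \<Longrightarrow> AE t in lebesgue. rep_L2 (abs_L2 f) t = f t"
  using abs_L2_eq_iff[OF rep_L2_wspace] by fastforce

lemma L2_eq_iff: "x = y \<longleftrightarrow> (AE t in lebesgue. rep_L2 x t = rep_L2 y t)"
  using abs_L2_eq_iff[OF rep_L2_wspace rep_L2_wspace, of x y] by simp

lemma abs_L2_add: "f \<in> wspace 0 \<Longrightarrow> g \<in> wspace 0 \<Longrightarrow> abs_L2 f + abs_L2 g = abs_L2 (\<lambda>t. f t + g t)"
  by (simp add: plus_L2.abs_eq)

lemma abs_L2_diff: "f \<in> wspace 0 \<Longrightarrow> g \<in> wspace 0 \<Longrightarrow> abs_L2 f - abs_L2 g = abs_L2 (\<lambda>t. f t - g t)"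
  by (simp add: minus_L2.abs_eq)

lemma abs_L2_scaleR: "f \<in> wspace 0 \<Longrightarrow> a *\<^sub>R abs_L2 f = abs_L2 (\<lambda>t. a *\<^sub>R f t)"
  by (simp add: scaleR_L2.abs_eq)

lemma inner_abs_L2:
  "f \<in> wspace 0 \<Longrightarrow> g \<in> wspace 0 \<Longrightarrow> abs_L2 f \<bullet> abs_L2 g = (\<integral>t. f t \<bullet> g t \<partial>lebesgue)"
  by (simp add: inner_L2.abs_eq integrable_wspace_0_cinner Re_cinner flip: integral_Re)

lemma norm_abs_L2:
  assumes "f \<in> wspace 0"
  shows "norm (abs_L2 f) = sqrt (\<integral>t. (norm (f t))\<^sup>2 \<partial>lebesgue)"
  unfolding norm_eq_sqrt_inner[of "abs_L2 f"] inner_abs_L2[OF assms assms]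
  by (simp add: dot_square_norm)

lemma norm_abs_L2_sq:
  assumes "f \<in> wspace 0"
  shows "(norm (abs_L2 f))\<^sup>2 = (\<integral>t. (norm (f t))\<^sup>2 \<partial>lebesgue)"
  using assms by (simp add: norm_abs_L2)

lemma nn_integral_wspace_0:
  assumes "f \<in> wspace 0"
  shows "(\<integral>\<^sup>+t. (norm (f t))\<^sup>2 \<partial>lebesgue) = ennreal ((norm (abs_L2 f))\<^sup>2)"
  using assms by (subst nn_integral_eq_integral) (auto simp: wspace_0 norm_abs_L2_sq)

text \<open>Serves where integrability is not known beforehand: after Fatou's lemma in the
  completeness proof and after Plancherel's identity, both of which concern nonnegative
  integrals.\<close>

lemma wspace_0_nn_integralI:
  assumes f: "strongly_measurable f" and le: "(\<integral>\<^sup>+t. (norm (f t))\<^sup>2 \<partial>lebesgue) \<le> ennreal C"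
  shows "f \<in> wspace 0" "0 \<le> C \<Longrightarrow> (norm (abs_L2 f))\<^sup>2 \<le> C"
proof -
  show f': "f \<in> wspace 0"
    using le strongly_measurable_norm[OF f] f
    by (auto simp: wspace_0 intro!: integrableI_bounded intro: le_less_trans)
  show "(norm (abs_L2 f))\<^sup>2 \<le> C" if "0 \<le> C"
    using le that by (simp add: nn_integral_wspace_0[OF f'] del: ennreal_power)
qed

text \<open>Dominated convergence of the scalar functions
  \<open>(norm (f n t - g t))\<^sup>2\<close>. Both \<open>f n\<close> and \<open>g\<close> are
  bounded by \<open>C * norm (h t)\<close>, whence the factor \<open>(2 * C)\<^sup>2\<close> in the
  majorant.\<close>

lemma LIMSEQ_abs_L2_dominated:
  fixes f :: "nat \<Rightarrow> real \<Rightarrow> 'a::complex_hilbert" and h :: "real \<Rightarrow> 'b::complex_hilbert"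
  assumes f: "\<And>n. strongly_measurable (f n)" and h: "h \<in> wspace 0"
    and le: "\<And>n. AE t in lebesgue. norm (f n t) \<le> C * norm (h t)"
    and lim: "AE t in lebesgue. (\<lambda>n. f n t) \<longlonglongrightarrow> g t"
  shows "(\<lambda>n. abs_L2 (f n)) \<longlonglongrightarrow> abs_L2 g"
proof -
  have le': "AE t in lebesgue. \<forall>n. norm (f n t) \<le> C * norm (h t)"
    using le by (simp add: AE_all_countable)
  have gle: "AE t in lebesgue. norm (g t) \<le> C * norm (h t)"
    using le' lim
  proof eventually_elim
    case (elim t)
    then show ?case
      by (intro LIMSEQ_le_const2[OF tendsto_norm[of _ "g t"]]) auto
  qed
  have fW: "f n \<in> wspace 0" for n
    by (rule wspace_0_dominated[OF f h le])
  have gW: "g \<in> wspace 0"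
    by (rule wspace_0_dominated[OF strongly_measurable_AE_LIMSEQ[OF f lim] h gle])
  have dW: "(\<lambda>t. f n t - g t) \<in> wspace 0" for n
    by (rule wspace_0_diff[OF fW gW])
  have "(\<lambda>n. \<integral>t. (norm (f n t - g t))\<^sup>2 \<partial>lebesgue) \<longlonglongrightarrow> (\<integral>t. 0 \<partial>(lebesgue :: real measure))"
  proof (rule integral_dominated_convergence[where w = "\<lambda>t. (2 * C)\<^sup>2 * (norm (h t))\<^sup>2"])
    show "integrable lebesgue (\<lambda>t. (2 * C)\<^sup>2 * (norm (h t))\<^sup>2)"
      using h by (simp add: wspace_0)
    show "(\<lambda>t. (norm (f n t - g t))\<^sup>2) \<in> borel_measurable lebesgue" for n
      using dW[of n] by (auto simp: wspace_0)
    show "AE t in lebesgue. (\<lambda>n. (norm (f n t - g t))\<^sup>2) \<longlonglongrightarrow> 0"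
      using lim
    proof eventually_elim
      case (elim t)
      then have "(\<lambda>n. (norm (f n t - g t))\<^sup>2) \<longlonglongrightarrow> 0\<^sup>2"
        by (intro tendsto_power) (simp add: LIM_zero tendsto_norm_zero)
      then show ?case
        by simp
    qed
    show "AE t in lebesgue. norm ((norm (f n t - g t))\<^sup>2) \<le> (2 * C)\<^sup>2 * (norm (h t))\<^sup>2" for n
      using le' gle
    proof eventually_elim
      case (elim t)
      then have "norm (f n t - g t) \<le> (2 * C) * norm (h t)"
        using norm_triangle_ineq4[of "f n t" "g t"] by (smt (verit) distrib_right)
      then have "(norm (f n t - g t))\<^sup>2 \<le> ((2 * C) * norm (h t))\<^sup>2"
        by (rule power_mono) simp
      then show ?case
        by (simp only: power_mult_distrib) simp
    qed
  qed simp
  then have "(\<lambda>n. (norm (abs_L2 (f n) - abs_L2 g))\<^sup>2) \<longlonglongrightarrow> 0"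
    by (simp add: abs_L2_diff fW gW norm_abs_L2_sq[OF dW])
  then have "(\<lambda>n. sqrt ((norm (abs_L2 (f n) - abs_L2 g))\<^sup>2)) \<longlonglongrightarrow> sqrt 0"
    by (rule tendsto_real_sqrt)
  then show ?thesis
    by (simp add: LIM_zero_iff tendsto_norm_zero_iff)
qed

section \<open>Completeness of the space of square-integrable functions\<close>

lemma summable_norm_imp_LIMSEQ:
  fixes f :: "nat \<Rightarrow> 'a::banach"
  assumes "\<And>n. norm (f (Suc n) - f n) \<le> C * q ^ n" "0 \<le> q" "q < 1"
  shows "convergent f"
proof -
  have "summable (\<lambda>n. C * q ^ n)"
    using assms by (intro summable_mult summable_geometric) simp
  then have "summable (\<lambda>n. f (Suc n) - f n)"
    by (rule summable_comparison_test[rotated]) (use assms(1) in auto)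
  then have "convergent (\<lambda>n. \<Sum>i<n. f (Suc i) - f i)"
    by (simp add: summable_iff_convergent)
  then have "convergent (\<lambda>n. (\<Sum>i<n. f (Suc i) - f i) + f 0)"
    by (rule convergent_add[OF _ convergent_const])
  then show ?thesis
    by (simp add: sum_lessThan_telescope)
qed

text \<open>The geometric weights \<open>2 ^ k\<close> turn the convergence of the sum of the squared norms into
  pointwise summability almost everywhere, without Minkowski's inequality.\<close>

instance L2 :: (complex_hilbert) complete_space
proof
  fix X :: "nat \<Rightarrow> 'a L2" assume X: "Cauchy X"
  have "\<exists>N. \<forall>m\<ge>N. \<forall>n\<ge>N. norm (X m - X n) < (1/2) ^ k" for k :: nat
    using CauchyD[OF X, of "(1/2)^k"] by simp
  then obtain N where N: "\<And>k m n. m \<ge> N k \<Longrightarrow> n \<ge> N k \<Longrightarrow> norm (X m - X n) < (1/2) ^ k"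
    by metis
  \<comment> \<open>Partial sums of \<open>Suc (N j)\<close> are strictly increasing and still at
    least \<open>N k\<close>.\<close>
  define r where "r k = (\<Sum>j\<le>k. Suc (N j))" for k
  have rN: "r k \<ge> N k" for k
    using member_le_sum[of k "{..k}" "\<lambda>j. Suc (N j)"] by (simp add: r_def)
  have r: "strict_mono r"
    by (rule strict_monoI_Suc) (simp add: r_def)
  define f where "f k = rep_L2 (X (r k))" for k
  have fW: "f k \<in> wspace 0" and fX: "abs_L2 (f k) = X (r k)" for k
    by (simp_all add: f_def rep_L2_wspace)
  define d where "d k t = f (Suc k) t - f k t" for k t
  have dW: "d k \<in> wspace 0" for k
    using wspace_0_diff[OF fW[of "Suc k"] fW[of k]] by (simp add: d_def[abs_def])
  have dn: "norm (abs_L2 (d k)) \<le> (1/2) ^ k" for k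
  proof -
    have "abs_L2 (d k) = X (r (Suc k)) - X (r k)"
      by (simp add: d_def[abs_def] fW fX flip: abs_L2_diff)
    moreover have "norm (X (r (Suc k)) - X (r k)) < (1/2) ^ k"
      using rN[of k] strict_mono_mono[OF r, THEN monoD, of k "Suc k"] by (intro N) simp_all
    ultimately show ?thesis
      by simp
  qed
  have meas: "(\<lambda>t. ennreal (2 ^ k * (norm (d k t))\<^sup>2)) \<in> borel_measurable lebesgue" for k
    using strongly_measurable_norm[of "d k"] dW by (auto simp: wspace_0)
  have "(\<integral>\<^sup>+t. (\<Sum>k. ennreal (2 ^ k * (norm (d k t))\<^sup>2)) \<partial>lebesgue)
      = (\<Sum>k. \<integral>\<^sup>+t. ennreal (2 ^ k * (norm (d k t))\<^sup>2) \<partial>lebesgue)"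
    by (rule nn_integral_suminf) (rule meas)
  also have "\<dots> \<le> (\<Sum>k. ennreal ((1/2) ^ k))"
  proof (rule suminf_le)
    fix k
    have "(\<integral>\<^sup>+t. ennreal (2 ^ k * (norm (d k t))\<^sup>2) \<partial>lebesgue)
        = ennreal (2 ^ k) * (\<integral>\<^sup>+t. ennreal ((norm (d k t))\<^sup>2) \<partial>lebesgue)"
      using strongly_measurable_norm[of "d k"] dW
      by (subst nn_integral_cmult[symmetric]) (auto simp: wspace_0 ennreal_mult)
    also have "\<dots> = ennreal (2 ^ k * (norm (abs_L2 (d k)))\<^sup>2)"
      by (simp add: nn_integral_wspace_0[OF dW] ennreal_mult)
    also have "\<dots> \<le> ennreal ((1/2) ^ k)"
    proof (rule ennreal_leI)
      have "2 ^ k * (norm (abs_L2 (d k)))\<^sup>2 \<le> 2 ^ k * ((1/2) ^ k)\<^sup>2"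
        using dn by (intro mult_left_mono power_mono) auto
      also have "\<dots> = (1/2) ^ k"
        by (simp add: power2_eq_square power_divide)
      finally show "2 ^ k * (norm (abs_L2 (d k)))\<^sup>2 \<le> (1/2) ^ k" .
    qed
    finally show "(\<integral>\<^sup>+t. ennreal (2 ^ k * (norm (d k t))\<^sup>2) \<partial>lebesgue) \<le> ennreal ((1/2) ^ k)" .
  qed simp_all
  also have "\<dots> = ennreal (\<Sum>k. (1/2) ^ k)"
    by (intro suminf_ennreal2 summable_geometric) auto
  also have "\<dots> < \<infinity>"
    by simp
  finally have "AE t in lebesgue. (\<Sum>k. ennreal (2 ^ k * (norm (d k t))\<^sup>2)) \<noteq> \<infinity>"
    using meas by (intro nn_integral_PInf_AE borel_measurable_suminf) auto
  note sum_AE = this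
  have real: "\<exists>C\<ge>0. x = ennreal C" if "x \<noteq> \<infinity>" for x
    using that by (cases x) auto
  have "AE t in lebesgue. convergent (\<lambda>k. f k t)"
    using sum_AE
  proof eventually_elim
    case (elim t)
    then obtain C where C: "C \<ge> 0" "(\<Sum>k. ennreal (2 ^ k * (norm (d k t))\<^sup>2)) = ennreal C"
      using real[OF elim] by blast
    have "norm (f (Suc k) t - f k t) \<le> sqrt C * (sqrt (1/2)) ^ k" for k
    proof -
      have "ennreal (2 ^ k * (norm (d k t))\<^sup>2) \<le> ennreal C"
      proof -
        have "(\<Sum>k\<in>{k}. ennreal (2 ^ k * (norm (d k t))\<^sup>2)) \<le> (\<Sum>k. ennreal (2 ^ k * (norm (d k t))\<^sup>2))"
          by (rule sum_le_suminf) auto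
        then show ?thesis
          by (simp only: C(2)) simp
      qed
      then have "2 ^ k * (norm (d k t))\<^sup>2 \<le> C"
        using C(1) by simp
      then have "(norm (d k t))\<^sup>2 \<le> C * (1/2) ^ k"
        by (simp add: field_simps power_divide)
      then have "norm (d k t) \<le> sqrt (C * (1/2) ^ k)"
        by (rule real_le_rsqrt)
      then show ?thesis
        by (simp add: d_def real_sqrt_mult real_sqrt_power)
    qed
    then show ?case
      by (rule summable_norm_imp_LIMSEQ) auto
  qed
  then have lim: "AE t in lebesgue. (\<lambda>k. f k t) \<longlonglongrightarrow> lim (\<lambda>k. f k t)"
    by eventually_elim (simp add: convergent_LIMSEQ_iff)
  define g where "g t = lim (\<lambda>k. f k t)" for t
  have lim: "AE t in lebesgue. (\<lambda>k. f k t) \<longlonglongrightarrow> g t"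
    using lim by (simp add: g_def)
  have gm: "strongly_measurable g"
    using fW by (intro strongly_measurable_AE_LIMSEQ[OF _ lim]) (simp add: wspace_0)
  \<comment> \<open>Fatou's lemma: \<open>f k - g\<close> is the pointwise limit of
    \<open>f k - f m\<close> as \<open>m\<close> grows, and for \<open>m \<ge> k\<close> these have
    norm at most \<open>(1/2) ^ k\<close>. The estimate also supplies
    \<open>g \<in> wspace 0\<close>, by way of \<open>g = f 0 - (f 0 - g)\<close>.\<close>
  have est: "(\<integral>\<^sup>+t. (norm (f k t - g t))\<^sup>2 \<partial>lebesgue) \<le> ennreal (((1/2) ^ k)\<^sup>2)" for k
  proof -
    have "(\<integral>\<^sup>+t. (norm (f k t - g t))\<^sup>2 \<partial>lebesgue)
        = (\<integral>\<^sup>+t. liminf (\<lambda>m. ennreal ((norm (f k t - f m t))\<^sup>2)) \<partial>lebesgue)"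
    proof (rule nn_integral_cong_AE)
      show "AE t in lebesgue. ennreal ((norm (f k t - g t))\<^sup>2)
          = liminf (\<lambda>m. ennreal ((norm (f k t - f m t))\<^sup>2))"
        using lim
      proof eventually_elim
        case (elim t)
        have "(\<lambda>m. ennreal ((norm (f k t - f m t))\<^sup>2)) \<longlonglongrightarrow> ennreal ((norm (f k t - g t))\<^sup>2)"
          by (intro tendsto_ennrealI tendsto_intros elim)
        then show ?case
          by (intro lim_imp_Liminf[symmetric]) simp_all
      qed
    qed
    also have "\<dots> \<le> liminf (\<lambda>m. \<integral>\<^sup>+t. ennreal ((norm (f k t - f m t))\<^sup>2) \<partial>lebesgue)"
    proof (rule nn_integral_liminf)
      fix m
      have "strongly_measurable (\<lambda>t. f k t - f m t)"
        using wspace_0_diff[OF fW fW] by (simp add: wspace_0)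
      then show "(\<lambda>t. ennreal ((norm (f k t - f m t))\<^sup>2)) \<in> borel_measurable lebesgue"
        using strongly_measurable_norm by fastforce
    qed
    also have "\<dots> \<le> limsup (\<lambda>m. \<integral>\<^sup>+t. ennreal ((norm (f k t - f m t))\<^sup>2) \<partial>lebesgue)"
      by (rule Liminf_le_Limsup) simp
    also have "\<dots> \<le> ennreal (((1/2) ^ k)\<^sup>2)"
    proof (rule Limsup_bounded, rule eventually_sequentiallyI[of k])
      fix m assume m: "m \<ge> k"
      have "(\<integral>\<^sup>+t. ennreal ((norm (f k t - f m t))\<^sup>2) \<partial>lebesgue) = ennreal ((norm (X (r k) - X (r m)))\<^sup>2)"
        by (simp add: nn_integral_wspace_0[OF wspace_0_diff[OF fW fW]] fX fW flip: abs_L2_diff)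
      also have "\<dots> \<le> ennreal (((1/2) ^ k)\<^sup>2)"
        using rN[of k] strict_mono_mono[OF r, THEN monoD, OF m]
        by (intro ennreal_leI power_mono less_imp_le[OF N]) simp_all
      finally show "(\<integral>\<^sup>+t. ennreal ((norm (f k t - f m t))\<^sup>2) \<partial>lebesgue) \<le> ennreal (((1/2) ^ k)\<^sup>2)" .
    qed
    finally show ?thesis .
  qed
  have fg: "strongly_measurable (\<lambda>t. f k t - g t)" for k
    using strongly_measurable_add[OF _ strongly_measurable_compose[OF gm, of uminus], of "f k"] fW
    by (simp add: wspace_0 continuous_intros)
  have "(\<lambda>t. f 0 t - (f 0 t - g t)) \<in> wspace 0"
    by (intro wspace_0_diff fW wspace_0_nn_integralI(1)[OF fg est])
  then have gW: "g \<in> wspace 0"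
    by simp
  have "norm (X (r k) - abs_L2 g) \<le> (1/2) ^ k" for k
    using wspace_0_nn_integralI(2)[OF fg est, of k]
    by (simp add: fW gW power2_le_iff_abs_le flip: abs_L2_diff fX)
  then have ev: "\<forall>\<^sub>F k in sequentially. norm (X (r k) - abs_L2 g) \<le> (1/2) ^ k"
    by (simp only: eventually_True)
  have "(\<lambda>k. (1/2) ^ k :: real) \<longlonglongrightarrow> 0"
    by (rule LIMSEQ_realpow_zero) simp_all
  with ev have "(\<lambda>k. X (r k) - abs_L2 g) \<longlonglongrightarrow> 0"
    by (rule Lim_null_comparison)
  then have "(\<lambda>k. X (r k)) \<longlonglongrightarrow> abs_L2 g"
    by (rule LIM_zero_cancel)
  then have "X \<longlonglongrightarrow> abs_L2 g"
    by (intro Cauchy_converges_subseq[OF X r]) (simp add: comp_def)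
  then show "convergent X"
    by (rule convergentI)
qed

instantiation L2 :: (complex_hilbert) complex_hilbert
begin
lift_definition scaleC_L2 :: "complex \<Rightarrow> 'a L2 \<Rightarrow> 'a L2" is "\<lambda>c f t. c *\<^sub>C f t"
  by (auto intro: wspace_0_scaleC elim: eventually_mono)
lift_definition cinner_L2 :: "'a L2 \<Rightarrow> 'a L2 \<Rightarrow> complex" is "\<lambda>f g. \<integral>t. cinner (f t) (g t) \<partial>lebesgue"
  by (auto intro!: integral_cinner_cong_AE)
instance
proof
  fix x y z :: "'a L2" and c d :: complex and a :: real
  show "c *\<^sub>C (x + y) = c *\<^sub>C x + c *\<^sub>C y"
    by transfer (auto intro!: wspace_0_add wspace_0_scaleC simp flip: scaleC_add_right)
  show "(c + d) *\<^sub>C x = c *\<^sub>C x + d *\<^sub>C x"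
    by transfer (auto intro!: wspace_0_scaleC simp flip: scaleC_add_left)
  show "c *\<^sub>C d *\<^sub>C x = (c * d) *\<^sub>C x"
    by transfer (auto intro!: wspace_0_scaleC simp: scaleC_scaleC)
  show "complex_of_real a *\<^sub>C x = a *\<^sub>R x"
    by transfer (auto intro!: wspace_0_scaleR simp: scaleC_of_real)
  have 1: "cinner x (y + z) = cinner x y + cinner x z" for x y z :: "'a L2"
    by transfer (simp add: integrable_wspace_0_cinner cinner_add_right)
  have 2: "cinner x (c *\<^sub>C y) = c * cinner x y" for x y :: "'a L2" and c
    by transfer (simp add: cinner_scaleC_right)
  have 3: "cinner x y = cnj (cinner y x)" for x y :: "'a L2"
  proof transfer
    fix f g :: "real \<Rightarrow> 'a"
    have "(\<integral>t. cinner (f t) (g t) \<partial>lebesgue) = (\<integral>t. cnj (cinner (g t) (f t)) \<partial>lebesgue)"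
      by (rule Bochner_Integration.integral_cong[OF refl]) (rule cinner_commute)
    then show "(\<integral>t. cinner (f t) (g t) \<partial>lebesgue) = cnj (\<integral>t. cinner (g t) (f t) \<partial>lebesgue)"
      by simp
  qed
  have 4: "Re (cinner x y) = x \<bullet> y" for x y :: "'a L2"
    by transfer simp
  show "cinner x (y + z) = cinner x y + cinner x z" "cinner x (c *\<^sub>C y) = c * cinner x y"
    "cinner x y = cnj (cinner y x)" "Re (cinner x y) = x \<bullet> y"
    by (rule 1 2 3 4)+
  have "Im (cinner x x) = 0"
    using 3[of x x] by (simp add: complex_eq_iff)
  then have 5: "cinner x x = of_real ((norm x)\<^sup>2)"
    by (simp add: complex_eq_iff 4 dot_square_norm)
  have "cinner (c *\<^sub>C x) (c *\<^sub>C x) = c * cnj c * cinner x x"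
    using 3[of "c *\<^sub>C x" x] 3[of x x] by (simp add: 2)
  then have "(norm (c *\<^sub>C x))\<^sup>2 = (cmod c)\<^sup>2 * (norm x)\<^sup>2"
    using 4[of "c *\<^sub>C x" "c *\<^sub>C x"]
    by (simp add: 5 dot_square_norm flip: complex_norm_square of_real_mult)
  then show "norm (c *\<^sub>C x) = cmod c * norm x"
    by (metis norm_ge_zero mult_nonneg_nonneg power2_eq_imp_eq power_mult_distrib)
qed
end

lemma abs_L2_scaleC: "f \<in> wspace 0 \<Longrightarrow> c *\<^sub>C abs_L2 f = abs_L2 (\<lambda>t. c *\<^sub>C f t)"
  by (simp add: scaleC_L2.abs_eq)

lemma cinner_abs_L2:
  "f \<in> wspace 0 \<Longrightarrow> g \<in> wspace 0 \<Longrightarrow> cinner (abs_L2 f) (abs_L2 g) = (\<integral>t. cinner (f t) (g t) \<partial>lebesgue)"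
  by (simp add: cinner_L2.abs_eq)

section \<open>Smooth functions and test functions\<close>

definition vderiv :: "(real \<Rightarrow> 'a::real_normed_vector) \<Rightarrow> real \<Rightarrow> 'a"
  where "vderiv f = (\<lambda>t. vector_derivative f (at t))"

definition smooth :: "(real \<Rightarrow> 'a::real_normed_vector) \<Rightarrow> bool"
  where "smooth f \<longleftrightarrow> (\<forall>n t. (vderiv ^^ n) f differentiable (at t))"

text \<open>Avoids formulas for higher derivatives: it suffices to name a class closed under
  differentiation, such as sums of products for the Leibniz rule.\<close>

lemma smooth_coinduct:
  assumes f: "f \<in> C"
    and step: "\<And>g. g \<in> C \<Longrightarrow> \<exists>g'\<in>C. \<forall>t. (g has_vector_derivative g' t) (at t)"
  shows "smooth f"
proof -
  have C: "vderiv g \<in> C" if g: "g \<in> C" for g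
  proof -
    obtain g' where g': "g' \<in> C" "\<And>t. (g has_vector_derivative g' t) (at t)"
      using step[OF g] by blast
    have "vderiv g = g'"
      using g'(2) by (auto simp: vderiv_def intro: vector_derivative_at)
    with g' show ?thesis
      by simp
  qed
  have "(vderiv ^^ n) f \<in> C" for n
    by (induction n) (auto simp: f C)
  then show ?thesis
    unfolding smooth_def using step differentiableI_vector by metis
qed

lemma smooth_has_vector_derivative:
  assumes "smooth f"
  shows "(f has_vector_derivative vderiv f t) (at t)"
proof -
  have "(vderiv ^^ 0) f differentiable (at t)"
    using assms unfolding smooth_def by blast
  then show ?thesis
    by (simp add: vderiv_def vector_derivative_works)
qed

lemma smooth_vderiv: "smooth f \<Longrightarrow> smooth (vderiv f)"
  unfolding smooth_def
proof (intro allI)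
  fix n t assume "\<forall>n t. (vderiv ^^ n) f differentiable (at t)"
  then have "(vderiv ^^ Suc n) f differentiable (at t)"
    by blast
  then show "(vderiv ^^ n) (vderiv f) differentiable (at t)"
    by (simp only: funpow_Suc_right comp_def)
qed

lemma smooth_continuous_on: "smooth f \<Longrightarrow> continuous_on S f"
  by (intro continuous_at_imp_continuous_on ballI
      has_vector_derivative_continuous[OF smooth_has_vector_derivative])

lemma smooth_antiderivative:
  assumes "smooth f" "\<And>t. (F has_vector_derivative f t) (at t)"
  shows "smooth F"
proof (rule smooth_coinduct[where C = "insert F (Collect smooth)"])
  fix g assume "g \<in> insert F (Collect smooth)"
  then consider "g = F" | "smooth g"
    by blast
  then show "\<exists>g'\<in>insert F (Collect smooth). \<forall>t. (g has_vector_derivative g' t) (at t)"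
  proof cases
    case 1
    with assms show ?thesis
      by (intro bexI[of _ f]) auto
  next
    case 2
    then show ?thesis
      using smooth_vderiv[OF 2] smooth_has_vector_derivative[OF 2]
      by (intro bexI[of _ "vderiv g"]) auto
  qed
qed simp

lemma smooth_const: "smooth (\<lambda>t. c)"
proof (rule smooth_coinduct[where C = "range (\<lambda>c t. c)"])
  fix g :: "real \<Rightarrow> 'a" assume "g \<in> range (\<lambda>c t. c)"
  then show "\<exists>g'\<in>range (\<lambda>c t. c). \<forall>t. (g has_vector_derivative g' t) (at t)"
    by (intro bexI[of _ "\<lambda>t. 0"]) auto
qed blast

lemma smooth_add:
  assumes "smooth f" "smooth g"
  shows "smooth (\<lambda>t. f t + g t)"
proof (rule smooth_coinduct[where C = "{\<lambda>t. f t + g t | f g. smooth f \<and> smooth g}"])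
  fix h assume "h \<in> {\<lambda>t. f t + g t | (f :: real \<Rightarrow> 'a) g. smooth f \<and> smooth g}"
  then obtain f g where h: "h = (\<lambda>t. f t + g t)" "smooth f" "smooth g"
    by blast
  show "\<exists>h'\<in>{\<lambda>t. f t + g t | f g. smooth f \<and> smooth g}. \<forall>t. (h has_vector_derivative h' t) (at t)"
    using h smooth_vderiv
    by (intro bexI[of _ "\<lambda>t. vderiv f t + vderiv g t"])
      (auto intro: has_vector_derivative_add smooth_has_vector_derivative)
qed (use assms in blast)

inductive product_sum :: "('a::real_normed_vector \<Rightarrow> 'b::real_normed_vector \<Rightarrow> 'c::real_normed_vector)
    \<Rightarrow> (real \<Rightarrow> 'c) \<Rightarrow> bool" for h where
  product_sum_base: "smooth f \<Longrightarrow> smooth g \<Longrightarrow> product_sum h (\<lambda>t. h (f t) (g t))"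
| product_sum_add: "product_sum h a \<Longrightarrow> product_sum h b \<Longrightarrow> product_sum h (\<lambda>t. a t + b t)"

lemma smooth_bilinear:
  assumes h: "bounded_bilinear h" and fg: "smooth f" "smooth g"
  shows "smooth (\<lambda>t. h (f t) (g t))"
proof (rule smooth_coinduct[where C = "Collect (product_sum h)"])
  have "\<exists>a'. product_sum h a' \<and> (\<forall>t. (a has_vector_derivative a' t) (at t))"
    if "product_sum h a" for a
    using that
  proof induction
    case (product_sum_base f g)
    then have "product_sum h (\<lambda>t. h (f t) (vderiv g t) + h (vderiv f t) (g t))"
      by (intro product_sum.intros smooth_vderiv)
    then show ?case
      using bounded_bilinear.has_vector_derivative[OF h smooth_has_vector_derivative[OF product_sum_base(1)]
          smooth_has_vector_derivative[OF product_sum_base(2)]]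
      by (intro exI[of _ "\<lambda>t. h (f t) (vderiv g t) + h (vderiv f t) (g t)"] conjI allI)
  next
    case (product_sum_add a b)
    then obtain a' b' where "product_sum h a'" "\<And>t. (a has_vector_derivative a' t) (at t)"
      "product_sum h b'" "\<And>t. (b has_vector_derivative b' t) (at t)"
      by blast
    then show ?case
      by (intro exI[of _ "\<lambda>t. a' t + b' t"] conjI allI product_sum.product_sum_add
          has_vector_derivative_add)
  qed
  then show "\<exists>g'\<in>Collect (product_sum h). \<forall>t. (g has_vector_derivative g' t) (at t)"
    if "g \<in> Collect (product_sum h)" for g
    using that by blast
qed (use fg in \<open>auto intro: product_sum_base\<close>)

lemma smooth_bounded_linear:
  assumes h: "bounded_linear h" and f: "smooth f"
  shows "smooth (\<lambda>t. h (f t))"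
proof (rule smooth_coinduct[where C = "{\<lambda>t. h (f t) | f. smooth f}"])
  fix g assume "g \<in> {\<lambda>t. h (f t) | f. smooth f}"
  then obtain f where "g = (\<lambda>t. h (f t))" "smooth f"
    by blast
  then show "\<exists>g'\<in>{\<lambda>t. h (f t) | f. smooth f}. \<forall>t. (g has_vector_derivative g' t) (at t)"
    by (intro bexI[of _ "\<lambda>t. h (vderiv f t)"])
      (auto intro: smooth_vderiv bounded_linear.has_vector_derivative[OF h smooth_has_vector_derivative])
qed (use f in blast)

text \<open>The scalar \<open>c\<close> in the class absorbs the factor \<open>a\<close> that each
  application of the chain rule produces.\<close>

lemma smooth_affine:
  assumes f: "smooth f"
  shows "smooth (\<lambda>t. f (a * t + b))"
proof (rule smooth_coinduct[where C = "{\<lambda>t. c *\<^sub>R f (a * t + b) | c f. smooth f}"])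
  fix g assume "g \<in> {\<lambda>t. c *\<^sub>R f (a * t + b) | c (f :: real \<Rightarrow> 'a). smooth f}"
  then obtain c f where g: "g = (\<lambda>t. c *\<^sub>R f (a * t + b))" "smooth f"
    by blast
  have "((\<lambda>t. c *\<^sub>R f (a * t + b)) has_vector_derivative c *\<^sub>R a *\<^sub>R vderiv f (a * t + b)) (at t)" for t
  proof -
    have "((\<lambda>t. a * t + b) has_vector_derivative a) (at t)"
      by (auto intro!: derivative_eq_intros simp flip: has_real_derivative_iff_has_vector_derivative)
    from vector_diff_chain_at[OF this smooth_has_vector_derivative[OF g(2)]]
    have "((\<lambda>t. f (a * t + b)) has_vector_derivative a *\<^sub>R vderiv f (a * t + b)) (at t)"
      by (simp add: comp_def)
    then show ?thesis
      by (rule bounded_linear.has_vector_derivative[OF bounded_linear_scaleR_right])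
  qed
  then show "\<exists>g'\<in>{\<lambda>t. c *\<^sub>R f (a * t + b) | c f. smooth f}. \<forall>t. (g has_vector_derivative g' t) (at t)"
    using g smooth_vderiv by (intro bexI[of _ "\<lambda>t. (c * a) *\<^sub>R vderiv f (a * t + b)"]) auto
next
  show "(\<lambda>t. f (a * t + b)) \<in> {\<lambda>t. c *\<^sub>R f (a * t + b) | c f. smooth f}"
    using f by (auto intro!: exI[of _ 1] exI[of _ f])
qed

lemma smooth_exp: "smooth (\<lambda>t. exp (a * t) :: real)"
proof (rule smooth_coinduct[where C = "range (\<lambda>c t. c * exp (a * t))"])
  show "(\<lambda>t. exp (a * t)) \<in> range (\<lambda>c t. c * exp (a * t))"
    by (rule range_eqI[of _ _ 1]) simp
  fix g assume "g \<in> range (\<lambda>c t. c * exp (a * t))"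
  then obtain c where "g = (\<lambda>t. c * exp (a * t))"
    by blast
  then show "\<exists>g'\<in>range (\<lambda>c t. c * exp (a * t)). \<forall>t. (g has_vector_derivative g' t) (at t)"
    by (intro bexI[of _ "\<lambda>t. (c * a) * exp (a * t)"])
      (auto intro!: derivative_eq_intros simp flip: has_real_derivative_iff_has_vector_derivative)
qed

section \<open>Flat exponentials and bump functions\<close>

lemma tendsto_poly_times_exp_minus: "((\<lambda>s::real. poly p s * exp (- s)) \<longlongrightarrow> 0) at_top"
proof -
  have "((\<lambda>s. \<Sum>i\<le>degree p. coeff p i * (s ^ i / exp s)) \<longlongrightarrow> (\<Sum>i\<le>degree p. coeff p i * 0)) at_top"
    by (intro tendsto_intros tendsto_power_div_exp_0)
  moreover have "(\<lambda>s. \<Sum>i\<le>degree p. coeff p i * (s ^ i / exp s)) = (\<lambda>s. poly p s * exp (- s))"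
    by (simp add: poly_altdef sum_distrib_right exp_minus divide_inverse mult.assoc)
  ultimately show ?thesis
    by simp
qed

text \<open>The classical smooth function that is flat at \<open>0\<close> without being analytic
  there; compactly supported smooth functions are built from it.\<close>

definition flat_exp :: "real \<Rightarrow> real"
  where "flat_exp t = (if t > 0 then exp (- 1 / t) else 0)"

lemma smooth_flat_exp: "smooth flat_exp"
proof -
  define G where "G p t = (if t > 0 then poly p (1 / t) * exp (- 1 / t) else 0)" for p and t :: real
  show ?thesis
  proof (rule smooth_coinduct[where C = "range G"])
    have "flat_exp = G 1"
      by (auto simp: G_def flat_exp_def)
    then show "flat_exp \<in> range G"
      by blast
    fix g assume "g \<in> range G"
    then obtain p where g: "g = G p"
      by blast
    \<comment> \<open>With \<open>s = 1 / t\<close>, the derivative in \<open>t\<close> is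
      \<open>- s\<^sup>2\<close> times the derivative in \<open>s\<close>, and
      \<open>p(s) exp (- s)\<close> has \<open>s\<close>-derivative
      \<open>(p' - p)(s) exp (- s)\<close>; this leads to the polynomial
      \<open>X\<^sup>2 (p - p')\<close>.\<close>
    define q where "q = monom 1 2 * (p - pderiv p)"
    have "(G p has_vector_derivative G q t) (at t)" for t
    proof -
      consider "t > 0" | "t < 0" | "t = 0"
        by linarith
      then show ?thesis
      proof cases
        case 1
        have "((\<lambda>t. poly p (1 / t) * exp (- 1 / t)) has_real_derivative G q t) (at t)"
          using 1 by (auto intro!: derivative_eq_intros DERIV_chain2[OF poly_DERIV]
              simp: G_def q_def poly_monom power2_eq_square field_simps)
        then have "((\<lambda>t. poly p (1 / t) * exp (- 1 / t)) has_vector_derivative G q t) (at t)"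
          by (simp add: has_real_derivative_iff_has_vector_derivative)
        then show ?thesis
          by (rule has_vector_derivative_transform_within_open[of _ _ _ "{0<..}"]) (use 1 in \<open>auto simp: G_def\<close>)
      next
        case 2
        have "((\<lambda>t. 0) has_vector_derivative G q t) (at t)"
          using 2 by (simp add: G_def)
        then show ?thesis
          by (rule has_vector_derivative_transform_within_open[of _ _ _ "{..<0}"]) (use 2 in \<open>auto simp: G_def\<close>)
      next
        case 3
        \<comment> \<open>From the right, the difference quotient at \<open>0\<close> is
          \<open>s p(s) exp (- s)\<close> with \<open>s = 1 / t\<close> tending to infinity;
          \<open>pCons 0 p\<close> is the polynomial \<open>X p\<close>.\<close>
        have "((\<lambda>s. poly (pCons 0 p) s * exp (- s)) \<longlongrightarrow> 0) at_top"
          by (rule tendsto_poly_times_exp_minus)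
        then have "((\<lambda>t. poly (pCons 0 p) (inverse t) * exp (- inverse t)) \<longlongrightarrow> 0) (at_right (0::real))"
          by (rule filterlim_compose[OF _ filterlim_inverse_at_top_right])
        then have "((\<lambda>t. (G p t - G p 0) / (t - 0)) \<longlongrightarrow> 0) (at_right 0)"
          by (rule Lim_transform_eventually)
            (auto simp: G_def eventually_at_filter field_simps inverse_eq_divide)
        moreover have "((\<lambda>t. (G p t - G p 0) / (t - 0)) \<longlongrightarrow> 0) (at_left 0)"
          by (rule Lim_transform_eventually[OF tendsto_const])
            (auto simp: G_def eventually_at_filter)
        ultimately have "(G p has_real_derivative 0) (at 0)"
          by (simp add: has_field_derivative_iff filterlim_split_at)
        then show ?thesis
          using 3 by (simp add: has_real_derivative_iff_has_vector_derivative G_def)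
      qed
    qed
    then show "\<exists>g'\<in>range G. \<forall>t. (g has_vector_derivative g' t) (at t)"
      using g by blast
  qed
qed

text \<open>As \<open>n\<close> grows both factors tend to \<open>1\<close> inside the open
  interval, so the bumps approximate its indicator while their support stays in
  \<open>{p..q}\<close>. For \<open>n = 0\<close> the function is zero.\<close>

definition bump :: "nat \<Rightarrow> real \<Rightarrow> real \<Rightarrow> real \<Rightarrow> real"
  where "bump n p q t = flat_exp (real n * t - real n * p) * flat_exp (real n * q - real n * t)"

lemma smooth_bump: "smooth (bump n p q)"
proof -
  have "smooth (\<lambda>t. flat_exp (real n * t + - (real n * p)) * flat_exp (- real n * t + real n * q))"
    by (intro smooth_bilinear[OF bounded_bilinear_mult] smooth_affine smooth_flat_exp)
  then show ?thesis
    by (simp add: bump_def[abs_def] algebra_simps)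
qed

lemma bump_eq_0: "t \<notin> {p..q} \<Longrightarrow> bump n p q t = 0"
  by (auto simp: bump_def flat_exp_def not_le zero_less_mult_iff simp flip: right_diff_distrib)

lemma abs_bump_le_1: "\<bar>bump n p q t\<bar> \<le> 1"
proof -
  have "0 \<le> flat_exp s" "flat_exp s \<le> 1" for s
    by (auto simp: flat_exp_def)
  then show ?thesis
    by (simp add: bump_def abs_mult mult_le_one)
qed

lemma LIMSEQ_bump: "(\<lambda>n. bump (Suc n) p q t) \<longlonglongrightarrow> indicat_real {p<..<q} t"
proof -
  have 1: "(\<lambda>n. flat_exp (real (Suc n) * s)) \<longlonglongrightarrow> (if s > 0 then 1 else 0)" for s
  proof (cases "s > 0")
    case True
    have "(\<lambda>n. exp (- (inverse (real (Suc n)) * (1 / s)))) \<longlonglongrightarrow> exp (- (0 * (1 / s)))"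
      by (intro tendsto_intros LIMSEQ_inverse_real_of_nat)
    moreover have "flat_exp (real (Suc n) * s) = exp (- (inverse (real (Suc n)) * (1 / s)))" for n
      using True by (simp add: flat_exp_def zero_less_mult_iff inverse_eq_divide del: of_nat_Suc)
    ultimately show ?thesis
      using True by simp
  next
    case False
    then have "flat_exp (real (Suc n) * s) = 0" for n
      by (simp add: flat_exp_def zero_less_mult_iff del: of_nat_Suc)
    then show ?thesis
      using False by simp
  qed
  have "(\<lambda>n. flat_exp (real (Suc n) * (t - p)) * flat_exp (real (Suc n) * (q - t)))
      \<longlonglongrightarrow> (if t - p > 0 then 1 else 0) * (if q - t > 0 then 1 else 0)"
    by (intro tendsto_mult 1)
  then show ?thesis
    by (auto simp: bump_def right_diff_distrib indicator_def simp del: of_nat_Suc split: if_splits)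
qed

section \<open>Test functions and their membership in the weighted spaces\<close>

lemma test_function_iff: "test_function f \<longleftrightarrow> smooth f \<and> (\<exists>L. \<forall>t. \<bar>t\<bar> > L \<longrightarrow> f t = 0)"
proof -
  have "compact (closure {t. f t \<noteq> 0}) \<longleftrightarrow> bounded {t. f t \<noteq> 0}"
    by (simp add: compact_closure)
  also have "\<dots> \<longleftrightarrow> (\<exists>L. \<forall>t. \<bar>t\<bar> > L \<longrightarrow> f t = 0)"
    by (auto simp: bounded_iff not_le) (metis not_le)+
  finally show ?thesis
    by (simp add: test_function_def smooth_def vderiv_def[abs_def])
qed

lemma test_function_imp_smooth: "test_function f \<Longrightarrow> smooth f"
  by (simp add: test_function_iff)

lemma test_function_support:
  assumes "test_function f"
  obtains L where "L > 0" "\<And>t. \<bar>t\<bar> > L \<Longrightarrow> f t = 0"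
proof -
  obtain L where L: "\<And>t. \<bar>t\<bar> > L \<Longrightarrow> f t = 0"
    using assms by (auto simp: test_function_iff)
  show ?thesis
    by (rule that[of "max L 1"]) (use L in auto)
qed

lemma test_function_vderiv:
  assumes "test_function f"
  shows "test_function (vderiv f)"
proof -
  obtain L where L: "\<And>t. \<bar>t\<bar> > L \<Longrightarrow> f t = 0"
    using test_function_support[OF assms] by metis
  have "vderiv f t = 0" if "\<bar>t\<bar> > L" for t
  proof -
    have op: "open {t. \<bar>t\<bar> > L}"
      by (intro open_Collect_less continuous_intros)
    have "(f has_vector_derivative 0) (at t)"
      by (rule has_vector_derivative_transform_within_open[OF has_vector_derivative_const op])
        (use that L in simp_all)
    then show ?thesis
      by (simp add: vderiv_def vector_derivative_at)
  qed
  then show ?thesis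
    using assms by (auto simp: test_function_iff smooth_vderiv)
qed

lemma test_function_bounded_linear:
  assumes "bounded_linear h" "test_function f"
  shows "test_function (\<lambda>t. h (f t))"
  using assms linear_0[OF bounded_linear.linear[OF assms(1)]]
  unfolding test_function_iff by (metis smooth_bounded_linear)

lemma test_function_bilinear:
  assumes h: "bounded_bilinear h" and f: "smooth f" and g: "test_function g"
  shows "test_function (\<lambda>t. h (f t) (g t))"
proof -
  obtain L where L: "\<And>t. \<bar>t\<bar> > L \<Longrightarrow> g t = 0"
    using test_function_support[OF g] by metis
  then have "\<forall>t. \<bar>t\<bar> > L \<longrightarrow> h (f t) (g t) = 0"
    by (simp add: bounded_bilinear.zero_right[OF h])
  then show ?thesis
    using smooth_bilinear[OF h f test_function_imp_smooth[OF g]] unfolding test_function_iff by blast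
qed

lemma test_function_add:
  assumes f: "test_function f" and g: "test_function g"
  shows "test_function (\<lambda>t. f t + g t)"
proof -
  obtain L where L: "\<And>t. \<bar>t\<bar> > L \<Longrightarrow> f t = 0"
    using test_function_support[OF f] by metis
  obtain L' where L': "\<And>t. \<bar>t\<bar> > L' \<Longrightarrow> g t = 0"
    using test_function_support[OF g] by metis
  have "\<forall>t. \<bar>t\<bar> > max L L' \<longrightarrow> f t + g t = 0"
    using L L' by simp
  then show ?thesis
    using smooth_add[OF test_function_imp_smooth[OF f] test_function_imp_smooth[OF g]]
    unfolding test_function_iff by blast
qed

lemma test_function_reflect:
  assumes f: "test_function f"
  shows "test_function (\<lambda>t. f (- t))"
proof -
  obtain L where "\<And>t. \<bar>t\<bar> > L \<Longrightarrow> f t = 0"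
    using test_function_support[OF f] by metis
  then have "\<forall>t. \<bar>t\<bar> > L \<longrightarrow> f (- t) = 0"
    by simp
  then show ?thesis
    using smooth_affine[OF test_function_imp_smooth[OF f], of "-1" 0]
    unfolding test_function_iff by auto
qed

lemma test_function_bump: "test_function (bump n p q)"
proof -
  have "\<forall>t. \<bar>t\<bar> > max \<bar>p\<bar> \<bar>q\<bar> \<longrightarrow> bump n p q t = 0"
    by (auto intro!: bump_eq_0)
  then show ?thesis
    using smooth_bump unfolding test_function_iff by blast
qed

lemma test_function_scaleR_const:
  "test_function b \<Longrightarrow> test_function (\<lambda>t. b t *\<^sub>R (v :: 'a::real_normed_vector))"
  by (rule test_function_bounded_linear[OF bounded_linear_scaleR_left])

lemma test_function_exp:
  "test_function f \<Longrightarrow> test_function (\<lambda>t. exp (a * t) *\<^sub>R (f t :: 'a::real_normed_vector))"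
  by (rule test_function_bilinear[OF bounded_bilinear_scaleR smooth_exp])

lemma wspace_bounded_support:
  fixes f :: "real \<Rightarrow> 'a::complex_hilbert"
  assumes f: "strongly_measurable f" and C: "\<And>t. norm (f t) \<le> C" and L: "\<And>t. \<bar>t\<bar> > L \<Longrightarrow> f t = 0"
  shows "f \<in> wspace 0"
proof -
  have "integrable lebesgue (\<lambda>t. indicat_real {- L..L} t * C\<^sup>2)"
    by (intro integrable_mult_left integrable_real_indicator) (auto simp: emeasure_lborel_Icc_eq)
  then have "integrable lebesgue (\<lambda>t. (norm (f t))\<^sup>2)"
  proof (rule Bochner_Integration.integrable_bound)
    show "(\<lambda>t. (norm (f t))\<^sup>2) \<in> borel_measurable lebesgue"
      using strongly_measurable_norm[OF f] by simp
    have "norm ((norm (f t))\<^sup>2) \<le> norm (indicat_real {- L..L} t * C\<^sup>2)" for t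
      using L[of t] power_mono[OF C, of t 2] by (auto simp: indicator_def)
    then show "AE t in lebesgue. norm ((norm (f t))\<^sup>2) \<le> norm (indicat_real {- L..L} t * C\<^sup>2)"
      by simp
  qed
  with f show ?thesis
    by (simp add: wspace_0)
qed

lemma test_function_bounded:
  fixes f :: "real \<Rightarrow> 'a::real_normed_vector"
  assumes f: "test_function f"
  obtains C where "C > 0" "\<And>t. norm (f t) \<le> C"
proof -
  obtain L where L: "L > 0" "\<And>t. \<bar>t\<bar> > L \<Longrightarrow> f t = 0"
    using test_function_support[OF f] by metis
  have "compact (f ` {- L..L})"
    using f by (intro compact_continuous_image smooth_continuous_on test_function_imp_smooth) auto
  then obtain C where C: "C > 0" "\<And>t. t \<in> {- L..L} \<Longrightarrow> norm (f t) \<le> C"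
    using compact_imp_bounded bounded_pos by (metis imageI)
  have "norm (f t) \<le> C" for t
    using C L(2)[of t] by (cases "t \<in> {- L..L}") (auto simp: abs_le_iff not_le)
  with C(1) show ?thesis
    by (rule that)
qed

lemma test_function_wspace_0:
  fixes f :: "real \<Rightarrow> 'a::complex_hilbert"
  assumes f: "test_function f"
  shows "f \<in> wspace 0"
proof -
  obtain C where C: "\<And>t. norm (f t) \<le> C"
    using test_function_bounded[OF f] by metis
  obtain L where L: "\<And>t. \<bar>t\<bar> > L \<Longrightarrow> f t = 0"
    using test_function_support[OF f] by metis
  show ?thesis
    using f C L
    by (intro wspace_bounded_support[of f C L] strongly_measurable_continuous smooth_continuous_on
        test_function_imp_smooth)
qed

lemma test_function_wspace:
  fixes f :: "real \<Rightarrow> 'a::complex_hilbert"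
  assumes f: "test_function f"
  shows "f \<in> wspace \<nu>"
  using test_function_wspace_0[OF test_function_exp[OF f, of "- \<nu>"]] by (simp add: wspace_iff_wspace_0[of _ \<nu>])

subsection \<open>Density of bump functions\<close>

text \<open>\<open>S\<close> records where the bumps live: the same density argument is used on the
  whole line for the Fourier transform and on the half-lines on either side of \<open>a\<close> for
  causality. Empty intervals are allowed and contribute zero.\<close>

definition bump_span :: "real set \<Rightarrow> 'a::complex_hilbert L2 set"
  where "bump_span S = span {abs_L2 (\<lambda>t. bump (Suc n) p q t *\<^sub>R v) | n p q v. {p..q} \<subseteq> S}"

lemma bump_wspace_0: "(\<lambda>t. bump n p q t *\<^sub>R v) \<in> wspace 0"
  by (intro test_function_wspace_0 test_function_scaleR_const test_function_bump)

text \<open>Density as a proof rule: a closed linear condition has to be checked on bumps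
  only.\<close>

lemma closure_bump_span_induct:
  assumes x: "x \<in> closure (bump_span S)" and P: "subspace {x. P x}" "closed {x. P x}"
    and basic: "\<And>n p q v. {p..q} \<subseteq> S \<Longrightarrow> P (abs_L2 (\<lambda>t. bump (Suc n) p q t *\<^sub>R v))"
  shows "P x"
proof -
  have "bump_span S \<subseteq> {x. P x}"
    unfolding bump_span_def by (rule span_minimal[OF _ P(1)]) (use basic in blast)
  then have "closure (bump_span S) \<subseteq> {x. P x}"
    using P(2) by (rule closure_minimal)
  with x show ?thesis
    by blast
qed

lemma wspace_indicator:
  assumes "A \<in> sets lebesgue" "A \<subseteq> {- L..L}"
  shows "(\<lambda>t. indicat_real A t *\<^sub>R (v :: 'a::complex_hilbert)) \<in> wspace 0"
proof (rule wspace_bounded_support[of _ "norm v" L])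
  show "strongly_measurable (\<lambda>t. indicat_real A t *\<^sub>R v)"
    using assms by (intro strongly_measurable_scaleR) auto
  show "norm (indicat_real A t *\<^sub>R v) \<le> norm v" for t
    by (auto simp: indicator_def)
  show "indicat_real A t *\<^sub>R v = 0" if "\<bar>t\<bar> > L" for t
    using that assms(2) by (force simp: indicator_def)
qed

lemma subspace_closure:
  fixes S :: "'a::real_normed_vector set"
  assumes sub: "subspace S"
  shows "subspace (closure S)"
  unfolding subspace_def
proof (intro conjI ballI allI)
  show "0 \<in> closure S"
    using sub closure_subset subspace_0 by blast
  show "x + y \<in> closure S" if xy: "x \<in> closure S" "y \<in> closure S" for x y
  proof -
    obtain a b where "\<And>n. a n \<in> S" "a \<longlonglongrightarrow> x" "\<And>n. b n \<in> S" "b \<longlonglongrightarrow> y"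
      using xy unfolding closure_sequential by blast
    then show ?thesis
      unfolding closure_sequential
      by (intro exI[of _ "\<lambda>n. a n + b n"]) (auto intro: tendsto_add subspace_add[OF sub])
  qed
  show "c *\<^sub>R x \<in> closure S" if x: "x \<in> closure S" for c x
  proof -
    obtain a where "\<And>n. a n \<in> S" "a \<longlonglongrightarrow> x"
      using x unfolding closure_sequential by blast
    then show ?thesis
      unfolding closure_sequential
      by (intro exI[of _ "\<lambda>n. c *\<^sub>R a n"]) (auto intro: tendsto_scaleR subspace_scale[OF sub])
  qed
qed

lemma subspace_closure_bump_span: "subspace (closure (bump_span S))"
  by (simp add: subspace_closure bump_span_def)

section \<open>Indicators and simple functions in the closure of the span of bumps\<close>

context
  fixes S :: "real set" and p q :: real
  assumes pq: "{p..q} \<subseteq> S"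
begin

lemma Int_greaterThanLessThan_bounded: "A \<inter> {p<..<q} \<subseteq> {- max \<bar>p\<bar> \<bar>q\<bar>..max \<bar>p\<bar> \<bar>q\<bar>}"
  by auto

lemma indicator_interval_closure_bump_span:
  assumes "{a..b} \<subseteq> S"
  shows "abs_L2 (\<lambda>t. indicat_real {a<..<b} t *\<^sub>R v) \<in> closure (bump_span S)"
proof -
  have h: "(\<lambda>t. indicat_real {a..b} t *\<^sub>R v) \<in> wspace 0"
    by (rule wspace_indicator[of _ "max \<bar>a\<bar> \<bar>b\<bar>"]) auto
  have "(\<lambda>n. abs_L2 (\<lambda>t. bump (Suc n) a b t *\<^sub>R v)) \<longlonglongrightarrow> abs_L2 (\<lambda>t. indicat_real {a<..<b} t *\<^sub>R v)"
  proof (rule LIMSEQ_abs_L2_dominated[OF _ h, where C = 1])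
    show "strongly_measurable (\<lambda>t. bump (Suc n) a b t *\<^sub>R v)" for n
      using bump_wspace_0 by (auto simp: wspace_0)
    have "norm (bump (Suc n) a b t *\<^sub>R v) \<le> 1 * norm (indicat_real {a..b} t *\<^sub>R v)" for n t
      using abs_bump_le_1[of "Suc n" a b t] bump_eq_0[of t a b "Suc n"]
      by (auto simp: indicator_def mult_left_le_one_le)
    then show "AE t in lebesgue. norm (bump (Suc n) a b t *\<^sub>R v) \<le> 1 * norm (indicat_real {a..b} t *\<^sub>R v)" for n
      by simp
    show "AE t in lebesgue. (\<lambda>n. bump (Suc n) a b t *\<^sub>R v) \<longlonglongrightarrow> indicat_real {a<..<b} t *\<^sub>R v"
      by (intro AE_I2 tendsto_scaleR LIMSEQ_bump tendsto_const)
  qed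
  moreover have "abs_L2 (\<lambda>t. bump (Suc n) a b t *\<^sub>R v) \<in> bump_span S" for n
    unfolding bump_span_def by (rule span_base) (use assms in blast)
  ultimately show ?thesis
    unfolding closure_sequential
    by (intro exI[of _ "\<lambda>n. abs_L2 (\<lambda>t. bump (Suc n) a b t *\<^sub>R v)"]) simp
qed

text \<open>Dynkin's argument: open intervals generate the Borel sets and are stable under
  intersection. Intersecting with the bounded interval \<open>{p<..<q}\<close> keeps the indicators
  square-integrable, so complements become differences and disjoint unions become limits in
  \<open>L2\<close>.\<close>

lemma indicator_borel_closure_bump_span:
  assumes E: "E \<in> sets borel"
  shows "abs_L2 (\<lambda>t. indicat_real (E \<inter> {p<..<q}) t *\<^sub>R v) \<in> closure (bump_span S)"
proof -
  let ?W = "closure (bump_span S) :: 'a L2 set"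
  have W: "(\<lambda>t. indicat_real (A \<inter> {p<..<q}) t *\<^sub>R v) \<in> wspace 0" if "A \<in> sets borel" for A
    using that by (intro wspace_indicator[OF _ Int_greaterThanLessThan_bounded]) auto
  have borel: "sets borel = sigma_sets UNIV (range (\<lambda>(a, b). {a<..<b :: real}))"
    unfolding borel_eq_box box_real by simp
  have "Int_stable (range (\<lambda>(a, b). {a<..<b :: real}))"
  proof (rule Int_stableI)
    fix A B assume "A \<in> range (\<lambda>(a, b). {a<..<b :: real})" "B \<in> range (\<lambda>(a, b). {a<..<b :: real})"
    then obtain a b c d where "A = {a<..<b}" "B = {c<..<d}"
      by auto
    then have "A \<inter> B = {max a c<..<min b d}"
      by auto
    then show "A \<inter> B \<in> range (\<lambda>(a, b). {a<..<b :: real})"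
      by (auto intro: image_eqI[of _ _ "(max a c, min b d)"])
  qed
  moreover have "range (\<lambda>(a, b). {a<..<b :: real}) \<subseteq> Pow UNIV"
    by blast
  moreover have "E \<in> sigma_sets UNIV (range (\<lambda>(a, b). {a<..<b :: real}))"
    using E by (simp add: borel)
  ultimately show ?thesis
  proof (induction E rule: sigma_sets_induct_disjoint)
    case (basic A)
    then obtain a b where "A = {a<..<b}"
      by auto
    then have "A \<inter> {p<..<q} = {max a p<..<min b q}"
      by auto
    then show ?case
      using indicator_interval_closure_bump_span[of "max a p" "min b q"] pq
      by (simp add: subset_eq)
  next
    case empty
    have "abs_L2 (\<lambda>t. 0 :: 'a) = 0"
      by (simp add: zero_L2_def)
    then show ?case
      using subspace_0[OF subspace_closure_bump_span] by simp
  next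
    case (compl A)
    then have A: "A \<in> sets borel"
      by (simp add: borel)
    have "abs_L2 (\<lambda>t. indicat_real (UNIV \<inter> {p<..<q}) t *\<^sub>R v)
        - abs_L2 (\<lambda>t. indicat_real (A \<inter> {p<..<q}) t *\<^sub>R v) \<in> ?W"
      using compl(2) indicator_interval_closure_bump_span[OF pq, of v]
      by (intro subspace_diff[OF subspace_closure_bump_span]) simp_all
    moreover have "(\<lambda>t. indicat_real (UNIV \<inter> {p<..<q}) t *\<^sub>R v - indicat_real (A \<inter> {p<..<q}) t *\<^sub>R v)
        = (\<lambda>t. indicat_real ((UNIV - A) \<inter> {p<..<q}) t *\<^sub>R v)"
      by (auto simp: indicator_def)
    ultimately show ?case
      using W[of UNIV] W[OF A] by (simp add: abs_L2_diff)
  next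
    case (union A)
    then have A: "A i \<in> sets borel" for i
      by (auto simp: borel)
    define f where "f n t = (\<Sum>i<n. indicat_real (A i \<inter> {p<..<q}) t *\<^sub>R v)" for n t
    have fW: "f n \<in> wspace 0 \<and> abs_L2 (f n) \<in> ?W" for n
    proof (induction n)
      case 0
      have "f 0 = (\<lambda>t. 0)"
        by (simp add: f_def[abs_def])
      then show ?case
        using subspace_0[OF subspace_closure_bump_span] by (simp add: zero_L2_def)
    next
      case (Suc n)
      have "f (Suc n) = (\<lambda>t. f n t + indicat_real (A n \<inter> {p<..<q}) t *\<^sub>R v)"
        by (rule ext) (simp only: f_def sum.lessThan_Suc)
      then show ?case
        using Suc W[OF A, of n]
          subspace_add[OF subspace_closure_bump_span conjunct2[OF Suc] union.IH[of n]]
        by (simp add: wspace_0_add abs_L2_add)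
    qed
    have f_eq: "f n t = (\<Sum>i<n. indicat_real (A i) t) *\<^sub>R indicat_real {p<..<q} t *\<^sub>R v" for n t
      by (simp add: f_def indicator_inter_arith scaleR_sum_left flip: scaleR_scaleR)
    have sums: "(\<lambda>i. indicat_real (A i) t) sums indicat_real (\<Union>i. A i) t" for t
      using union(1) by (intro indicator_sums) (auto simp: disjoint_family_on_def)
    have "(\<lambda>n. abs_L2 (f n)) \<longlonglongrightarrow> abs_L2 (\<lambda>t. indicat_real ((\<Union>i. A i) \<inter> {p<..<q}) t *\<^sub>R v)"
    proof (rule LIMSEQ_abs_L2_dominated[where h = "\<lambda>t. indicat_real (UNIV \<inter> {p<..<q}) t *\<^sub>R v" and C = 1])
      show "strongly_measurable (f n)" for n
        using fW by (auto simp: wspace_0)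
      show "(\<lambda>t. indicat_real (UNIV \<inter> {p<..<q}) t *\<^sub>R v) \<in> wspace 0"
        by (rule W) simp
      have "norm (f n t) \<le> 1 * norm (indicat_real (UNIV \<inter> {p<..<q}) t *\<^sub>R v)" for n t
      proof -
        have "(\<Sum>i<n. indicat_real (A i) t) \<le> indicat_real (\<Union>i. A i) t"
          using sum_le_suminf[OF sums_summable[OF sums], of "{..<n}" t] sums_unique[OF sums, of t] by simp
        also have "\<dots> \<le> 1"
          by (simp add: indicator_def)
        finally have "(\<Sum>i<n. indicat_real (A i) t) \<le> 1" .
        moreover have "0 \<le> (\<Sum>i<n. indicat_real (A i) t)"
          by (simp add: sum_nonneg)
        ultimately show ?thesis
          using mult_right_mono[of "\<Sum>i<n. indicat_real (A i) t" 1 "indicat_real {p<..<q} t * norm v"]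
          unfolding f_eq by (simp add: mult.assoc)
      qed
      then show "AE t in lebesgue. norm (f n t) \<le> 1 * norm (indicat_real (UNIV \<inter> {p<..<q}) t *\<^sub>R v)" for n
        by simp
      have "(\<lambda>n. f n t) \<longlonglongrightarrow> indicat_real (\<Union>i. A i) t *\<^sub>R indicat_real {p<..<q} t *\<^sub>R v" for t
        unfolding f_eq using sums[of t] by (intro tendsto_scaleR tendsto_const) (simp add: sums_def)
      then show "AE t in lebesgue. (\<lambda>n. f n t) \<longlonglongrightarrow> indicat_real ((\<Union>i. A i) \<inter> {p<..<q}) t *\<^sub>R v"
        by (simp add: indicator_inter_arith)
    qed
    moreover have "abs_L2 (f n) \<in> ?W" for n
      using fW by blast
    ultimately show ?case
      using closed_sequentially[OF closed_closure, of "\<lambda>n. abs_L2 (f n)"] by blast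
  qed
qed

text \<open>A Lebesgue measurable set differs from a Borel set by a subset of a null set, which
  \<open>L2\<close> does not see.\<close>

lemma indicator_lebesgue_closure_bump_span:
  assumes E: "E \<in> sets lebesgue"
  shows "abs_L2 (\<lambda>t. indicat_real (E \<inter> {p<..<q}) t *\<^sub>R v) \<in> closure (bump_span S)"
proof -
  obtain A N N' where E': "E = A \<union> N" "N \<subseteq> N'" "N' \<in> null_sets lborel" "A \<in> sets lborel"
    using E by (rule sets_completionE)
  have "AE t in lebesgue. t \<notin> N'"
    using null_sets_completionI[OF E'(3)] by (rule AE_not_in)
  then have "AE t in lebesgue. indicat_real (E \<inter> {p<..<q}) t *\<^sub>R v = indicat_real (A \<inter> {p<..<q}) t *\<^sub>R v"
    by eventually_elim (use E' in \<open>auto simp: indicator_def\<close>)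
  moreover have "(\<lambda>t. indicat_real (B \<inter> {p<..<q}) t *\<^sub>R v) \<in> wspace 0" if "B \<in> sets lebesgue" for B
    using that by (intro wspace_indicator[OF _ Int_greaterThanLessThan_bounded]) auto
  ultimately have "abs_L2 (\<lambda>t. indicat_real (E \<inter> {p<..<q}) t *\<^sub>R v)
      = abs_L2 (\<lambda>t. indicat_real (A \<inter> {p<..<q}) t *\<^sub>R v)"
    using E E' by (subst abs_L2_eq_iff) auto
  then show ?thesis
    using indicator_borel_closure_bump_span[of A v] E' by simp
qed

lemma sum_closure_bump_span:
  assumes "finite Y" "\<And>y. y \<in> Y \<Longrightarrow> f y \<in> wspace 0" "\<And>y. y \<in> Y \<Longrightarrow> abs_L2 (f y) \<in> closure (bump_span S)"
  shows "(\<lambda>t. \<Sum>y\<in>Y. f y t) \<in> wspace 0 \<and> abs_L2 (\<lambda>t. \<Sum>y\<in>Y. f y t) \<in> closure (bump_span S)"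
  using assms
proof (induction Y)
  case empty
  then show ?case
    using subspace_0[OF subspace_closure_bump_span] by (simp add: zero_L2_def)
next
  case (insert y Y)
  then have "abs_L2 (f y) + abs_L2 (\<lambda>t. \<Sum>y\<in>Y. f y t) \<in> closure (bump_span S)"
    by (intro subspace_add[OF subspace_closure_bump_span]) auto
  with insert show ?case
    by (simp add: wspace_0_add abs_L2_add)
qed

lemma simple_closure_bump_span:
  assumes h: "simple_function lebesgue h" and h0: "\<And>t. t \<notin> {p<..<q} \<Longrightarrow> h t = 0"
  shows "abs_L2 h \<in> closure (bump_span S)"
proof -
  have "h -` {y} \<in> sets lebesgue" if "y \<in> range h" for y
    using h that by (auto simp: simple_function_def)
  moreover have fin: "finite (range h)"
    using h by (simp add: simple_function_def)
  ultimately have *: "(\<lambda>t. \<Sum>y\<in>range h. indicat_real (h -` {y} \<inter> {p<..<q}) t *\<^sub>R y) \<in> wspace 0 \<and>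
      abs_L2 (\<lambda>t. \<Sum>y\<in>range h. indicat_real (h -` {y} \<inter> {p<..<q}) t *\<^sub>R y) \<in> closure (bump_span S)"
    by (intro sum_closure_bump_span indicator_lebesgue_closure_bump_span
        wspace_indicator[OF _ Int_greaterThanLessThan_bounded]) auto
  have "(\<Sum>y\<in>range h. indicat_real (h -` {y} \<inter> {p<..<q}) t *\<^sub>R y) = h t" for t
  proof -
    have "(\<Sum>y\<in>range h. indicat_real (h -` {y} \<inter> {p<..<q}) t *\<^sub>R y)
        = (\<Sum>y\<in>range h. if y = h t then h t else 0)"
      using h0[of t] by (intro sum.cong) (auto simp: indicator_def)
    then show ?thesis
      using fin by (simp add: sum.delta)
  qed
  with * show ?thesis
    by simp
qed

end

text \<open>Approximating simple functions are cut off twice: to \<open>{p n<..<q n}\<close>, which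
  places them in the closed span, and by \<open>2 * norm (g t)\<close>, which dominates
  them.\<close>

lemma closure_bump_span:
  fixes g :: "real \<Rightarrow> 'a::complex_hilbert" and p q :: "nat \<Rightarrow> real"
  assumes g: "g \<in> wspace 0" and S: "\<And>n. {p n..q n} \<subseteq> S"
    and supp: "AE t in lebesgue. g t \<noteq> 0 \<longrightarrow> (\<forall>\<^sub>F n in sequentially. t \<in> {p n<..<q n})"
  shows "abs_L2 g \<in> closure (bump_span S)"
proof -
  obtain s where s: "\<And>n. simple_function lebesgue (s n)" "AE t in lebesgue. (\<lambda>n. s n t) \<longlonglongrightarrow> g t"
    using g unfolding wspace_0 strongly_measurable_def by blast
  \<comment> \<open>The factor \<open>2\<close> leaves room: where \<open>g t \<noteq> 0\<close> the
    bound is inactive for large \<open>n\<close>, and where \<open>g t = 0\<close> it forces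
    \<open>h n t = 0\<close>.\<close>
  define h where "h n t = (if t \<in> {p n<..<q n} \<and> norm (s n t) \<le> 2 * norm (g t) then s n t else 0)" for n t
  have simple: "simple_function lebesgue (h n)" for n
  proof -
    have "(\<lambda>t. norm (s n t)) \<in> borel_measurable lebesgue"
      using strongly_measurable_norm[OF strongly_measurable_simple[OF s(1)]] .
    moreover have "(\<lambda>t. 2 * norm (g t)) \<in> borel_measurable lebesgue"
      using strongly_measurable_norm[of g] g by (auto simp: wspace_0)
    ultimately have "{t \<in> space lebesgue. norm (s n t) \<le> 2 * norm (g t)} \<in> sets lebesgue"
      by (intro borel_measurable_le)
    moreover have "{p n<..<q n} \<in> sets lebesgue"
      by simp
    ultimately have "{t \<in> space lebesgue. norm (s n t) \<le> 2 * norm (g t)} \<inter> {p n<..<q n} \<in> sets lebesgue"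
      by (rule sets.Int)
    then have "{t \<in> space lebesgue. t \<in> {p n<..<q n} \<and> norm (s n t) \<le> 2 * norm (g t)} \<in> sets lebesgue"
      by (rule back_subst[of "\<lambda>A. A \<in> sets lebesgue"]) auto
    then show ?thesis
      unfolding h_def[abs_def] by (intro simple_function_If s simple_function_const)
  qed
  have "(\<lambda>n. abs_L2 (h n)) \<longlonglongrightarrow> abs_L2 g"
  proof (rule LIMSEQ_abs_L2_dominated[OF _ g, where C = 2])
    show "strongly_measurable (h n)" for n
      by (rule strongly_measurable_simple[OF simple])
    show "AE t in lebesgue. norm (h n t) \<le> 2 * norm (g t)" for n
      by (simp add: h_def)
    show "AE t in lebesgue. (\<lambda>n. h n t) \<longlonglongrightarrow> g t"
      using s(2) supp
    proof eventually_elim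
      case (elim t)
      show ?case
      proof (cases "g t = 0")
        case True
        then have "h n t = 0" for n
          by (simp add: h_def)
        then show ?thesis
          using True by simp
      next
        case False
        have "(\<lambda>n. norm (s n t)) \<longlonglongrightarrow> norm (g t)"
          using elim(1) by (rule tendsto_norm)
        then have "\<forall>\<^sub>F n in sequentially. norm (s n t) < 2 * norm (g t)"
          by (rule order_tendstoD) (use False in simp)
        moreover have "\<forall>\<^sub>F n in sequentially. t \<in> {p n<..<q n}"
          using elim(2) False by blast
        ultimately have "\<forall>\<^sub>F n in sequentially. s n t = h n t"
          by eventually_elim (simp add: h_def)
        then show ?thesis
          by (rule Lim_transform_eventually[OF elim(1)])
      qed
    qed
  qed
  moreover have "abs_L2 (h n) \<in> closure (bump_span S)" for n
    by (rule simple_closure_bump_span[OF S simple]) (auto simp: h_def)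
  ultimately show ?thesis
    using closed_sequentially[OF closed_closure, of "\<lambda>n. abs_L2 (h n)"] by blast
qed

lemma closure_bump_span_UNIV: "closure (bump_span UNIV) = UNIV"
proof -
  have "x \<in> closure (bump_span UNIV)" for x :: "'a L2"
  proof -
    have "abs_L2 (rep_L2 x) \<in> closure (bump_span UNIV)"
    proof (rule closure_bump_span[OF rep_L2_wspace, of "\<lambda>n. - real n" "\<lambda>n. real n"])
      have "\<forall>\<^sub>F n in sequentially. t \<in> {- real n<..<real n}" for t
        using eventually_gt_at_top[of "nat \<lceil>\<bar>t\<bar>\<rceil>"] by eventually_elim (auto simp: abs_less_iff, linarith+)
      then show "AE t in lebesgue. rep_L2 x t \<noteq> 0 \<longrightarrow> (\<forall>\<^sub>F n in sequentially. t \<in> {- real n<..<real n})"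
        by simp
    qed simp
    then show ?thesis
      by simp
  qed
  then show ?thesis
    by blast
qed

lemma AE_not_point: "AE t in lebesgue. t \<noteq> (a :: real)"
  using AE_not_in[of "{a}" lebesgue] by (simp add: null_sets_completionI)

lemma closure_bump_span_atLeast:
  assumes "g \<in> wspace 0" "AE t in lebesgue. t \<le> a \<longrightarrow> g t = 0"
  shows "abs_L2 g \<in> closure (bump_span {a..})"
proof (rule closure_bump_span[OF assms(1), of "\<lambda>n. a" "\<lambda>n. a + real n"])
  have ev: "\<forall>\<^sub>F n in sequentially. t \<in> {a<..<a + real n}" if "t > a" for t
    using eventually_gt_at_top[of "nat \<lceil>t - a\<rceil>"] by eventually_elim (use that in \<open>auto, linarith\<close>)
  show "AE t in lebesgue. g t \<noteq> 0 \<longrightarrow> (\<forall>\<^sub>F n in sequentially. t \<in> {a<..<a + real n})"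
    using assms(2) by eventually_elim (use ev not_le in blast)
qed auto

lemma closure_bump_span_atMost:
  assumes "g \<in> wspace 0" "AE t in lebesgue. t > a \<longrightarrow> g t = 0"
  shows "abs_L2 g \<in> closure (bump_span {..a})"
proof (rule closure_bump_span[OF assms(1), of "\<lambda>n. a - real n" "\<lambda>n. a"])
  have ev: "\<forall>\<^sub>F n in sequentially. t \<in> {a - real n<..<a}" if "t < a" for t
    using eventually_gt_at_top[of "nat \<lceil>a - t\<rceil>"] by eventually_elim (use that in \<open>auto, linarith\<close>)
  \<comment> \<open>The open intervals never contain \<open>a\<close> itself, where \<open>g\<close>
    may be nonzero; a single point is a null set.\<close>
  show "AE t in lebesgue. g t \<noteq> 0 \<longrightarrow> (\<forall>\<^sub>F n in sequentially. t \<in> {a - real n<..<a})"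
    using assms(2) AE_not_point[of a] by eventually_elim (use ev in \<open>metis linorder_neqE_linordered_idom\<close>)
qed auto

lemma L2_test_function_induct:
  assumes P: "subspace {x. P x}" "closed {x. P x}"
    and test: "\<And>\<phi>. test_function \<phi> \<Longrightarrow> P (abs_L2 \<phi>)"
  shows "P x"
  by (rule closure_bump_span_induct[OF _ P, where S = UNIV])
    (auto simp: closure_bump_span_UNIV intro: test test_function_scaleR_const test_function_bump)

section \<open>The Fourier transform of test functions\<close>

text \<open>The two-sided Laplace transform. Up to normalization it is the Fourier transform on the
  imaginary axis and the Fourier-Laplace transform on \<open>Re \<zeta> = \<nu>\<close>; having
  \<open>\<zeta>\<close> as a variable makes the shift of the line possible.\<close>

definition laplace :: "(real \<Rightarrow> 'a::complex_hilbert) \<Rightarrow> complex \<Rightarrow> 'a"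
  where "laplace \<phi> \<zeta> = integral UNIV (\<lambda>t. exp (- (\<zeta> * of_real t)) *\<^sub>C \<phi> t)"

definition supported :: "real \<Rightarrow> (real \<Rightarrow> 'a::real_normed_vector) \<Rightarrow> bool"
  where "supported L \<phi> \<longleftrightarrow> continuous_on UNIV \<phi> \<and> (\<forall>t. \<bar>t\<bar> > L \<longrightarrow> \<phi> t = 0)"

lemma test_function_supported:
  assumes "test_function \<phi>"
  obtains L where "L > 0" "supported L \<phi>"
  using test_function_support[OF assms] smooth_continuous_on[OF test_function_imp_smooth[OF assms]]
  unfolding supported_def by metis

lemma supported_continuous_on: "supported L \<phi> \<Longrightarrow> continuous_on S \<phi>"
  using continuous_on_subset unfolding supported_def by blast

lemma supported_compose:
  assumes "supported L \<phi>" "continuous_on S f" "f ` S \<subseteq> UNIV"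
  shows "continuous_on S (\<lambda>x. \<phi> (f x))"
  using continuous_on_compose2[OF supported_continuous_on[OF assms(1)] assms(2)] by blast

lemma supported_eq_0: "supported L \<phi> \<Longrightarrow> t \<notin> {- L..L} \<Longrightarrow> \<phi> t = 0"
  by (auto simp: supported_def abs_le_iff not_le)

lemma supported_bounded:
  assumes "supported L \<phi>"
  obtains C where "C > 0" "\<And>t. norm (\<phi> t) \<le> C"
proof -
  have "compact (\<phi> ` {- L..L})"
    using assms by (intro compact_continuous_image supported_continuous_on) auto
  then obtain C where C: "C > 0" "\<And>t. t \<in> {- L..L} \<Longrightarrow> norm (\<phi> t) \<le> C"
    using compact_imp_bounded bounded_pos by (metis imageI)
  have "norm (\<phi> t) \<le> C" for t
    using C supported_eq_0[OF assms, of t] by (cases "t \<in> {- L..L}") simp_all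
  with C(1) show ?thesis
    by (rule that)
qed

lemma continuous_on_laplace_integrand:
  fixes \<phi> :: "real \<Rightarrow> 'a::complex_hilbert"
  assumes "supported L \<phi>"
  shows "continuous_on S (\<lambda>t. exp (- (\<zeta> * of_real t)) *\<^sub>C \<phi> t)"
  using supported_continuous_on[OF assms] by (intro scaleC.continuous_on) (auto intro!: continuous_intros)

lemma has_integral_laplace:
  assumes "supported L \<phi>"
  shows "((\<lambda>t. exp (- (\<zeta> * of_real t)) *\<^sub>C \<phi> t) has_integral laplace \<phi> \<zeta>) UNIV"
    and "((\<lambda>t. exp (- (\<zeta> * of_real t)) *\<^sub>C \<phi> t) has_integral laplace \<phi> \<zeta>) {- L..L}"
proof -
  let ?f = "\<lambda>t. exp (- (\<zeta> * of_real t)) *\<^sub>C \<phi> t"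
  have "?f integrable_on {- L..L}"
    by (intro integrable_continuous_real continuous_on_laplace_integrand[OF assms])
  then have 1: "(?f has_integral integral {- L..L} ?f) {- L..L}"
    by (rule integrable_integral)
  have "(?f has_integral integral {- L..L} ?f) UNIV"
    by (rule has_integral_on_superset[OF 1]) (simp_all add: supported_eq_0[OF assms])
  moreover from this have "laplace \<phi> \<zeta> = integral {- L..L} ?f"
    unfolding laplace_def by (rule integral_unique)
  ultimately show "(?f has_integral laplace \<phi> \<zeta>) UNIV" "(?f has_integral laplace \<phi> \<zeta>) {- L..L}"
    using 1 by (simp_all only:)
qed

lemma laplace_bounded_linear:
  fixes T :: "'a::complex_hilbert \<Rightarrow>\<^sub>L 'b::complex_hilbert"
  assumes T: "complex_linear T" and \<phi>: "supported L \<phi>"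
  shows "laplace (\<lambda>t. T (\<phi> t)) \<zeta> = T (laplace \<phi> \<zeta>)"
proof -
  have "((\<lambda>t. T (exp (- (\<zeta> * of_real t)) *\<^sub>C \<phi> t)) has_integral T (laplace \<phi> \<zeta>)) UNIV"
    using has_integral_linear[OF has_integral_laplace(1)[OF \<phi>] blinfun.bounded_linear_right]
    by (simp add: comp_def)
  then show ?thesis
    using T by (simp add: laplace_def complex_linear_def integral_unique)
qed

lemma integrable_compact_support:
  fixes f :: "'a::euclidean_space \<Rightarrow> 'b::{banach, second_countable_topology}"
  assumes "continuous_on UNIV f" "compact S" "\<And>x. x \<notin> S \<Longrightarrow> f x = 0"
  shows "integrable lborel f"
proof -
  have "integrable lborel (\<lambda>x. indicator S x *\<^sub>R f x)"
    by (intro borel_integrable_compact assms(2) continuous_on_subset[OF assms(1)] subset_UNIV)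
  moreover have "(\<lambda>x. indicator S x *\<^sub>R f x) = f"
    using assms(3) by (auto simp: indicator_def)
  ultimately show ?thesis
    by simp
qed

lemma integrable_pair_compact_support:
  fixes f :: "real \<Rightarrow> real \<Rightarrow> complex"
  assumes "continuous_on UNIV (\<lambda>z. f (fst z) (snd z))"
    and "\<And>s u. f s u \<noteq> 0 \<Longrightarrow> \<bar>s\<bar> \<le> L \<and> \<bar>u\<bar> \<le> L'"
  shows "integrable (lborel \<Otimes>\<^sub>M lborel) (\<lambda>(s, u). f s u)"
proof -
  have "integrable lborel (\<lambda>z. f (fst z) (snd z))"
  proof (rule integrable_compact_support)
    show "compact ({- L..L} \<times> {- L'..L'})"
      by (intro compact_Times) simp_all
    show "f (fst z) (snd z) = 0" if "z \<notin> {- L..L} \<times> {- L'..L'}" for z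
      by (rule ccontr) (use that assms(2)[of "fst z" "snd z"] in \<open>auto simp: abs_le_iff mem_Times_iff\<close>)
  qed (use assms in simp)
  then show ?thesis
    by (simp add: case_prod_beta' lborel_prod)
qed

text \<open>Pairing with a fixed vector turns the vector-valued integral into a scalar Lebesgue
  integral, the form in which Fubini's theorem is applied below.\<close>

lemma cinner_laplace:
  assumes \<phi>: "supported L \<phi>"
  shows "cinner v (laplace \<phi> \<zeta>) = (\<integral>t. exp (- (\<zeta> * of_real t)) * cinner v (\<phi> t) \<partial>lborel)"
proof -
  have "((\<lambda>t. cinner v (exp (- (\<zeta> * of_real t)) *\<^sub>C \<phi> t)) has_integral cinner v (laplace \<phi> \<zeta>)) UNIV"
    using has_integral_linear[OF has_integral_laplace(1)[OF \<phi>] cinner.bounded_linear_right]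
    by (simp add: comp_def)
  moreover have "integrable lborel (\<lambda>t. cinner v (exp (- (\<zeta> * of_real t)) *\<^sub>C \<phi> t))"
    using supported_eq_0[OF \<phi>] cinner.zero_right
    by (intro integrable_compact_support[where S = "{- L..L}"] cinner.continuous_on
        continuous_on_laplace_integrand[OF \<phi>] continuous_on_const) auto
  ultimately have "cinner v (laplace \<phi> \<zeta>)
      = (\<integral>t. cinner v (exp (- (\<zeta> * of_real t)) *\<^sub>C \<phi> t) \<partial>lborel)"
    using has_integral_integral_lborel has_integral_unique by blast
  then show ?thesis
    by (simp add: cinner_scaleC_right)
qed

lemma norm_laplace_le:
  assumes \<phi>: "supported L \<phi>" and "0 \<le> L"
    and B: "\<And>t. t \<in> {- L..L} \<Longrightarrow> norm (exp (- (\<zeta> * of_real t)) *\<^sub>C \<phi> t) \<le> B"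
  shows "norm (laplace \<phi> \<zeta>) \<le> B * (2 * L)"
proof -
  have "norm (integral {- L..L} (\<lambda>t. exp (- (\<zeta> * of_real t)) *\<^sub>C \<phi> t)) \<le> B * (L - (- L))"
    by (rule integral_bound) (use assms continuous_on_laplace_integrand[OF \<phi>] in auto)
  then show ?thesis
    using integral_unique[OF has_integral_laplace(2)[OF \<phi>]] by simp
qed

lemma laplace_vderiv:
  fixes \<phi> :: "real \<Rightarrow> 'a::complex_hilbert"
  assumes \<phi>: "test_function \<phi>"
  shows "laplace (vderiv \<phi>) \<zeta> = \<zeta> *\<^sub>C laplace \<phi> \<zeta>"
proof -
  obtain L0 where L0: "L0 > 0" "\<And>t. \<bar>t\<bar> > L0 \<Longrightarrow> \<phi> t = 0"
    using test_function_support[OF \<phi>] by metis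
  obtain L1 where L1: "L1 > 0" "\<And>t. \<bar>t\<bar> > L1 \<Longrightarrow> vderiv \<phi> t = 0"
    using test_function_support[OF test_function_vderiv[OF \<phi>]] by metis
  \<comment> \<open>One unit beyond both supports, so that \<open>\<phi>\<close> vanishes at the
    endpoints \<open>L\<close> and \<open>- L\<close> and integration by parts leaves no boundary
    term.\<close>
  define L where "L = max L0 L1 + 1"
  have s: "supported L \<phi>" "supported L (vderiv \<phi>)"
    using L0 L1 test_function_imp_smooth[OF \<phi>]
    by (auto simp: supported_def L_def smooth_continuous_on smooth_vderiv)
  have "((\<lambda>t. exp (- (\<zeta> * of_real t)) *\<^sub>C \<phi> t) has_vector_derivative
      exp (- (\<zeta> * of_real t)) *\<^sub>C vderiv \<phi> t + (- \<zeta> * exp (- (\<zeta> * of_real t))) *\<^sub>C \<phi> t) (at t within S)" for t S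
  proof -
    have "((\<lambda>z. exp (- (\<zeta> * z))) has_field_derivative - \<zeta> * exp (- (\<zeta> * of_real t))) (at (of_real t))"
      by (auto intro!: derivative_eq_intros)
    from has_vector_derivative_real_field[OF this]
    have "((\<lambda>t. exp (- (\<zeta> * of_real t))) has_vector_derivative - \<zeta> * exp (- (\<zeta> * of_real t))) (at t within S)" .
    moreover have "(\<phi> has_vector_derivative vderiv \<phi> t) (at t within S)"
      using smooth_has_vector_derivative[OF test_function_imp_smooth[OF \<phi>]]
      by (rule has_vector_derivative_at_within)
    ultimately show ?thesis
      by (rule scaleC.has_vector_derivative)
  qed
  then have "((\<lambda>t. exp (- (\<zeta> * of_real t)) *\<^sub>C vderiv \<phi> t + (- \<zeta> * exp (- (\<zeta> * of_real t))) *\<^sub>C \<phi> t)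
      has_integral (exp (- (\<zeta> * of_real L)) *\<^sub>C \<phi> L - exp (- (\<zeta> * of_real (- L))) *\<^sub>C \<phi> (- L))) {- L..L}"
    using L0 L1 by (intro fundamental_theorem_of_calculus) (auto simp: L_def)
  moreover have "\<phi> L = 0" "\<phi> (- L) = 0"
    using L0 L1 by (auto simp: L_def)
  ultimately have 1: "((\<lambda>t. exp (- (\<zeta> * of_real t)) *\<^sub>C vderiv \<phi> t
      + (- \<zeta> * exp (- (\<zeta> * of_real t))) *\<^sub>C \<phi> t) has_integral 0) {- L..L}"
    by simp
  have "((\<lambda>t. (- \<zeta>) *\<^sub>C exp (- (\<zeta> * of_real t)) *\<^sub>C \<phi> t) has_integral (- \<zeta>) *\<^sub>C laplace \<phi> \<zeta>) {- L..L}"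
    using has_integral_linear[OF has_integral_laplace(2)[OF s(1)] scaleC.bounded_linear_right, of "- \<zeta>"]
    by (simp only: comp_def)
  then have "((\<lambda>t. (- \<zeta> * exp (- (\<zeta> * of_real t))) *\<^sub>C \<phi> t) has_integral (- \<zeta>) *\<^sub>C laplace \<phi> \<zeta>) {- L..L}"
    by (simp only: scaleC_scaleC)
  from has_integral_unique[OF 1 has_integral_add[OF has_integral_laplace(2)[OF s(2)] this]]
  have "laplace (vderiv \<phi>) \<zeta> + (- \<zeta>) *\<^sub>C laplace \<phi> \<zeta> = 0"
    by simp
  then show ?thesis
    by (simp add: scaleC.minus_left)
qed

lemma continuous_on_laplace_imaginary:
  assumes \<phi>: "supported L \<phi>"
  shows "continuous_on UNIV (\<lambda>x. laplace \<phi> (\<i> * of_real x))"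
proof -
  have "continuous_on UNIV (\<lambda>x. integral (cbox (- L) L) (\<lambda>t. exp (- (\<i> * of_real x * of_real t)) *\<^sub>C \<phi> t))"
  proof (rule integral_continuous_on_param)
    have "continuous_on (UNIV \<times> cbox (- L) L) (\<lambda>z. \<phi> (snd z))"
      by (rule supported_compose[OF \<phi>]) (auto intro: continuous_intros)
    then show "continuous_on (UNIV \<times> cbox (- L) L)
        (\<lambda>(x, t). exp (- (\<i> * complex_of_real x * of_real t)) *\<^sub>C \<phi> t)"
      unfolding split_beta by (intro scaleC.continuous_on continuous_intros)
  qed
  then show ?thesis
    using integral_unique[OF has_integral_laplace(2)[OF \<phi>]] by simp
qed

subsection \<open>Plancherel's theorem\<close>

context
  fixes \<phi> :: "real \<Rightarrow> 'a::complex_hilbert" and L C :: real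
  assumes \<phi>: "supported L \<phi>" and C: "\<And>t. norm (\<phi> t) \<le> C" and L: "L > 0"
begin

text \<open>Up to the sign of the exponent, its Fourier integral is the squared norm of the
  transform of \<open>\<phi>\<close>, and its value at \<open>0\<close> is the squared norm of
  \<open>\<phi>\<close>. Plancherel's identity thus becomes Fourier inversion of a scalar function
  at the single point \<open>0\<close>.\<close>

definition autocorrelation :: "real \<Rightarrow> complex"
  where "autocorrelation u = (\<integral>s. cinner (\<phi> (s + u)) (\<phi> s) \<partial>lborel)"

lemma integrable_pair_autocorrelation:
  "integrable (lborel \<Otimes>\<^sub>M lborel) (\<lambda>(u, s). exp (\<i> * of_real (x * u)) * cinner (\<phi> (s + u)) (\<phi> s))"
proof (rule integrable_pair_compact_support[where L = "2 * L" and L' = L])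
  show "continuous_on UNIV (\<lambda>z. exp (\<i> * of_real (x * fst z)) * cinner (\<phi> (snd z + fst z)) (\<phi> (snd z)))"
    by (intro continuous_intros cinner.continuous_on supported_compose[OF \<phi>]) auto
  \<comment> \<open>Both \<open>s\<close> and \<open>s + u\<close> lie in \<open>{- L..L}\<close>,
    which confines \<open>u\<close> to twice that range.\<close>
  show "\<bar>u\<bar> \<le> 2 * L \<and> \<bar>s\<bar> \<le> L" if "exp (\<i> * of_real (x * u)) * cinner (\<phi> (s + u)) (\<phi> s) \<noteq> 0" for u s
  proof -
    have "\<phi> (s + u) \<noteq> 0" "\<phi> s \<noteq> 0"
      using that by (auto simp: cinner.zero_left cinner.zero_right)
    then have "\<bar>s + u\<bar> \<le> L" "\<bar>s\<bar> \<le> L"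
      using \<phi> unfolding supported_def by (meson not_le)+
    then show ?thesis
      by linarith
  qed
qed

lemma integrable_autocorrelation: "integrable lborel autocorrelation"
  using lborel_pair.integrable_fst'[OF integrable_pair_autocorrelation[of 0]]
  by (simp add: autocorrelation_def[abs_def])

lemma norm_cinner_supported_le: "norm (cinner (\<phi> (s + u)) (\<phi> s)) \<le> indicat_real {- L..L} s * C\<^sup>2"
proof (cases "s \<in> {- L..L}")
  case True
  have "norm (cinner (\<phi> (s + u)) (\<phi> s)) \<le> norm (\<phi> (s + u)) * norm (\<phi> s)"
    by (rule cmod_cinner_le)
  also have "\<dots> \<le> C * C"
    using C[of s] norm_ge_zero[of "\<phi> s"] by (intro mult_mono C) linarith+
  finally show ?thesis
    using True by (simp add: power2_eq_square)
next
  case False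
  then show ?thesis
    using supported_eq_0[OF \<phi> False] by (simp add: cinner.zero_right)
qed

lemma borel_measurable_cinner_supported: "(\<lambda>s. cinner (\<phi> (s + u)) (\<phi> s)) \<in> borel_measurable lborel"
  by (simp, intro borel_measurable_continuous_onI cinner.continuous_on supported_compose[OF \<phi>])
    (auto intro: continuous_intros)

lemma integrable_indicator_const: "integrable lborel (\<lambda>s. indicat_real {- L..L} s * C\<^sup>2)"
  by (intro integrable_mult_left integrable_real_indicator) (auto simp: emeasure_lborel_Icc_eq)

lemma norm_autocorrelation_le: "norm (autocorrelation u) \<le> (\<integral>s. indicat_real {- L..L} s * C\<^sup>2 \<partial>lborel)"
  unfolding autocorrelation_def
proof (rule order_trans[OF integral_norm_bound integral_mono])
  show "integrable lborel (\<lambda>s. norm (cinner (\<phi> (s + u)) (\<phi> s)))"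
    by (intro integrable_norm Bochner_Integration.integrable_bound[OF integrable_indicator_const]
        borel_measurable_cinner_supported AE_I2)
      (use norm_cinner_supported_le in \<open>auto intro: order_trans\<close>)
qed (use integrable_indicator_const norm_cinner_supported_le in auto)

lemma LIMSEQ_autocorrelation:
  assumes "u \<longlonglongrightarrow> 0"
  shows "(\<lambda>n. autocorrelation (u n)) \<longlonglongrightarrow> autocorrelation 0"
  unfolding autocorrelation_def
proof (rule integral_dominated_convergence[OF _ _ integrable_indicator_const])
  show "(\<lambda>s. cinner (\<phi> (s + 0)) (\<phi> s)) \<in> borel_measurable lborel"
    "(\<lambda>s. cinner (\<phi> (s + u n)) (\<phi> s)) \<in> borel_measurable lborel" for n
    by (rule borel_measurable_cinner_supported)+
  have "(\<lambda>n. \<phi> (s + u n)) \<longlonglongrightarrow> \<phi> (s + 0)" for s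
  proof (rule isCont_tendsto_compose[of _ \<phi>])
    show "isCont \<phi> (s + 0)"
      using \<phi> by (auto simp: supported_def continuous_on_eq_continuous_at)
  qed (intro tendsto_intros assms)
  then show "AE s in lborel. (\<lambda>n. cinner (\<phi> (s + u n)) (\<phi> s)) \<longlonglongrightarrow> cinner (\<phi> (s + 0)) (\<phi> s)"
    by (intro AE_I2 cinner.tendsto tendsto_const)
qed (use norm_cinner_supported_le in auto)

text \<open>Both arguments of the inner product are written as integrals; the substitution
  \<open>t = s + u\<close> collects the exponentials into one that depends on \<open>u\<close> only,
  and Fubini isolates the autocorrelation.\<close>

lemma norm_laplace_autocorrelation:
  "complex_of_real ((norm (laplace \<phi> (\<i> * of_real x)))\<^sup>2)
    = (\<integral>u. exp (\<i> * of_real (x * u)) * autocorrelation u \<partial>lborel)"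
proof -
  let ?l = "laplace \<phi> (\<i> * of_real x)"
  have inner: "cinner ?l v = (\<integral>t. exp (\<i> * of_real (x * t)) * cinner (\<phi> t) v \<partial>lborel)" for v
  proof -
    have "cinner ?l v = cnj (cinner v ?l)"
      by (rule cinner_commute)
    also have "\<dots> = (\<integral>t. cnj (exp (- (\<i> * of_real x * of_real t)) * cinner v (\<phi> t)) \<partial>lborel)"
      by (subst Bochner_Integration.integral_cnj) (simp only: cinner_laplace[OF \<phi>])
    also have "\<dots> = (\<integral>t. exp (\<i> * of_real (x * t)) * cinner (\<phi> t) v \<partial>lborel)"
      by (intro Bochner_Integration.integral_cong refl)
        (simp add: exp_cnj mult.assoc flip: cinner_commute)
    finally show ?thesis .
  qed
  have "complex_of_real ((norm ?l)\<^sup>2) = cinner ?l ?l"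
    by (rule cinner_self[symmetric])
  also have "\<dots> = (\<integral>s. exp (- (\<i> * of_real x * of_real s)) * cinner ?l (\<phi> s) \<partial>lborel)"
    by (rule cinner_laplace[OF \<phi>])
  also have "\<dots> = (\<integral>s. (\<integral>u. exp (\<i> * of_real (x * u)) * cinner (\<phi> (s + u)) (\<phi> s) \<partial>lborel) \<partial>lborel)"
  proof (intro Bochner_Integration.integral_cong refl)
    fix s
    have "exp (- (\<i> * of_real x * of_real s)) * cinner ?l (\<phi> s)
        = (\<integral>t. exp (- (\<i> * of_real x * of_real s)) * (exp (\<i> * of_real (x * t)) * cinner (\<phi> t) (\<phi> s)) \<partial>lborel)"
      unfolding inner by simp
    also have "\<dots> = (\<integral>u. exp (- (\<i> * of_real x * of_real s)) *
        (exp (\<i> * of_real (x * (s + u))) * cinner (\<phi> (s + u)) (\<phi> s)) \<partial>lborel)"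
      by (subst lborel_integral_real_affine[where c = 1 and t = s]) simp_all
    also have "\<dots> = (\<integral>u. exp (\<i> * of_real (x * u)) * cinner (\<phi> (s + u)) (\<phi> s) \<partial>lborel)"
    proof (intro Bochner_Integration.integral_cong refl)
      fix u
      have "exp (- (\<i> * of_real x * of_real s)) * exp (\<i> * of_real (x * (s + u))) = exp (\<i> * of_real (x * u))"
        by (simp add: algebra_simps flip: exp_add)
      then show "exp (- (\<i> * of_real x * of_real s)) * (exp (\<i> * of_real (x * (s + u))) * cinner (\<phi> (s + u)) (\<phi> s))
          = exp (\<i> * of_real (x * u)) * cinner (\<phi> (s + u)) (\<phi> s)"
        by (simp only: mult.assoc[symmetric])
    qed
    finally show "exp (- (\<i> * of_real x * of_real s)) * cinner ?l (\<phi> s)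
        = (\<integral>u. exp (\<i> * of_real (x * u)) * cinner (\<phi> (s + u)) (\<phi> s) \<partial>lborel)" .
  qed
  also have "\<dots> = (\<integral>u. (\<integral>s. exp (\<i> * of_real (x * u)) * cinner (\<phi> (s + u)) (\<phi> s) \<partial>lborel) \<partial>lborel)"
    by (rule lborel_pair.Fubini_integral[OF integrable_pair_autocorrelation])
  also have "\<dots> = (\<integral>u. exp (\<i> * of_real (x * u)) * autocorrelation u \<partial>lborel)"
    by (simp add: autocorrelation_def)
  finally show ?thesis .
qed

text \<open>The characteristic function of the standard normal distribution, rescaled by
  \<open>n\<close>.\<close>

lemma integral_gaussian_iexp:
  fixes n :: real
  assumes n: "n > 0"
  shows "(\<integral>x. of_real (exp (- (x / n)\<^sup>2 / 2)) * exp (\<i> * of_real (x * u)) \<partial>lborel)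
    = of_real (n * sqrt (2 * pi) * exp (- (n * u)\<^sup>2 / 2))" (is "?I = _")
proof -
  have "complex_of_real (exp (- ((n * u)\<^sup>2) / 2)) = (\<integral>x. exp (\<i> * of_real (n * u * x)) \<partial>std_normal_distribution)"
    using fun_cong[OF char_std_normal_distribution, of "n * u"] by (simp add: char_def)
  also have "\<dots> = (\<integral>x. std_normal_density x *\<^sub>R exp (\<i> * of_real (n * u * x)) \<partial>lborel)"
    by (intro integral_density) (auto intro!: borel_measurable_continuous_onI continuous_intros)
  also have "\<dots> = (\<integral>x. of_real (1 / sqrt (2 * pi)) * (of_real (exp (- x\<^sup>2 / 2)) * exp (\<i> * of_real (n * u * x))) \<partial>lborel)"
    by (intro Bochner_Integration.integral_cong refl) (simp add: std_normal_density_def scaleR_conv_of_real)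
  also have "\<dots> = of_real (1 / sqrt (2 * pi)) * (\<integral>x. of_real (exp (- x\<^sup>2 / 2)) * exp (\<i> * of_real (n * u * x)) \<partial>lborel)"
    by simp
  finally have 1: "(\<integral>x. of_real (exp (- x\<^sup>2 / 2)) * exp (\<i> * of_real (n * u * x)) \<partial>lborel)
      = complex_of_real (sqrt (2 * pi) * exp (- ((n * u)\<^sup>2) / 2))"
    by (simp add: field_simps)
  have "?I = \<bar>n\<bar> *\<^sub>R (\<integral>x. of_real (exp (- ((0 + n * x) / n)\<^sup>2 / 2)) * exp (\<i> * of_real ((0 + n * x) * u)) \<partial>lborel)"
    by (rule lborel_integral_real_affine) (use n in simp)
  also have "\<dots> = n *\<^sub>R (\<integral>x. of_real (exp (- x\<^sup>2 / 2)) * exp (\<i> * of_real (n * u * x)) \<partial>lborel)"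
    using n by (simp add: mult_ac)
  also have "\<dots> = of_real (n * sqrt (2 * pi) * exp (- (n * u)\<^sup>2 / 2))"
    unfolding 1 by (simp add: scaleR_conv_of_real)
  finally show ?thesis .
qed

lemma integrable_gaussian:
  fixes n :: real
  assumes n: "n > 0"
  shows "integrable lborel (\<lambda>x. exp (- (x / n)\<^sup>2 / 2))"
proof -
  have "integrable lborel (\<lambda>x. sqrt (2 * pi) * std_normal_density x)"
    by (intro integrable_mult_right integrable_normal_density) simp
  then have "integrable lborel (\<lambda>x. exp (- (x :: real)\<^sup>2 / 2))"
    by (simp add: std_normal_density_def)
  then have "integrable lborel (\<lambda>x :: real. exp (- (0 + (1 / n) * x)\<^sup>2 / 2))"
    by (rule lborel_integrable_real_affine) (use n in simp)
  then show ?thesis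
    by simp
qed

text \<open>The Gaussian factor makes the double integral absolutely convergent, so the order may be
  exchanged. The inner integral is again Gaussian, and the substitution \<open>u = v / n\<close>
  turns it into a normal density that averages the autocorrelation near \<open>0\<close>.\<close>

lemma integral_gaussian_norm_laplace:
  fixes n :: real
  assumes n: "n > 0"
  shows "integrable lborel (\<lambda>x. exp (- (x / n)\<^sup>2 / 2) * (norm (laplace \<phi> (\<i> * of_real x)))\<^sup>2)"
    and "of_real (\<integral>x. exp (- (x / n)\<^sup>2 / 2) * (norm (laplace \<phi> (\<i> * of_real x)))\<^sup>2 \<partial>lborel)
      = 2 * pi * (\<integral>v. std_normal_density v *\<^sub>R autocorrelation (v / n) \<partial>lborel)"
proof -
  let ?g = "\<lambda>x. exp (- (x / n)\<^sup>2 / 2)"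
  let ?F = "\<lambda>x u. complex_of_real (?g x) * (exp (\<i> * of_real (x * u)) * autocorrelation u)"
  have [measurable]: "autocorrelation \<in> borel_measurable borel"
    using borel_measurable_integrable[OF integrable_autocorrelation] by simp
  have [measurable]: "(\<lambda>z. exp (\<i> * of_real (fst z * snd z))) \<in> borel_measurable (borel \<Otimes>\<^sub>M borel)"
    unfolding borel_prod by (intro borel_measurable_continuous_onI continuous_intros)
  have int: "integrable (lborel \<Otimes>\<^sub>M lborel) (\<lambda>(x, u). ?F x u)"
  proof (rule lborel_pair.Fubini_integrable)
    have "(\<lambda>z. complex_of_real (?g (fst z)) * (exp (\<i> * of_real (fst z * snd z)) * autocorrelation (snd z)))
        \<in> borel_measurable (lborel \<Otimes>\<^sub>M lborel)"
      by measurable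
    then show "(\<lambda>(x, u). ?F x u) \<in> borel_measurable (lborel \<Otimes>\<^sub>M lborel)"
      by (simp add: split_beta)
    have "integrable lborel (\<lambda>x. ?g x * (\<integral>u. norm (autocorrelation u) \<partial>lborel))"
      by (intro integrable_mult_left integrable_gaussian n)
    then show "integrable lborel (\<lambda>x. \<integral>u. norm (case (x, u) of (x, u) \<Rightarrow> ?F x u) \<partial>lborel)"
      by (simp add: norm_mult)
    have "integrable lborel (\<lambda>u. ?F x u)" for x
    proof (rule Bochner_Integration.integrable_bound[OF integrable_norm[OF integrable_autocorrelation]])
      show "(\<lambda>u. ?F x u) \<in> borel_measurable lborel"
        by measurable
    qed (simp add: norm_mult mult_left_le_one_le)
    then show "AE x in lborel. integrable lborel (\<lambda>u. case (x, u) of (x, u) \<Rightarrow> ?F x u)"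
      by simp
  qed
  have l: "complex_of_real (?g x * (norm (laplace \<phi> (\<i> * of_real x)))\<^sup>2) = (\<integral>u. ?F x u \<partial>lborel)" for x
    using norm_laplace_autocorrelation[of x] by simp
  have "integrable lborel (\<lambda>x. \<integral>u. ?F x u \<partial>lborel)"
    using lborel_pair.integrable_fst'[OF int] by simp
  then have int': "integrable lborel (\<lambda>x. complex_of_real (?g x * (norm (laplace \<phi> (\<i> * of_real x)))\<^sup>2))"
    by (simp only: l)
  from integrable_Re[OF int'] show "integrable lborel (\<lambda>x. ?g x * (norm (laplace \<phi> (\<i> * of_real x)))\<^sup>2)"
    by simp
  have "of_real (\<integral>x. ?g x * (norm (laplace \<phi> (\<i> * of_real x)))\<^sup>2 \<partial>lborel)
      = (\<integral>x. complex_of_real (?g x * (norm (laplace \<phi> (\<i> * of_real x)))\<^sup>2) \<partial>lborel)"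
    by (rule integral_complex_of_real[symmetric])
  also have "\<dots> = (\<integral>x. (\<integral>u. ?F x u \<partial>lborel) \<partial>lborel)"
    by (simp only: l)
  also have "\<dots> = (\<integral>u. (\<integral>x. ?F x u \<partial>lborel) \<partial>lborel)"
    by (rule lborel_pair.Fubini_integral[OF int, symmetric])
  also have "\<dots> = (\<integral>u. autocorrelation u * of_real (n * sqrt (2 * pi) * exp (- (n * u)\<^sup>2 / 2)) \<partial>lborel)"
  proof (intro Bochner_Integration.integral_cong refl)
    fix u
    have "(\<integral>x. ?F x u \<partial>lborel) = (\<integral>x. autocorrelation u * (complex_of_real (?g x) * exp (\<i> * of_real (x * u))) \<partial>lborel)"
      by (intro Bochner_Integration.integral_cong refl) (simp add: mult_ac)
    also have "\<dots> = autocorrelation u * of_real (n * sqrt (2 * pi) * exp (- (n * u)\<^sup>2 / 2))"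
      by (subst integral_mult_right_zero) (simp only: integral_gaussian_iexp[OF n])
    finally show "(\<integral>x. ?F x u \<partial>lborel) = autocorrelation u * of_real (n * sqrt (2 * pi) * exp (- (n * u)\<^sup>2 / 2))" .
  qed
  also have "\<dots> = \<bar>1 / n\<bar> *\<^sub>R (\<integral>v. autocorrelation (0 + 1 / n * v) *
      of_real (n * sqrt (2 * pi) * exp (- (n * (0 + 1 / n * v))\<^sup>2 / 2)) \<partial>lborel)"
    by (rule lborel_integral_real_affine) (use n in simp)
  also have "\<dots> = (\<integral>v. of_real (1 / n) * (autocorrelation (0 + 1 / n * v) *
      of_real (n * sqrt (2 * pi) * exp (- (n * (0 + 1 / n * v))\<^sup>2 / 2))) \<partial>lborel)"
    using n by (subst integral_mult_right_zero) (simp add: scaleR_conv_of_real)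
  \<comment> \<open>The constant arises because \<open>sqrt (2 * pi) * exp (- v\<^sup>2 / 2)\<close>
    is \<open>2 * pi\<close> times the standard normal density.\<close>
  also have "\<dots> = (\<integral>v. (2 * pi) * (std_normal_density v *\<^sub>R autocorrelation (v / n)) \<partial>lborel)"
    using n
    by (intro Bochner_Integration.integral_cong refl)
      (simp add: std_normal_density_def scaleR_conv_of_real field_simps flip: of_real_mult power2_eq_square)
  also have "\<dots> = 2 * pi * (\<integral>v. std_normal_density v *\<^sub>R autocorrelation (v / n) \<partial>lborel)"
    by (rule integral_mult_right_zero)
  finally show "of_real (\<integral>x. ?g x * (norm (laplace \<phi> (\<i> * of_real x)))\<^sup>2 \<partial>lborel)
      = 2 * pi * (\<integral>v. std_normal_density v *\<^sub>R autocorrelation (v / n) \<partial>lborel)" .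
qed

lemma LIMSEQ_gaussian_autocorrelation:
  "(\<lambda>n. \<integral>v. std_normal_density v *\<^sub>R autocorrelation (v / real (Suc n)) \<partial>lborel) \<longlonglongrightarrow> autocorrelation 0"
proof -
  let ?c = "\<integral>s. indicat_real {- L..L} s * C\<^sup>2 \<partial>lborel"
  have [measurable]: "autocorrelation \<in> borel_measurable borel"
    using borel_measurable_integrable[OF integrable_autocorrelation] by simp
  have "(\<lambda>n. \<integral>v. std_normal_density v *\<^sub>R autocorrelation (v / real (Suc n)) \<partial>lborel)
      \<longlonglongrightarrow> (\<integral>v. std_normal_density v *\<^sub>R autocorrelation 0 \<partial>lborel)"
  proof (rule integral_dominated_convergence[where w = "\<lambda>v. std_normal_density v * ?c"])
    show "integrable lborel (\<lambda>v. std_normal_density v * ?c)"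
      by (intro integrable_mult_left integrable_normal_density) simp
    have "(\<lambda>n. v / real (Suc n)) \<longlonglongrightarrow> 0" for v
      using tendsto_mult_right_zero[OF LIMSEQ_inverse_real_of_nat, of v] by (simp add: divide_inverse)
    then show "AE v in lborel. (\<lambda>n. std_normal_density v *\<^sub>R autocorrelation (v / real (Suc n)))
        \<longlonglongrightarrow> std_normal_density v *\<^sub>R autocorrelation 0"
      by (intro AE_I2 tendsto_scaleR tendsto_const LIMSEQ_autocorrelation)
    show "AE v in lborel. norm (std_normal_density v *\<^sub>R autocorrelation (v / real (Suc n)))
        \<le> std_normal_density v * ?c" for n
      unfolding norm_scaleR abs_of_nonneg[OF normal_density_nonneg]
      by (intro AE_I2 mult_left_mono norm_autocorrelation_le normal_density_nonneg)
  qed measurable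
  then show ?thesis
    by simp
qed

text \<open>The Gaussian weights increase to \<open>1\<close>, so monotone convergence treats the
  left side without knowing that it is finite, while the averages of the autocorrelation tend to its
  value at \<open>0\<close>.\<close>

lemma nn_integral_norm_laplace:
  "(\<integral>\<^sup>+x. (norm (laplace \<phi> (\<i> * of_real x)))\<^sup>2 \<partial>lborel) = ennreal (2 * pi * (\<integral>t. (norm (\<phi> t))\<^sup>2 \<partial>lborel))"
proof -
  let ?l = "\<lambda>x. (norm (laplace \<phi> (\<i> * of_real x)))\<^sup>2"
  let ?I = "\<lambda>n. \<integral>x. exp (- (x / real (Suc n))\<^sup>2 / 2) * ?l x \<partial>lborel"
  have cont: "continuous_on UNIV ?l"
    by (intro continuous_intros continuous_on_laplace_imaginary[OF \<phi>])
  have "(\<lambda>n. complex_of_real (2 * pi) * (\<integral>v. std_normal_density v *\<^sub>R autocorrelation (v / real (Suc n)) \<partial>lborel))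
      \<longlonglongrightarrow> of_real (2 * pi) * autocorrelation 0"
    by (intro tendsto_mult tendsto_const LIMSEQ_gaussian_autocorrelation)
  then have "(\<lambda>n. complex_of_real (?I n)) \<longlonglongrightarrow> of_real (2 * pi) * autocorrelation 0"
    using integral_gaussian_norm_laplace(2)[of "real (Suc n)" for n] by simp
  moreover have "autocorrelation 0 = of_real (\<integral>t. (norm (\<phi> t))\<^sup>2 \<partial>lborel)"
    by (simp add: autocorrelation_def cinner_self del: of_real_power)
  ultimately have "(\<lambda>n. complex_of_real (?I n)) \<longlonglongrightarrow> of_real (2 * pi * (\<integral>t. (norm (\<phi> t))\<^sup>2 \<partial>lborel))"
    by simp
  then have I: "?I \<longlonglongrightarrow> 2 * pi * (\<integral>t. (norm (\<phi> t))\<^sup>2 \<partial>lborel)"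
    by (simp only: tendsto_of_real_iff)
  have "(\<lambda>n. \<integral>\<^sup>+x. ennreal (exp (- (x / real (Suc n))\<^sup>2 / 2) * ?l x) \<partial>lborel) \<longlonglongrightarrow> (\<integral>\<^sup>+x. ennreal (?l x) \<partial>lborel)"
  proof (rule nn_integral_LIMSEQ)
    show "incseq (\<lambda>n x. ennreal (exp (- (x / real (Suc n))\<^sup>2 / 2) * ?l x))"
    proof (intro incseq_SucI le_funI ennreal_leI mult_right_mono)
      fix n and x :: real
      have "(x / real (Suc (Suc n)))\<^sup>2 \<le> (x / real (Suc n))\<^sup>2"
        unfolding power_divide by (intro divide_left_mono power_mono) auto
      then show "exp (- (x / real (Suc n))\<^sup>2 / 2) \<le> exp (- (x / real (Suc (Suc n)))\<^sup>2 / 2)"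
        by simp
    qed simp
    have [measurable]: "?l \<in> borel_measurable borel"
      by (rule borel_measurable_continuous_onI[OF cont])
    show "(\<lambda>x. ennreal (exp (- (x / real (Suc n))\<^sup>2 / 2) * ?l x)) \<in> borel_measurable lborel" for n
      by measurable
    fix x :: real
    have "(\<lambda>n. x / real (Suc n)) \<longlonglongrightarrow> 0"
      using tendsto_mult_right_zero[OF LIMSEQ_inverse_real_of_nat, of x] by (simp add: divide_inverse)
    then have "(\<lambda>n. exp (- (x / real (Suc n))\<^sup>2 / 2) * ?l x) \<longlonglongrightarrow> exp (- 0\<^sup>2 / 2) * ?l x"
      by (intro tendsto_intros) auto
    then show "(\<lambda>n. ennreal (exp (- (x / real (Suc n))\<^sup>2 / 2) * ?l x)) \<longlonglongrightarrow> ennreal (?l x)"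
      by (intro tendsto_ennrealI) simp
  qed
  moreover have "(\<integral>\<^sup>+x. ennreal (exp (- (x / real (Suc n))\<^sup>2 / 2) * ?l x) \<partial>lborel) = ennreal (?I n)" for n
    by (intro nn_integral_eq_integral integral_gaussian_norm_laplace) simp_all
  ultimately have "(\<lambda>n. ennreal (?I n)) \<longlonglongrightarrow> (\<integral>\<^sup>+x. ennreal (?l x) \<partial>lborel)"
    by simp
  moreover have "(\<lambda>n. ennreal (?I n)) \<longlonglongrightarrow> ennreal (2 * pi * (\<integral>t. (norm (\<phi> t))\<^sup>2 \<partial>lborel))"
    by (intro tendsto_ennrealI I)
  ultimately show ?thesis
    by (rule LIMSEQ_unique)
qed

end

definition hat :: "(real \<Rightarrow> 'a::complex_hilbert) \<Rightarrow> real \<Rightarrow> 'a"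
  where "hat \<phi> x = (1 / sqrt (2 * pi)) *\<^sub>R laplace \<phi> (\<i> * of_real x)"

text \<open>Plancherel's identity for test functions; the normalization in \<open>hat\<close>
  cancels the factor \<open>2 * pi\<close>.\<close>

lemma
  fixes \<phi> :: "real \<Rightarrow> 'a::complex_hilbert"
  assumes \<phi>: "test_function \<phi>"
  shows hat_wspace_0: "hat \<phi> \<in> wspace 0"
    and norm_abs_L2_hat: "norm (abs_L2 (hat \<phi>)) = norm (abs_L2 \<phi>)"
proof -
  obtain L where L: "L > 0" "supported L \<phi>"
    using test_function_supported[OF \<phi>] .
  obtain C where C: "\<And>t. norm (\<phi> t) \<le> C"
    using supported_bounded[OF L(2)] by metis
  have W: "\<phi> \<in> wspace 0"
    by (rule test_function_wspace_0[OF \<phi>])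
  have cont: "continuous_on UNIV (hat \<phi>)"
    unfolding hat_def[abs_def] by (intro continuous_intros continuous_on_laplace_imaginary[OF L(2)])
  have sm: "strongly_measurable (hat \<phi>)"
    by (rule strongly_measurable_continuous[OF cont])
  have "(\<integral>\<^sup>+x. ennreal ((norm (hat \<phi> x))\<^sup>2) \<partial>lebesgue)
      = (\<integral>\<^sup>+x. ennreal (1 / (2 * pi)) * ennreal ((norm (laplace \<phi> (\<i> * of_real x)))\<^sup>2) \<partial>lborel)"
    unfolding nn_integral_completion
    by (intro nn_integral_cong) (simp add: hat_def power_mult_distrib power_divide flip: ennreal_mult)
  also have "\<dots> = ennreal (1 / (2 * pi)) * (\<integral>\<^sup>+x. ennreal ((norm (laplace \<phi> (\<i> * of_real x)))\<^sup>2) \<partial>lborel)"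
    by (intro nn_integral_cmult measurable_compose[OF _ measurable_ennreal])
      (simp, intro borel_measurable_continuous_onI continuous_intros continuous_on_laplace_imaginary[OF L(2)])
  also have "\<dots> = ennreal (\<integral>t. (norm (\<phi> t))\<^sup>2 \<partial>lborel)"
    by (simp add: nn_integral_norm_laplace[OF L(2) C L(1)] flip: ennreal_mult)
  also have "(\<integral>t. (norm (\<phi> t))\<^sup>2 \<partial>lborel) = (\<integral>t. (norm (\<phi> t))\<^sup>2 \<partial>lebesgue)"
    using L(2) by (intro integral_completion[symmetric])
      (simp, intro borel_measurable_continuous_onI continuous_intros supported_continuous_on)
  finally have *: "(\<integral>\<^sup>+x. ennreal ((norm (hat \<phi> x))\<^sup>2) \<partial>lebesgue) = ennreal ((norm (abs_L2 \<phi>))\<^sup>2)"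
    by (simp add: norm_abs_L2_sq[OF W])
  show hW: "hat \<phi> \<in> wspace 0"
    by (rule wspace_0_nn_integralI(1)[OF sm, of "(norm (abs_L2 \<phi>))\<^sup>2"]) (simp only: * order_refl)
  then have "(norm (abs_L2 (hat \<phi>)))\<^sup>2 = (norm (abs_L2 \<phi>))\<^sup>2"
    using * by (simp add: nn_integral_wspace_0 del: ennreal_power)
  then show "norm (abs_L2 (hat \<phi>)) = norm (abs_L2 \<phi>)"
    by (metis norm_ge_zero power2_eq_imp_eq)
qed

lemma integral_lebesgue_lborel:
  fixes f :: "real \<Rightarrow> complex"
  assumes "continuous_on UNIV f"
  shows "(\<integral>x. f x \<partial>lebesgue) = (\<integral>x. f x \<partial>lborel)"
  using assms by (intro integral_completion) (simp add: borel_measurable_continuous_onI)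

lemma laplace_reflect:
  fixes \<psi> :: "real \<Rightarrow> 'a::complex_hilbert"
  assumes \<psi>: "supported L \<psi>"
  shows "laplace (\<lambda>t. \<psi> (- t)) \<zeta> = laplace \<psi> (- \<zeta>)"
proof -
  have s: "supported L (\<lambda>t. \<psi> (- t))"
    using supported_compose[OF \<psi> continuous_on_minus[OF continuous_on_id]] \<psi>
    by (simp add: supported_def)
  have "((\<lambda>t. exp (- (- \<zeta> * of_real (- t))) *\<^sub>C \<psi> (- t)) has_integral laplace \<psi> (- \<zeta>)) {- L..- (- L)}"
    using has_integral_laplace(2)[OF \<psi>] by (subst has_integral_reflect_real)
  then have "((\<lambda>t. exp (- (\<zeta> * of_real t)) *\<^sub>C \<psi> (- t)) has_integral laplace \<psi> (- \<zeta>)) {- L..L}"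
    by simp
  from has_integral_unique[OF this has_integral_laplace(2)[OF s]] show ?thesis
    by simp
qed

text \<open>The multiplication formula, by Fubini: on test functions the adjoint of the transform is
  the transform preceded by a reflection. This provides the preimages needed for
  surjectivity.\<close>

lemma cinner_hat:
  fixes \<phi> \<psi> :: "real \<Rightarrow> 'a::complex_hilbert"
  assumes \<phi>: "test_function \<phi>" and \<psi>: "test_function \<psi>"
  shows "cinner (abs_L2 (hat \<phi>)) (abs_L2 \<psi>) = cinner (abs_L2 \<phi>) (abs_L2 (hat (\<lambda>t. \<psi> (- t))))"
proof -
  obtain L where L: "L > 0" "supported L \<phi>"
    using test_function_supported[OF \<phi>] .
  obtain L' where L': "L' > 0" "supported L' \<psi>"
    using test_function_supported[OF \<psi>] .
  let ?c = "complex_of_real (1 / sqrt (2 * pi))"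
  have hcont: "continuous_on UNIV (\<lambda>t. hat \<psi> (- t))" "continuous_on UNIV (hat \<phi>)"
    unfolding hat_def[abs_def]
    by (intro continuous_intros continuous_on_compose2[OF continuous_on_laplace_imaginary[OF L'(2)], of _ uminus]
        continuous_on_laplace_imaginary[OF L(2)]; simp)+
  have hr: "hat (\<lambda>t. \<psi> (- t)) = (\<lambda>t. hat \<psi> (- t))"
    by (simp add: fun_eq_iff hat_def laplace_reflect[OF L'(2)])
  have W: "(\<lambda>t. hat \<psi> (- t)) \<in> wspace 0"
    using hat_wspace_0[OF test_function_reflect[OF \<psi>]] by (simp add: hr)
  let ?F = "\<lambda>x t. exp (\<i> * of_real (x * t)) * cinner (\<phi> t) (\<psi> x)"
  have int: "integrable (lborel \<Otimes>\<^sub>M lborel) (\<lambda>(x, t). ?F x t)"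
  proof (rule integrable_pair_compact_support[where L = L' and L' = L])
    show "continuous_on UNIV (\<lambda>z. ?F (fst z) (snd z))"
      by (intro continuous_intros cinner.continuous_on supported_compose[OF L(2)] supported_compose[OF L'(2)]) auto
    show "\<bar>x\<bar> \<le> L' \<and> \<bar>t\<bar> \<le> L" if "?F x t \<noteq> 0" for x t
    proof -
      have "\<phi> t \<noteq> 0" "\<psi> x \<noteq> 0"
        using that by (auto simp: cinner.zero_left cinner.zero_right)
      then show ?thesis
        using L(2) L'(2) unfolding supported_def by (meson not_le)
    qed
  qed
  have "cinner (abs_L2 (hat \<phi>)) (abs_L2 \<psi>) = (\<integral>x. cinner (hat \<phi> x) (\<psi> x) \<partial>lborel)"
    unfolding cinner_abs_L2[OF hat_wspace_0[OF \<phi>] test_function_wspace_0[OF \<psi>]]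
    by (intro integral_lebesgue_lborel cinner.continuous_on hcont supported_continuous_on[OF L'(2)])
  also have "\<dots> = (\<integral>x. ?c * (\<integral>t. ?F x t \<partial>lborel) \<partial>lborel)"
  proof (intro Bochner_Integration.integral_cong refl)
    fix x
    have "cinner (hat \<phi> x) (\<psi> x) = ?c * cnj (cinner (\<psi> x) (laplace \<phi> (\<i> * of_real x)))"
      by (simp add: hat_def cinner.scaleR_left scaleR_conv_of_real flip: cinner_commute)
    also have "\<dots> = ?c * (\<integral>t. cnj (exp (- (\<i> * of_real x * of_real t)) * cinner (\<psi> x) (\<phi> t)) \<partial>lborel)"
      by (subst Bochner_Integration.integral_cnj) (simp only: cinner_laplace[OF L(2)])
    also have "(\<integral>t. cnj (exp (- (\<i> * of_real x * of_real t)) * cinner (\<psi> x) (\<phi> t)) \<partial>lborel) = (\<integral>t. ?F x t \<partial>lborel)"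
      by (intro Bochner_Integration.integral_cong refl)
        (simp add: exp_cnj mult.assoc flip: cinner_commute)
    finally show "cinner (hat \<phi> x) (\<psi> x) = ?c * (\<integral>t. ?F x t \<partial>lborel)" .
  qed
  also have "\<dots> = ?c * (\<integral>x. (\<integral>t. ?F x t \<partial>lborel) \<partial>lborel)"
    by (rule integral_mult_right_zero)
  also have "(\<integral>x. (\<integral>t. ?F x t \<partial>lborel) \<partial>lborel) = (\<integral>t. (\<integral>x. ?F x t \<partial>lborel) \<partial>lborel)"
    by (rule lborel_pair.Fubini_integral[OF int, symmetric])
  also have "?c * \<dots> = (\<integral>t. ?c * (\<integral>x. ?F x t \<partial>lborel) \<partial>lborel)"
    by (rule integral_mult_right_zero[symmetric])
  also have "\<dots> = (\<integral>t. cinner (\<phi> t) (hat \<psi> (- t)) \<partial>lborel)"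
  proof (intro Bochner_Integration.integral_cong refl)
    fix t
    show "?c * (\<integral>x. ?F x t \<partial>lborel) = cinner (\<phi> t) (hat \<psi> (- t))"
      by (simp add: hat_def cinner.scaleR_right scaleR_conv_of_real cinner_laplace[OF L'(2)] mult_ac)
  qed
  also have "\<dots> = cinner (abs_L2 \<phi>) (abs_L2 (\<lambda>t. hat \<psi> (- t)))"
    unfolding cinner_abs_L2[OF test_function_wspace_0[OF \<phi>] W]
    by (intro integral_lebesgue_lborel[symmetric] cinner.continuous_on hcont supported_continuous_on[OF L(2)])
  finally show ?thesis
    by (simp only: hr)
qed

section \<open>The unitary Fourier transform\<close>

text \<open>The closure of the graph is still isometric, and an isometric linear relation is
  single-valued; density and completeness make it total.\<close>

lemma isometric_extension:
  fixes G :: "('a::real_normed_vector \<times> 'b::banach) set"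
  assumes G: "subspace G" and iso: "\<And>x y. (x, y) \<in> G \<Longrightarrow> norm y = norm x"
    and dense: "closure (Domain G) = UNIV"
  obtains U where "linear U" "\<And>x. norm (U x) = norm x" "\<And>x y. (x, y) \<in> G \<Longrightarrow> U x = y"
proof -
  have sub: "subspace (closure G)"
    by (rule subspace_closure[OF G])
  have iso': "norm y = norm x" if "(x, y) \<in> closure G" for x y
  proof -
    have "closed {p. norm (snd p) = norm (fst p :: 'a)}"
      by (intro closed_Collect_eq continuous_intros)
    then have "closure G \<subseteq> {p. norm (snd p) = norm (fst p)}"
      by (intro closure_minimal) (auto dest: iso)
    then show ?thesis
      using that by auto
  qed
  have uniq: "y = y'" if "(x, y) \<in> closure G" "(x, y') \<in> closure G" for x y y'
    using iso'[of "x - x" "y - y'"] subspace_diff[OF sub that] by simp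
  have "\<exists>y. (x, y) \<in> closure G" for x
  proof -
    have "x \<in> closure (Domain G)"
      using dense by simp
    then obtain s where s: "\<And>n. s n \<in> Domain G" "s \<longlonglongrightarrow> x"
      unfolding closure_sequential by blast
    then have "\<forall>n. \<exists>y. (s n, y) \<in> G"
      by (simp add: Domain_iff)
    then obtain r where r: "\<And>n. (s n, r n) \<in> G"
      by metis
    have "dist (r m) (r n) = dist (s m) (s n)" for m n
      using iso[of "s m - s n" "r m - r n"] subspace_diff[OF G r[of m] r[of n]] by (simp add: dist_norm)
    then have "Cauchy r"
      using LIMSEQ_imp_Cauchy[OF s(2)] by (simp add: Cauchy_def)
    then obtain y where "r \<longlonglongrightarrow> y"
      using Cauchy_convergent_iff convergent_def by blast
    then have "(\<lambda>n. (s n, r n)) \<longlonglongrightarrow> (x, y)"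
      by (intro tendsto_Pair s(2))
    then have "(x, y) \<in> closure G"
      using r unfolding closure_sequential by (intro exI[of _ "\<lambda>n. (s n, r n)"]) simp
    then show ?thesis ..
  qed
  then obtain U where U: "\<And>x. (x, U x) \<in> closure G"
    by metis
  show ?thesis
  proof
    show "linear U"
    proof (rule linearI)
      show "U (x + y) = U x + U y" for x y
        using subspace_add[OF sub U[of x] U[of y]] by (intro uniq[OF U]) simp
      show "U (a *\<^sub>R x) = a *\<^sub>R U x" for a x
        using subspace_scale[OF sub U[of x], of a] by (intro uniq[OF U]) simp
    qed
    show "norm (U x) = norm x" for x
      by (rule iso'[OF U])
    show "U x = y" if "(x, y) \<in> G" for x y
      using that closure_subset by (intro uniq[OF U]) blast
  qed
qed

lemma hat_add:
  assumes "test_function \<phi>" "test_function \<psi>"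
  shows "hat (\<lambda>t. \<phi> t + \<psi> t) = (\<lambda>x. hat \<phi> x + hat \<psi> x)"
proof -
  obtain L where L: "supported L \<phi>"
    using test_function_supported[OF assms(1)] .
  obtain L' where L': "supported L' \<psi>"
    using test_function_supported[OF assms(2)] .
  have "laplace (\<lambda>t. \<phi> t + \<psi> t) \<zeta> = laplace \<phi> \<zeta> + laplace \<psi> \<zeta>" for \<zeta>
    using has_integral_add[OF has_integral_laplace(1)[OF L] has_integral_laplace(1)[OF L'], of \<zeta> \<zeta>]
    unfolding laplace_def by (simp add: scaleC_add_right integral_unique)
  then show ?thesis
    by (simp add: hat_def[abs_def] scaleR_add_right)
qed

lemma hat_bounded_linear:
  fixes T :: "'a::complex_hilbert \<Rightarrow>\<^sub>L 'b::complex_hilbert"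
  assumes "complex_linear T" "test_function \<phi>"
  shows "hat (\<lambda>t. T (\<phi> t)) = (\<lambda>x. T (hat \<phi> x))"
proof -
  obtain L where L: "supported L \<phi>"
    using test_function_supported[OF assms(2)] .
  show ?thesis
    by (simp add: hat_def[abs_def] laplace_bounded_linear[OF assms(1) L] blinfun.scaleR_right)
qed

lemma complex_linear_scaleC_id: "complex_linear (c *\<^sub>C id_blinfun :: 'a::complex_hilbert \<Rightarrow>\<^sub>L 'a)"
  by (simp add: complex_linear_def scaleC_blinfun.rep_eq scaleC_scaleC mult.commute)

lemma hat_scaleC: "test_function \<phi> \<Longrightarrow> hat (\<lambda>t. c *\<^sub>C \<phi> t) = (\<lambda>x. c *\<^sub>C hat \<phi> x)"
  using hat_bounded_linear[OF complex_linear_scaleC_id, of \<phi> c] by (simp add: scaleC_blinfun.rep_eq)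

lemma fourier_op_exists:
  "\<exists>U :: 'a::complex_hilbert L2 \<Rightarrow> 'a L2. linear U \<and> (\<forall>x. norm (U x) = norm x) \<and>
    (\<forall>\<phi>. test_function \<phi> \<longrightarrow> U (abs_L2 \<phi>) = abs_L2 (hat \<phi>))"
proof -
  define G where "G = {(abs_L2 \<phi> :: 'a L2, abs_L2 (hat \<phi>)) | \<phi>. test_function \<phi>}"
  have "subspace G"
    unfolding subspace_def
  proof (intro conjI ballI allI)
    have "hat (\<lambda>t. 0 :: 'a) = (\<lambda>t. 0)"
      by (simp add: hat_def[abs_def] laplace_def)
    moreover have "test_function (\<lambda>t. 0 :: 'a)"
      using smooth_const[of 0] by (auto simp: test_function_iff)
    ultimately show "0 \<in> G"
      unfolding G_def zero_prod_def zero_L2_def by (intro CollectI exI[of _ "\<lambda>t. 0"]) simp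
  next
    fix p q assume "p \<in> G" "q \<in> G"
    then obtain \<phi> \<psi> where "test_function \<phi>" "p = (abs_L2 \<phi>, abs_L2 (hat \<phi>))"
      "test_function \<psi>" "q = (abs_L2 \<psi>, abs_L2 (hat \<psi>))"
      by (auto simp: G_def)
    then show "p + q \<in> G"
      unfolding G_def
      by (intro CollectI exI[of _ "\<lambda>t. \<phi> t + \<psi> t"])
        (simp add: test_function_add abs_L2_add test_function_wspace_0 hat_wspace_0 hat_add)
  next
    fix a p assume "p \<in> G"
    then obtain \<phi> where "test_function \<phi>" "p = (abs_L2 \<phi>, abs_L2 (hat \<phi>))"
      by (auto simp: G_def)
    then show "a *\<^sub>R p \<in> G"
      unfolding G_def
      by (intro CollectI exI[of _ "\<lambda>t. of_real a *\<^sub>C \<phi> t"])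
        (simp only: hat_scaleC, simp add: abs_L2_scaleR test_function_wspace_0 hat_wspace_0
          scaleC_of_real test_function_bounded_linear[OF bounded_linear_scaleR_right])
  qed
  moreover have "norm y = norm x" if "(x, y) \<in> G" for x y
    using that norm_abs_L2_hat by (auto simp: G_def)
  moreover have "closure (Domain G) = UNIV"
  proof -
    have "bump_span UNIV \<subseteq> Domain G"
      unfolding bump_span_def
    proof (rule span_minimal)
      show "{abs_L2 (\<lambda>t. bump (Suc n) p q t *\<^sub>R v) | n p q v. {p..q} \<subseteq> UNIV} \<subseteq> Domain G"
        by (auto simp: G_def Domain_iff intro!: test_function_scaleR_const test_function_bump)
      show "subspace (Domain G)"
        using linear_subspace_image[OF linear_fst \<open>subspace G\<close>] by (simp add: Domain_fst)
    qed
    then show ?thesis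
      using closure_mono closure_bump_span_UNIV by blast
  qed
  ultimately obtain U where "linear U" "\<And>x. norm (U x) = norm x" "\<And>x y. (x, y) \<in> G \<Longrightarrow> U x = y"
    using isometric_extension[of G] by blast
  then show ?thesis
    by (intro exI[of _ U]) (auto simp: G_def)
qed

text \<open>The choice is harmless: bounded linear maps that agree on test functions are equal, by
  density.\<close>

definition fourier_op :: "'a::complex_hilbert L2 \<Rightarrow> 'a L2"
  where "fourier_op = (SOME U. linear U \<and> (\<forall>x. norm (U x) = norm x) \<and>
    (\<forall>\<phi>. test_function \<phi> \<longrightarrow> U (abs_L2 \<phi>) = abs_L2 (hat \<phi>)))"

lemma linear_fourier_op: "linear fourier_op"
  and norm_fourier_op [simp]: "norm (fourier_op x) = norm x"
  and fourier_op_test_function: "test_function \<phi> \<Longrightarrow> fourier_op (abs_L2 \<phi>) = abs_L2 (hat \<phi>)"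
  using someI_ex[OF fourier_op_exists] unfolding fourier_op_def[symmetric] by blast+

lemma bounded_linear_fourier_op: "bounded_linear fourier_op"
  by (rule bounded_linear_intro[where K = 1])
    (simp_all add: linear_add[OF linear_fourier_op] linear_scale[OF linear_fourier_op])

lemma continuous_on_fourier_op: "continuous_on S fourier_op"
  by (rule linear_continuous_on[OF bounded_linear_fourier_op])

lemma subspace_Collect_linear_eq:
  assumes "linear f" "linear g"
  shows "subspace {x. f x = g x}"
  using assms by (simp add: subspace_def linear_0 linear_add linear_scale)

lemma L2_linear_eqI:
  fixes f g :: "'a::complex_hilbert L2 \<Rightarrow> 'b::real_normed_vector"
  assumes f: "bounded_linear f" and g: "bounded_linear g"
    and test: "\<And>\<phi>. test_function \<phi> \<Longrightarrow> f (abs_L2 \<phi>) = g (abs_L2 \<phi>)"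
  shows "f x = g x"
proof (rule L2_test_function_induct[where P = "\<lambda>x. f x = g x"])
  show "subspace {x. f x = g x}"
    by (intro subspace_Collect_linear_eq bounded_linear.linear f g)
  show "closed {x. f x = g x}"
    by (intro closed_Collect_eq linear_continuous_on f g)
qed (rule test)

lemma fourier_op_scaleC: "fourier_op (c *\<^sub>C x) = c *\<^sub>C fourier_op (x :: 'a::complex_hilbert L2)"
proof (rule L2_linear_eqI[where f = "\<lambda>x. fourier_op (c *\<^sub>C x)" and g = "\<lambda>x. c *\<^sub>C fourier_op x"])
  show "bounded_linear (\<lambda>x. fourier_op (c *\<^sub>C x))"
    by (rule bounded_linear_compose[OF bounded_linear_fourier_op scaleC.bounded_linear_right])
  show "bounded_linear (\<lambda>x. c *\<^sub>C fourier_op x)"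
    by (rule bounded_linear_compose[OF scaleC.bounded_linear_right bounded_linear_fourier_op])
  fix \<phi> :: "real \<Rightarrow> 'a" assume \<phi>: "test_function \<phi>"
  have "test_function (\<lambda>t. c *\<^sub>C \<phi> t)"
    by (rule test_function_bounded_linear[OF scaleC.bounded_linear_right \<phi>])
  then show "fourier_op (c *\<^sub>C abs_L2 \<phi>) = c *\<^sub>C fourier_op (abs_L2 \<phi>)"
    using \<phi> by (simp add: abs_L2_scaleC test_function_wspace_0 fourier_op_test_function hat_wspace_0
        hat_scaleC)
qed

lemma cinner_fourier_op [simp]: "cinner (fourier_op x) (fourier_op y) = cinner x y"
  by (rule complex_isometry_cinner) (simp_all add: linear_fourier_op fourier_op_scaleC)

lemma norm_abs_L2_reflect:
  fixes \<psi> :: "real \<Rightarrow> 'a::complex_hilbert"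
  assumes \<psi>: "test_function \<psi>"
  shows "norm (abs_L2 (\<lambda>t. \<psi> (- t))) = norm (abs_L2 \<psi>)"
proof -
  have leb: "(\<integral>t. (norm (\<psi> t))\<^sup>2 \<partial>lebesgue) = (\<integral>t. (norm (\<psi> t))\<^sup>2 \<partial>lborel)"
    if "test_function \<psi>" for \<psi> :: "real \<Rightarrow> 'a"
    using that
    by (intro integral_completion)
      (simp, intro borel_measurable_continuous_onI continuous_intros smooth_continuous_on
        test_function_imp_smooth)
  have "(\<integral>t. (norm (\<psi> t))\<^sup>2 \<partial>lborel) = (\<integral>t. (norm (\<psi> (- t)))\<^sup>2 \<partial>lborel)"
    by (subst lborel_integral_real_affine[where c = "-1" and t = 0]) simp_all
  then show ?thesis
    by (simp add: norm_abs_L2 test_function_wspace_0 test_function_reflect \<psi> leb)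
qed

text \<open>The range is closed, being an isometric image of a complete space, so test functions
  suffice. The candidate preimage \<open>u\<close> of \<open>\<psi>\<close> is the transform of the
  reflected \<open>\<psi>\<close>, as the multiplication formula suggests.\<close>

lemma surj_fourier_op: "surj (fourier_op :: 'a::complex_hilbert L2 \<Rightarrow> 'a L2)"
proof -
  have "y \<in> range fourier_op" for y :: "'a L2"
  proof (rule L2_test_function_induct[where P = "\<lambda>y. y \<in> range fourier_op"])
    have "subspace (range fourier_op)"
      by (intro linear_subspace_image linear_fourier_op subspace_UNIV)
    then show "subspace {y. y \<in> range fourier_op}"
      by simp
    have "closed (range fourier_op)"
      by (rule complete_imp_closed[OF complete_isometric_image[of 1 UNIV]])
        (simp_all add: bounded_linear_fourier_op complete_UNIV)
    then show "closed {y. y \<in> range fourier_op}"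
      by simp
  next
    fix \<psi> :: "real \<Rightarrow> 'a" assume \<psi>: "test_function \<psi>"
    define u where "u = fourier_op (abs_L2 (\<lambda>t. \<psi> (- t)))"
    have adj: "cinner (fourier_op x) (abs_L2 \<psi>) = cinner x u" for x
    proof -
      have "cinner (abs_L2 \<psi>) (fourier_op x) = cinner u x"
      proof (rule L2_linear_eqI[where f = "\<lambda>x. cinner (abs_L2 \<psi>) (fourier_op x)" and g = "cinner u"])
        show "bounded_linear (\<lambda>x. cinner (abs_L2 \<psi>) (fourier_op x))"
          by (rule bounded_linear_compose[OF cinner.bounded_linear_right bounded_linear_fourier_op])
        show "bounded_linear (cinner u)"
          by (rule cinner.bounded_linear_right)
        fix \<phi> :: "real \<Rightarrow> 'a" assume "test_function \<phi>"
        then have "cinner (fourier_op (abs_L2 \<phi>)) (abs_L2 \<psi>) = cinner (abs_L2 \<phi>) u"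
          using \<psi> by (simp add: u_def fourier_op_test_function test_function_reflect cinner_hat)
        then show "cinner (abs_L2 \<psi>) (fourier_op (abs_L2 \<phi>)) = cinner u (abs_L2 \<phi>)"
          by (metis cinner_commute)
      qed
      then show ?thesis
        by (metis cinner_commute)
    qed
    have nu: "norm u = norm (abs_L2 \<psi>)"
      by (simp add: u_def norm_abs_L2_reflect \<psi>)
    \<comment> \<open>The first and the last term are both \<open>(norm u)\<^sup>2\<close> and the
      inner product is \<open>(norm u)\<^sup>2\<close> too, so the expanded square is zero.\<close>
    have "(norm (fourier_op u - abs_L2 \<psi>))\<^sup>2
        = (norm (fourier_op u))\<^sup>2 - 2 * (fourier_op u \<bullet> abs_L2 \<psi>) + (norm (abs_L2 \<psi>))\<^sup>2"
      using dot_norm_neg[of "fourier_op u" "abs_L2 \<psi>"] by simp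
    also have "fourier_op u \<bullet> abs_L2 \<psi> = (norm u)\<^sup>2"
      using adj[of u] by (simp add: cinner_self flip: Re_cinner)
    finally have "fourier_op u = abs_L2 \<psi>"
      by (simp add: nu)
    then show "abs_L2 \<psi> \<in> range fourier_op"
      by (metis rangeI)
  qed
  then show ?thesis
    by blast
qed

lemma bij_fourier_op: "bij fourier_op"
proof (rule bijI[OF _ surj_fourier_op])
  show "inj fourier_op"
    unfolding linear_injective_0[OF linear_fourier_op] by (metis norm_fourier_op norm_eq_zero)
qed

abbreviation "inv_fourier_op \<equiv> inv fourier_op"

lemma fourier_op_inv [simp]: "fourier_op (inv_fourier_op y) = y" "inv_fourier_op (fourier_op x) = x"
  by (rule surj_f_inv_f[OF surj_fourier_op], rule inv_f_f[OF bij_is_inj[OF bij_fourier_op]])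

lemma fourier_op_eq_iff [simp]: "fourier_op x = fourier_op y \<longleftrightarrow> x = y"
  by (metis fourier_op_inv(2))

lemma norm_inv_fourier_op [simp]: "norm (inv_fourier_op y) = norm y"
  by (metis fourier_op_inv(1) norm_fourier_op)

lemma bounded_linear_inv_fourier_op: "bounded_linear inv_fourier_op"
proof (rule bounded_linear_intro[where K = 1])
  show "inv_fourier_op (x + y) = inv_fourier_op x + inv_fourier_op y" for x y
    by (rule fourier_op_eq_iff[THEN iffD1]) (simp add: linear_add[OF linear_fourier_op])
  show "inv_fourier_op (a *\<^sub>R x) = a *\<^sub>R inv_fourier_op x" for a x
    by (rule fourier_op_eq_iff[THEN iffD1]) (simp add: linear_scale[OF linear_fourier_op])
qed simp

subsection \<open>Multiplication operators\<close>

text \<open>Measurability is meant in operator norm; the symbols used below are continuous functions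
  or their truncations, so this strong form is available.\<close>

definition bounded_symbol :: "(real \<Rightarrow> 'a::complex_hilbert \<Rightarrow>\<^sub>L 'b::complex_hilbert) \<Rightarrow> bool"
  where "bounded_symbol N \<longleftrightarrow> strongly_measurable N \<and> (\<exists>C. \<forall>x. norm (N x) \<le> C)"

definition mult_L2 :: "(real \<Rightarrow> 'a::complex_hilbert \<Rightarrow>\<^sub>L 'b::complex_hilbert) \<Rightarrow> 'a L2 \<Rightarrow> 'b L2"
  where "mult_L2 N x = abs_L2 (\<lambda>t. N t (rep_L2 x t))"

lemma bounded_symbol_const: "bounded_symbol (\<lambda>t. T)"
  by (auto simp: bounded_symbol_def)

lemma strongly_measurable_blinfun_apply:
  fixes N :: "real \<Rightarrow> 'a::real_normed_vector \<Rightarrow>\<^sub>L 'b::real_normed_vector"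
  assumes "strongly_measurable N" "strongly_measurable f"
  shows "strongly_measurable (\<lambda>t. N t (f t))"
  by (rule strongly_measurable_bilinear[OF bounded_bilinear_blinfun_apply assms])

lemma bounded_symbol_wspace_0:
  assumes N: "bounded_symbol N" and f: "f \<in> wspace 0"
  shows "(\<lambda>t. N t (f t)) \<in> wspace 0"
proof -
  obtain C where C: "\<And>x. norm (N x) \<le> C"
    using N by (auto simp: bounded_symbol_def)
  have "norm (N t (f t)) \<le> C * norm (f t)" for t
    by (meson C norm_blinfun mult_right_mono norm_ge_zero order_trans)
  then show ?thesis
    using N f by (intro wspace_0_dominated[OF _ f, where C = C] strongly_measurable_blinfun_apply)
      (auto simp: wspace_0 bounded_symbol_def)
qed

lemma mult_L2_abs_L2:
  assumes N: "bounded_symbol N" and f: "f \<in> wspace 0"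
  shows "mult_L2 N (abs_L2 f) = abs_L2 (\<lambda>t. N t (f t))"
  unfolding mult_L2_def
proof (subst abs_L2_eq_iff)
  show "AE t in lebesgue. N t (rep_L2 (abs_L2 f) t) = N t (f t)"
    using rep_abs_L2[OF f] by eventually_elim simp
qed (intro bounded_symbol_wspace_0 N f rep_L2_wspace)+

lemma rep_mult_L2:
  assumes N: "bounded_symbol N"
  shows "AE t in lebesgue. rep_L2 (mult_L2 N x) t = N t (rep_L2 x t)"
  unfolding mult_L2_def by (intro rep_abs_L2 bounded_symbol_wspace_0 N rep_L2_wspace)

lemma bounded_linear_mult_L2:
  assumes N: "bounded_symbol N"
  shows "bounded_linear (mult_L2 N)"
proof -
  obtain C where C: "\<And>x. norm (N x) \<le> C"
    using N by (auto simp: bounded_symbol_def)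
  have C0: "0 \<le> C"
    using C norm_ge_zero order_trans by blast
  note W = rep_L2_wspace bounded_symbol_wspace_0[OF N]
  show ?thesis
  proof (rule bounded_linear_intro)
    fix x y
    have "mult_L2 N (abs_L2 (rep_L2 x) + abs_L2 (rep_L2 y))
        = mult_L2 N (abs_L2 (rep_L2 x)) + mult_L2 N (abs_L2 (rep_L2 y))"
      by (simp only: abs_L2_add mult_L2_abs_L2 N W wspace_0_add blinfun.add_right)
    then show "mult_L2 N (x + y) = mult_L2 N x + mult_L2 N y"
      by simp
  next
    fix a x
    have "mult_L2 N (a *\<^sub>R abs_L2 (rep_L2 x)) = a *\<^sub>R mult_L2 N (abs_L2 (rep_L2 x))"
      by (simp only: abs_L2_scaleR mult_L2_abs_L2 N W wspace_0_scaleR blinfun.scaleR_right)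
    then show "mult_L2 N (a *\<^sub>R x) = a *\<^sub>R mult_L2 N x"
      by simp
  next
    fix x
    have NW: "(\<lambda>t. N t (rep_L2 x t)) \<in> wspace 0"
      by (rule W(2)[OF W(1)])
    have le: "norm (N t (rep_L2 x t)) \<le> C * norm (rep_L2 x t)" for t
      by (meson C norm_blinfun mult_right_mono norm_ge_zero order_trans)
    have "(norm (mult_L2 N x))\<^sup>2 = (\<integral>t. (norm (N t (rep_L2 x t)))\<^sup>2 \<partial>lebesgue)"
      by (simp add: mult_L2_def norm_abs_L2_sq[OF NW])
    also have "\<dots> \<le> (\<integral>t. C\<^sup>2 * (norm (rep_L2 x t))\<^sup>2 \<partial>lebesgue)"
    proof (rule integral_mono)
      show "(norm (N t (rep_L2 x t)))\<^sup>2 \<le> C\<^sup>2 * (norm (rep_L2 x t))\<^sup>2" for t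
        using power_mono[OF le[of t] norm_ge_zero, of 2] by (simp only: power_mult_distrib)
    qed (use NW W(1)[of x] in \<open>simp_all add: wspace_0\<close>)
    also have "\<dots> = (C * norm (abs_L2 (rep_L2 x)))\<^sup>2"
      by (simp only: power_mult_distrib norm_abs_L2_sq[OF W(1)] integral_mult_right_zero)
    finally have "(norm (mult_L2 N x))\<^sup>2 \<le> (C * norm x)\<^sup>2"
      by simp
    then show "norm (mult_L2 N x) \<le> norm x * C"
      using C0 by (simp add: power2_le_iff_abs_le mult.commute)
  qed
qed

text \<open>A constant operator can be pulled out of the Fourier integral because it is bounded and,
  being complex linear, commutes with the exponentials.\<close>

lemma fourier_op_mult_const:
  fixes T :: "'a::complex_hilbert \<Rightarrow>\<^sub>L 'b::complex_hilbert"
  assumes T: "complex_linear T"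
  shows "fourier_op (mult_L2 (\<lambda>t. T) x) = mult_L2 (\<lambda>t. T) (fourier_op x)"
proof (rule L2_linear_eqI[where f = "\<lambda>x. fourier_op (mult_L2 (\<lambda>t. T) x)"
      and g = "\<lambda>x. mult_L2 (\<lambda>t. T) (fourier_op x)"])
  note bl = bounded_linear_mult_L2[OF bounded_symbol_const[of T]]
  show "bounded_linear (\<lambda>x. fourier_op (mult_L2 (\<lambda>t. T) x))"
    by (rule bounded_linear_compose[OF bounded_linear_fourier_op bl])
  show "bounded_linear (\<lambda>x. mult_L2 (\<lambda>t. T) (fourier_op x))"
    by (rule bounded_linear_compose[OF bl bounded_linear_fourier_op])
  fix \<phi> :: "real \<Rightarrow> 'a" assume \<phi>: "test_function \<phi>"
  have "test_function (\<lambda>t. T (\<phi> t))"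
    by (rule test_function_bounded_linear[OF blinfun.bounded_linear_right \<phi>])
  then show "fourier_op (mult_L2 (\<lambda>t. T) (abs_L2 \<phi>)) = mult_L2 (\<lambda>t. T) (fourier_op (abs_L2 \<phi>))"
    using \<phi> by (simp add: mult_L2_abs_L2 bounded_symbol_const test_function_wspace_0
        fourier_op_test_function hat_wspace_0 hat_bounded_linear[OF T])
qed

text \<open>Pointwise membership in the range of a projection becomes one operator equation in
  \<open>L2\<close>, which the Fourier transform can transport.\<close>

lemma AE_mem_iff_mult_L2:
  fixes P :: "'a::complex_hilbert \<Rightarrow>\<^sub>L 'a"
  assumes "\<And>x. P x \<in> A" "\<And>x. x \<in> A \<Longrightarrow> P x = x"
  shows "(AE t in lebesgue. rep_L2 z t \<in> A) \<longleftrightarrow> mult_L2 (\<lambda>t. P) z = z"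
proof -
  have *: "AE t in lebesgue. rep_L2 (mult_L2 (\<lambda>t. P) z) t = P (rep_L2 z t)"
    by (rule rep_mult_L2[OF bounded_symbol_const])
  show ?thesis
    unfolding L2_eq_iff
  proof
    assume "AE t in lebesgue. rep_L2 z t \<in> A"
    then show "AE t in lebesgue. rep_L2 (mult_L2 (\<lambda>t. P) z) t = rep_L2 z t"
      using * by eventually_elim (simp add: assms(2))
  next
    assume "AE t in lebesgue. rep_L2 (mult_L2 (\<lambda>t. P) z) t = rep_L2 z t"
    then show "AE t in lebesgue. rep_L2 z t \<in> A"
      using * by eventually_elim (metis assms(1))
  qed
qed

text \<open>The Fourier transform commutes with the pointwise orthogonal projection onto \<open>A\<close>, hence
  with the pointwise extension of the relation \<open>A\<close>.\<close>

lemma AE_mem_fourier_op_iff: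
  fixes A :: "('a::complex_hilbert \<times> 'b::complex_hilbert) set"
  assumes A: "subspace A" "closed A" "\<And>c p. p \<in> A \<Longrightarrow> c *\<^sub>C p \<in> A"
  shows "(AE t in lebesgue. (rep_L2 (fourier_op x) t, rep_L2 (fourier_op y) t) \<in> A) \<longleftrightarrow>
    (AE t in lebesgue. (rep_L2 x t, rep_L2 y t) \<in> A)"
proof -
  obtain P :: "('a \<times> 'b) \<Rightarrow>\<^sub>L ('a \<times> 'b)" where P: "complex_linear P" "\<And>z. P z \<in> A" "\<And>z. z \<in> A \<Longrightarrow> P z = z"
    using orthogonal_projection_op[OF A] by metis
  \<comment> \<open>The pair is regarded as one element of \<open>L2\<close> over the product space;
    its components come back through the constant multipliers \<open>fst\<close> and
    \<open>snd\<close>, which commute with the Fourier transform.\<close>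
  define z where "z = abs_L2 (\<lambda>t. (rep_L2 x t, rep_L2 y t))"
  have W: "(\<lambda>t. (rep_L2 x t, rep_L2 y t)) \<in> wspace 0"
    using rep_L2_wspace[of x] rep_L2_wspace[of y]
    by (simp add: wspace_0 strongly_measurable_Pair norm_Pair)
  have fs: "blinfun_apply (Blinfun fst) = (fst :: 'a \<times> 'b \<Rightarrow> 'a)"
    "blinfun_apply (Blinfun snd) = (snd :: 'a \<times> 'b \<Rightarrow> 'b)"
    by (simp_all add: bounded_linear_Blinfun_apply bounded_linear_fst bounded_linear_snd)
  have lin: "complex_linear (Blinfun fst :: ('a \<times> 'b) \<Rightarrow>\<^sub>L 'a)" "complex_linear (Blinfun snd :: ('a \<times> 'b) \<Rightarrow>\<^sub>L 'b)"
    by (simp_all add: complex_linear_def fs scaleC_prod_def)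
  have x: "mult_L2 (\<lambda>t. Blinfun fst) z = x" and y: "mult_L2 (\<lambda>t. Blinfun snd) z = y"
    by (simp_all add: z_def mult_L2_abs_L2[OF bounded_symbol_const W] fs)
  have "AE t in lebesgue. rep_L2 (mult_L2 (\<lambda>t. Blinfun fst :: ('a \<times> 'b) \<Rightarrow>\<^sub>L 'a) (fourier_op z)) t
      = (Blinfun fst :: ('a \<times> 'b) \<Rightarrow>\<^sub>L 'a) (rep_L2 (fourier_op z) t)"
    by (rule rep_mult_L2[OF bounded_symbol_const])
  moreover have "AE t in lebesgue. rep_L2 (mult_L2 (\<lambda>t. Blinfun snd :: ('a \<times> 'b) \<Rightarrow>\<^sub>L 'b) (fourier_op z)) t
      = (Blinfun snd :: ('a \<times> 'b) \<Rightarrow>\<^sub>L 'b) (rep_L2 (fourier_op z) t)"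
    by (rule rep_mult_L2[OF bounded_symbol_const])
  ultimately have hat: "AE t in lebesgue. (rep_L2 (fourier_op x) t, rep_L2 (fourier_op y) t) = rep_L2 (fourier_op z) t"
    by eventually_elim (simp add: fs prod_eq_iff x y flip: fourier_op_mult_const[OF lin(1)] fourier_op_mult_const[OF lin(2)])
  have "(AE t in lebesgue. (rep_L2 (fourier_op x) t, rep_L2 (fourier_op y) t) \<in> A) \<longleftrightarrow>
      (AE t in lebesgue. rep_L2 (fourier_op z) t \<in> A)"
    using hat by (intro eventually_cong) auto
  also have "\<dots> \<longleftrightarrow> mult_L2 (\<lambda>t. P) (fourier_op z) = fourier_op z"
    by (rule AE_mem_iff_mult_L2) (use P in auto)
  also have "\<dots> \<longleftrightarrow> mult_L2 (\<lambda>t. P) z = z"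
    by (simp flip: fourier_op_mult_const[OF P(1)])
  also have "\<dots> \<longleftrightarrow> (AE t in lebesgue. rep_L2 z t \<in> A)"
    by (rule AE_mem_iff_mult_L2[symmetric]) (use P in auto)
  also have "\<dots> \<longleftrightarrow> (AE t in lebesgue. (rep_L2 x t, rep_L2 y t) \<in> A)"
    using rep_abs_L2[OF W] by (intro eventually_cong) (auto simp: z_def)
  finally show ?thesis .
qed

lemma eq_inv_fourier_op_iff: "x = inv_fourier_op y \<longleftrightarrow> fourier_op x = y"
  by auto

section \<open>Operators in the weighted spaces\<close>

text \<open>The unitary map \<open>exp (- \<nu> m)\<close> followed by the passage to classes;
  \<open>unweighted\<close> selects a representative of the preimage.\<close>

definition weighted :: "real \<Rightarrow> (real \<Rightarrow> 'a::complex_hilbert) \<Rightarrow> 'a L2"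
  where "weighted \<nu> f = abs_L2 (\<lambda>t. exp (- \<nu> * t) *\<^sub>R f t)"

definition unweighted :: "real \<Rightarrow> 'a::complex_hilbert L2 \<Rightarrow> real \<Rightarrow> 'a"
  where "unweighted \<nu> x = (\<lambda>t. exp (\<nu> * t) *\<^sub>R rep_L2 x t)"

lemma unweighted_wspace: "unweighted \<nu> x \<in> wspace \<nu>"
  using rep_L2_wspace[of x]
  by (simp add: wspace_iff_wspace_0[of _ \<nu>] unweighted_def flip: exp_add)

lemma weighted_unweighted [simp]: "weighted \<nu> (unweighted \<nu> x) = x"
  by (simp add: weighted_def unweighted_def flip: exp_add)

lemma rep_weighted:
  "f \<in> wspace \<nu> \<Longrightarrow> AE t in lebesgue. rep_L2 (weighted \<nu> f) t = exp (- \<nu> * t) *\<^sub>R f t"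
  unfolding weighted_def wspace_iff_wspace_0[of _ \<nu>] by (rule rep_abs_L2)

lemma weighted_eq_iff:
  assumes "f \<in> wspace \<nu>" "g \<in> wspace \<nu>"
  shows "weighted \<nu> f = weighted \<nu> g \<longleftrightarrow> (AE t in lebesgue. f t = g t)"
  using assms unfolding weighted_def wspace_iff_wspace_0[of _ \<nu>] by (simp add: abs_L2_eq_iff)

lemma weighted_0 [simp]: "weighted 0 f = abs_L2 f"
  by (simp add: weighted_def)

lemma wspace_add: "f \<in> wspace \<nu> \<Longrightarrow> g \<in> wspace \<nu> \<Longrightarrow> (\<lambda>t. f t + g t) \<in> wspace \<nu>"
  using wspace_0_add by (fastforce simp: wspace_iff_wspace_0[of _ \<nu>] scaleR_add_right)

lemma wspace_diff: "f \<in> wspace \<nu> \<Longrightarrow> g \<in> wspace \<nu> \<Longrightarrow> (\<lambda>t. f t - g t) \<in> wspace \<nu>"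
  using wspace_0_diff by (fastforce simp: wspace_iff_wspace_0[of _ \<nu>] scaleR_diff_right)

lemma weighted_add:
  "f \<in> wspace \<nu> \<Longrightarrow> g \<in> wspace \<nu> \<Longrightarrow> weighted \<nu> (\<lambda>t. f t + g t) = weighted \<nu> f + weighted \<nu> g"
  by (simp add: weighted_def wspace_iff_wspace_0[of _ \<nu>] abs_L2_add scaleR_add_right)

lemma weighted_diff:
  "f \<in> wspace \<nu> \<Longrightarrow> g \<in> wspace \<nu> \<Longrightarrow> weighted \<nu> (\<lambda>t. f t - g t) = weighted \<nu> f - weighted \<nu> g"
  by (simp add: weighted_def wspace_iff_wspace_0[of _ \<nu>] abs_L2_diff scaleR_diff_right)

lemma wnorm_eq_norm_weighted:
  assumes "f \<in> wspace \<nu>"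
  shows "wnorm \<nu> f = norm (weighted \<nu> f)"
proof -
  have "(norm (exp (- \<nu> * t) *\<^sub>R f t))\<^sup>2 = (norm (f t))\<^sup>2 * exp (- 2 * \<nu> * t)" for t
    by (simp add: power_mult_distrib mult.commute mult.left_commute flip: exp_double)
  then show ?thesis
    using assms by (simp add: weighted_def wspace_iff_wspace_0[of _ \<nu>] norm_abs_L2 wnorm_def)
qed

lemma winner_eq_cinner_weighted:
  assumes "f \<in> wspace \<nu>" "g \<in> wspace \<nu>"
  shows "winner \<nu> f g = cinner (weighted \<nu> f) (weighted \<nu> g)"
proof -
  have "cinner (exp (- \<nu> * t) *\<^sub>R f t) (exp (- \<nu> * t) *\<^sub>R g t)
      = cinner (f t) (g t) * of_real (exp (- 2 * \<nu> * t))" for t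
  proof -
    have e: "complex_of_real (exp (- 2 * \<nu> * t)) = of_real (exp (- \<nu> * t)) * of_real (exp (- \<nu> * t))"
      by (simp only: of_real_mult[symmetric] exp_add[symmetric]) simp
    show ?thesis
      unfolding e cinner.scaleR_left cinner.scaleR_right scaleR_conv_of_real by (simp only: mult_ac)
  qed
  then show ?thesis
    using assms by (simp add: weighted_def wspace_iff_wspace_0[of _ \<nu>] cinner_abs_L2 winner_def)
qed

text \<open>Sequences converging in the weighted seminorm are traded for the topological closure of
  a graph in a product of \<open>L2\<close> spaces.\<close>

lemma wclosure_iff:
  "(f, g) \<in> wclosure \<nu> T \<longleftrightarrow> f \<in> wspace \<nu> \<and> g \<in> wspace \<nu> \<and>
    (weighted \<nu> f, weighted \<nu> g) \<in> closure {(weighted \<nu> p, weighted \<nu> q) | p q.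
      (p, q) \<in> T \<and> p \<in> wspace \<nu> \<and> q \<in> wspace \<nu>}" (is "_ \<longleftrightarrow> _ \<and> _ \<and> _ \<in> closure ?S")
proof (cases "f \<in> wspace \<nu> \<and> g \<in> wspace \<nu>")
  case True
  have lim: "(\<lambda>n. wnorm \<nu> (\<lambda>t. p n t - h t)) \<longlonglongrightarrow> 0 \<longleftrightarrow> (\<lambda>n. weighted \<nu> (p n)) \<longlonglongrightarrow> weighted \<nu> h"
    if "\<And>n. p n \<in> wspace \<nu>" "h \<in> wspace \<nu>" for p :: "nat \<Rightarrow> real \<Rightarrow> 'z::complex_hilbert" and h
    using that
    by (simp add: wnorm_eq_norm_weighted wspace_diff weighted_diff tendsto_norm_zero_iff LIM_zero_iff)
  show ?thesis
  proof
    assume "(f, g) \<in> wclosure \<nu> T"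
    then obtain p q where pq: "\<And>n. (p n, q n) \<in> T" "\<And>n. p n \<in> wspace \<nu>" "\<And>n. q n \<in> wspace \<nu>"
      "(\<lambda>n. wnorm \<nu> (\<lambda>t. p n t - f t)) \<longlonglongrightarrow> 0" "(\<lambda>n. wnorm \<nu> (\<lambda>t. q n t - g t)) \<longlonglongrightarrow> 0"
      unfolding wclosure_def by blast
    have "(\<lambda>n. (weighted \<nu> (p n), weighted \<nu> (q n))) \<longlonglongrightarrow> (weighted \<nu> f, weighted \<nu> g)"
      using pq True by (intro tendsto_Pair) (simp_all add: lim)
    moreover have "(weighted \<nu> (p n), weighted \<nu> (q n)) \<in> ?S" for n
      using pq by blast
    ultimately show "f \<in> wspace \<nu> \<and> g \<in> wspace \<nu> \<and> (weighted \<nu> f, weighted \<nu> g) \<in> closure ?S"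
      using True unfolding closure_sequential
      by (intro conjI exI[of _ "\<lambda>n. (weighted \<nu> (p n), weighted \<nu> (q n))"]) simp_all
  next
    assume "f \<in> wspace \<nu> \<and> g \<in> wspace \<nu> \<and> (weighted \<nu> f, weighted \<nu> g) \<in> closure ?S"
    then obtain s where s: "\<And>n. s n \<in> ?S" "s \<longlonglongrightarrow> (weighted \<nu> f, weighted \<nu> g)"
      unfolding closure_sequential by blast
    then have "\<forall>n. \<exists>p q. s n = (weighted \<nu> p, weighted \<nu> q) \<and> (p, q) \<in> T \<and> p \<in> wspace \<nu> \<and> q \<in> wspace \<nu>"
      by blast
    then obtain p q where pq: "\<And>n. s n = (weighted \<nu> (p n), weighted \<nu> (q n))" "\<And>n. (p n, q n) \<in> T"
      "\<And>n. p n \<in> wspace \<nu>" "\<And>n. q n \<in> wspace \<nu>"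
      by metis
    have "(\<lambda>n. wnorm \<nu> (\<lambda>t. p n t - f t)) \<longlonglongrightarrow> 0" "(\<lambda>n. wnorm \<nu> (\<lambda>t. q n t - g t)) \<longlonglongrightarrow> 0"
      using tendsto_fst[OF s(2)] tendsto_snd[OF s(2)] True pq by (simp_all add: lim)
    then show "(f, g) \<in> wclosure \<nu> T"
      using True pq unfolding wclosure_def by blast
  qed
next
  case False
  then show ?thesis
    by (auto simp: wclosure_def)
qed

text \<open>The common tool for the operators introduced through closures: the Fourier transform,
  the inverse of the time derivative and the solution operator each start as the restriction of a
  continuous map to a dense set.\<close>

lemma closure_restricted_graph:
  fixes B :: "'a::real_normed_vector \<Rightarrow> 'b::real_normed_vector"
  assumes B: "continuous_on UNIV B" and D: "closure D = UNIV" and S: "S = {(x, B x) | x. x \<in> D}"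
  shows "(x, y) \<in> closure S \<longleftrightarrow> y = B x"
proof
  have "closed {p. snd p = B (fst p)}"
    by (intro closed_Collect_eq continuous_intros continuous_on_compose2[OF B]) auto
  then have "closure S \<subseteq> {p. snd p = B (fst p)}"
    by (intro closure_minimal) (auto simp: S)
  then show "y = B x" if "(x, y) \<in> closure S"
    using that by auto
next
  assume y: "y = B x"
  have "x \<in> closure D"
    using D by simp
  then obtain s where s: "\<And>n. s n \<in> D" "s \<longlonglongrightarrow> x"
    unfolding closure_sequential by blast
  have "(\<lambda>n. (s n, B (s n))) \<longlonglongrightarrow> (x, B x)"
    by (intro tendsto_Pair s continuous_on_tendsto_compose[OF B]) auto
  then show "(x, y) \<in> closure S"
    using s(1) y unfolding closure_sequential S by (intro exI[of _ "\<lambda>n. (s n, B (s n))"]) auto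
qed

lemma closure_test_functions: "closure {weighted \<nu> \<phi> | \<phi>. test_function \<phi>} = UNIV"
proof -
  have "abs_L2 \<phi> \<in> {weighted \<nu> \<phi> | \<phi>. test_function \<phi>}" if "test_function \<phi>" for \<phi> :: "real \<Rightarrow> 'a"
    using test_function_exp[OF that, of \<nu>]
    by (intro CollectI exI[of _ "\<lambda>t. exp (\<nu> * t) *\<^sub>R \<phi> t"]) (simp add: weighted_def flip: exp_add)
  then have "closure {abs_L2 \<phi> | \<phi> :: real \<Rightarrow> 'a. test_function \<phi>} \<subseteq> closure {weighted \<nu> \<phi> | \<phi>. test_function \<phi>}"
    by (intro closure_mono) blast
  moreover have "x \<in> closure {abs_L2 \<phi> | \<phi> :: real \<Rightarrow> 'a. test_function \<phi>}" for x
  proof (rule L2_test_function_induct[where P = "\<lambda>x. x \<in> closure {abs_L2 \<phi> | \<phi>. test_function \<phi>}"])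
    have "subspace {abs_L2 \<phi> | \<phi> :: real \<Rightarrow> 'a. test_function \<phi>}"
      unfolding subspace_def
    proof (intro conjI ballI allI)
      have "test_function (\<lambda>t. 0 :: 'a)"
        using smooth_const[of 0] by (auto simp: test_function_iff)
      then show "0 \<in> {abs_L2 \<phi> | \<phi> :: real \<Rightarrow> 'a. test_function \<phi>}"
        unfolding zero_L2_def by fastforce
    next
      fix x y assume "x \<in> {abs_L2 \<phi> | \<phi> :: real \<Rightarrow> 'a. test_function \<phi>}" "y \<in> {abs_L2 \<phi> | \<phi> :: real \<Rightarrow> 'a. test_function \<phi>}"
      then obtain \<phi> \<psi> where "x = abs_L2 \<phi>" "test_function \<phi>" "y = abs_L2 \<psi>" "test_function \<psi>"
        by blast
      then show "x + y \<in> {abs_L2 \<phi> | \<phi> :: real \<Rightarrow> 'a. test_function \<phi>}"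
        by (intro CollectI exI[of _ "\<lambda>t. \<phi> t + \<psi> t"])
          (simp add: abs_L2_add test_function_add test_function_wspace_0)
    next
      fix a x assume "x \<in> {abs_L2 \<phi> | \<phi> :: real \<Rightarrow> 'a. test_function \<phi>}"
      then obtain \<phi> where "x = abs_L2 \<phi>" "test_function \<phi>"
        by blast
      then show "a *\<^sub>R x \<in> {abs_L2 \<phi> | \<phi> :: real \<Rightarrow> 'a. test_function \<phi>}"
        by (intro CollectI exI[of _ "\<lambda>t. a *\<^sub>R \<phi> t"])
          (simp add: abs_L2_scaleR test_function_bounded_linear[OF bounded_linear_scaleR_right] test_function_wspace_0)
    qed
    then show "subspace {x. x \<in> closure {abs_L2 \<phi> | \<phi> :: real \<Rightarrow> 'a. test_function \<phi>}}"
      using subspace_closure by simp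
    show "abs_L2 \<phi> \<in> closure {abs_L2 \<phi> | \<phi>. test_function \<phi>}" if "test_function \<phi>" for \<phi> :: "real \<Rightarrow> 'a"
      using closure_subset[of "{abs_L2 \<phi> | \<phi> :: real \<Rightarrow> 'a. test_function \<phi>}"] that by blast
  qed simp
  ultimately show ?thesis
    by blast
qed

section \<open>The Fourier-Laplace transform and the material law on classes of functions\<close>

lemma fourier_iff:
  "(f, g) \<in> fourier \<longleftrightarrow> f \<in> wspace 0 \<and> g \<in> wspace 0 \<and> abs_L2 g = fourier_op (abs_L2 f)"
proof -
  have hat: "(\<lambda>x. (1 / sqrt (2 * pi)) *\<^sub>R integral UNIV (\<lambda>t. cis (- (x * t)) *\<^sub>C \<phi> t)) = hat \<phi>"
    for \<phi> :: "real \<Rightarrow> 'a"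
    by (simp add: hat_def[abs_def] laplace_def cis_conv_exp mult.assoc)
  show ?thesis
    unfolding fourier_def hat wclosure_iff weighted_0
    by (subst closure_restricted_graph[OF continuous_on_fourier_op closure_test_functions[of 0]])
      (auto simp: fourier_op_test_function hat_wspace_0 test_function_wspace_0)
qed

lemma fourier_laplace_iff:
  "(f, g) \<in> fourier_laplace \<nu> \<longleftrightarrow>
    f \<in> wspace \<nu> \<and> g \<in> wspace 0 \<and> abs_L2 g = fourier_op (weighted \<nu> f)"
  by (auto simp: fourier_laplace_def fourier_iff wspace_iff_wspace_0[of f \<nu>] weighted_def)

text \<open>The adjoint of a unitary operator is its inverse. One direction tests against functions
  with arbitrary transform \<open>y\<close>, which exist because the Fourier transform is onto; the
  other is preservation of inner products.\<close>

lemma wadjoint_fourier_laplace_iff: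
  "(g, h) \<in> wadjoint \<nu> 0 (fourier_laplace \<nu>) \<longleftrightarrow>
    g \<in> wspace 0 \<and> h \<in> wspace \<nu> \<and> fourier_op (weighted \<nu> h) = abs_L2 g"
proof (cases "g \<in> wspace 0 \<and> h \<in> wspace \<nu>")
  case True
  have winner: "winner 0 v g = cinner (abs_L2 v) (abs_L2 g)" "winner \<nu> u h = cinner (weighted \<nu> u) (weighted \<nu> h)"
    if "(u, v) \<in> fourier_laplace \<nu>" for u v
    using that True by (auto simp: fourier_laplace_iff winner_eq_cinner_weighted)
  show ?thesis
  proof
    assume "(g, h) \<in> wadjoint \<nu> 0 (fourier_laplace \<nu>)"
    then have *: "winner 0 v g = winner \<nu> u h" if "(u, v) \<in> fourier_laplace \<nu>" for u v
      using that by (auto simp: wadjoint_def)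
    have "cinner y (abs_L2 g - fourier_op (weighted \<nu> h)) = 0" for y
    proof -
      define u where "u = unweighted \<nu> (inv_fourier_op y)"
      have uv: "(u, rep_L2 y) \<in> fourier_laplace \<nu>"
        by (simp add: fourier_laplace_iff u_def unweighted_wspace rep_L2_wspace)
      have "cinner y (abs_L2 g) = cinner (inv_fourier_op y) (weighted \<nu> h)"
        using *[OF uv] winner[OF uv] by (simp add: u_def)
      also have "\<dots> = cinner (fourier_op (inv_fourier_op y)) (fourier_op (weighted \<nu> h))"
        by (rule cinner_fourier_op[symmetric])
      finally show ?thesis
        by (simp add: cinner.diff_right)
    qed
    then have "abs_L2 g - fourier_op (weighted \<nu> h) = 0"
      by (metis cinner_self norm_eq_zero of_real_eq_0_iff power2_eq_iff_nonneg zero_eq_power2)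
    then show "g \<in> wspace 0 \<and> h \<in> wspace \<nu> \<and> fourier_op (weighted \<nu> h) = abs_L2 g"
      using True by simp
  next
    assume *: "g \<in> wspace 0 \<and> h \<in> wspace \<nu> \<and> fourier_op (weighted \<nu> h) = abs_L2 g"
    have "winner 0 v g = winner \<nu> u h" if "(u, v) \<in> fourier_laplace \<nu>" for u v
    proof -
      have "cinner (abs_L2 v) (abs_L2 g) = cinner (fourier_op (weighted \<nu> u)) (fourier_op (weighted \<nu> h))"
        using that * by (simp add: fourier_laplace_iff del: cinner_fourier_op)
      then show ?thesis
        using winner[OF that] by simp
    qed
    then show "(g, h) \<in> wadjoint \<nu> 0 (fourier_laplace \<nu>)"
      using True by (auto simp: wadjoint_def)
  qed
next
  case False
  then show ?thesis
    by (auto simp: wadjoint_def)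
qed

text \<open>Collapses the composition of three relations into one condition on the frequency side,
  so that it can be combined with the resolvent at almost every frequency.\<close>

lemma material_law_operator_iff:
  "(f, h) \<in> material_law_operator \<nu> M \<longleftrightarrow> f \<in> wspace \<nu> \<and> h \<in> wspace \<nu> \<and>
    (AE x in lebesgue. rep_L2 (fourier_op (weighted \<nu> h)) x =
      M (1 / (\<i> * of_real x + of_real \<nu>)) (rep_L2 (fourier_op (weighted \<nu> f)) x))"
  (is "_ \<longleftrightarrow> _ \<and> _ \<and> (AE x in lebesgue. ?h x = blinfun_apply (?M x) (?f x))")
proof
  assume "(f, h) \<in> material_law_operator \<nu> M"
  then obtain p q where pq: "(f, p) \<in> fourier_laplace \<nu>"
    "(p, q) \<in> multiplication_operator ?M" "(q, h) \<in> wadjoint \<nu> 0 (fourier_laplace \<nu>)"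
    by (auto simp: material_law_operator_def)
  then have "p \<in> wspace 0" "q \<in> wspace 0" and *: "AE x in lebesgue. q x = ?M x (p x)"
    by (auto simp: multiplication_operator_def)
  then have "AE x in lebesgue. ?f x = p x" "AE x in lebesgue. ?h x = q x"
    using rep_abs_L2[of p] rep_abs_L2[of q] pq(1,3)
    by (auto simp: fourier_laplace_iff wadjoint_fourier_laplace_iff)
  then have "AE x in lebesgue. ?h x = ?M x (?f x)"
    using * by eventually_elim simp
  then show "f \<in> wspace \<nu> \<and> h \<in> wspace \<nu> \<and> (AE x in lebesgue. ?h x = ?M x (?f x))"
    using pq(1,3) by (simp add: fourier_laplace_iff wadjoint_fourier_laplace_iff)
next
  assume *: "f \<in> wspace \<nu> \<and> h \<in> wspace \<nu> \<and> (AE x in lebesgue. ?h x = ?M x (?f x))"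
  then have "(f, ?f) \<in> fourier_laplace \<nu>" "(?f, ?h) \<in> multiplication_operator ?M"
    "(?h, h) \<in> wadjoint \<nu> 0 (fourier_laplace \<nu>)"
    by (auto simp: fourier_laplace_iff multiplication_operator_def wadjoint_fourier_laplace_iff rep_L2_wspace)
  then show "(f, h) \<in> material_law_operator \<nu> M"
    unfolding material_law_operator_def by blast
qed

subsection \<open>The time derivative\<close>

context
  fixes \<nu> :: real
  assumes \<nu>: "\<nu> > 0"
begin

lemma frequency_nonzero: "\<i> * of_real x + complex_of_real \<nu> \<noteq> 0"
  using \<nu> by (simp add: complex_eq_iff)

text \<open>The symbol of the inverse of the time derivative, bounded in norm by
  \<open>1 / \<nu>\<close>.\<close>

definition integration_symbol :: "real \<Rightarrow> 'a::complex_hilbert \<Rightarrow>\<^sub>L 'a"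
  where "integration_symbol x = inverse (\<i> * of_real x + of_real \<nu>) *\<^sub>C id_blinfun"

lemma integration_symbol_apply:
  "integration_symbol x v = inverse (\<i> * of_real x + of_real \<nu>) *\<^sub>C v"
  by (simp add: integration_symbol_def scaleC_blinfun.rep_eq)

lemma bounded_symbol_integration_symbol:
  "bounded_symbol (integration_symbol :: real \<Rightarrow> 'a::complex_hilbert \<Rightarrow>\<^sub>L 'a)"
  unfolding bounded_symbol_def
proof
  show "strongly_measurable (integration_symbol :: real \<Rightarrow> 'a \<Rightarrow>\<^sub>L 'a)"
    unfolding integration_symbol_def[abs_def]
    using frequency_nonzero
    by (intro strongly_measurable_continuous scaleC.continuous_on continuous_intros) auto
  have "norm (integration_symbol x :: 'a \<Rightarrow>\<^sub>L 'a) \<le> 1 / \<nu>" for x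
  proof -
    have "\<nu> \<le> cmod (\<i> * of_real x + of_real \<nu>)"
      using abs_Re_le_cmod[of "\<i> * of_real x + of_real \<nu>"] \<nu> by simp
    then have "inverse (cmod (\<i> * of_real x + of_real \<nu>)) \<le> 1 / \<nu>"
      using \<nu> by (simp add: divide_inverse le_imp_inverse_le)
    moreover have "norm (integration_symbol x :: 'a \<Rightarrow>\<^sub>L 'a) \<le> inverse (cmod (\<i> * of_real x + of_real \<nu>)) * 1"
      unfolding integration_symbol_def norm_scaleC norm_inverse
      by (intro mult_left_mono norm_blinfun_id_le) simp
    ultimately show ?thesis
      by simp
  qed
  then show "\<exists>C. \<forall>x. norm (integration_symbol x :: 'a \<Rightarrow>\<^sub>L 'a) \<le> C"
    by blast
qed

definition integration_op :: "'a::complex_hilbert L2 \<Rightarrow> 'a L2"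
  where "integration_op y = inv_fourier_op (mult_L2 integration_symbol (fourier_op y))"

lemma bounded_linear_integration_op: "bounded_linear integration_op"
  unfolding integration_op_def[abs_def]
  by (intro bounded_linear_compose[OF bounded_linear_inv_fourier_op]
      bounded_linear_compose[OF bounded_linear_mult_L2[OF bounded_symbol_integration_symbol]]
      bounded_linear_fourier_op)

text \<open>The weight \<open>exp (- \<nu> t)\<close> moves the transform from the imaginary axis to
  the line \<open>Re \<zeta> = \<nu>\<close>.\<close>

lemma fourier_op_weighted_test_function:
  assumes "test_function \<phi>"
  shows "AE x in lebesgue. rep_L2 (fourier_op (weighted \<nu> \<phi>)) x =
    (1 / sqrt (2 * pi)) *\<^sub>R laplace \<phi> (\<i> * of_real x + of_real \<nu>)"
proof -
  let ?\<psi> = "\<lambda>t. exp (- \<nu> * t) *\<^sub>R \<phi> t"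
  have \<psi>: "test_function ?\<psi>"
    by (rule test_function_exp[OF assms])
  have "exp (- (\<i> * of_real x * of_real t)) *\<^sub>C exp (- \<nu> * t) *\<^sub>R \<phi> t
      = exp (- ((\<i> * of_real x + of_real \<nu>) * of_real t)) *\<^sub>C \<phi> t" for x t
    by (simp add: scaleC_scaleC ring_distribs flip: scaleC_of_real exp_of_real exp_add)
  then have eq: "hat ?\<psi> x = (1 / sqrt (2 * pi)) *\<^sub>R laplace \<phi> (\<i> * of_real x + of_real \<nu>)" for x
    by (simp only: hat_def laplace_def)
  show ?thesis
    unfolding weighted_def fourier_op_test_function[OF \<psi>] eq[symmetric]
    by (rule rep_abs_L2[OF hat_wspace_0[OF \<psi>]])
qed

lemma integration_op_vderiv:
  assumes \<phi>: "test_function \<phi>"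
  shows "integration_op (weighted \<nu> (vderiv \<phi>)) = weighted \<nu> \<phi>"
proof -
  let ?F = "fourier_op (weighted \<nu> \<phi>)" and ?F' = "fourier_op (weighted \<nu> (vderiv \<phi>))"
  have "AE x in lebesgue. rep_L2 (mult_L2 integration_symbol ?F') x = rep_L2 ?F x"
    using rep_mult_L2[OF bounded_symbol_integration_symbol, of ?F'] fourier_op_weighted_test_function[OF \<phi>]
      fourier_op_weighted_test_function[OF test_function_vderiv[OF \<phi>]]
  proof eventually_elim
    case (elim x)
    then show ?case
      using frequency_nonzero[of x]
      by (simp add: integration_symbol_apply laplace_vderiv[OF \<phi>] scaleC_scaleR scaleC_scaleC)
  qed
  then have "mult_L2 integration_symbol ?F' = ?F"
    by (simp add: L2_eq_iff)
  then show ?thesis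
    by (simp add: integration_op_def)
qed

text \<open>A test function \<open>\<psi>\<close> is approximated by the derivatives \<open>\<psi> - \<psi>(\<cdot> - n)\<close>: the difference of
  an antiderivative of \<open>\<psi>\<close> and its translate has compact support, and the weight makes the
  translate of \<open>\<psi>\<close> small.\<close>

lemma closure_vderiv_test_functions:
  "closure {weighted \<nu> (vderiv \<phi>) | \<phi> :: real \<Rightarrow> 'a::complex_hilbert. test_function \<phi>} = UNIV"
proof -
  let ?D = "{weighted \<nu> (vderiv \<phi>) | \<phi> :: real \<Rightarrow> 'a. test_function \<phi>}"
  have "weighted \<nu> \<psi> \<in> closure ?D" if \<psi>: "test_function \<psi>" for \<psi> :: "real \<Rightarrow> 'a"
  proof -
    obtain L where L: "L > 0" "\<And>t. \<bar>t\<bar> > L \<Longrightarrow> \<psi> t = 0"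
      using test_function_support[OF \<psi>] by metis
    have cont: "continuous_on S \<psi>" for S
      by (rule smooth_continuous_on[OF test_function_imp_smooth[OF \<psi>]])
    define \<Psi> where "\<Psi> t = integral {- L - 1..t} \<psi>" for t
    have \<Psi>': "(\<Psi> has_vector_derivative \<psi> t) (at t)" for t
    proof -
      \<comment> \<open>\<open>t\<close> becomes interior to \<open>{a..b}\<close>, which makes the
        derivative there two-sided; \<open>a\<close> also lies left of the base point of
        \<open>\<Psi>\<close>, and the two antiderivatives agree because \<open>\<psi>\<close>
        vanishes left of \<open>- L\<close>.\<close>
      define b where "b = max t (- L - 1) + 1"
      define a where "a = min t (- L - 1) - 1"
      have "((\<lambda>t. integral {a..t} \<psi>) has_vector_derivative \<psi> t) (at t within {a..b})"
        by (rule integral_has_vector_derivative[OF cont]) (auto simp: a_def b_def)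
      then have deriv: "((\<lambda>t. integral {a..t} \<psi>) has_vector_derivative \<psi> t) (at t)"
        by (subst (asm) at_within_interior) (auto simp: a_def b_def)
      have eq: "integral {a..s} \<psi> = \<Psi> s" if "s \<in> {a<..<b}" for s
      proof (cases "s \<le> - L - 1")
        case True
        have "integral {a..s} \<psi> = integral {a..s} (\<lambda>t. 0)"
          using L True by (intro Henstock_Kurzweil_Integration.integral_cong) auto
        moreover have "\<Psi> s = integral {- L - 1..s} (\<lambda>t. 0)"
          unfolding \<Psi>_def using L True by (intro Henstock_Kurzweil_Integration.integral_cong) auto
        ultimately show ?thesis
          by simp
      next
        case False
        have "integral {a..- L - 1} \<psi> = integral {a..- L - 1} (\<lambda>t. 0)"
          using L by (intro Henstock_Kurzweil_Integration.integral_cong) auto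
        then show ?thesis
          using False Henstock_Kurzweil_Integration.integral_combine[of a "- L - 1" s \<psi>] integrable_continuous_real[OF cont]
          by (simp add: \<Psi>_def a_def)
      qed
      show ?thesis
      proof (rule has_vector_derivative_transform_within_open[OF deriv _ _ eq])
        show "t \<in> {a<..<b}"
          by (simp add: a_def b_def min_def max_def)
      qed simp
    qed
    have \<Psi>: "smooth \<Psi>"
      by (rule smooth_antiderivative[OF test_function_imp_smooth[OF \<psi>] \<Psi>'])
    have \<Psi>_left: "\<Psi> t = 0" if "t < - L" for t
    proof -
      have "\<Psi> t = integral {- L - 1..t} (\<lambda>t. 0)"
        unfolding \<Psi>_def using L that by (intro Henstock_Kurzweil_Integration.integral_cong) auto
      then show ?thesis
        by simp
    qed
    have \<Psi>_right: "\<Psi> t = \<Psi> L" if "t > L" for t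
    proof -
      \<comment> \<open>The support condition is silent at \<open>L\<close> itself, so this one
        point is removed as a negligible set.\<close>
      have "integral {L..t} \<psi> = integral {L..t} (\<lambda>t. 0)"
      proof (rule integral_spike[of "{L}"])
        show "0 = \<psi> s" if "s \<in> {L..t} - {L}" for s
          using that L by auto
      qed simp
      then show ?thesis
        using that L(1) Henstock_Kurzweil_Integration.integral_combine[of "- L - 1" L t \<psi>] integrable_continuous_real[OF cont]
        by (simp add: \<Psi>_def)
    qed
    define \<phi> where "\<phi> n t = \<Psi> t + (- 1) *\<^sub>R \<Psi> (1 * t + - real n)" for n t
    have \<phi>_test: "test_function (\<phi> n)" for n
      unfolding test_function_iff
    proof
      show "smooth (\<phi> n)"
        unfolding \<phi>_def[abs_def]
        by (intro smooth_add \<Psi> smooth_bounded_linear[OF bounded_linear_scaleR_right] smooth_affine)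
      have "\<phi> n t = 0" if "\<bar>t\<bar> > L + real n" for t
      proof (cases "t > 0")
        case True
        then have "\<Psi> t = \<Psi> L" "\<Psi> (1 * t + - real n) = \<Psi> L"
          using that by (auto intro!: \<Psi>_right)
        then show ?thesis
          by (simp add: \<phi>_def)
      next
        case False
        then have "\<Psi> t = 0" "\<Psi> (1 * t + - real n) = 0"
          using that by (auto intro!: \<Psi>_left)
        then show ?thesis
          by (simp add: \<phi>_def)
      qed
      then show "\<exists>L. \<forall>t. \<bar>t\<bar> > L \<longrightarrow> \<phi> n t = 0"
        by blast
    qed
    have \<phi>': "vderiv (\<phi> n) t = \<psi> t - \<psi> (t - real n)" for n t
    proof -
      have "((\<lambda>t. t - real n) has_vector_derivative 1) (at t)"
        by (auto intro!: derivative_eq_intros simp flip: has_real_derivative_iff_has_vector_derivative)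
      from vector_diff_chain_at[OF this \<Psi>']
      have "((\<lambda>t. \<Psi> (t - real n)) has_vector_derivative 1 *\<^sub>R \<psi> (t - real n)) (at t)"
        by (simp add: comp_def)
      then have "((\<lambda>t. \<Psi> t - \<Psi> (t - real n)) has_vector_derivative \<psi> t - \<psi> (t - real n)) (at t)"
        using has_vector_derivative_diff[OF \<Psi>'[of t]] by simp
      then show ?thesis
        by (simp add: \<phi>_def[abs_def] vderiv_def vector_derivative_at)
    qed
    have diff: "norm (weighted \<nu> (vderiv (\<phi> n)) - weighted \<nu> \<psi>) = exp (- \<nu> * real n) * norm (weighted \<nu> \<psi>)" for n
    proof -
      have meas: "(\<lambda>t. (norm (exp (- \<nu> * t) *\<^sub>R \<psi> (t - c)))\<^sup>2) \<in> borel_measurable lborel" for c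
        by (simp, intro borel_measurable_continuous_onI continuous_intros continuous_on_compose2[OF cont[of UNIV]]) auto
      have w: "\<psi> \<in> wspace \<nu>" "vderiv (\<phi> n) \<in> wspace \<nu>"
        by (intro test_function_wspace \<psi> test_function_vderiv \<phi>_test)+
      have W: "(\<lambda>t. exp (- \<nu> * t) *\<^sub>R \<psi> (t - real n)) \<in> wspace 0"
        using wspace_diff[OF w] by (simp add: \<phi>' wspace_iff_wspace_0[of _ \<nu>])
      have W': "(\<lambda>t. exp (- \<nu> * t) *\<^sub>R \<psi> t) \<in> wspace 0"
        using test_function_wspace[OF \<psi>, of \<nu>] by (simp add: wspace_iff_wspace_0[of _ \<nu>])
      have "weighted \<nu> \<psi> - weighted \<nu> (vderiv (\<phi> n)) = abs_L2 (\<lambda>t. exp (- \<nu> * t) *\<^sub>R \<psi> (t - real n))"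
        using weighted_diff[OF w] by (simp add: \<phi>' weighted_def)
      moreover have "(norm (abs_L2 (\<lambda>t. exp (- \<nu> * t) *\<^sub>R \<psi> (t - real n))))\<^sup>2 = (exp (- \<nu> * real n) * norm (weighted \<nu> \<psi>))\<^sup>2"
      proof -
        have "(norm (abs_L2 (\<lambda>t. exp (- \<nu> * t) *\<^sub>R \<psi> (t - real n))))\<^sup>2
            = (\<integral>t. (norm (exp (- \<nu> * t) *\<^sub>R \<psi> (t - real n)))\<^sup>2 \<partial>lborel)"
          unfolding norm_abs_L2_sq[OF W] by (rule integral_completion[OF meas])
        also have "\<dots> = (\<integral>t. (norm (exp (- \<nu> * (real n + t)) *\<^sub>R \<psi> t))\<^sup>2 \<partial>lborel)"
          by (subst lborel_integral_real_affine[where c = 1 and t = "real n"]) simp_all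
        also have "\<dots> = (\<integral>t. (exp (- \<nu> * real n))\<^sup>2 * (norm (exp (- \<nu> * t) *\<^sub>R \<psi> t))\<^sup>2 \<partial>lborel)"
        proof (intro Bochner_Integration.integral_cong refl)
          fix t
          have "exp (- \<nu> * (real n + t)) = exp (- \<nu> * real n) * exp (- \<nu> * t)"
            by (simp add: ring_distribs flip: exp_add)
          then show "(norm (exp (- \<nu> * (real n + t)) *\<^sub>R \<psi> t))\<^sup>2
              = (exp (- \<nu> * real n))\<^sup>2 * (norm (exp (- \<nu> * t) *\<^sub>R \<psi> t))\<^sup>2"
            by (simp only: norm_scaleR abs_mult abs_exp_cancel power_mult_distrib mult.assoc)
        qed
        also have "\<dots> = (exp (- \<nu> * real n))\<^sup>2 * (\<integral>t. (norm (exp (- \<nu> * t) *\<^sub>R \<psi> t))\<^sup>2 \<partial>lborel)"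
          by (rule integral_mult_right_zero)
        also have "(\<integral>t. (norm (exp (- \<nu> * t) *\<^sub>R \<psi> t))\<^sup>2 \<partial>lborel) = (norm (weighted \<nu> \<psi>))\<^sup>2"
          unfolding weighted_def norm_abs_L2_sq[OF W']
          using integral_completion[OF meas[of 0]] by simp
        finally show ?thesis
          by (simp only: power_mult_distrib)
      qed
      ultimately have "(norm (weighted \<nu> (vderiv (\<phi> n)) - weighted \<nu> \<psi>))\<^sup>2 = (exp (- \<nu> * real n) * norm (weighted \<nu> \<psi>))\<^sup>2"
        by (subst norm_minus_commute) (simp only:)
      then show ?thesis
        by (rule power2_eq_imp_eq) simp_all
    qed
    have "(\<lambda>n. exp (- \<nu> * real n) * norm (weighted \<nu> \<psi>)) \<longlonglongrightarrow> 0"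
    proof -
      have "(\<lambda>n. (exp (- \<nu>)) ^ n) \<longlonglongrightarrow> 0"
        by (rule LIMSEQ_realpow_zero) (use \<nu> in auto)
      then show ?thesis
        by (intro tendsto_mult_left_zero) (simp add: mult.commute flip: exp_of_nat_mult)
    qed
    then have "(\<lambda>n. weighted \<nu> (vderiv (\<phi> n)) - weighted \<nu> \<psi>) \<longlonglongrightarrow> 0"
      by (simp only: diff flip: tendsto_norm_zero_iff[of "\<lambda>n. weighted \<nu> (vderiv (\<phi> n)) - weighted \<nu> \<psi>"])
    then have "(\<lambda>n. weighted \<nu> (vderiv (\<phi> n))) \<longlonglongrightarrow> weighted \<nu> \<psi>"
      by (rule LIM_zero_cancel)
    moreover have "weighted \<nu> (vderiv (\<phi> n)) \<in> ?D" for n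
      using \<phi>_test by blast
    ultimately show ?thesis
      unfolding closure_sequential by (intro exI[of _ "\<lambda>n. weighted \<nu> (vderiv (\<phi> n))"]) simp
  qed
  then show ?thesis
    using closure_minimal[of "{weighted \<nu> \<psi> | \<psi>. test_function \<psi>}" "closure ?D"] closure_test_functions[of \<nu>]
    by auto
qed

text \<open>The graph of the derivative is closed by way of its converse: sending a derivative back
  to its test function is the restriction of the bounded \<open>integration_op\<close> to a dense
  set. Inverting the nonzero symbol then gives the multiplier.\<close>

lemma time_derivative_iff:
  "(f, g) \<in> time_derivative \<nu> \<longleftrightarrow> f \<in> wspace \<nu> \<and> g \<in> wspace \<nu> \<and>
    (AE x in lebesgue. rep_L2 (fourier_op (weighted \<nu> g)) x =
      (\<i> * of_real x + of_real \<nu>) *\<^sub>C rep_L2 (fourier_op (weighted \<nu> f)) x)"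
proof (cases "f \<in> wspace \<nu> \<and> g \<in> wspace \<nu>")
  case True
  let ?S = "{(weighted \<nu> p, weighted \<nu> q) | p q. (p, q) \<in> {(\<phi>, \<lambda>t. vector_derivative \<phi> (at t)) | \<phi> :: real \<Rightarrow> 'a.
      test_function \<phi>} \<and> p \<in> wspace \<nu> \<and> q \<in> wspace \<nu>}"
  have S: "?S = {(weighted \<nu> \<phi>, weighted \<nu> (vderiv \<phi>)) | \<phi>. test_function \<phi>}"
    unfolding vderiv_def[symmetric] using test_function_vderiv test_function_wspace by blast
  have swap: "(x, y) \<in> closure R \<longleftrightarrow> (y, x) \<in> closure (R\<inverse>)" for x y :: "'a L2" and R
  proof -
    have *: "(y, x) \<in> closure (R\<inverse>)" if xy: "(x, y) \<in> closure R" for x y :: "'a L2" and R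
    proof -
      obtain s where s: "\<And>n. s n \<in> R" "s \<longlonglongrightarrow> (x, y)"
        using xy unfolding closure_sequential by blast
      have "(\<lambda>n. (snd (s n), fst (s n))) \<longlonglongrightarrow> (y, x)"
        using tendsto_Pair[OF tendsto_snd[OF s(2)] tendsto_fst[OF s(2)]] by simp
      then show ?thesis
        using s(1) unfolding closure_sequential
        by (intro exI[of _ "\<lambda>n. (snd (s n), fst (s n))"]) simp
    qed
    show ?thesis
      using *[of x y R] *[of y x "R\<inverse>"] by auto
  qed
  have "(f, g) \<in> time_derivative \<nu> \<longleftrightarrow> (weighted \<nu> f, weighted \<nu> g) \<in> closure ?S"
    using True unfolding time_derivative_def wclosure_iff by blast
  also have "\<dots> \<longleftrightarrow> weighted \<nu> f = integration_op (weighted \<nu> g)"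
    unfolding S
    by (subst swap, rule closure_restricted_graph[OF linear_continuous_on[OF bounded_linear_integration_op]
          closure_vderiv_test_functions]) (auto simp: integration_op_vderiv)
  also have "\<dots> \<longleftrightarrow> fourier_op (weighted \<nu> f) = mult_L2 integration_symbol (fourier_op (weighted \<nu> g))"
    unfolding integration_op_def by (rule eq_inv_fourier_op_iff)
  also have "\<dots> \<longleftrightarrow> (AE x in lebesgue. rep_L2 (fourier_op (weighted \<nu> f)) x =
      integration_symbol x (rep_L2 (fourier_op (weighted \<nu> g)) x))"
  proof -
    have "AE x in lebesgue. rep_L2 (mult_L2 integration_symbol (fourier_op (weighted \<nu> g))) x =
        integration_symbol x (rep_L2 (fourier_op (weighted \<nu> g)) x)"
      by (rule rep_mult_L2[OF bounded_symbol_integration_symbol])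
    then show ?thesis
      unfolding L2_eq_iff by (intro eventually_cong) auto
  qed
  also have "\<dots> \<longleftrightarrow> (AE x in lebesgue. rep_L2 (fourier_op (weighted \<nu> g)) x =
      (\<i> * of_real x + of_real \<nu>) *\<^sub>C rep_L2 (fourier_op (weighted \<nu> f)) x)"
  proof (rule arg_cong[where f = "\<lambda>P. AE x in lebesgue. P x"], rule ext)
    fix x
    show "(rep_L2 (fourier_op (weighted \<nu> f)) x = integration_symbol x (rep_L2 (fourier_op (weighted \<nu> g)) x))
        = (rep_L2 (fourier_op (weighted \<nu> g)) x =
          (\<i> * of_real x + of_real \<nu>) *\<^sub>C rep_L2 (fourier_op (weighted \<nu> f)) x)"
      using frequency_nonzero[of x] by (auto simp: integration_symbol_apply scaleC_scaleC)
  qed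
  finally show ?thesis
    using True by simp
next
  case False
  then show ?thesis
    by (auto simp: time_derivative_def wclosure_def)
qed

end

section \<open>Complex differentiability of resolvents\<close>

definition has_cderiv :: "(complex \<Rightarrow> 'a::complex_normed_vector) \<Rightarrow> 'a \<Rightarrow> complex \<Rightarrow> bool"
  where "has_cderiv f D z \<longleftrightarrow> ((\<lambda>w. inverse (w - z) *\<^sub>C (f w - f z)) \<longlongrightarrow> D) (at z)"

lemma has_cderiv_tendsto:
  assumes "has_cderiv f D z"
  shows "(f \<longlongrightarrow> f z) (at z)"
proof -
  have "((\<lambda>w. (w - z) *\<^sub>C inverse (w - z) *\<^sub>C (f w - f z)) \<longlongrightarrow> (z - z) *\<^sub>C D) (at z)"
    using assms unfolding has_cderiv_def by (intro scaleC.tendsto tendsto_intros)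
  then have "((\<lambda>w. f w - f z) \<longlongrightarrow> 0) (at z)"
    by (rule Lim_transform_eventually[THEN tendsto_eq_rhs])
      (auto simp: eventually_at_filter scaleC_scaleC)
  then show ?thesis
    by (rule LIM_zero_cancel)
qed

text \<open>The quotient rule: the increment of \<open>f w / w\<close> is split into that of
  \<open>f\<close> and that of \<open>1 / w\<close>.\<close>

lemma has_cderiv_scaleC_inverse:
  assumes f: "has_cderiv f D z" and z: "z \<noteq> 0"
  shows "has_cderiv (\<lambda>w. inverse w *\<^sub>C f w) (inverse z *\<^sub>C D - (inverse z)\<^sup>2 *\<^sub>C f z) z"
  unfolding has_cderiv_def
proof (rule Lim_transform_eventually)
  show "((\<lambda>w. inverse w *\<^sub>C inverse (w - z) *\<^sub>C (f w - f z) - (inverse w * inverse z) *\<^sub>C f z)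
      \<longlongrightarrow> inverse z *\<^sub>C D - (inverse z)\<^sup>2 *\<^sub>C f z) (at z)"
    using f z unfolding has_cderiv_def power2_eq_square
    by (intro tendsto_diff scaleC.tendsto tendsto_intros) auto
  have "\<forall>\<^sub>F w in at z. w \<in> - {0} - {z}"
    using z by (intro eventually_at_in_open) auto
  then show "\<forall>\<^sub>F w in at z. inverse w *\<^sub>C inverse (w - z) *\<^sub>C (f w - f z) - (inverse w * inverse z) *\<^sub>C f z
      = inverse (w - z) *\<^sub>C (inverse w *\<^sub>C f w - inverse z *\<^sub>C f z)"
  proof eventually_elim
    case (elim w)
    then have "inverse w * inverse z = inverse (w - z) * (inverse z - inverse w)"
      using z by (simp add: field_simps)
    then show ?case
      by (simp add: scaleC.diff_right scaleC.diff_left scaleC_scaleC right_diff_distrib mult.commute)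
  qed
qed

lemma has_cderiv_bounded_linear:
  assumes E: "bounded_linear E" "\<And>c x. E (c *\<^sub>C x) = c *\<^sub>C E x" and f: "has_cderiv f D z"
  shows "has_cderiv (\<lambda>w. E (f w)) (E D) z"
  using bounded_linear.tendsto[OF E(1) f[unfolded has_cderiv_def]]
  by (simp add: has_cderiv_def E(2) linear_diff[OF bounded_linear.linear[OF E(1)]])

lemma has_cderiv_add_const: "has_cderiv f D z \<Longrightarrow> has_cderiv (\<lambda>w. f w + a) D z"
  by (simp add: has_cderiv_def)

text \<open>The resolvent identity with the uniform bound \<open>1 / c\<close> gives continuity;
  divided by \<open>w - z\<close> it gives the derivative \<open>- Q D Q\<close>. Holomorphy is
  stated after pairing with vectors, where scalar complex analysis applies.\<close>

lemma
  fixes P :: "complex \<Rightarrow> 'a::complex_hilbert \<Rightarrow>\<^sub>L 'a"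
  assumes A: "skew_selfadjoint A" and c: "c > 0" and S: "open S"
    and P: "\<And>z w. z \<in> S \<Longrightarrow> P z w \<bullet> w \<ge> c * (norm w)\<^sup>2" "\<And>z. z \<in> S \<Longrightarrow> \<exists>D. has_cderiv P D z"
    and lin: "\<And>z. z \<in> S \<Longrightarrow> complex_linear (P z)"
  shows continuous_on_skew_resolvent: "continuous_on S (\<lambda>z. skew_resolvent A (P z))"
    and holomorphic_on_skew_resolvent: "(\<lambda>z. cinner e (skew_resolvent A (P z) v)) holomorphic_on S"
proof -
  let ?Q = "\<lambda>z. skew_resolvent A (P z)"
  have lim: "(?Q \<longlongrightarrow> ?Q z) (at z)" if z: "z \<in> S" for z
  proof -
    have "(P \<longlongrightarrow> P z) (at z)"
      using P(2)[OF z] has_cderiv_tendsto by blast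
    then have "((\<lambda>w. (1 / c) * norm (P z - P w) * (1 / c)) \<longlongrightarrow> (1 / c) * norm (P z - P z) * (1 / c)) (at z)"
      by (intro tendsto_intros)
    moreover have "\<forall>\<^sub>F w in at z. norm (?Q w - ?Q z) \<le> (1 / c) * norm (P z - P w) * (1 / c)"
    proof -
      have "\<forall>\<^sub>F w in at z. w \<in> S - {z}"
        by (rule eventually_at_in_open[OF S z])
      then show ?thesis
      proof eventually_elim
        case (elim w)
        then have w: "w \<in> S"
          by simp
        have "norm (?Q w - ?Q z) = norm (?Q w o\<^sub>L (P z - P w) o\<^sub>L ?Q z)"
          by (simp only: skew_resolvent_diff[OF A c P(1)[OF w] P(1)[OF z]])
        also have "\<dots> \<le> norm (?Q w) * norm (P z - P w) * norm (?Q z)"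
          by (meson norm_blinfun_compose mult_right_mono norm_ge_zero order_trans)
        also have "\<dots> \<le> (1 / c) * norm (P z - P w) * (1 / c)"
          using c norm_skew_resolvent[OF A c P(1)[OF w]] norm_skew_resolvent[OF A c P(1)[OF z]]
          by (intro mult_mono) auto
        finally show ?case .
      qed
    qed
    ultimately have "((\<lambda>w. ?Q w - ?Q z) \<longlongrightarrow> 0) (at z)"
      using Lim_null_comparison by fastforce
    then show ?thesis
      by (rule LIM_zero_cancel)
  qed
  show "continuous_on S ?Q"
    using lim S by (simp add: continuous_on_eq_continuous_at isCont_def)
  show "(\<lambda>z. cinner e (?Q z v)) holomorphic_on S"
    unfolding holomorphic_on_open[OF S]
  proof (intro ballI)
    fix z assume z: "z \<in> S"
    obtain D where D: "has_cderiv P D z"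
      using P(2)[OF z] by blast
    have "((\<lambda>w. cinner e ((?Q w o\<^sub>L (inverse (w - z) *\<^sub>C (P w - P z)) o\<^sub>L ?Q z) v))
        \<longlongrightarrow> cinner e ((?Q z o\<^sub>L D o\<^sub>L ?Q z) v)) (at z)"
      using D[unfolded has_cderiv_def] lim[OF z]
      by (intro cinner.tendsto tendsto_const blinfun.tendsto
          bounded_bilinear.tendsto[OF bounded_bilinear_blinfun_compose])
    then have "((\<lambda>w. - cinner e ((?Q w o\<^sub>L (inverse (w - z) *\<^sub>C (P w - P z)) o\<^sub>L ?Q z) v))
        \<longlongrightarrow> - cinner e ((?Q z o\<^sub>L D o\<^sub>L ?Q z) v)) (at z)"
      by (rule tendsto_minus)
    moreover have "\<forall>\<^sub>F w in at z. - cinner e ((?Q w o\<^sub>L (inverse (w - z) *\<^sub>C (P w - P z)) o\<^sub>L ?Q z) v)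
        = (cinner e (?Q w v) - cinner e (?Q z v)) / (w - z)"
    proof -
      have "\<forall>\<^sub>F w in at z. w \<in> S - {z}"
        by (rule eventually_at_in_open[OF S z])
      then show ?thesis
      proof eventually_elim
        case (elim w)
        then have w: "w \<in> S" "w - z \<noteq> 0"
          by auto
        have "cinner e (?Q w v) - cinner e (?Q z v) = cinner e ((?Q w - ?Q z) v)"
          by (simp add: blinfun.diff_left cinner.diff_right)
        also have "\<dots> = cinner e (?Q w ((P z - P w) (?Q z v)))"
          by (simp add: skew_resolvent_diff[OF A c P(1)[OF w(1)] P(1)[OF z]])
        also have "\<dots> = - cinner e (?Q w ((P w - P z) (?Q z v)))"
          by (simp add: blinfun.diff_left blinfun.diff_right cinner.diff_right)
        finally show ?case
          using w(2) complex_linear_skew_resolvent[OF A c P(1)[OF w(1)] lin[OF w(1)]]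
          by (simp add: scaleC_blinfun.rep_eq complex_linear_def cinner_scaleC_right divide_inverse mult.commute)
      qed
    qed
    ultimately have "((\<lambda>w. (cinner e (?Q w v) - cinner e (?Q z v)) / (w - z))
        \<longlongrightarrow> - cinner e ((?Q z o\<^sub>L D o\<^sub>L ?Q z) v)) (at z)"
      by (rule Lim_transform_eventually)
    then show "\<exists>f'. ((\<lambda>z. cinner e (?Q z v)) has_field_derivative f') (at z)"
      by (auto simp: has_field_derivative_iff)
  qed
qed

section \<open>Evolutionary systems\<close>

text \<open>Accretivity and differentiability are assumed of \<open>inverse z *\<^sub>C M z\<close>,
  since this is \<open>\<zeta> M(1 / \<zeta>)\<close> at \<open>z = 1 / \<zeta>\<close>. The bound
  on \<open>\<nu>\<close> makes inversion map the line \<open>Re \<zeta> = \<nu>\<close> into the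
  ball.\<close>

locale evolutionary_system =
  fixes A :: "('a::complex_hilbert \<times> 'a) set" and M :: "complex \<Rightarrow> 'a \<Rightarrow>\<^sub>L 'a" and r c \<nu> :: real
  assumes A: "skew_selfadjoint A" and r: "r > 0" and c: "c > 0" and \<nu>: "\<nu> > 1 / (2 * r)"
    and accretive: "\<And>z w. z \<in> ball (of_real r) r \<Longrightarrow> (inverse z *\<^sub>C M z) w \<bullet> w \<ge> c * (norm w)\<^sup>2"
    and lin: "\<And>z. z \<in> ball (of_real r) r \<Longrightarrow> complex_linear (M z)"
    and diff: "\<And>z. z \<in> ball (of_real r) r \<Longrightarrow> \<exists>D. has_cderiv (\<lambda>z. inverse z *\<^sub>C M z) D z"
begin

text \<open>Expanding \<open>|r \<zeta> - 1|\<^sup>2\<close> shows that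
  \<open>|r \<zeta> - 1| < r |\<zeta>|\<close> once \<open>2 r Re \<zeta> > 1\<close>; division by
  \<open>|\<zeta>|\<close> gives the distance of \<open>1 / \<zeta>\<close> from the centre.\<close>

lemma inverse_mem_ball:
  assumes "Re \<zeta> > 1 / (2 * r)"
  shows "inverse \<zeta> \<in> ball (of_real r) r"
proof -
  have \<zeta>: "\<zeta> \<noteq> 0"
    using assms r by (auto simp: field_simps)
  have "2 * r * Re \<zeta> > 1"
    using assms r by (simp add: field_simps)
  moreover have "(cmod (of_real r * \<zeta> - 1))\<^sup>2 = (r * cmod \<zeta>)\<^sup>2 + 1 - 2 * r * Re \<zeta>"
    unfolding power_mult_distrib cmod_power2 by (simp add: power2_eq_square algebra_simps)
  ultimately have "(cmod (of_real r * \<zeta> - 1))\<^sup>2 < (r * cmod \<zeta>)\<^sup>2"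
    by linarith
  then have "cmod (of_real r * \<zeta> - 1) < r * cmod \<zeta>"
    by (rule power_less_imp_less_base) (use r in simp)
  moreover have "of_real r * \<zeta> - 1 = (of_real r - inverse \<zeta>) * \<zeta>"
    using \<zeta> by (simp add: left_diff_distrib)
  ultimately have "cmod (of_real r - inverse \<zeta>) * cmod \<zeta> < r * cmod \<zeta>"
    by (simp only: norm_mult)
  then show ?thesis
    using \<zeta> by (simp add: dist_norm)
qed

lemma \<nu>_pos: "\<nu> > 0"
  using \<nu> r by (meson divide_pos_pos less_trans mult_pos_pos zero_less_numeral zero_less_one)

abbreviation frequency :: "real \<Rightarrow> complex"
  where "frequency x \<equiv> \<i> * of_real x + of_real \<nu>"

text \<open>The inverse of \<open>\<zeta> M(1 / \<zeta>) + A\<close>. The doubled inverse keeps it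
  literally a composition of \<open>z \<mapsto> skew_resolvent A (inverse z *\<^sub>C M z)\<close>
  with inversion, so that regularity on the ball carries over.\<close>

definition resolvent :: "complex \<Rightarrow> 'a \<Rightarrow>\<^sub>L 'a"
  where "resolvent \<zeta> = skew_resolvent A (inverse (inverse \<zeta>) *\<^sub>C M (inverse \<zeta>))"

lemma ball_nonzero: "z \<in> ball (of_real r) r \<Longrightarrow> z \<noteq> (0 :: complex)"
  using r by (auto simp: dist_norm)

lemma complex_linear_scaled_M: "z \<in> ball (of_real r) r \<Longrightarrow> complex_linear (inverse z *\<^sub>C M z)"
  using lin[of z] by (simp add: complex_linear_def scaleC_blinfun.rep_eq scaleC_scaleC mult.commute)

lemma
  assumes "Re \<zeta> > 1 / (2 * r)"
  shows resolvent_iff: "(w, g - (\<zeta> *\<^sub>C M (inverse \<zeta>)) w) \<in> A \<longleftrightarrow> w = resolvent \<zeta> g"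
    and norm_resolvent: "norm (resolvent \<zeta>) \<le> 1 / c"
    and complex_linear_resolvent: "complex_linear (resolvent \<zeta>)"
proof -
  note z = inverse_mem_ball[OF assms]
  show "(w, g - (\<zeta> *\<^sub>C M (inverse \<zeta>)) w) \<in> A \<longleftrightarrow> w = resolvent \<zeta> g"
    using skew_resolvent_iff[OF A c accretive[OF z]] by (simp add: resolvent_def)
  show "norm (resolvent \<zeta>) \<le> 1 / c"
    unfolding resolvent_def by (rule norm_skew_resolvent[OF A c accretive[OF z]])
  show "complex_linear (resolvent \<zeta>)"
    unfolding resolvent_def
    by (rule complex_linear_skew_resolvent[OF A c accretive[OF z] complex_linear_scaled_M[OF z]])
qed

lemma
  assumes "S \<subseteq> {\<zeta>. Re \<zeta> > 1 / (2 * r)}"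
  shows holomorphic_on_resolvent: "(\<lambda>\<zeta>. cinner e (resolvent \<zeta> v)) holomorphic_on S"
    and continuous_on_resolvent: "continuous_on S resolvent"
    and continuous_on_scaled_M: "continuous_on S (\<lambda>\<zeta>. \<zeta> *\<^sub>C M (inverse \<zeta>))"
proof -
  have S: "inverse ` S \<subseteq> ball (of_real r) r"
    using assms inverse_mem_ball by blast
  have S0: "\<zeta> \<noteq> 0" if "\<zeta> \<in> S" for \<zeta>
    using S that ball_nonzero by force
  have hol: "inverse holomorphic_on S"
    by (intro holomorphic_intros S0)
  then have cont: "continuous_on S inverse"
    by (rule holomorphic_on_imp_continuous_on)
  note * = A c open_ball accretive diff complex_linear_scaled_M
  have "((\<lambda>z. cinner e (skew_resolvent A (inverse z *\<^sub>C M z) v)) \<circ> inverse) holomorphic_on S"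
    by (rule holomorphic_on_compose[OF hol
          holomorphic_on_subset[OF holomorphic_on_skew_resolvent[OF *] S]])
  then show "(\<lambda>\<zeta>. cinner e (resolvent \<zeta> v)) holomorphic_on S"
    by (simp add: comp_def resolvent_def)
  show "continuous_on S resolvent"
    unfolding resolvent_def[abs_def]
    by (rule continuous_on_compose2[OF continuous_on_skew_resolvent[OF *] cont S])
  have "continuous_on (ball (of_real r) r) (\<lambda>z. inverse z *\<^sub>C M z)"
    using diff has_cderiv_tendsto by (fastforce simp: continuous_on_eq_continuous_at isCont_def)
  from continuous_on_compose2[OF this cont S] show "continuous_on S (\<lambda>\<zeta>. \<zeta> *\<^sub>C M (inverse \<zeta>))"
    by simp
qed

lemma Re_frequency: "Re (frequency x) > 1 / (2 * r)"
  using \<nu> by simp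

lemma bounded_symbol_resolvent: "bounded_symbol (\<lambda>x. resolvent (frequency x))"
proof -
  have "continuous_on UNIV (\<lambda>x. resolvent (frequency x))"
    by (rule continuous_on_compose2[OF continuous_on_resolvent[OF order_refl]])
      (auto simp: Re_frequency intro!: continuous_intros \<nu>)
  then show ?thesis
    using norm_resolvent[OF Re_frequency] unfolding bounded_symbol_def
    by (blast intro: strongly_measurable_continuous)
qed

definition solution :: "'a L2 \<Rightarrow> 'a L2"
  where "solution y = inv_fourier_op (mult_L2 (\<lambda>x. resolvent (frequency x)) (fourier_op y))"

lemma bounded_linear_solution: "bounded_linear solution"
  unfolding solution_def[abs_def]
  by (intro bounded_linear_compose[OF bounded_linear_inv_fourier_op]
      bounded_linear_compose[OF bounded_linear_mult_L2[OF bounded_symbol_resolvent]]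
      bounded_linear_fourier_op)

section \<open>The system relation and its agreement with the bounded solution operator\<close>

abbreviation system :: "('a, 'a) woperator"
  where "system \<equiv> woperator_plus (material_law_operator \<nu> M O time_derivative \<nu>) (pointwise_extension \<nu> A)"

lemma rep_L2_add: "AE t in lebesgue. rep_L2 (x + y) t = rep_L2 x t + rep_L2 y t"
  using rep_abs_L2[OF wspace_0_add[OF rep_L2_wspace rep_L2_wspace], of x y]
  by (simp flip: abs_L2_add[OF rep_L2_wspace rep_L2_wspace])

lemma A_subspace: "subspace A" "closed A" "p \<in> A \<Longrightarrow> b *\<^sub>C p \<in> A"
  using A by (auto simp: skew_selfadjoint_def)

lemma system_wspace:
  assumes "(f, g) \<in> system"
  shows "f \<in> wspace \<nu>" "g \<in> wspace \<nu>"
  using assms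
  by (auto simp: woperator_plus_def pointwise_extension_def time_derivative_iff[OF \<nu>_pos] intro!: wspace_add)

text \<open>At almost every frequency the transformed equation is the relation defining the
  resolvent. The spatial relation survives because both the real weight and the Fourier transform
  preserve membership in \<open>A\<close>. Uniqueness and the norm bound follow from this
  identity.\<close>

lemma system_imp_solution:
  assumes "(f, g) \<in> system"
  shows "weighted \<nu> f = solution (weighted \<nu> g)"
proof -
  obtain h k m where g: "g = (\<lambda>t. h t + k t)" and m: "(f, m) \<in> material_law_operator \<nu> M"
    and h: "(m, h) \<in> time_derivative \<nu>" and k: "(f, k) \<in> pointwise_extension \<nu> A"
    using assms by (auto simp: woperator_plus_def)
  have W: "f \<in> wspace \<nu>" "h \<in> wspace \<nu>" "k \<in> wspace \<nu>"
    using m h k by (auto simp: time_derivative_iff[OF \<nu>_pos] pointwise_extension_def)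
  let ?F = "fourier_op (weighted \<nu> f)" and ?G = "fourier_op (weighted \<nu> g)"
    and ?H = "fourier_op (weighted \<nu> h)" and ?K = "fourier_op (weighted \<nu> k)"
  have "AE t in lebesgue. (f t, k t) \<in> A"
    using k by (simp add: pointwise_extension_def)
  then have "AE t in lebesgue. (rep_L2 (weighted \<nu> f) t, rep_L2 (weighted \<nu> k) t) \<in> A"
    using rep_weighted[OF W(1)] rep_weighted[OF W(3)]
  proof eventually_elim
    case (elim t)
    then show ?case
      using subspace_scale[OF A_subspace(1) elim(1), of "exp (- \<nu> * t)"] by simp
  qed
  then have mem: "AE x in lebesgue. (rep_L2 ?F x, rep_L2 ?K x) \<in> A"
    by (subst AE_mem_fourier_op_iff[OF A_subspace])
  have "?G = ?H + ?K"
    by (simp add: g weighted_add W linear_add[OF linear_fourier_op])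
  then have add: "AE x in lebesgue. rep_L2 ?G x = rep_L2 ?H x + rep_L2 ?K x"
    using rep_L2_add[of ?H ?K] by simp
  have "AE x in lebesgue. rep_L2 ?F x = rep_L2 (mult_L2 (\<lambda>x. resolvent (frequency x)) ?G) x"
    using mem add m[unfolded material_law_operator_iff, THEN conjunct2, THEN conjunct2]
      h[unfolded time_derivative_iff[OF \<nu>_pos], THEN conjunct2, THEN conjunct2]
      rep_mult_L2[OF bounded_symbol_resolvent, of ?G]
  proof eventually_elim
    case (elim x)
    then have "(rep_L2 ?F x, rep_L2 ?G x - (frequency x *\<^sub>C M (inverse (frequency x))) (rep_L2 ?F x)) \<in> A"
      by (simp add: scaleC_blinfun.rep_eq inverse_eq_divide)
    then show ?case
      using elim(5) by (simp only: resolvent_iff[OF Re_frequency])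
  qed
  then have "?F = mult_L2 (\<lambda>x. resolvent (frequency x)) ?G"
    by (subst L2_eq_iff)
  then show ?thesis
    by (simp add: solution_def eq_inv_fourier_op_iff)
qed

text \<open>The symbol \<open>\<zeta> M(1 / \<zeta>)\<close> may be unbounded along the line; on a
  bounded set of frequencies continuity and compactness bound it.\<close>

lemma bounded_symbol_truncated:
  assumes "continuous_on UNIV N"
  shows "bounded_symbol (\<lambda>x. indicat_real {- L..L} x *\<^sub>R (N x :: 'a \<Rightarrow>\<^sub>L 'a))"
  unfolding bounded_symbol_def
proof
  show "strongly_measurable (\<lambda>x. indicat_real {- L..L} x *\<^sub>R N x)"
    by (intro strongly_measurable_scaleR strongly_measurable_continuous assms borel_measurable_indicator) auto
  have "compact (N ` {- L..L})"
    using assms by (intro compact_continuous_image continuous_on_subset[OF assms]) auto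
  then obtain C where C: "C > 0" "\<And>x. x \<in> {- L..L} \<Longrightarrow> norm (N x) \<le> C"
    using compact_imp_bounded bounded_pos by (metis imageI)
  have "norm (indicat_real {- L..L} x *\<^sub>R N x) \<le> C" for x
    using C by (cases "x \<in> {- L..L}") simp_all
  then show "\<exists>C. \<forall>x. norm (indicat_real {- L..L} x *\<^sub>R N x) \<le> C"
    by blast
qed

lemma continuous_on_M_frequency:
  "continuous_on UNIV (\<lambda>x. frequency x *\<^sub>C M (inverse (frequency x)))"
  "continuous_on UNIV (\<lambda>x. M (inverse (frequency x)))"
proof -
  show 1: "continuous_on UNIV (\<lambda>x. frequency x *\<^sub>C M (inverse (frequency x)))"
    by (rule continuous_on_compose2[OF continuous_on_scaled_M[OF order_refl], of _ frequency])
      (auto simp: Re_frequency intro!: continuous_intros \<nu>)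
  have "continuous_on UNIV (\<lambda>x. inverse (frequency x) *\<^sub>C frequency x *\<^sub>C M (inverse (frequency x)))"
    using frequency_nonzero[OF \<nu>_pos] by (intro scaleC.continuous_on 1 continuous_intros) auto
  then show "continuous_on UNIV (\<lambda>x. M (inverse (frequency x)))"
    using frequency_nonzero[OF \<nu>_pos] by (simp add: scaleC_scaleC)
qed

text \<open>The resolvents are linear, so the transform of the solution vanishes outside
  \<open>{- L..L}\<close> along with that of the source. There the unbounded symbol acts like its
  truncation, and the intermediate functions \<open>m\<close>, \<open>h\<close> and \<open>k\<close>
  are all square-integrable.\<close>

lemma system_surjective:
  assumes supp: "AE x in lebesgue. \<bar>x\<bar> > L \<longrightarrow> rep_L2 (fourier_op y) x = 0"
  obtains f g where "(f, g) \<in> system" "weighted \<nu> g = y"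
proof -
  let ?G = "fourier_op y"
  let ?N1 = "\<lambda>x. indicat_real {- L..L} x *\<^sub>R M (inverse (frequency x))"
  let ?N2 = "\<lambda>x. indicat_real {- L..L} x *\<^sub>R (frequency x *\<^sub>C M (inverse (frequency x)))"
  note N1 = bounded_symbol_truncated[OF continuous_on_M_frequency(2), of L]
  note N2 = bounded_symbol_truncated[OF continuous_on_M_frequency(1), of L]
  define F where "F = mult_L2 (\<lambda>x. resolvent (frequency x)) ?G"
  define f where "f = unweighted \<nu> (inv_fourier_op F)"
  define m where "m = unweighted \<nu> (inv_fourier_op (mult_L2 ?N1 F))"
  define h where "h = unweighted \<nu> (inv_fourier_op (mult_L2 ?N2 F))"
  define k where "k = unweighted \<nu> (inv_fourier_op (?G - mult_L2 ?N2 F))"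
  have W: "f \<in> wspace \<nu>" "m \<in> wspace \<nu>" "h \<in> wspace \<nu>" "k \<in> wspace \<nu>"
    by (simp_all add: f_def m_def h_def k_def unweighted_wspace)
  have F: "AE x in lebesgue. rep_L2 F x = resolvent (frequency x) (rep_L2 ?G x)"
    unfolding F_def by (rule rep_mult_L2[OF bounded_symbol_resolvent])
  have F0: "AE x in lebesgue. \<bar>x\<bar> > L \<longrightarrow> rep_L2 F x = 0"
    using F supp by eventually_elim (simp add: blinfun.zero_right)
  have m: "AE x in lebesgue. rep_L2 (mult_L2 ?N1 F) x = M (inverse (frequency x)) (rep_L2 F x)"
    using rep_mult_L2[OF N1, of F] F0
  proof eventually_elim
    case (elim x)
    then show ?case
      by (cases "x \<in> {- L..L}") (auto simp: abs_le_iff not_le blinfun.zero_right)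
  qed
  have h: "AE x in lebesgue. rep_L2 (mult_L2 ?N2 F) x = (frequency x *\<^sub>C M (inverse (frequency x))) (rep_L2 F x)"
    using rep_mult_L2[OF N2, of F] F0
  proof eventually_elim
    case (elim x)
    then show ?case
      by (cases "x \<in> {- L..L}") (auto simp: abs_le_iff not_le blinfun.zero_right)
  qed
  have "(f, m) \<in> material_law_operator \<nu> M"
    unfolding material_law_operator_iff using W m
    by (simp add: f_def m_def inverse_eq_divide)
  moreover have "(m, h) \<in> time_derivative \<nu>"
    unfolding time_derivative_iff[OF \<nu>_pos]
  proof (intro conjI W)
    show "AE x in lebesgue. rep_L2 (fourier_op (weighted \<nu> h)) x = frequency x *\<^sub>C rep_L2 (fourier_op (weighted \<nu> m)) x"
      using m h by eventually_elim (simp add: m_def h_def scaleC_blinfun.rep_eq)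
  qed
  moreover have "(f, k) \<in> pointwise_extension \<nu> A"
  proof -
    have "AE x in lebesgue. rep_L2 ?G x = rep_L2 (?G - mult_L2 ?N2 F) x + rep_L2 (mult_L2 ?N2 F) x"
      using rep_L2_add[of "?G - mult_L2 ?N2 F" "mult_L2 ?N2 F"] by simp
    then have "AE x in lebesgue. (rep_L2 F x, rep_L2 (?G - mult_L2 ?N2 F) x) \<in> A"
      using F h
    proof eventually_elim
      case (elim x)
      have "a = g - n" if "g = a + b" "b = n" for a b g n :: 'a
        using that by simp
      from this[OF elim(1,3)] have "rep_L2 (?G - mult_L2 ?N2 F) x
          = rep_L2 ?G x - (frequency x *\<^sub>C M (inverse (frequency x))) (rep_L2 F x)" .
      then show ?case
        using elim(2) by (simp only: resolvent_iff[OF Re_frequency])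
    qed
    then have "AE x in lebesgue. (rep_L2 (fourier_op (inv_fourier_op F)) x,
        rep_L2 (fourier_op (inv_fourier_op (?G - mult_L2 ?N2 F))) x) \<in> A"
      by (simp only: fourier_op_inv)
    then have "AE t in lebesgue. (rep_L2 (inv_fourier_op F) t, rep_L2 (inv_fourier_op (?G - mult_L2 ?N2 F)) t) \<in> A"
      by (simp only: AE_mem_fourier_op_iff[OF A_subspace])
    then have "AE t in lebesgue. (f t, k t) \<in> A"
    proof eventually_elim
      case (elim t)
      then show ?case
        using subspace_scale[OF A_subspace(1) elim, of "exp (\<nu> * t)"] by (simp add: f_def k_def unweighted_def)
    qed
    then show ?thesis
      using W by (simp add: pointwise_extension_def)
  qed
  ultimately have "(f, \<lambda>t. h t + k t) \<in> system"
    unfolding woperator_plus_def by blast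
  moreover have "weighted \<nu> (\<lambda>t. h t + k t) = y"
  proof (rule fourier_op_eq_iff[THEN iffD1])
    show "fourier_op (weighted \<nu> (\<lambda>t. h t + k t)) = fourier_op y"
      by (simp add: weighted_add W linear_add[OF linear_fourier_op]) (simp add: h_def k_def)
  qed
  ultimately show ?thesis
    by (rule that)
qed

text \<open>Truncation in frequency approximates every source by solvable ones.\<close>

lemma closure_range_system: "closure {weighted \<nu> g | f g. (f, g) \<in> system} = UNIV"
proof -
  have "y \<in> closure {weighted \<nu> g | f g. (f, g) \<in> system}" for y
  proof -
    let ?G = "rep_L2 (fourier_op y)"
    define G where "G n x = indicat_real {- real n..real n} x *\<^sub>R ?G x" for n x
    have sm: "strongly_measurable (G n)" for n
      unfolding G_def using rep_L2_wspace[of "fourier_op y"]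
      by (intro strongly_measurable_scaleR borel_measurable_indicator) (auto simp: wspace_0)
    have le: "norm (G n x) \<le> 1 * norm (?G x)" for n x
      by (simp add: G_def indicator_def)
    have W: "G n \<in> wspace 0" for n
      by (rule wspace_0_dominated[OF sm rep_L2_wspace[of "fourier_op y"], where C = 1]) (use le in simp)
    have "(\<lambda>n. abs_L2 (G n)) \<longlonglongrightarrow> abs_L2 ?G"
    proof (rule LIMSEQ_abs_L2_dominated[OF sm rep_L2_wspace, where C = 1])
      show "AE x in lebesgue. norm (G n x) \<le> 1 * norm (?G x)" for n
        using le by simp
      have "(\<lambda>n. G n x) \<longlonglongrightarrow> ?G x" for x
      proof (rule tendsto_eventually)
        show "\<forall>\<^sub>F n in sequentially. G n x = ?G x"
          using eventually_ge_at_top[of "nat \<lceil>\<bar>x\<bar>\<rceil>"]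
          by eventually_elim (auto simp: G_def indicator_def abs_le_iff nat_le_iff ceiling_le_iff)
      qed
      then show "AE x in lebesgue. (\<lambda>n. G n x) \<longlonglongrightarrow> ?G x"
        by simp
    qed
    then have "(\<lambda>n. inv_fourier_op (abs_L2 (G n))) \<longlonglongrightarrow> inv_fourier_op (abs_L2 ?G)"
      by (rule bounded_linear.tendsto[OF bounded_linear_inv_fourier_op])
    moreover have "inv_fourier_op (abs_L2 (G n)) \<in> {weighted \<nu> g | f g. (f, g) \<in> system}" for n
    proof -
      have "AE x in lebesgue. \<bar>x\<bar> > real n \<longrightarrow> rep_L2 (fourier_op (inv_fourier_op (abs_L2 (G n)))) x = 0"
        unfolding fourier_op_inv using rep_abs_L2[OF W[of n]]
        by eventually_elim (auto simp: G_def indicator_def)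
      then obtain f g where "(f, g) \<in> system" "weighted \<nu> g = inv_fourier_op (abs_L2 (G n))"
        by (rule system_surjective)
      then show ?thesis
        by (intro CollectI exI[of _ g] exI[of _ f]) simp
    qed
    ultimately show ?thesis
      unfolding closure_sequential by (intro exI[of _ "\<lambda>n. inv_fourier_op (abs_L2 (G n))"]) simp
  qed
  then show ?thesis
    by blast
qed

lemma densely_defined_bounded_inverse_system: "densely_defined_bounded_inverse \<nu> system"
  unfolding densely_defined_bounded_inverse_def
proof (intro conjI)
  have "AE t in lebesgue. f t = f' t"
    if fg: "(f, g) \<in> system" and fg': "(f', g') \<in> system" and "AE t in lebesgue. g t = g' t" for f g f' g'
  proof -
    from that have "weighted \<nu> g = weighted \<nu> g'"
      using weighted_eq_iff system_wspace by blast
    then have "weighted \<nu> f = weighted \<nu> f'"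
      using system_imp_solution[OF fg] system_imp_solution[OF fg'] by simp
    then show ?thesis
      using weighted_eq_iff system_wspace(1)[OF fg] system_wspace(1)[OF fg'] by blast
  qed
  then show "\<forall>(f, g)\<in>system. \<forall>(f', g')\<in>system. (AE t in lebesgue. g t = g' t) \<longrightarrow> (AE t in lebesgue. f t = f' t)"
    unfolding Ball_def split_paired_All prod.case by blast
  obtain C where C: "\<And>y. norm (solution y) \<le> norm y * C"
    using bounded_linear.bounded[OF bounded_linear_solution] by blast
  have "wnorm \<nu> f \<le> C * wnorm \<nu> g" if fg: "(f, g) \<in> system" for f g
    using C[of "weighted \<nu> g"]
    by (simp add: wnorm_eq_norm_weighted system_wspace[OF fg] system_imp_solution[OF fg] mult.commute)
  then show "\<exists>C. \<forall>(f, g)\<in>system. wnorm \<nu> f \<le> C * wnorm \<nu> g"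
    unfolding Ball_def split_paired_All prod.case by blast
  show "\<forall>h\<in>wspace \<nu>. \<forall>\<epsilon>>0. \<exists>(f, g)\<in>system. wnorm \<nu> (\<lambda>t. g t - h t) < \<epsilon>"
  proof (intro ballI allI impI)
    fix h :: "real \<Rightarrow> 'a" and \<epsilon> :: real assume h: "h \<in> wspace \<nu>" and e: "\<epsilon> > 0"
    have "weighted \<nu> h \<in> closure {weighted \<nu> g | f g. (f, g) \<in> system}"
      by (simp add: closure_range_system)
    then obtain f g where fg: "(f, g) \<in> system" "dist (weighted \<nu> g) (weighted \<nu> h) < \<epsilon>"
      using e unfolding closure_approachable by blast
    then have "wnorm \<nu> (\<lambda>t. g t - h t) < \<epsilon>"
      by (simp add: wnorm_eq_norm_weighted wspace_diff weighted_diff system_wspace[OF fg(1)] h dist_norm)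
    with fg(1) show "\<exists>(f, g)\<in>system. wnorm \<nu> (\<lambda>t. g t - h t) < \<epsilon>"
      by blast
  qed
qed

text \<open>The converse of the system is a restriction of \<open>solution\<close> with dense
  domain, so its closure is all of \<open>solution\<close>.\<close>

lemma wclosure_converse_system_iff:
  "(g, f) \<in> wclosure \<nu> (system\<inverse>) \<longleftrightarrow> g \<in> wspace \<nu> \<and> f \<in> wspace \<nu> \<and> weighted \<nu> f = solution (weighted \<nu> g)"
proof -
  have "{(weighted \<nu> p, weighted \<nu> q) | p q. (p, q) \<in> system\<inverse> \<and> p \<in> wspace \<nu> \<and> q \<in> wspace \<nu>}
      = {(x, solution x) | x. x \<in> {weighted \<nu> g | f g. (f, g) \<in> system}}" (is "?S = _")
  proof (intro equalityI subsetI)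
    fix z assume "z \<in> ?S"
    then obtain p q where "z = (weighted \<nu> p, weighted \<nu> q)" "(q, p) \<in> system"
      by blast
    then show "z \<in> {(x, solution x) | x. x \<in> {weighted \<nu> g | f g. (f, g) \<in> system}}"
      using system_imp_solution[of q p] by auto
  next
    fix z assume "z \<in> {(x, solution x) | x. x \<in> {weighted \<nu> g | f g. (f, g) \<in> system}}"
    then obtain f g where "z = (weighted \<nu> g, solution (weighted \<nu> g))" "(f, g) \<in> system"
      by blast
    then show "z \<in> ?S"
      using system_imp_solution[of f g] system_wspace[of f g]
      by (intro CollectI exI[of _ g] exI[of _ f]) simp
  qed
  from closure_restricted_graph[OF linear_continuous_on[OF bounded_linear_solution] closure_range_system this]
  show ?thesis
    unfolding wclosure_iff by blast
qed

end

section \<open>Causality\<close>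

text \<open>Makes \<open>laplace\<close> and its rules applicable to scalar test functions.\<close>

instantiation complex :: complex_hilbert
begin
definition scaleC_complex :: "complex \<Rightarrow> complex \<Rightarrow> complex"
  where "scaleC_complex c z = c * z"
definition cinner_complex :: "complex \<Rightarrow> complex \<Rightarrow> complex"
  where "cinner_complex w z = cnj w * z"
instance
  by intro_classes
    (simp_all add: scaleC_complex_def cinner_complex_def inner_complex_def norm_mult
      scaleR_conv_of_real algebra_simps)
end

section \<open>Laplace transforms of scalar test functions\<close>

lemma cnj_laplace:
  "cnj (laplace (\<lambda>t. complex_of_real (b t)) \<zeta>) = laplace (\<lambda>t. complex_of_real (b t)) (cnj \<zeta>)"
  by (simp add: laplace_def Henstock_Kurzweil_Integration.integral_cnj scaleC_complex_def exp_cnj)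

text \<open>Inserting \<open>exp (\<nu> t)\<close> is compensated by shifting the argument by
  \<open>\<nu>\<close>. Transforms on the imaginary axis thereby become values of a scalar
  holomorphic function on the line \<open>Re \<zeta> = \<nu>\<close>.\<close>

lemma laplace_scaleR_vector:
  fixes v :: "'a::complex_hilbert"
  assumes b: "supported L (\<lambda>t. complex_of_real (exp (\<nu> * t) * b t))"
  shows "laplace (\<lambda>t. b t *\<^sub>R v) \<zeta> = laplace (\<lambda>t. complex_of_real (exp (\<nu> * t) * b t)) (\<zeta> + of_real \<nu>) *\<^sub>C v"
proof -
  define T where "T = Blinfun (\<lambda>z. z *\<^sub>C v)"
  have T: "blinfun_apply T z = z *\<^sub>C v" for z
    unfolding T_def by (simp add: bounded_linear_Blinfun_apply scaleC.bounded_linear_left)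
  have "complex_linear T"
    by (simp add: complex_linear_def T scaleC_complex_def scaleC_scaleC)
  from laplace_bounded_linear[OF this b, of "\<zeta> + of_real \<nu>"]
  have "laplace (\<lambda>t. complex_of_real (exp (\<nu> * t) * b t) *\<^sub>C v) (\<zeta> + of_real \<nu>)
      = laplace (\<lambda>t. complex_of_real (exp (\<nu> * t) * b t)) (\<zeta> + of_real \<nu>) *\<^sub>C v"
    by (simp add: T)
  moreover have "exp (- ((\<zeta> + of_real \<nu>) * of_real t)) *\<^sub>C complex_of_real (exp (\<nu> * t) * b t) *\<^sub>C v
      = exp (- (\<zeta> * of_real t)) *\<^sub>C b t *\<^sub>R v" for t
  proof -
    have "exp (- ((\<zeta> + of_real \<nu>) * of_real t)) * complex_of_real (exp (\<nu> * t)) = exp (- (\<zeta> * of_real t))"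
      by (simp add: ring_distribs flip: exp_of_real exp_add)
    then show ?thesis
      by (simp add: scaleC_scaleC mult.assoc[symmetric] flip: scaleC_of_real)
  qed
  ultimately show ?thesis
    by (simp only: laplace_def)
qed

text \<open>Differentiation under the integral over a fixed compact interval.\<close>

lemma holomorphic_on_laplace:
  fixes b :: "real \<Rightarrow> complex"
  assumes b: "supported L b"
  shows "laplace b holomorphic_on S"
proof -
  have cont: "continuous_on T (\<lambda>x. b (snd x))" for T :: "(complex \<times> real) set"
    by (rule supported_compose[OF b]) (auto intro: continuous_intros)
  have "(\<lambda>\<zeta>. integral (cbox (- L) L) (\<lambda>t. exp (- (\<zeta> * of_real t)) * b t)) holomorphic_on UNIV"
  proof (rule leibniz_rule_holomorphic)
    show "((\<lambda>\<zeta>. exp (- (\<zeta> * of_real t)) * b t) has_field_derivative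
        - of_real t * exp (- (\<zeta> * of_real t)) * b t) (at \<zeta> within UNIV)" for \<zeta> t
      by (auto intro!: derivative_eq_intros)
    show "(\<lambda>t. exp (- (\<zeta> * of_real t)) * b t) integrable_on cbox (- L) L" for \<zeta>
      using has_integral_laplace(2)[OF b, of \<zeta>]
      by (auto simp: scaleC_complex_def integrable_on_def)
    show "continuous_on (UNIV \<times> cbox (- L) L) (\<lambda>(\<zeta>, t). - of_real t * exp (- (\<zeta> * of_real t)) * b t)"
      unfolding split_beta by (intro continuous_intros cont)
  qed simp
  moreover have "(\<lambda>\<zeta>. integral (cbox (- L) L) (\<lambda>t. exp (- (\<zeta> * of_real t)) * b t)) = laplace b"
    using integral_unique[OF has_integral_laplace(2)[OF b]] by (auto simp: scaleC_complex_def)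
  ultimately have "laplace b holomorphic_on UNIV"
    by (simp only:)
  then show ?thesis
    by (rule holomorphic_on_subset) simp
qed

text \<open>On the support \<open>t \<ge> p\<close>, so \<open>exp (- (Re \<zeta> * t))\<close> is
  largest at \<open>t = p\<close> when \<open>Re \<zeta> \<ge> 0\<close>.\<close>

lemma laplace_bound:
  fixes b :: "real \<Rightarrow> complex"
  assumes b: "test_function b" and p: "\<And>t. t < p \<Longrightarrow> b t = 0"
  obtains C where "C \<ge> 0" "\<And>\<zeta>. Re \<zeta> \<ge> 0 \<Longrightarrow> norm (laplace b \<zeta>) \<le> C * exp (- (Re \<zeta> * p))"
proof -
  obtain L where L: "L > 0" "supported L b"
    using test_function_supported[OF b] .
  obtain C where C: "C > 0" "\<And>t. norm (b t) \<le> C"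
    using supported_bounded[OF L(2)] by metis
  have "norm (laplace b \<zeta>) \<le> (C * (2 * L)) * exp (- (Re \<zeta> * p))" if "Re \<zeta> \<ge> 0" for \<zeta>
  proof -
    have "norm (laplace b \<zeta>) \<le> (exp (- (Re \<zeta> * p)) * C) * (2 * L)"
    proof (rule norm_laplace_le[OF L(2)])
      show "norm (exp (- (\<zeta> * of_real t)) *\<^sub>C b t) \<le> exp (- (Re \<zeta> * p)) * C" for t
      proof (cases "t < p")
        case True
        then show ?thesis
          using p C(1) by simp
      next
        case False
        then have "exp (- (Re \<zeta> * t)) \<le> exp (- (Re \<zeta> * p))"
          using that by (simp add: mult_left_mono)
        then have "exp (- (Re \<zeta> * t)) * norm (b t) \<le> exp (- (Re \<zeta> * p)) * C"
          using C by (intro mult_mono) auto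
        then show ?thesis
          by (simp add: scaleC_complex_def norm_mult)
      qed
    qed (use L in simp)
    then show ?thesis
      by (simp add: mult_ac)
  qed
  then show ?thesis
    using C L by (intro that[of "C * (2 * L)"]) auto
qed

lemma vderiv_eq_0_lessThan:
  assumes "\<And>t. t < p \<Longrightarrow> f t = 0" "t < p"
  shows "vderiv f t = 0"
proof -
  have "(f has_vector_derivative 0) (at t)"
    by (rule has_vector_derivative_transform_within_open[OF has_vector_derivative_const, of "{..<p}"])
      (use assms in auto)
  then show ?thesis
    by (simp add: vderiv_def vector_derivative_at)
qed

text \<open>Two derivatives multiply the transform by \<open>\<zeta>\<^sup>2\<close> and keep the
  support to the right of \<open>p\<close>. The quadratic decay obtained is what the shift of the
  line requires.\<close>

lemma laplace_quadratic_bound: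
  fixes b :: "real \<Rightarrow> complex"
  assumes b: "test_function b" and p: "\<And>t. t < p \<Longrightarrow> b t = 0"
  obtains C where "C \<ge> 0" "\<And>\<zeta>. Re \<zeta> \<ge> 0 \<Longrightarrow> (cmod \<zeta>)\<^sup>2 * norm (laplace b \<zeta>) \<le> C * exp (- (Re \<zeta> * p))"
proof -
  have 1: "vderiv b t = 0" if "t < p" for t
    by (rule vderiv_eq_0_lessThan[OF p that])
  have 2: "vderiv (vderiv b) t = 0" if "t < p" for t
    by (rule vderiv_eq_0_lessThan[OF 1 that])
  obtain C where C: "C \<ge> 0"
    "\<And>\<zeta>. Re \<zeta> \<ge> 0 \<Longrightarrow> norm (laplace (vderiv (vderiv b)) \<zeta>) \<le> C * exp (- (Re \<zeta> * p))"
    using laplace_bound[OF test_function_vderiv[OF test_function_vderiv[OF b]] 2] by metis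
  have "laplace (vderiv (vderiv b)) \<zeta> = \<zeta> * (\<zeta> * laplace b \<zeta>)" for \<zeta>
    by (simp add: laplace_vderiv b test_function_vderiv scaleC_complex_def)
  then show ?thesis
    using C by (intro that[of C]) (auto simp: norm_mult power2_eq_square mult.assoc)
qed

text \<open>The integral over the segment from \<open>\<nu> - iR\<close> to \<open>\<nu> + iR\<close> is moved to the other three sides
  of the rectangle with corners \<open>\<nu> \<plusminus> iR\<close> and \<open>R \<plusminus> iR\<close>, on which the integrand is \<open>O(1/R\<^sup>2)\<close>.\<close>

lemma integral_vertical_line_eq_0:
  fixes \<Phi> :: "complex \<Rightarrow> complex"
  assumes hol: "\<Phi> holomorphic_on {\<zeta>. Re \<zeta> > s}" and \<nu>: "\<nu> > s" "\<nu> > 0"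
    and bound: "\<And>\<zeta>. Re \<zeta> \<ge> \<nu> \<Longrightarrow> norm (\<Phi> \<zeta>) \<le> C / (cmod \<zeta>)\<^sup>2"
    and int: "integrable lebesgue (\<lambda>x. \<Phi> (\<i> * of_real x + of_real \<nu>))"
  shows "(\<integral>x. \<Phi> (\<i> * of_real x + of_real \<nu>) \<partial>lebesgue) = 0"
proof -
  let ?g = "\<lambda>x. \<Phi> (\<i> * of_real x + of_real \<nu>)"
  let ?H = "{\<zeta>. Re \<zeta> > s}"
  \<comment> \<open>On the convex half-plane \<open>\<Phi>\<close> has a primitive, so integrals
    along the sides become differences of \<open>\<Psi>\<close> at the corners.\<close>
  obtain \<Psi> where \<Psi>: "\<And>z. z \<in> ?H \<Longrightarrow> (\<Psi> has_field_derivative \<Phi> z) (at z within ?H)"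
    using holomorphic_convex_primitive'[OF convex_halfspace_Re_gt open_halfspace_Re_gt hol] by metis
  have \<Psi>': "(\<Psi> has_field_derivative \<Phi> z) (at z)" if "Re z > s" for z
    using \<Psi>[of z] that at_within_open[OF _ open_halfspace_Re_gt[of s], of z] by simp
  have C: "C \<ge> 0"
  proof -
    have "0 \<le> norm (\<Phi> (of_real \<nu>))"
      by simp
    also have "\<dots> \<le> C / (cmod (of_real \<nu>))\<^sup>2"
      by (rule bound) simp
    finally show ?thesis
      using \<nu> by (simp add: zero_le_divide_iff)
  qed
  \<comment> \<open>Mean value estimate on a convex set outside the open disc of radius
    \<open>R\<close>, where the derivative is at most \<open>C / R\<^sup>2\<close>; each of the
    three sides lies in such a set.\<close>
  have edge: "norm (\<Psi> w - \<Psi> z) \<le> C / R\<^sup>2 * norm (w - z)"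
    if "convex S" "S \<subseteq> {z. Re z \<ge> \<nu> \<and> cmod z \<ge> R}" "w \<in> S" "z \<in> S" "R > 0" for S w z R
  proof (rule field_differentiable_bound[OF that(1), of \<Psi> \<Phi>])
    fix z assume "z \<in> S"
    then have z: "Re z \<ge> \<nu>" "cmod z \<ge> R"
      using that(2) by auto
    show "(\<Psi> has_field_derivative \<Phi> z) (at z within S)"
      using \<Psi>'[of z] z \<nu> by (simp add: has_field_derivative_at_within)
    have "norm (\<Phi> z) \<le> C / (cmod z)\<^sup>2"
      using bound z by blast
    also have "\<dots> \<le> C / R\<^sup>2"
      using z \<open>R > 0\<close> C by (intro divide_left_mono power_mono mult_pos_pos) auto
    finally show "norm (\<Phi> z) \<le> C / R\<^sup>2" .
  qed (use that in auto)
  have line: "norm (\<Psi> (\<i> * of_real R + of_real \<nu>) - \<Psi> (\<i> * of_real (- R) + of_real \<nu>)) \<le> 4 * C / R"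
    if R: "R > \<nu>" for R
  proof -
    let ?c = "\<lambda>\<mu> y. \<i> * complex_of_real y + of_real \<mu>"
    have R0: "R > 0"
      using R \<nu> by simp
    have im: "cmod z \<ge> R" if "\<bar>Im z\<bar> \<ge> R" for z
      using that abs_Im_le_cmod[of z] by linarith
    have "norm (\<Psi> (?c \<nu> R) - \<Psi> (?c R R)) \<le> C / R\<^sup>2 * norm (?c \<nu> R - ?c R R)"
      by (rule edge[of "{z. Re z \<ge> \<nu>} \<inter> {z. Im z \<ge> R}"])
        (use R R0 im in \<open>auto intro!: convex_Int convex_halfspace_Re_ge convex_halfspace_Im_ge\<close>)
    moreover have "norm (\<Psi> (?c R R) - \<Psi> (?c R (- R))) \<le> C / R\<^sup>2 * norm (?c R R - ?c R (- R))"
    proof (rule edge[of "{z. Re z \<ge> R}"])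
      show "{z. Re z \<ge> R} \<subseteq> {z. Re z \<ge> \<nu> \<and> cmod z \<ge> R}"
        using R complex_Re_le_cmod order_trans by fastforce
    qed (use R0 in \<open>auto intro: convex_halfspace_Re_ge\<close>)
    moreover have "norm (\<Psi> (?c R (- R)) - \<Psi> (?c \<nu> (- R))) \<le> C / R\<^sup>2 * norm (?c R (- R) - ?c \<nu> (- R))"
      by (rule edge[of "{z. Re z \<ge> \<nu>} \<inter> {z. Im z \<le> - R}"])
        (use R R0 im in \<open>auto intro!: convex_Int convex_halfspace_Re_ge convex_halfspace_Im_le\<close>)
    moreover have "?c \<nu> R - ?c R R = of_real (\<nu> - R)" "?c R R - ?c R (- R) = \<i> * of_real (2 * R)"
      "?c R (- R) - ?c \<nu> (- R) = of_real (R - \<nu>)"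
      by (simp_all add: complex_eq_iff)
    moreover have "norm (\<Psi> (?c \<nu> R) - \<Psi> (?c \<nu> (- R))) \<le> norm (\<Psi> (?c \<nu> R) - \<Psi> (?c R R))
        + norm (\<Psi> (?c R R) - \<Psi> (?c R (- R))) + norm (\<Psi> (?c R (- R)) - \<Psi> (?c \<nu> (- R)))"
      using norm_triangle_ineq[of "\<Psi> (?c \<nu> R) - \<Psi> (?c R R) + (\<Psi> (?c R R) - \<Psi> (?c R (- R)))" "\<Psi> (?c R (- R)) - \<Psi> (?c \<nu> (- R))"]
        norm_triangle_ineq[of "\<Psi> (?c \<nu> R) - \<Psi> (?c R R)" "\<Psi> (?c R R) - \<Psi> (?c R (- R))"] by simp
    \<comment> \<open>The three sides have lengths \<open>R - \<nu>\<close>, \<open>2 * R\<close>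
      and \<open>R - \<nu>\<close>, together at most \<open>4 * R\<close>.\<close>
    ultimately have "norm (\<Psi> (?c \<nu> R) - \<Psi> (?c \<nu> (- R))) \<le> C / R\<^sup>2 * (R - \<nu>) + C / R\<^sup>2 * (2 * R) + C / R\<^sup>2 * (R - \<nu>)"
      using R R0 by (simp only: norm_of_real norm_mult norm_ii) simp
    also have "\<dots> \<le> C / R\<^sup>2 * R + C / R\<^sup>2 * (2 * R) + C / R\<^sup>2 * R"
      using C \<nu> by (intro add_mono mult_left_mono) auto
    also have "\<dots> = 4 * C / R"
      using R0 by (simp add: power2_eq_square field_simps)
    finally show ?thesis .
  qed
  \<comment> \<open>Along the line \<open>d\<zeta> = \<i> dx\<close>, hence the division by
    \<open>\<i>\<close>.\<close>
  have eq: "(\<integral>x. indicat_real {- R..R} x *\<^sub>R ?g x \<partial>lebesgue)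
      = (\<Psi> (\<i> * of_real R + of_real \<nu>) - \<Psi> (\<i> * of_real (- R) + of_real \<nu>)) / \<i>" if "R > 0" for R
  proof -
    have "((\<lambda>x. \<Psi> (\<i> * of_real x + of_real \<nu>) / \<i>) has_vector_derivative ?g x) (at x within {- R..R})" for x
    proof -
      have "((\<lambda>z. \<Psi> (\<i> * z + of_real \<nu>) / \<i>) has_field_derivative \<Phi> (\<i> * of_real x + of_real \<nu>)) (at (of_real x))"
        using \<nu> by (auto intro!: derivative_eq_intros DERIV_chain2[OF \<Psi>'] simp: mult.assoc)
      from has_vector_derivative_real_field[OF this] show ?thesis .
    qed
    then have "(?g has_integral (\<Psi> (\<i> * of_real R + of_real \<nu>) / \<i> - \<Psi> (\<i> * of_real (- R) + of_real \<nu>) / \<i>)) {- R..R}"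
      using that by (intro fundamental_theorem_of_calculus) auto
    then have "((\<lambda>x. if x \<in> {- R..R} then ?g x else 0) has_integral
        (\<Psi> (\<i> * of_real R + of_real \<nu>) / \<i> - \<Psi> (\<i> * of_real (- R) + of_real \<nu>) / \<i>)) UNIV"
      by (simp only: has_integral_restrict_UNIV)
    moreover have "(\<lambda>x. if x \<in> {- R..R} then ?g x else 0) = (\<lambda>x. indicat_real {- R..R} x *\<^sub>R ?g x)"
      by (auto simp: indicator_def)
    ultimately have "((\<lambda>x. indicat_real {- R..R} x *\<^sub>R ?g x) has_integral
        (\<Psi> (\<i> * of_real R + of_real \<nu>) / \<i> - \<Psi> (\<i> * of_real (- R) + of_real \<nu>) / \<i>)) UNIV"
      by (simp only:)
    moreover have "integrable lebesgue (\<lambda>x. indicat_real {- R..R} x *\<^sub>R ?g x)"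
      by (rule integrable_mult_indicator[OF _ int]) simp
    ultimately show ?thesis
      unfolding diff_divide_distrib using has_integral_unique[OF has_integral_integral_lebesgue] by blast
  qed
  have "(\<lambda>n. \<integral>x. indicat_real {- real n..real n} x *\<^sub>R ?g x \<partial>lebesgue) \<longlonglongrightarrow> (\<integral>x. ?g x \<partial>lebesgue)"
  proof (rule integral_dominated_convergence[OF _ _ integrable_norm[OF int]])
    show "(\<lambda>x. indicat_real {- real n..real n} x *\<^sub>R ?g x) \<in> borel_measurable lebesgue" for n
      using int by (intro borel_measurable_scaleR borel_measurable_indicator) auto
    have "(\<lambda>n. indicat_real {- real n..real n} x *\<^sub>R ?g x) \<longlonglongrightarrow> ?g x" for x
    proof (rule tendsto_eventually)
      show "\<forall>\<^sub>F n in sequentially. indicat_real {- real n..real n} x *\<^sub>R ?g x = ?g x"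
        using eventually_ge_at_top[of "nat \<lceil>\<bar>x\<bar>\<rceil>"]
        by eventually_elim (auto simp: indicator_def abs_le_iff nat_le_iff ceiling_le_iff)
    qed
    then show "AE x in lebesgue. (\<lambda>n. indicat_real {- real n..real n} x *\<^sub>R ?g x) \<longlonglongrightarrow> ?g x"
      by simp
    show "AE x in lebesgue. norm (indicat_real {- real n..real n} x *\<^sub>R ?g x) \<le> norm (?g x)" for n
      by (auto simp: indicator_def)
  qed (use int in auto)
  moreover have "(\<lambda>n. \<integral>x. indicat_real {- real n..real n} x *\<^sub>R ?g x \<partial>lebesgue) \<longlonglongrightarrow> 0"
  proof (rule Lim_null_comparison)
    show "(\<lambda>n. 4 * C / real n) \<longlonglongrightarrow> 0"
      by (rule lim_const_over_n)
    show "\<forall>\<^sub>F n in sequentially. norm (\<integral>x. indicat_real {- real n..real n} x *\<^sub>R ?g x \<partial>lebesgue) \<le> 4 * C / real n"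
      using eventually_gt_at_top[of "nat \<lceil>\<nu>\<rceil>"]
    proof eventually_elim
      case (elim n)
      then have n: "real n > \<nu>"
        by linarith
      then have "real n > 0"
        using \<nu> by linarith
      then show ?case
        using line[OF n] by (simp only: eq norm_divide norm_ii div_by_1)
    qed
  qed
  ultimately show ?thesis
    by (rule LIMSEQ_unique)
qed

context evolutionary_system
begin

text \<open>By Plancherel the inner product is an integral over frequencies whose integrand extends
  holomorphically to a half-plane. The supports contribute exponentials with product
  \<open>exp (Re \<zeta> * (q' - p))\<close>, at most \<open>1\<close> because
  \<open>q' \<le> a \<le> p\<close>, and this permits the shift of the line.\<close>

lemma cinner_solution_bump_eq_0:
  assumes pq: "{p..q} \<subseteq> {a..}" and pq': "{p'..q'} \<subseteq> {..a}"
  shows "cinner (abs_L2 (\<lambda>t. bump n' p' q' t *\<^sub>R e)) (solution (abs_L2 (\<lambda>t. bump n p q t *\<^sub>R v))) = 0"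
proof (cases "p \<le> q \<and> p' \<le> q'")
  \<comment> \<open>One of the intervals is empty and its bump is zero; only for nonempty intervals
    do the inclusions compare \<open>q'\<close> with \<open>p\<close>.\<close>
  case False
  have "(\<lambda>t. bump n p q t *\<^sub>R v) = (\<lambda>t. 0) \<or> (\<lambda>t. bump n' p' q' t *\<^sub>R e) = (\<lambda>t. 0)"
    using False bump_eq_0[of _ p q n] bump_eq_0[of _ p' q' n'] by auto
  moreover have "solution 0 = 0"
    by (rule linear_0[OF bounded_linear.linear[OF bounded_linear_solution]])
  moreover have "abs_L2 (\<lambda>t. 0 :: 'a) = 0"
    by (simp add: zero_L2_def)
  ultimately show ?thesis
    by (auto simp: cinner.zero_left cinner.zero_right)
next
  case True
  then have ap: "q' \<le> p"
    using pq pq' by auto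
  let ?b1 = "bump n' p' q'" and ?b2 = "bump n p q"
  \<comment> \<open>The first bump stands in the conjugate-linear argument. Conjugating its
    transform at \<open>\<i> x\<close> gives the transform of the reflected bump there, which is
    holomorphic instead of antiholomorphic. The factors \<open>exp (\<nu> * t)\<close> move the
    argument to \<open>\<i> x + \<nu>\<close>.\<close>
  define \<beta>1 where "\<beta>1 t = complex_of_real (exp (\<nu> * t) * ?b1 (- t))" for t
  define \<beta>2 where "\<beta>2 t = complex_of_real (exp (\<nu> * t) * ?b2 t)" for t
  have t1: "test_function \<beta>1" and t2: "test_function \<beta>2" and t0: "test_function (\<lambda>t. complex_of_real (exp (0 * t) * ?b1 t))"
  proof -
    have exp: "test_function (\<lambda>t. complex_of_real (exp (a * t) * b t))" if "test_function b" for a b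
      using test_function_bounded_linear[OF bounded_linear_of_real test_function_exp[OF that, of a]]
      by (simp only: real_scaleR_def)
    show "test_function \<beta>1" "test_function \<beta>2" "test_function (\<lambda>t. complex_of_real (exp (0 * t) * ?b1 t))"
      unfolding \<beta>1_def[abs_def] \<beta>2_def[abs_def]
      by (intro exp test_function_reflect test_function_bump)+
  qed
  obtain L1 where L1: "supported L1 \<beta>1"
    using test_function_supported[OF t1] .
  obtain L2 where L2: "supported L2 \<beta>2"
    using test_function_supported[OF t2] .
  obtain L0 where L0: "supported L0 (\<lambda>t. complex_of_real (exp (0 * t) * ?b1 t))"
    using test_function_supported[OF t0] .
  \<comment> \<open>Reflection turns the upper end \<open>q'\<close> of the support into the lower
    end \<open>- q'\<close>.\<close>
  have b10: "\<beta>1 t = 0" if "t < - q'" for t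
    using that by (auto simp: \<beta>1_def intro!: bump_eq_0)
  have b20: "\<beta>2 t = 0" if "t < p" for t
    using that by (auto simp: \<beta>2_def intro!: bump_eq_0)
  obtain C1 where C1: "C1 \<ge> 0" "\<And>\<zeta>. Re \<zeta> \<ge> 0 \<Longrightarrow> norm (laplace \<beta>1 \<zeta>) \<le> C1 * exp (- (Re \<zeta> * (- q')))"
    using laplace_bound[OF t1 b10] by metis
  obtain C2 where C2: "C2 \<ge> 0" "\<And>\<zeta>. Re \<zeta> \<ge> 0 \<Longrightarrow> (cmod \<zeta>)\<^sup>2 * norm (laplace \<beta>2 \<zeta>) \<le> C2 * exp (- (Re \<zeta> * p))"
    using laplace_quadratic_bound[OF t2 b20] by metis
  define \<Phi> where "\<Phi> \<zeta> = laplace \<beta>1 \<zeta> * laplace \<beta>2 \<zeta> * cinner e (resolvent \<zeta> v)" for \<zeta>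
  have lap2: "laplace (\<lambda>t. ?b2 t *\<^sub>R v) (\<i> * of_real x) = laplace \<beta>2 (frequency x) *\<^sub>C v" for x
    unfolding \<beta>2_def[abs_def] by (rule laplace_scaleR_vector[OF L2[unfolded \<beta>2_def[abs_def]]])
  have hat2: "hat (\<lambda>t. ?b2 t *\<^sub>R v) x = (of_real (1 / sqrt (2 * pi)) * laplace \<beta>2 (frequency x)) *\<^sub>C v" for x
    by (simp only: hat_def lap2 scaleC_scaleC scaleC_of_real[symmetric, of "1 / sqrt (2 * pi)"])
  have hat1: "cinner (hat (\<lambda>t. ?b1 t *\<^sub>R e) x) w = of_real (1 / sqrt (2 * pi)) * laplace \<beta>1 (frequency x) * cinner e w" for x w
  proof -
    have L0': "supported L0 (\<lambda>t. complex_of_real (?b1 t))"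
      using L0 by simp
    have "laplace (\<lambda>t. ?b1 t *\<^sub>R e) (\<i> * of_real x) = laplace (\<lambda>t. complex_of_real (?b1 t)) (\<i> * of_real x) *\<^sub>C e"
      using laplace_scaleR_vector[OF L0, of e "\<i> * of_real x"] by simp
    then have "cinner (hat (\<lambda>t. ?b1 t *\<^sub>R e) x) w
        = of_real (1 / sqrt (2 * pi)) * cnj (laplace (\<lambda>t. complex_of_real (?b1 t)) (\<i> * of_real x)) * cinner e w"
      by (simp add: hat_def cinner.scaleR_left cinner_scaleC_left scaleR_conv_of_real mult.assoc)
    also have "cnj (laplace (\<lambda>t. complex_of_real (?b1 t)) (\<i> * of_real x)) = laplace (\<lambda>t. complex_of_real (?b1 (- t))) (\<i> * of_real x)"
      by (simp add: cnj_laplace laplace_reflect[OF L0'])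
    also have "\<dots> = laplace \<beta>1 (frequency x)"
      using laplace_scaleR_vector[OF L1[unfolded \<beta>1_def[abs_def]], of "1 :: complex" "\<i> * of_real x"]
      by (simp add: \<beta>1_def[abs_def] scaleC_complex_def scaleR_conv_of_real)
    finally show ?thesis .
  qed
  have W: "hat (\<lambda>t. ?b1 t *\<^sub>R e) \<in> wspace 0" "hat (\<lambda>t. ?b2 t *\<^sub>R v) \<in> wspace 0"
    by (intro hat_wspace_0 test_function_scaleR_const test_function_bump)+
  have RW: "(\<lambda>x. resolvent (frequency x) (hat (\<lambda>t. ?b2 t *\<^sub>R v) x)) \<in> wspace 0"
    by (rule bounded_symbol_wspace_0[OF bounded_symbol_resolvent W(2)])
  have pointwise: "cinner (hat (\<lambda>t. ?b1 t *\<^sub>R e) x) (resolvent (frequency x) (hat (\<lambda>t. ?b2 t *\<^sub>R v) x))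
      = of_real (1 / (2 * pi)) * \<Phi> (frequency x)" for x
  proof -
    have "complex_of_real (1 / sqrt (2 * pi)) * of_real (1 / sqrt (2 * pi)) = of_real (1 / (2 * pi))"
      by (simp flip: of_real_mult)
    moreover have "resolvent (frequency x) (b *\<^sub>C w) = b *\<^sub>C resolvent (frequency x) w" for b w
      using complex_linear_resolvent[OF Re_frequency, of x] by (simp add: complex_linear_def)
    ultimately show ?thesis
      unfolding hat1 hat2 \<Phi>_def by (simp add: cinner_scaleC_right mult_ac)
  qed
  have "cinner (abs_L2 (\<lambda>t. ?b1 t *\<^sub>R e)) (solution (abs_L2 (\<lambda>t. ?b2 t *\<^sub>R v)))
      = cinner (fourier_op (abs_L2 (\<lambda>t. ?b1 t *\<^sub>R e))) (fourier_op (solution (abs_L2 (\<lambda>t. ?b2 t *\<^sub>R v))))"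
    by simp
  also have "\<dots> = cinner (abs_L2 (hat (\<lambda>t. ?b1 t *\<^sub>R e)))
      (abs_L2 (\<lambda>x. resolvent (frequency x) (hat (\<lambda>t. ?b2 t *\<^sub>R v) x)))"
    unfolding solution_def fourier_op_inv
    by (simp only: fourier_op_test_function test_function_scaleR_const test_function_bump
        mult_L2_abs_L2[OF bounded_symbol_resolvent W(2)])
  also have "\<dots> = (\<integral>x. of_real (1 / (2 * pi)) * \<Phi> (frequency x) \<partial>lebesgue)"
    by (simp only: cinner_abs_L2[OF W(1) RW] pointwise)
  also have "\<dots> = of_real (1 / (2 * pi)) * (\<integral>x. \<Phi> (frequency x) \<partial>lebesgue)"
    by (rule integral_mult_right_zero)
  also have "(\<integral>x. \<Phi> (frequency x) \<partial>lebesgue) = 0"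
  proof (rule integral_vertical_line_eq_0[OF _ \<nu> \<nu>_pos])
    show "\<Phi> holomorphic_on {\<zeta>. Re \<zeta> > 1 / (2 * r)}"
      unfolding \<Phi>_def[abs_def]
      by (intro holomorphic_intros holomorphic_on_laplace[OF L1] holomorphic_on_laplace[OF L2]
          holomorphic_on_resolvent order_refl)
    have "integrable lebesgue (\<lambda>x. of_real (2 * pi) * (of_real (1 / (2 * pi)) * \<Phi> (frequency x)))"
      using integrable_wspace_0_cinner[OF W(1) RW] unfolding pointwise by (rule integrable_mult_right)
    then show "integrable lebesgue (\<lambda>x. \<Phi> (frequency x))"
      by simp
    fix \<zeta> assume \<zeta>: "Re \<zeta> \<ge> \<nu>"
    have Re: "Re \<zeta> \<ge> 0" "Re \<zeta> > 1 / (2 * r)"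
      using \<zeta> \<nu> \<nu>_pos by linarith+
    have cm: "cmod \<zeta> > 0"
      using \<zeta> \<nu>_pos complex_Re_le_cmod[of \<zeta>] by linarith
    have "norm (resolvent \<zeta> v) \<le> 1 / c * norm v"
      using norm_blinfun[of "resolvent \<zeta>" v] norm_resolvent[OF Re(2)]
      by (meson mult_right_mono norm_ge_zero order_trans)
    then have R: "norm (cinner e (resolvent \<zeta> v)) \<le> norm e * (1 / c * norm v)"
      using cmod_cinner_le[of e "resolvent \<zeta> v"] by (meson mult_left_mono norm_ge_zero order_trans)
    have "exp (- (Re \<zeta> * (- q'))) * exp (- (Re \<zeta> * p)) = exp (Re \<zeta> * (q' - p))"
      by (simp add: algebra_simps flip: exp_add)
    also have "\<dots> \<le> 1"
      using ap Re by (simp add: mult_nonneg_nonpos)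
    finally have ex: "exp (- (Re \<zeta> * (- q'))) * exp (- (Re \<zeta> * p)) \<le> 1" .
    have "(cmod \<zeta>)\<^sup>2 * norm (\<Phi> \<zeta>) = norm (laplace \<beta>1 \<zeta>) * ((cmod \<zeta>)\<^sup>2 * norm (laplace \<beta>2 \<zeta>)) * norm (cinner e (resolvent \<zeta> v))"
      by (simp add: \<Phi>_def norm_mult mult_ac)
    also have "\<dots> \<le> (C1 * exp (- (Re \<zeta> * (- q')))) * (C2 * exp (- (Re \<zeta> * p))) * (norm e * (1 / c * norm v))"
      by (rule mult_mono[OF mult_mono[OF C1(2)[OF Re(1)] C2(2)[OF Re(1)]] R]) (use C1(1) C2(1) in auto)
    also have "\<dots> = (C1 * C2 * (norm e * (1 / c * norm v))) * (exp (- (Re \<zeta> * (- q'))) * exp (- (Re \<zeta> * p)))"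
      by (simp only: mult_ac)
    also have "\<dots> \<le> C1 * C2 * (norm e * (1 / c * norm v))"
      using ex C1(1) C2(1) c by (intro mult_left_le) auto
    finally show "norm (\<Phi> \<zeta>) \<le> (C1 * C2 * (norm e * (1 / c * norm v))) / (cmod \<zeta>)\<^sup>2"
      using cm by (subst pos_le_divide_eq) (simp_all only: mult.commute zero_less_power)
  qed
  finally show ?thesis
    by simp
qed

text \<open>Density extends the orthogonality of bumps to all sources vanishing up to
  \<open>a\<close> and all test elements living there. The restriction of the solution to times up
  to \<open>a\<close> is such a test element, hence orthogonal to itself.\<close>

lemma solution_eq_0:
  assumes y: "AE t in lebesgue. t \<le> a \<longrightarrow> rep_L2 y t = 0"
  shows "AE t in lebesgue. t \<le> a \<longrightarrow> rep_L2 (solution y) t = 0"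
proof -
  have yc: "y \<in> closure (bump_span {a..})"
    using closure_bump_span_atLeast[OF rep_L2_wspace y] by simp
  note bl = bounded_linear_solution
  have step: "cinner (abs_L2 (\<lambda>t. bump n' p' q' t *\<^sub>R e)) (solution y) = 0"
    if "{p'..q'} \<subseteq> {..a}" for n' p' q' e
  proof (rule closure_bump_span_induct[OF yc,
        where P = "\<lambda>y. cinner (abs_L2 (\<lambda>t. bump n' p' q' t *\<^sub>R e)) (solution y) = 0"])
    note bl' = bounded_linear_compose[OF cinner.bounded_linear_right bl]
    show "subspace {y. cinner (abs_L2 (\<lambda>t. bump n' p' q' t *\<^sub>R e)) (solution y) = 0}"
      by (intro subspace_Collect_linear_eq bounded_linear.linear bl' bounded_linear_zero)
    show "closed {y. cinner (abs_L2 (\<lambda>t. bump n' p' q' t *\<^sub>R e)) (solution y) = 0}"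
      by (intro closed_Collect_eq linear_continuous_on[OF bl'] continuous_on_const)
  qed (rule cinner_solution_bump_eq_0[OF _ that])
  define s where "s = rep_L2 (solution y)"
  define x where "x t = indicat_real {..a} t *\<^sub>R s t" for t
  have sW: "s \<in> wspace 0"
    by (simp add: s_def rep_L2_wspace)
  have xW: "x \<in> wspace 0"
  proof (rule wspace_0_dominated[OF _ sW, where C = 1])
    show "strongly_measurable x"
      unfolding x_def using sW
      by (intro strongly_measurable_scaleR borel_measurable_indicator) (auto simp: wspace_0)
  qed (auto simp: x_def indicator_def)
  have "abs_L2 x \<in> closure (bump_span {..a})"
    by (rule closure_bump_span_atMost[OF xW]) (auto simp: x_def)
  then have "cinner (abs_L2 x) (solution y) = 0"
  proof (rule closure_bump_span_induct[where P = "\<lambda>x. cinner x (solution y) = 0"])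
    note bl' = cinner.bounded_linear_left[of "solution y"]
    show "subspace {x. cinner x (solution y) = 0}"
      by (intro subspace_Collect_linear_eq bounded_linear.linear bl' bounded_linear_zero)
    show "closed {x. cinner x (solution y) = 0}"
      by (intro closed_Collect_eq linear_continuous_on[OF bl'] continuous_on_const)
  qed (rule step)
  moreover have "cinner (abs_L2 x) (abs_L2 s) = cinner (abs_L2 x) (abs_L2 x)"
    unfolding cinner_abs_L2[OF xW sW] cinner_abs_L2[OF xW xW]
    by (intro Bochner_Integration.integral_cong refl)
      (simp add: x_def indicator_def cinner.zero_left)
  ultimately have "abs_L2 x = 0"
    by (simp add: s_def cinner_self)
  then have "AE t in lebesgue. x t = 0"
    using abs_L2_eq_iff[OF xW wspace_0_zero] by (simp add: zero_L2_def)
  then show ?thesis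
    by eventually_elim (auto simp: x_def s_def indicator_def split: if_splits)
qed

lemma cutoff_exists: "f \<in> wspace \<nu> \<Longrightarrow> (\<lambda>t. indicat_real {..a} t *\<^sub>R f t) \<in> wspace \<nu>"
proof -
  assume f: "f \<in> wspace \<nu>"
  have "(\<lambda>t. indicat_real {..a} t *\<^sub>R exp (- \<nu> * t) *\<^sub>R f t) \<in> wspace 0"
  proof (rule wspace_0_dominated[where C = 1])
    show W: "(\<lambda>t. exp (- \<nu> * t) *\<^sub>R f t) \<in> wspace 0"
      using f by (simp add: wspace_iff_wspace_0[of _ \<nu>])
    show "strongly_measurable (\<lambda>t. indicat_real {..a} t *\<^sub>R exp (- \<nu> * t) *\<^sub>R f t)"
      by (rule strongly_measurable_scaleR[OF borel_measurable_indicator W[unfolded wspace_0, THEN conjunct1]])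
        simp
  qed (auto simp: indicator_def)
  then show ?thesis
    by (simp add: wspace_iff_wspace_0[of _ \<nu>] mult.commute)
qed

text \<open>By linearity only the difference of a source and its cutoff matters; it vanishes up to
  \<open>a\<close>, so the two solutions agree there. What remains is to pass between
  representatives in the composed relations.\<close>

lemma causal_solution: "causal \<nu> (wclosure \<nu> (system\<inverse>))"
  unfolding causal_def
proof
  fix a
  let ?S = "wclosure \<nu> (system\<inverse>)"
  have key: "AE t in lebesgue. t \<le> a \<longrightarrow> g t = g' t"
    if "(f, g) \<in> ?S" "(f', g') \<in> ?S" "(f, f') \<in> cutoff \<nu> a" for f g f' g'
  proof -
    have W: "f \<in> wspace \<nu>" "g \<in> wspace \<nu>" "f' \<in> wspace \<nu>" "g' \<in> wspace \<nu>"
      and sol: "weighted \<nu> g = solution (weighted \<nu> f)" "weighted \<nu> g' = solution (weighted \<nu> f')"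
      using that(1,2) by (simp_all add: wclosure_converse_system_iff)
    have "AE t in lebesgue. f' t = indicat_real {..a} t *\<^sub>R f t"
      using that(3) by (simp add: cutoff_def)
    then have "AE t in lebesgue. t \<le> a \<longrightarrow> rep_L2 (weighted \<nu> (\<lambda>t. f t - f' t)) t = 0"
      using rep_weighted[OF wspace_diff[OF W(1,3)]] by eventually_elim auto
    from solution_eq_0[OF this]
    have "AE t in lebesgue. t \<le> a \<longrightarrow> rep_L2 (weighted \<nu> (\<lambda>t. g t - g' t)) t = 0"
      by (simp add: weighted_diff W sol linear_diff[OF bounded_linear.linear[OF bounded_linear_solution]])
    then show ?thesis
      using rep_weighted[OF wspace_diff[OF W(2,4)]] by eventually_elim auto
  qed
  have total: "\<exists>g. (f, g) \<in> ?S" if "f \<in> wspace \<nu>" for f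
    using that by (intro exI[of _ "unweighted \<nu> (solution (weighted \<nu> f))"])
      (simp add: wclosure_converse_system_iff unweighted_wspace)
  have SW: "f \<in> wspace \<nu>" "g \<in> wspace \<nu>" if "(f, g) \<in> ?S" for f g
    using that by (simp_all add: wclosure_converse_system_iff)
  show "cutoff \<nu> a O ?S O cutoff \<nu> a = ?S O cutoff \<nu> a"
  proof (intro equalityI subrelI)
    fix f h assume "(f, h) \<in> cutoff \<nu> a O ?S O cutoff \<nu> a"
    then obtain f' g' where f': "(f, f') \<in> cutoff \<nu> a" "(f', g') \<in> ?S" "(g', h) \<in> cutoff \<nu> a"
      by blast
    obtain g where g: "(f, g) \<in> ?S"
      using total f'(1) by (auto simp: cutoff_def)
    have "AE t in lebesgue. h t = indicat_real {..a} t *\<^sub>R g' t"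
      using f'(3) by (simp add: cutoff_def)
    then have "AE t in lebesgue. h t = indicat_real {..a} t *\<^sub>R g t"
      using key[OF g f'(2,1)] by eventually_elim (auto simp: indicator_def)
    then have "(g, h) \<in> cutoff \<nu> a"
      using f'(3) SW(2)[OF g] by (simp add: cutoff_def)
    with g show "(f, h) \<in> ?S O cutoff \<nu> a"
      by blast
  next
    fix f h assume "(f, h) \<in> ?S O cutoff \<nu> a"
    then obtain g where g: "(f, g) \<in> ?S" "(g, h) \<in> cutoff \<nu> a"
      by blast
    define f' where "f' t = indicat_real {..a} t *\<^sub>R f t" for t
    have f': "(f, f') \<in> cutoff \<nu> a"
      using cutoff_exists[OF SW(1)[OF g(1)]] SW(1)[OF g(1)] by (simp add: cutoff_def f'_def[abs_def])
    then obtain g' where g': "(f', g') \<in> ?S"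
      using total by (auto simp: cutoff_def)
    have "AE t in lebesgue. h t = indicat_real {..a} t *\<^sub>R g t"
      using g(2) by (simp add: cutoff_def)
    then have "AE t in lebesgue. h t = indicat_real {..a} t *\<^sub>R g' t"
      using key[OF g(1) g' f'] by eventually_elim (auto simp: indicator_def)
    then have "(g', h) \<in> cutoff \<nu> a"
      using g(2) SW(2)[OF g'] by (simp add: cutoff_def)
    with f' g' show "(f, h) \<in> cutoff \<nu> a O ?S O cutoff \<nu> a"
      by blast
  qed
qed

end

section \<open>Well-posedness of control systems\<close>

lemma block_op_apply:
  "block_op A B C D (p, y) = (A p + B y, C p + D y)"
  by (simp add: block_op_def column_op.rep_eq row_op.rep_eq)

text \<open>Placing an operator in the upper left corner is bounded and complex linear, so complex
  differentiability of \<open>K\<close> passes to the block operator.\<close>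

lemma bounded_linear_block_op_corner:
  "bounded_linear (\<lambda>T :: 'a::complex_hilbert \<Rightarrow>\<^sub>L 'a. block_op T 0 0 (0 :: 'b::complex_hilbert \<Rightarrow>\<^sub>L 'b))"
proof (rule bounded_linear_intro[where K = 1])
  show "block_op (S + T) 0 0 0 = block_op S 0 0 0 + block_op T 0 0 0" for S T :: "'a \<Rightarrow>\<^sub>L 'a"
    by (rule blinfun_eqI) (simp add: block_op_apply blinfun.add_left split_paired_all)
  show "block_op (a *\<^sub>R T) 0 0 0 = a *\<^sub>R block_op T 0 0 0" for a and T :: "'a \<Rightarrow>\<^sub>L 'a"
    by (rule blinfun_eqI) (simp add: block_op_apply blinfun.scaleR_left split_paired_all)
  show "norm (block_op T 0 0 (0 :: 'b \<Rightarrow>\<^sub>L 'b)) \<le> norm T * 1" for T :: "'a \<Rightarrow>\<^sub>L 'a"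
  proof (rule norm_blinfun_bound)
    fix z :: "'a \<times> 'b"
    have "norm (block_op T 0 0 0 z) = norm (T (fst z))"
      by (cases z) (simp add: block_op_apply norm_prod_def)
    also have "\<dots> \<le> norm T * norm (fst z)"
      by (rule norm_blinfun)
    also have "\<dots> \<le> norm T * 1 * norm z"
      using norm_fst_le[of "fst z" "snd z"] by (simp add: mult_left_mono)
    finally show "norm (block_op T 0 0 0 z) \<le> norm T * 1 * norm z" .
  qed simp
qed

lemma block_op_corner_scaleC:
  "block_op (a *\<^sub>C T :: 'a::complex_hilbert \<Rightarrow>\<^sub>L 'a) 0 0 (0 :: 'b::complex_hilbert \<Rightarrow>\<^sub>L 'b) = a *\<^sub>C block_op T 0 0 0"
  by (rule blinfun_eqI) (simp add: block_op_apply scaleC_blinfun.rep_eq split_paired_all scaleC_prod_def)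

text \<open>The off-diagonal blocks contribute \<open>2 * (J y \<bullet> p)\<close>, which explains
  the form of \<open>J\<close>. The inequality \<open>2 |p| |y| \<le> \<delta> |p|\<^sup>2 +
  |y|\<^sup>2 / \<delta>\<close> distributes this term over the two diagonal ones.\<close>

lemma accretive_block_op:
  fixes K :: "('h0::complex_hilbert \<times> 'h1::complex_hilbert) \<Rightarrow>\<^sub>L ('h0 \<times> 'h1)"
    and M102 :: "'y::complex_hilbert \<Rightarrow>\<^sub>L 'h0" and M112 :: "'y \<Rightarrow>\<^sub>L 'h1"
    and M120 :: "'h0 \<Rightarrow>\<^sub>L 'y" and M121 :: "'h1 \<Rightarrow>\<^sub>L 'y" and M122 :: "'y \<Rightarrow>\<^sub>L 'y"
  assumes M1: "complex_linear M120" "complex_linear M121"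
    and J: "J = (1 / 2) *\<^sub>R column_op (M102 + adj M120) (M112 + adj M121)"
    and K: "Re_ge K c0" and M122: "Re_ge M122 c1" and \<delta>: "\<delta> > 0"
  shows "block_op K (column_op M102 M112) (row_op M120 M121) M122 w \<bullet> w
    \<ge> min (c0 - \<delta> * norm J) (c1 - 1 / \<delta> * norm J) * (norm w)\<^sup>2"
proof -
  obtain p y where w: "w = (p, y)"
    by (cases w)
  obtain p0 p1 where p: "p = (p0, p1)"
    by (cases p)
  have Kp: "K p \<bullet> p \<ge> c0 * (norm p)\<^sup>2" and My: "M122 y \<bullet> y \<ge> c1 * (norm y)\<^sup>2"
    using K M122 unfolding Re_ge_def Re_cinner by blast+
  have adj: "M120 p0 \<bullet> y = p0 \<bullet> adj M120 y" "M121 p1 \<bullet> y = p1 \<bullet> adj M121 y"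
    using cinner_adj[OF M1(1), of p0 y] cinner_adj[OF M1(2), of p1 y] by (simp_all flip: Re_cinner)
  have "block_op K (column_op M102 M112) (row_op M120 M121) M122 w \<bullet> w
      = K p \<bullet> p + column_op M102 M112 y \<bullet> p + row_op M120 M121 p \<bullet> y + M122 y \<bullet> y"
    by (simp add: w block_op_apply inner_prod_def inner_add_left)
  \<comment> \<open>The adjoints move the lower row across the inner product, so that both
    off-diagonal blocks act on \<open>y\<close> and add up to \<open>2 * J\<close>.\<close>
  moreover have "column_op M102 M112 y \<bullet> p + row_op M120 M121 p \<bullet> y = 2 * (J y \<bullet> p)"
    by (simp add: J p column_op.rep_eq row_op.rep_eq inner_prod_def blinfun.scaleR_left
        blinfun.add_left inner_add_left inner_add_right add_divide_distrib adj inner_commute[of _ p0] inner_commute[of _ p1])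
  ultimately have eq: "block_op K (column_op M102 M112) (row_op M120 M121) M122 w \<bullet> w
      = K p \<bullet> p + 2 * (J y \<bullet> p) + M122 y \<bullet> y"
    by simp
  have "2 * norm p * norm y \<le> \<delta> * (norm p)\<^sup>2 + 1 / \<delta> * (norm y)\<^sup>2"
  proof -
    have "0 \<le> (\<delta> * norm p - norm y)\<^sup>2 / \<delta>"
      using \<delta> by simp
    also have "\<dots> = \<delta> * (norm p)\<^sup>2 + 1 / \<delta> * (norm y)\<^sup>2 - 2 * norm p * norm y"
      using \<delta> by (simp add: power2_diff field_simps power2_eq_square)
    finally show ?thesis
      by simp
  qed
  then have "norm J * (2 * norm p * norm y) \<le> norm J * (\<delta> * (norm p)\<^sup>2 + 1 / \<delta> * (norm y)\<^sup>2)"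
    by (rule mult_left_mono) simp
  moreover have "- (J y \<bullet> p) \<le> norm J * norm y * norm p"
  proof -
    have "- (J y \<bullet> p) \<le> norm (J y) * norm p"
      using Cauchy_Schwarz_ineq2[of "J y" p] by linarith
    also have "\<dots> \<le> norm J * norm y * norm p"
      by (intro mult_right_mono norm_blinfun) simp
    finally show ?thesis .
  qed
  ultimately have "2 * (J y \<bullet> p) \<ge> - (norm J * (\<delta> * (norm p)\<^sup>2 + 1 / \<delta> * (norm y)\<^sup>2))"
    by (simp add: mult_ac)
  then have "block_op K (column_op M102 M112) (row_op M120 M121) M122 w \<bullet> w
      \<ge> (c0 - \<delta> * norm J) * (norm p)\<^sup>2 + (c1 - 1 / \<delta> * norm J) * (norm y)\<^sup>2"
    using Kp My by (simp add: eq algebra_simps)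
  moreover have "(c0 - \<delta> * norm J) * (norm p)\<^sup>2 \<ge> min (c0 - \<delta> * norm J) (c1 - 1 / \<delta> * norm J) * (norm p)\<^sup>2"
    "(c1 - 1 / \<delta> * norm J) * (norm y)\<^sup>2 \<ge> min (c0 - \<delta> * norm J) (c1 - 1 / \<delta> * norm J) * (norm y)\<^sup>2"
    by (intro mult_right_mono; simp)+
  moreover have "(norm w)\<^sup>2 = (norm p)\<^sup>2 + (norm y)\<^sup>2"
    by (simp add: w norm_Pair)
  ultimately show ?thesis
    by (simp add: distrib_left)
qed

text \<open>In \<open>inverse z *\<^sub>C M z\<close> the factor \<open>z\<close> of the second
  block matrix cancels: only the corner depends on \<open>z\<close>, and the other blocks are
  constant. Accretivity and differentiability therefore reduce to those of \<open>K\<close>, and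
  \<open>evolutionary_system\<close> applies.\<close>

theorem theorem3p2:
  fixes F :: "('h0::complex_hilbert \<times> 'h1::complex_hilbert) set"
    and r c0 c1 \<delta> :: real
    and K :: "complex \<Rightarrow> ('h0 \<times> 'h1) \<Rightarrow>\<^sub>L ('h0 \<times> 'h1)"
    and M102 :: "'y::complex_hilbert \<Rightarrow>\<^sub>L 'h0" and M112 :: "'y \<Rightarrow>\<^sub>L 'h1"
    and M120 :: "'h0 \<Rightarrow>\<^sub>L 'y" and M121 :: "'h1 \<Rightarrow>\<^sub>L 'y" and M122 :: "'y \<Rightarrow>\<^sub>L 'y"
    and M :: "complex \<Rightarrow> (('h0 \<times> 'h1) \<times> 'y) \<Rightarrow>\<^sub>L (('h0 \<times> 'h1) \<times> 'y)"
    and J :: "'y \<Rightarrow>\<^sub>L ('h0 \<times> 'h1)"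
    and B :: "real \<Rightarrow> (real \<Rightarrow> 'u::complex_hilbert) \<Rightarrow> (real \<Rightarrow> ('h0 \<times> 'h1) \<times> 'y)"
    and \<C> :: "('h0, 'h1, 'y, 'u) control_system"
  assumes F: "densely_defined_closed_operator F"
    and r: "r > 0"
    and K: "linear_material_law r K"
    and M1: "complex_linear M102" "complex_linear M112" "complex_linear M120"
      "complex_linear M121" "complex_linear M122"
    and M: "\<And>z. z \<in> ball (of_real r) r \<Longrightarrow>
      M z = block_op (K z) 0 0 0 + z *\<^sub>C block_op 0 (column_op M102 M112) (row_op M120 M121) M122"
    and J: "J = (1 / 2) *\<^sub>R column_op (M102 + adj M120) (M112 + adj M121)"
    and B: "\<forall>\<^sub>F \<nu> in at_top. wbounded_operator \<nu> (B \<nu>)"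
    and \<C>: "\<C> = \<lparr>material_law = M, spatial_operator = F, control_operator = B\<rparr>"
    and pos: "c0 > 0" "c1 > 0"
    and Re_K: "\<And>z. z \<in> ball (of_real r) r \<Longrightarrow> Re_ge (inverse z *\<^sub>C K z) c0"
    and Re_M122: "Re_ge M122 c1"
    and \<delta>: "\<delta> > 0" "c0 - \<delta> * norm J > 0" "c1 - 1 / \<delta> * norm J > 0"
  shows "well_posed \<C> \<and> (\<forall>\<^sub>F \<nu> in at_top. causal \<nu> (solution_operator \<C> \<nu>))"
proof -
  let ?M1 = "block_op 0 (column_op M102 M112) (row_op M120 M121) M122"
  let ?c = "min (c0 - \<delta> * norm J) (c1 - 1 / \<delta> * norm J)"
  have c: "?c > 0"
    using \<delta> by simp
  have nz: "z \<noteq> 0" if "z \<in> ball (of_real r) r" for z :: complex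
    using that r by (auto simp: dist_norm)
  have scaled: "inverse z *\<^sub>C M z = block_op (inverse z *\<^sub>C K z) (column_op M102 M112) (row_op M120 M121) M122"
    if "z \<in> ball (of_real r) r" for z
    using nz[OF that]
    by (intro blinfun_eqI)
      (simp add: M[OF that] split_paired_all scaleC_blinfun.rep_eq blinfun.add_left block_op_apply
        scaleC_prod_def scaleC_add_right scaleC_scaleC)
  have scaled': "inverse z *\<^sub>C M z = inverse z *\<^sub>C block_op (K z) 0 0 0 + ?M1"
    if "z \<in> ball (of_real r) r" for z
    using nz[OF that] by (simp add: M[OF that] scaleC_add_right scaleC_scaleC)
  have lin: "complex_linear (M z)" if z: "z \<in> ball (of_real r) r" for z
  proof -
    have Kz: "K z (a *\<^sub>C p) = a *\<^sub>C K z p" for a p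
      using K z unfolding linear_material_law_def complex_linear_def by blast
    show ?thesis
      unfolding complex_linear_def M[OF z]
      using M1[unfolded complex_linear_def]
      by (simp add: split_paired_all scaleC_blinfun.rep_eq blinfun.add_left block_op_apply
          scaleC_prod_def scaleC_add_right scaleC_scaleC column_op.rep_eq row_op.rep_eq mult.commute
          Kz[unfolded scaleC_prod_def])
  qed
  have acc: "(inverse z *\<^sub>C M z) w \<bullet> w \<ge> ?c * (norm w)\<^sup>2" if z: "z \<in> ball (of_real r) r" for z w
    unfolding scaled[OF z] by (rule accretive_block_op[OF M1(3,4) J Re_K[OF z] Re_M122 \<delta>(1)])
  have diff: "\<exists>D. has_cderiv (\<lambda>z. inverse z *\<^sub>C M z) D z" if z: "z \<in> ball (of_real r) r" for z
  proof -
    obtain D where D: "has_cderiv K D z"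
      using K z unfolding linear_material_law_def analytic_on_open_def has_cderiv_def by blast
    have "\<exists>D. has_cderiv (\<lambda>z. inverse z *\<^sub>C block_op (K z) 0 0 0 + ?M1) D z"
      using has_cderiv_add_const[OF has_cderiv_scaleC_inverse[OF has_cderiv_bounded_linear[OF
            bounded_linear_block_op_corner block_op_corner_scaleC D] nz[OF z]]] by blast
    then obtain D' where D': "has_cderiv (\<lambda>z. inverse z *\<^sub>C block_op (K z) 0 0 0 + ?M1) D' z"
      by blast
    \<comment> \<open>\<open>M\<close> is prescribed on the ball only, so the two difference
      quotients are compared near \<open>z\<close>, which is enough for the limit.\<close>
    have "\<forall>\<^sub>F w in at z. w \<in> ball (of_real r) r - {z}"
      by (rule eventually_at_in_open[OF open_ball z])
    then have "\<forall>\<^sub>F w in at z.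
        inverse (w - z) *\<^sub>C (inverse w *\<^sub>C block_op (K w) 0 0 0 + ?M1 - (inverse z *\<^sub>C block_op (K z) 0 0 0 + ?M1))
        = inverse (w - z) *\<^sub>C (inverse w *\<^sub>C M w - inverse z *\<^sub>C M z)"
      by eventually_elim (simp only: scaled' z DiffD1)
    with D' show ?thesis
      unfolding has_cderiv_def by (blast intro: Lim_transform_eventually)
  qed
  \<comment> \<open>The threshold \<open>1 / (2 * r)\<close> is the one from
    \<open>inverse_mem_ball\<close>; both claims hold for every larger \<open>\<nu>\<close>.\<close>
  have sys: "evolutionary_system (skew_matrix F) M r ?c \<nu>" if "\<nu> > 1 / (2 * r)" for \<nu>
    by unfold_locales (use skew_selfadjoint_skew_matrix[OF F] r c that acc lin diff in auto)
  have "densely_defined_bounded_inverse \<nu> (system_operator \<C> \<nu>)"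
    "causal \<nu> (solution_operator \<C> \<nu>)" if "\<nu> > 1 / (2 * r)" for \<nu>
    using evolutionary_system.densely_defined_bounded_inverse_system[OF sys[OF that]]
      evolutionary_system.causal_solution[OF sys[OF that]]
    by (simp_all add: \<C> system_operator_def solution_operator_def)
  then show ?thesis
    unfolding well_posed_def
    by (intro conjI; intro eventually_mono[OF eventually_gt_at_top[of "1 / (2 * r)"]])
qed

end
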